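(* Let $T$ be a countable complete linearly ordered theory satisfying the Restriction, let $A$ be a finite subset of a countable saturated model $\mathfrak M$ of $T$, and let $p(x)\in S_1(A)$ be a non-algebraic 1-type. If $CRF(p)$ is infinite and has no least formula, then $T$ has $2^{\aleph_0}$ pairwise non-isomorphic countable models.
   Context: A linearly ordered theory is a theory in a language containing a binary symbol $<$ interpreted as a linear order. A set $X$ is convex in $Y\supseteq X$ if for all $a,b\in X$ and $c\in Y$, $a<c<b$ implies $c\in X$. For $X,Y$ subsets of a model, $X<Y$ means $x<y$ for all $x\in X,y\in Y$, and $\gamma<X$ means $\{\gamma\}<X$. Convex closure: for a formula $\varphi(x,\bar c)$, $\varphi^c(x,\bar c):=\exists y_1\exists y_2(\varphi(y_1,\bar c)\wedge\varphi(y_2,\bar c)\wedge y_1\le x\le y_2)$; for a 1-type $p$, $p^c:=\{\varphi^c\mid\varphi\in p\}$. Let $\mathfrak N\models T$, $A\subseteq N$, $\mathfrak N$ be $|A|^+$-saturated, $p\in S_1(A)$ non-algebraic. An $A$-definable formula $\varphi(x,y)$ is $p$-preserving if there are $\alpha,\gamma_1,\gamma_2\in p(\mathfrak N)$ with $p(\mathfrak N)\cap(\varphi(N,\alpha)\setminus\{\alpha\})\ne\emptyset$ and $\gamma_1<\varphi(N,\alpha)<\gamma_2$. A $p$-preserving $\varphi$ is convex to the right (left) on $p$ if there is $\alpha\in p(\mathfrak N)$ such that $p(\mathfrak N)\cap\varphi(N,\alpha)$ is convex, $\alpha\in\varphi(N,\alpha)$, and $\alpha$ is the left (right) endpoint of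 $\varphi(N,\alpha)$. Such a convex to the right (left) $\varphi$ is equivalence-generating if for every $\alpha\in p(\mathfrak N)$ and every $\beta\in\varphi(N,\alpha)\cap p(\mathfrak N)$, $\mathfrak N\models\forall x\,(x\ge\beta\to(\varphi(x,\alpha)\leftrightarrow\varphi(x,\beta)))$ (respectively with $x\le\beta$). $CRF(p)$ is the family of all $p$-preserving convex to the right $A$-formulas. Two formulas $\varphi_1,\varphi_2\in CRF(p)$ are equivalent on $p$ if $\varphi_1(N,\alpha)\cap p(\mathfrak N)=\varphi_2(N,\alpha)\cap p(\mathfrak N)$ for some (equivalently every) $\alpha\in p(\mathfrak N)$; $CRF(p)$ is considered up to this equivalence, so "$CRF(p)$ is infinite" means it contains infinitely many pairwise non-equivalent formulas. A formula $\varphi\in CRF(p)$ is least (greatest) if $\varphi(N,\alpha)\cap p(\mathfrak N)\subseteq\psi(N,\alpha)\cap p(\mathfrak N)$ (respectively $\supseteq$) for every $\psi\in CRF(p)$ and $\alpha\in p(\mathfrak N)$. The Restriction: for every (sufficiently saturated) model $\mathfrak N$ of $T$, every finite $A\subseteq N$ and every $A$-definable $B\subseteq N$: (1) for every $p\in S_1(A)$ and every $A$-formula $E(x,y,\bar z)$ there is no infinite sequence of tuples $\bar b_1,\bar b_2,\dots$ from $B$ such that for every $i$, $E(x,y,\bar b_i)$ is an equivalence relation on $p(\mathfrak N)$ whose classes are convex in $p(\mathfrak N)$ and mutually dense (densely ordered), each partitioned into infinitely many infinite $E(x,y,\bar b_{i+1})$-classes; (2) for every $p\in S_1(A)$ the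 set $\{q\in S_1(A)\mid q^c=p^c\}$ is finite; (3) for every $p\in S_1(A)$ all $p$-preserving convex to the right and all $p$-preserving convex to the left $A$-formulas are equivalence-generating. *)

theory Defs
  imports Main "HOL-Library.Countable_Set" "HOL-Library.Equipollence" "HOL-Library.Disjoint_Sets"
begin

section \<open>First-order logic with a distinguished order symbol\<close>

text \<open>A language consists of a set of function symbols and a set of relation symbols, with
  arities; constants are function symbols of arity 0, and equality is logical.  The field
  \<open>lt\<close> names the symbol that is read as \<open><\<close>.\<close>

record ('f, 'r) lang =
  funs :: "'f set"
  rels :: "'r set"
  far :: "'f \<Rightarrow> nat"
  rar :: "'r \<Rightarrow> nat"
  lt :: 'r

datatype 'f tm = Var nat | Fn 'f "'f tm list"

datatype ('f, 'r) fm =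
    Eq "'f tm" "'f tm"
  | Rel 'r "'f tm list"
  | Neg "('f, 'r) fm"
  | Conj "('f, 'r) fm" "('f, 'r) fm"
  | Ex nat "('f, 'r) fm"

abbreviation Disj :: "('f, 'r) fm \<Rightarrow> ('f, 'r) fm \<Rightarrow> ('f, 'r) fm" where
  "Disj \<phi> \<psi> \<equiv> Neg (Conj (Neg \<phi>) (Neg \<psi>))"

fun tm_vars :: "'f tm \<Rightarrow> nat set" where
  "tm_vars (Var i) = {i}"
| "tm_vars (Fn f ts) = (\<Union>t\<in>set ts. tm_vars t)"

fun free_vars :: "('f, 'r) fm \<Rightarrow> nat set" where
  "free_vars (Eq s t) = tm_vars s \<union> tm_vars t"
| "free_vars (Rel r ts) = (\<Union>t\<in>set ts. tm_vars t)"
| "free_vars (Neg \<phi>) = free_vars \<phi>"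
| "free_vars (Conj \<phi> \<psi>) = free_vars \<phi> \<union> free_vars \<psi>"
| "free_vars (Ex i \<phi>) = free_vars \<phi> - {i}"

fun wf_tm :: "('f, 'r) lang \<Rightarrow> 'f tm \<Rightarrow> bool" where
  "wf_tm L (Var i) \<longleftrightarrow> True"
| "wf_tm L (Fn f ts) \<longleftrightarrow> f \<in> funs L \<and> length ts = far L f \<and> (\<forall>t\<in>set ts. wf_tm L t)"

fun wf_fm :: "('f, 'r) lang \<Rightarrow> ('f, 'r) fm \<Rightarrow> bool" where
  "wf_fm L (Eq s t) \<longleftrightarrow> wf_tm L s \<and> wf_tm L t"
| "wf_fm L (Rel r ts) \<longleftrightarrow> r \<in> rels L \<and> length ts = rar L r \<and> (\<forall>t\<in>set ts. wf_tm L t)"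
| "wf_fm L (Neg \<phi>) \<longleftrightarrow> wf_fm L \<phi>"
| "wf_fm L (Conj \<phi> \<psi>) \<longleftrightarrow> wf_fm L \<phi> \<and> wf_fm L \<psi>"
| "wf_fm L (Ex i \<phi>) \<longleftrightarrow> wf_fm L \<phi>"

text \<open>\<open>L\<close>-formulas whose free variables are among the first \<open>n\<close>; \<open>formulas L 0\<close> are the
  sentences.\<close>

definition formulas :: "('f, 'r) lang \<Rightarrow> nat \<Rightarrow> ('f, 'r) fm set" where
  "formulas L n = {\<phi>. wf_fm L \<phi> \<and> free_vars \<phi> \<subseteq> {..<n}}"

text \<open>Only the values of \<open>fint\<close> and \<open>rint\<close> on symbols of the language and tuples of the right
  length from the universe matter; \<open>isomorphic\<close> below ignores all others.\<close>

record ('f, 'r, 'm) struct =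
  univ :: "'m set"
  fint :: "'f \<Rightarrow> 'm list \<Rightarrow> 'm"
  rint :: "'r \<Rightarrow> 'm list \<Rightarrow> bool"

definition tuples :: "'m set \<Rightarrow> nat \<Rightarrow> 'm list set" where
  "tuples X n = {xs. length xs = n \<and> set xs \<subseteq> X}"

definition is_struct :: "('f, 'r) lang \<Rightarrow> ('f, 'r, 'm) struct \<Rightarrow> bool" where
  "is_struct L N \<longleftrightarrow> univ N \<noteq> {} \<and>
     (\<forall>f\<in>funs L. \<forall>xs\<in>tuples (univ N) (far L f). fint N f xs \<in> univ N)"

fun eval_tm :: "('f, 'r, 'm) struct \<Rightarrow> (nat \<Rightarrow> 'm) \<Rightarrow> 'f tm \<Rightarrow> 'm" where
  "eval_tm N e (Var i) = e i"
| "eval_tm N e (Fn f ts) = fint N f (map (eval_tm N e) ts)"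

fun sat :: "('f, 'r, 'm) struct \<Rightarrow> (nat \<Rightarrow> 'm) \<Rightarrow> ('f, 'r) fm \<Rightarrow> bool" where
  "sat N e (Eq s t) \<longleftrightarrow> eval_tm N e s = eval_tm N e t"
| "sat N e (Rel r ts) \<longleftrightarrow> rint N r (map (eval_tm N e) ts)"
| "sat N e (Neg \<phi>) \<longleftrightarrow> \<not> sat N e \<phi>"
| "sat N e (Conj \<phi> \<psi>) \<longleftrightarrow> sat N e \<phi> \<and> sat N e \<psi>"
| "sat N e (Ex i \<phi>) \<longleftrightarrow> (\<exists>a\<in>univ N. sat N (e(i := a)) \<phi>)"

text \<open>\<open>N \<Turnstile> \<phi>(a\<^sub>0, \<dots>, a\<^sub>n\<^sub>-\<^sub>1)\<close>; used only for \<open>\<phi> \<in> formulas L n\<close> with \<open>n\<close> the length of the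
  list, so the unspecified values of \<open>(!)\<close> beyond the list play no role.\<close>

definition holds :: "('f, 'r, 'm) struct \<Rightarrow> ('f, 'r) fm \<Rightarrow> 'm list \<Rightarrow> bool" where
  "holds N \<phi> as \<longleftrightarrow> sat N (\<lambda>i. as ! i) \<phi>"

definition model :: "('f, 'r) lang \<Rightarrow> ('f, 'r) fm set \<Rightarrow> ('f, 'r, 'm) struct \<Rightarrow> bool" where
  "model L T N \<longleftrightarrow> is_struct L N \<and> (\<forall>\<phi>\<in>T. holds N \<phi> [])"

definition isomorphic ::
  "('f, 'r) lang \<Rightarrow> ('f, 'r, 'm) struct \<Rightarrow> ('f, 'r, 'n) struct \<Rightarrow> bool" where
  "isomorphic L N N' \<longleftrightarrow> (\<exists>h. bij_betw h (univ N) (univ N') \<and>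
     (\<forall>f\<in>funs L. \<forall>xs\<in>tuples (univ N) (far L f). h (fint N f xs) = fint N' f (map h xs)) \<and>
     (\<forall>r\<in>rels L. \<forall>xs\<in>tuples (univ N) (rar L r). rint N r xs \<longleftrightarrow> rint N' r (map h xs)))"

text \<open>Semantic notions that quantify over all models of a theory take the type \<open>'m\<close> of the
  elements of these models as an argument.  If the language is countable and \<open>'m\<close> is infinite,
  then by Loewenheim-Skolem entailment and completeness do not depend on \<open>'m\<close>.\<close>

definition entails ::
  "'m itself \<Rightarrow> ('f, 'r) lang \<Rightarrow> ('f, 'r) fm set \<Rightarrow> ('f, 'r) fm \<Rightarrow> bool" where
  "entails _ L T \<phi> \<longleftrightarrow> (\<forall>N :: ('f, 'r, 'm) struct. model L T N \<longrightarrow> holds N \<phi> [])"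

definition complete_theory :: "'m itself \<Rightarrow> ('f, 'r) lang \<Rightarrow> ('f, 'r) fm set \<Rightarrow> bool" where
  "complete_theory TM L T \<longleftrightarrow> T \<subseteq> formulas L 0 \<and>
     (\<exists>N :: ('f, 'r, 'm) struct. model L T N) \<and>
     (\<forall>\<phi>\<in>formulas L 0. entails TM L T \<phi> \<or> entails TM L T (Neg \<phi>))"

definition countable_lang :: "('f, 'r) lang \<Rightarrow> bool" where
  "countable_lang L \<longleftrightarrow> countable (funs L) \<and> countable (rels L)"


section \<open>The order\<close>

definition less_in :: "('f, 'r) lang \<Rightarrow> ('f, 'r, 'm) struct \<Rightarrow> 'm \<Rightarrow> 'm \<Rightarrow> bool" where
  "less_in L N a b \<longleftrightarrow> rint N (lt L) [a, b]"

definition le_in :: "('f, 'r) lang \<Rightarrow> ('f, 'r, 'm) struct \<Rightarrow> 'm \<Rightarrow> 'm \<Rightarrow> bool" where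
  "le_in L N a b \<longleftrightarrow> less_in L N a b \<or> a = b"

definition linearly_ordered_theory ::
  "'m itself \<Rightarrow> ('f, 'r) lang \<Rightarrow> ('f, 'r) fm set \<Rightarrow> bool" where
  "linearly_ordered_theory _ L T \<longleftrightarrow> lt L \<in> rels L \<and> rar L (lt L) = 2 \<and>
     (\<forall>N :: ('f, 'r, 'm) struct. model L T N \<longrightarrow>
        strict_linear_order_on (univ N) {(a, b) \<in> univ N \<times> univ N. less_in L N a b})"

definition set_less ::
  "('f, 'r) lang \<Rightarrow> ('f, 'r, 'm) struct \<Rightarrow> 'm set \<Rightarrow> 'm set \<Rightarrow> bool" where
  "set_less L N X Y \<longleftrightarrow> (\<forall>x\<in>X. \<forall>y\<in>Y. less_in L N x y)"

definition convex_in ::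
  "('f, 'r) lang \<Rightarrow> ('f, 'r, 'm) struct \<Rightarrow> 'm set \<Rightarrow> 'm set \<Rightarrow> bool" where
  "convex_in L N X Y \<longleftrightarrow> X \<subseteq> Y \<and>
     (\<forall>a\<in>X. \<forall>b\<in>X. \<forall>c\<in>Y. less_in L N a c \<and> less_in L N c b \<longrightarrow> c \<in> X)"


section \<open>Parameters, types and saturation\<close>

text \<open>The language \<open>L(A)\<close> adds a constant \<open>Inr a\<close> for each \<open>a \<in> A\<close>.  The expansion of \<open>N\<close>
  interprets \<open>Inr a\<close> as \<open>a\<close>; one expansion serves for all \<open>A\<close>.\<close>

definition lang_with :: "('f, 'r) lang \<Rightarrow> 'm set \<Rightarrow> ('f + 'm, 'r) lang" where
  "lang_with L A = \<lparr>funs = Inl ` funs L \<union> Inr ` A, rels = rels L,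
     far = case_sum (far L) (\<lambda>_. 0), rar = rar L, lt = lt L\<rparr>"

definition struct_with :: "('f, 'r, 'm) struct \<Rightarrow> ('f + 'm, 'r, 'm) struct" where
  "struct_with N = \<lparr>univ = univ N, fint = case_sum (fint N) (\<lambda>a _. a), rint = rint N\<rparr>"

abbreviation pformulas :: "('f, 'r) lang \<Rightarrow> 'm set \<Rightarrow> nat \<Rightarrow> ('f + 'm, 'r) fm set" where
  "pformulas L A n \<equiv> formulas (lang_with L A) n"

abbreviation pholds :: "('f, 'r, 'm) struct \<Rightarrow> ('f + 'm, 'r) fm \<Rightarrow> 'm list \<Rightarrow> bool" where
  "pholds N \<phi> as \<equiv> holds (struct_with N) \<phi> as"

text \<open>\<open>sol N \<phi> bs\<close> is \<open>\<phi>(N, bs)\<close>: variable 0 is \<open>x\<close> and variables 1, 2, ... take the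
  values \<open>bs\<close>.\<close>

definition sol :: "('f, 'r, 'm) struct \<Rightarrow> ('f + 'm, 'r) fm \<Rightarrow> 'm list \<Rightarrow> 'm set" where
  "sol N \<phi> bs = {a \<in> univ N. pholds N \<phi> (a # bs)}"

definition definable :: "('f, 'r) lang \<Rightarrow> ('f, 'r, 'm) struct \<Rightarrow> 'm set \<Rightarrow> 'm set \<Rightarrow> bool" where
  "definable L N A B \<longleftrightarrow> (\<exists>\<phi>\<in>pformulas L A 1. B = sol N \<phi> [])"

text \<open>\<open>S\<^sub>1(A)\<close>: the complete 1-types over \<open>A\<close>; being consistent with the elementary diagram of
  \<open>N\<close> over \<open>A\<close> means being finitely satisfiable in \<open>N\<close>.\<close>

definition S1 ::
  "('f, 'r) lang \<Rightarrow> ('f, 'r, 'm) struct \<Rightarrow> 'm set \<Rightarrow> ('f + 'm, 'r) fm set set" where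
  "S1 L N A = {p. p \<subseteq> pformulas L A 1 \<and>
     (\<forall>F. F \<subseteq> p \<and> finite F \<longrightarrow> (\<exists>a\<in>univ N. \<forall>\<phi>\<in>F. a \<in> sol N \<phi> [])) \<and>
     (\<forall>\<phi>\<in>pformulas L A 1. \<phi> \<in> p \<or> Neg \<phi> \<in> p)}"

definition realizations ::
  "('f, 'r, 'm) struct \<Rightarrow> ('f + 'm, 'r) fm set \<Rightarrow> 'm set" where
  "realizations N p = {a \<in> univ N. \<forall>\<phi>\<in>p. a \<in> sol N \<phi> []}"

definition nonalgebraic :: "('f, 'r, 'm) struct \<Rightarrow> ('f + 'm, 'r) fm set \<Rightarrow> bool" where
  "nonalgebraic N p \<longleftrightarrow> (\<forall>\<phi>\<in>p. infinite (sol N \<phi> []))"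

text \<open>\<open>\<kappa>\<close>-saturation, for \<open>\<kappa>\<close> the cardinality of the set \<open>K\<close>.\<close>

definition saturated_at ::
  "('f, 'r) lang \<Rightarrow> ('f, 'r, 'm) struct \<Rightarrow> 'k set \<Rightarrow> bool" where
  "saturated_at L N K \<longleftrightarrow>
     (\<forall>A. A \<subseteq> univ N \<and> A \<prec> K \<longrightarrow> (\<forall>p\<in>S1 L N A. realizations N p \<noteq> {}))"

definition saturated :: "('f, 'r) lang \<Rightarrow> ('f, 'r, 'm) struct \<Rightarrow> bool" where
  "saturated L N \<longleftrightarrow> saturated_at L N (univ N)"

definition aleph0_saturated :: "('f, 'r) lang \<Rightarrow> ('f, 'r, 'm) struct \<Rightarrow> bool" where
  "aleph0_saturated L N \<longleftrightarrow> saturated_at L N (UNIV :: nat set)"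


section \<open>Convex closure\<close>

text \<open>For \<open>\<phi>(x)\<close> whose only free variable is \<open>x = Var 0\<close>, the instance \<open>\<phi>(y\<^sub>i)\<close> with
  \<open>y\<^sub>i = Var i\<close> is written \<open>\<exists>x (x = y\<^sub>i \<and> \<phi>(x))\<close>, which avoids a capture-avoiding
  substitution.\<close>

definition inst_at :: "nat \<Rightarrow> ('f, 'r) fm \<Rightarrow> ('f, 'r) fm" where
  "inst_at i \<phi> = Ex 0 (Conj (Eq (Var 0) (Var i)) \<phi>)"

definition le_fm :: "('f, 'r) lang \<Rightarrow> nat \<Rightarrow> nat \<Rightarrow> ('g, 'r) fm" where
  "le_fm L i j = Disj (Rel (lt L) [Var i, Var j]) (Eq (Var i) (Var j))"

definition convex_closure :: "('f, 'r) lang \<Rightarrow> ('g, 'r) fm \<Rightarrow> ('g, 'r) fm" where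
  "convex_closure L \<phi> =
     Ex 1 (Ex 2 (Conj (Conj (inst_at 1 \<phi>) (inst_at 2 \<phi>)) (Conj (le_fm L 1 0) (le_fm L 0 2))))"

text \<open>\<open>p\<^sup>c\<close>, with formulas taken up to equivalence in \<open>N\<close>, that is, represented by their
  solution sets.  (As syntactic objects, \<open>p\<^sup>c = q\<^sup>c\<close> would force \<open>p = q\<close>.)\<close>

definition type_closure ::
  "('f, 'r) lang \<Rightarrow> ('f, 'r, 'm) struct \<Rightarrow> ('f + 'm, 'r) fm set \<Rightarrow> 'm set set" where
  "type_closure L N p = {sol N (convex_closure L \<phi>) [] |\<phi>. \<phi> \<in> p}"


section \<open>Formulas on a type\<close>

text \<open>The trace \<open>\<phi>(N, \<alpha>) \<inter> p(N)\<close>.\<close>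

definition trace ::
  "('f, 'r, 'm) struct \<Rightarrow> ('f + 'm, 'r) fm set \<Rightarrow> ('f + 'm, 'r) fm \<Rightarrow> 'm \<Rightarrow> 'm set" where
  "trace N p \<phi> \<alpha> = sol N \<phi> [\<alpha>] \<inter> realizations N p"

definition preserving ::
  "('f, 'r) lang \<Rightarrow> ('f, 'r, 'm) struct \<Rightarrow> ('f + 'm, 'r) fm set \<Rightarrow> ('f + 'm, 'r) fm \<Rightarrow> bool" where
  "preserving L N p \<phi> \<longleftrightarrow>
     (\<exists>\<alpha>\<in>realizations N p. \<exists>\<gamma>1\<in>realizations N p. \<exists>\<gamma>2\<in>realizations N p.
        realizations N p \<inter> (sol N \<phi> [\<alpha>] - {\<alpha>}) \<noteq> {} \<and>
        set_less L N {\<gamma>1} (sol N \<phi> [\<alpha>]) \<and> set_less L N (sol N \<phi> [\<alpha>]) {\<gamma>2})"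

text \<open>Convexity of the trace means convexity in \<open>p(N)\<close>.\<close>

definition convex_right ::
  "('f, 'r) lang \<Rightarrow> ('f, 'r, 'm) struct \<Rightarrow> ('f + 'm, 'r) fm set \<Rightarrow> ('f + 'm, 'r) fm \<Rightarrow> bool" where
  "convex_right L N p \<phi> \<longleftrightarrow> preserving L N p \<phi> \<and>
     (\<exists>\<alpha>\<in>realizations N p. convex_in L N (trace N p \<phi> \<alpha>) (realizations N p) \<and>
        \<alpha> \<in> sol N \<phi> [\<alpha>] \<and> (\<forall>b\<in>sol N \<phi> [\<alpha>]. le_in L N \<alpha> b))"

definition convex_left ::
  "('f, 'r) lang \<Rightarrow> ('f, 'r, 'm) struct \<Rightarrow> ('f + 'm, 'r) fm set \<Rightarrow> ('f + 'm, 'r) fm \<Rightarrow> bool" where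
  "convex_left L N p \<phi> \<longleftrightarrow> preserving L N p \<phi> \<and>
     (\<exists>\<alpha>\<in>realizations N p. convex_in L N (trace N p \<phi> \<alpha>) (realizations N p) \<and>
        \<alpha> \<in> sol N \<phi> [\<alpha>] \<and> (\<forall>b\<in>sol N \<phi> [\<alpha>]. le_in L N b \<alpha>))"

definition eq_generating_right ::
  "('f, 'r) lang \<Rightarrow> ('f, 'r, 'm) struct \<Rightarrow> ('f + 'm, 'r) fm set \<Rightarrow> ('f + 'm, 'r) fm \<Rightarrow> bool" where
  "eq_generating_right L N p \<phi> \<longleftrightarrow>
     (\<forall>\<alpha>\<in>realizations N p. \<forall>\<beta>\<in>trace N p \<phi> \<alpha>. \<forall>x\<in>univ N.
        le_in L N \<beta> x \<longrightarrow> (pholds N \<phi> [x, \<alpha>] \<longleftrightarrow> pholds N \<phi> [x, \<beta>]))"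

definition eq_generating_left ::
  "('f, 'r) lang \<Rightarrow> ('f, 'r, 'm) struct \<Rightarrow> ('f + 'm, 'r) fm set \<Rightarrow> ('f + 'm, 'r) fm \<Rightarrow> bool" where
  "eq_generating_left L N p \<phi> \<longleftrightarrow>
     (\<forall>\<alpha>\<in>realizations N p. \<forall>\<beta>\<in>trace N p \<phi> \<alpha>. \<forall>x\<in>univ N.
        le_in L N x \<beta> \<longrightarrow> (pholds N \<phi> [x, \<alpha>] \<longleftrightarrow> pholds N \<phi> [x, \<beta>]))"

definition CRF ::
  "('f, 'r) lang \<Rightarrow> ('f, 'r, 'm) struct \<Rightarrow> 'm set \<Rightarrow> ('f + 'm, 'r) fm set \<Rightarrow> ('f + 'm, 'r) fm set"
  where
  "CRF L N A p = {\<phi> \<in> pformulas L A 2. convex_right L N p \<phi>}"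

text \<open>Over a finite set \<open>A\<close> of parameters in a countable saturated model, ``for some \<open>\<alpha>\<close>'' is the
  same as ``for every \<open>\<alpha>\<close>'' here, by homogeneity.\<close>

definition equivalent_on ::
  "('f, 'r, 'm) struct \<Rightarrow> ('f + 'm, 'r) fm set \<Rightarrow> ('f + 'm, 'r) fm \<Rightarrow> ('f + 'm, 'r) fm \<Rightarrow> bool"
  where
  "equivalent_on N p \<phi> \<psi> \<longleftrightarrow> (\<exists>\<alpha>\<in>realizations N p. trace N p \<phi> \<alpha> = trace N p \<psi> \<alpha>)"

definition CRF_infinite ::
  "('f, 'r) lang \<Rightarrow> ('f, 'r, 'm) struct \<Rightarrow> 'm set \<Rightarrow> ('f + 'm, 'r) fm set \<Rightarrow> bool" where
  "CRF_infinite L N A p \<longleftrightarrow>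
     (\<exists>F \<subseteq> CRF L N A p. infinite F \<and> pairwise (\<lambda>\<phi> \<psi>. \<not> equivalent_on N p \<phi> \<psi>) F)"

definition least_CRF ::
  "('f, 'r) lang \<Rightarrow> ('f, 'r, 'm) struct \<Rightarrow> 'm set \<Rightarrow> ('f + 'm, 'r) fm set \<Rightarrow> ('f + 'm, 'r) fm \<Rightarrow> bool"
  where
  "least_CRF L N A p \<phi> \<longleftrightarrow> \<phi> \<in> CRF L N A p \<and>
     (\<forall>\<psi>\<in>CRF L N A p. \<forall>\<alpha>\<in>realizations N p. trace N p \<phi> \<alpha> \<subseteq> trace N p \<psi> \<alpha>)"


section \<open>The Restriction\<close>

text \<open>The relation that \<open>E(x, y, bs)\<close> induces on \<open>p(N)\<close>.\<close>

definition rel_on ::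
  "('f, 'r, 'm) struct \<Rightarrow> ('f + 'm, 'r) fm set \<Rightarrow> ('f + 'm, 'r) fm \<Rightarrow> 'm list \<Rightarrow> ('m \<times> 'm) set" where
  "rel_on N p E bs =
     {(a, a'). a \<in> realizations N p \<and> a' \<in> realizations N p \<and> pholds N E (a # a' # bs)}"

text \<open>Mutual density of the classes: strictly between any two of them there is a third.\<close>

definition convex_dense_equiv ::
  "('f, 'r) lang \<Rightarrow> ('f, 'r, 'm) struct \<Rightarrow> 'm set \<Rightarrow> ('m \<times> 'm) set \<Rightarrow> bool" where
  "convex_dense_equiv L N P R \<longleftrightarrow> equiv P R \<and> (\<forall>C\<in>P // R. convex_in L N C P) \<and>
     (\<forall>C\<in>P // R. \<forall>D\<in>P // R. set_less L N C D \<longrightarrow>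
        (\<exists>C'\<in>P // R. set_less L N C C' \<and> set_less L N C' D))"

definition splits_infinitely :: "'m set \<Rightarrow> ('m \<times> 'm) set \<Rightarrow> ('m \<times> 'm) set \<Rightarrow> bool" where
  "splits_infinitely P R R' \<longleftrightarrow> (\<forall>C\<in>P // R.
     partition_on C {D \<in> P // R'. D \<subseteq> C} \<and> infinite {D \<in> P // R'. D \<subseteq> C} \<and>
     (\<forall>D\<in>P // R'. D \<subseteq> C \<longrightarrow> infinite D))"

definition no_descending_equivs ::
  "('f, 'r) lang \<Rightarrow> ('f, 'r, 'm) struct \<Rightarrow> 'm set \<Rightarrow> 'm set \<Rightarrow> bool" where
  "no_descending_equivs L N A B \<longleftrightarrow>
     (\<forall>p\<in>S1 L N A. \<forall>n. \<forall>E\<in>pformulas L A (n + 2).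
        \<not> (\<exists>b :: nat \<Rightarrow> 'm list. \<forall>i. b i \<in> tuples B n \<and>
             convex_dense_equiv L N (realizations N p) (rel_on N p E (b i)) \<and>
             splits_infinitely (realizations N p) (rel_on N p E (b i)) (rel_on N p E (b (Suc i)))))"

definition restriction :: "'m itself \<Rightarrow> ('f, 'r) lang \<Rightarrow> ('f, 'r) fm set \<Rightarrow> bool" where
  "restriction _ L T \<longleftrightarrow>
     (\<forall>(N :: ('f, 'r, 'm) struct) A B.
        model L T N \<and> aleph0_saturated L N \<and> A \<subseteq> univ N \<and> finite A \<and> definable L N A B \<longrightarrow>
        no_descending_equivs L N A B \<and>
        (\<forall>p\<in>S1 L N A. finite {q \<in> S1 L N A. type_closure L N q = type_closure L N p}) \<and>
        (\<forall>p\<in>S1 L N A. \<forall>\<phi>\<in>pformulas L A 2.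
           (convex_right L N p \<phi> \<longrightarrow> eq_generating_right L N p \<phi>) \<and>
           (convex_left L N p \<phi> \<longrightarrow> eq_generating_left L N p \<phi>)))"

end

theory Submission
  imports Defs "HOL-Library.Ramsey" "HOL-Library.Countable" Complex_Main
begin

text \<open>Without a least formula, \<open>CRF(p)\<close> yields a strictly decreasing chain of convex relations
  \<open>E 0, E 1, \<dots>\<close> on \<open>p(M)\<close>, coinitial among the formulas of \<open>CRF(p)\<close>; the Restriction makes them
  equivalence relations and limits how definable sets with parameters can cut the classes of their
  intersection.  Points in distinct \<open>E 0\<close>-classes can then be chosen as indiscernibles indexed by the
  rationals, and a set \<open>S\<close> of natural numbers is coded as the order type of those classes that a
  countable elementary submodel realizes in a prescribed way.  The coding orders are rigid, so,
  up to the countably many choices of parameters, isomorphic submodels give the same \<open>S\<close>.\<close>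

text \<open>The intersection \<open>Einf\<close> of the chain is not definable, so no formula can
  count or omit its classes. What replaces this is a dichotomy: over finitely many parameters, the
  type of a realization of \<open>p\<close> either contains a whole \<open>E k\<close>-class around
  it or lies inside its \<open>Einf\<close>-class. In the first case no set definable from the point
  and the parameters ends inside the \<open>Einf\<close>-class strictly above the point; this is the
  hard core, where such an end would produce the descending sequence of equivalence relations that
  the Restriction forbids. Hence a pair z < w in one \<open>Einf\<close>-class away from the chosen
  classes can be kept out of a submodel, while a lone point of such a class is not controlled. So a
  class is counted only if the submodel contains such a pair, and every chosen point carries a
  companion above it. Two outer points bound the region in which pairs are controlled. The argument
  runs on predicates of assignments closed under first-order operations, with the order given by a
  real-valued map whose negation yields the mirror images; formulas enter only at the end.\<close>

section \<open>Assignments with values in a set\<close>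

definition asg :: "'m set \<Rightarrow> (nat \<Rightarrow> 'm) set" where
  "asg U = {e. \<forall>i. e i \<in> U}"

lemma asgI: "(\<And>i. e i \<in> U) \<Longrightarrow> e \<in> asg U"
  by (simp add: asg_def)

lemma asgD: "e \<in> asg U \<Longrightarrow> e i \<in> U"
  by (simp add: asg_def)

lemma asg_upd [simp]: "e \<in> asg U \<Longrightarrow> a \<in> U \<Longrightarrow> e(i := a) \<in> asg U"
  by (simp add: asg_def)

lemma asg_comp [simp]: "e \<in> asg U \<Longrightarrow> (\<lambda>i. e (g i)) \<in> asg U"
  by (simp add: asg_def)

lemma asg_const [simp]: "a \<in> U \<Longrightarrow> (\<lambda>_. a) \<in> asg U"
  by (simp add: asg_def)

lemma asg_case [simp]: "a \<in> U \<Longrightarrow> e \<in> asg U \<Longrightarrow> case_nat a e \<in> asg U"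
  by (simp add: asg_def split: nat.split)

text \<open>Predicates take infinite assignments, so a finite list is read periodically: every
  variable gets a value among the entries.\<close>

definition cyc :: "'m list \<Rightarrow> nat \<Rightarrow> 'm" where
  "cyc xs = (\<lambda>i. xs ! (i mod length xs))"

lemma cyc_asg [simp]: "xs \<noteq> [] \<Longrightarrow> set xs \<subseteq> U \<Longrightarrow> cyc xs \<in> asg U"
  by (auto simp: asg_def cyc_def)

lemma cyc_single [simp]: "cyc [a] = (\<lambda>_. a)"
  by (simp add: cyc_def)

section \<open>Definable predicates over a countable saturated structure\<close>

text \<open>\<open>Dp B P\<close> stands for definability of \<open>P\<close> by a formula with
  parameters in \<open>B\<close>. The order enters through an injection into the reals, so that
  reversing it is negation. \<open>D_abs\<close> trades a parameter for a variable,
  \<open>D_cnt\<close> bounds the number of predicates, and \<open>D_sat\<close> is saturation for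
  1-types over finite sets.\<close>

locale definability =
  fixes U :: "'m set" and r :: "'m \<Rightarrow> real" and Dp :: "'m set \<Rightarrow> ((nat \<Rightarrow> 'm) \<Rightarrow> bool) \<Rightarrow> bool"
  assumes U_inf: "infinite U" and U_cnt: "countable U"
    and r_inj: "inj_on r U"
    and D_par: "Dp B P \<Longrightarrow> B \<subseteq> U"
    and D_cong: "Dp B P \<Longrightarrow> (\<And>e. e \<in> asg U \<Longrightarrow> P e = Q e) \<Longrightarrow> Dp B Q"
    and D_sub: "Dp B P \<Longrightarrow> (\<And>i b. t i = Inr b \<Longrightarrow> b \<in> B) \<Longrightarrow>
      Dp B (\<lambda>e. P (\<lambda>i. case t i of Inl j \<Rightarrow> e j | Inr b \<Rightarrow> b))"
    and D_neg: "Dp B P \<Longrightarrow> Dp B (\<lambda>e. \<not> P e)"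
    and D_conj: "Dp B P \<Longrightarrow> Dp B Q \<Longrightarrow> Dp B (\<lambda>e. P e \<and> Q e)"
    and D_ex: "Dp B P \<Longrightarrow> Dp B (\<lambda>e. \<exists>a\<in>U. P (e(i := a)))"
    and D_supp: "Dp B P \<Longrightarrow> \<exists>n. \<forall>e\<in>asg U. \<forall>e'\<in>asg U. (\<forall>i<n. e i = e' i) \<longrightarrow> P e = P e'"
    and D_abs: "Dp (insert b B) P \<Longrightarrow> \<exists>Q j. Dp B Q \<and> (\<forall>e\<in>asg U. P e = Q (e(j := b)))"
    and D_mono: "Dp B P \<Longrightarrow> B \<subseteq> C \<Longrightarrow> C \<subseteq> U \<Longrightarrow> Dp C P"
    and D_eq: "B \<subseteq> U \<Longrightarrow> Dp B (\<lambda>e. e i = e j)"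
    and D_lt: "B \<subseteq> U \<Longrightarrow> Dp B (\<lambda>e. r (e i) < r (e j))"
    and D_cnt: "finite B \<Longrightarrow> B \<subseteq> U \<Longrightarrow>
      \<exists>f. \<forall>P. Dp B P \<longrightarrow> (\<exists>n::nat. Dp B (f n) \<and> (\<forall>e\<in>asg U. P e = f n e))"
    and D_sat: "finite B \<Longrightarrow> B \<subseteq> U \<Longrightarrow> (\<And>Q. Q \<in> \<Q> \<Longrightarrow> Dp B Q) \<Longrightarrow>
      (\<And>F. F \<subseteq> \<Q> \<Longrightarrow> finite F \<Longrightarrow> \<exists>a\<in>U. \<forall>Q\<in>F. Q (\<lambda>_. a)) \<Longrightarrow> \<exists>a\<in>U. \<forall>Q\<in>\<Q>. Q (\<lambda>_. a)"
begin

abbreviation "AS \<equiv> asg U"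

lemma U_ne: "U \<noteq> {}" using U_inf by auto

definition tmd :: "'m set \<Rightarrow> ((nat \<Rightarrow> 'm) \<Rightarrow> 'm) \<Rightarrow> bool" where
  "tmd B s \<longleftrightarrow> (\<exists>i. s = (\<lambda>e. e i)) \<or> (\<exists>b\<in>B. s = (\<lambda>e. b))"

lemma tmv: "tmd B (\<lambda>e. e i)" by (auto simp: tmd_def)
lemma tmc: "b \<in> B \<Longrightarrow> tmd B (\<lambda>e. b)" by (auto simp: tmd_def)

lemma D_terms:
  assumes "Dp B P" "\<And>i. tmd B (s i)" shows "Dp B (\<lambda>e. P (\<lambda>i. s i e))"
proof -
  define t where "t i = (if \<exists>j. s i = (\<lambda>e. e j) then Inl (SOME j. s i = (\<lambda>e. e j))
      else Inr (SOME b. b \<in> B \<and> s i = (\<lambda>e. b)))" for i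
  have *: "s i e = (case t i of Inl j \<Rightarrow> e j | Inr b \<Rightarrow> b) \<and> (\<forall>b. t i = Inr b \<longrightarrow> b \<in> B)" for i e
  proof (cases "\<exists>j. s i = (\<lambda>e. e j)")
    case True
    then have "s i = (\<lambda>e. e (SOME j. s i = (\<lambda>e. e j)))" by (rule someI_ex)
    then show ?thesis using True by (simp add: t_def) metis
  next
    case False
    then have "\<exists>b. b \<in> B \<and> s i = (\<lambda>e. b)" using assms(2)[of i] by (auto simp: tmd_def)
    then have "(SOME b. b \<in> B \<and> s i = (\<lambda>e. b)) \<in> B \<and> s i = (\<lambda>e. (SOME b. b \<in> B \<and> s i = (\<lambda>e. b)))"
      by (rule someI_ex)
    then show ?thesis using False by (simp add: t_def) metis
  qed
  have "Dp B (\<lambda>e. P (\<lambda>i. case t i of Inl j \<Rightarrow> e j | Inr b \<Rightarrow> b))"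
    using assms(1) * by (intro D_sub) auto
  then show ?thesis using * by simp
qed

lemma D_ren: "Dp B P \<Longrightarrow> Dp B (\<lambda>e. P (\<lambda>i. e (g i)))"
  using D_terms[of B P "\<lambda>i e. e (g i)"] tmv by blast

lemma D1: "Dp B (\<lambda>e. X (e 0)) \<Longrightarrow> tmd B s \<Longrightarrow> Dp B (\<lambda>e. X (s e))"
  using D_terms[of B "\<lambda>e. X (e 0)" "\<lambda>i. s"] by simp

lemma D2:
  assumes "Dp B (\<lambda>e. X (e 0) (e 1))" "tmd B s" "tmd B t" shows "Dp B (\<lambda>e. X (s e) (t e))"
  using D_terms[OF assms(1), of "\<lambda>i. if i = 0 then s else t"] assms by auto

text \<open>\<open>D_ex\<close> binds a named variable. Here the bound value sits at position 0 and
  the rest is shifted, so that nested quantifiers need no names; a variable outside the support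
  serves as the bound one.\<close>

lemma D_exn:
  assumes "Dp B (\<lambda>e. Q (\<lambda>i. e (Suc i)) (e 0))" shows "Dp B (\<lambda>e. \<exists>a\<in>U. Q e a)"
proof -
  let ?P = "\<lambda>e. Q (\<lambda>i. e (Suc i)) (e 0)"
  obtain n where n: "\<And>e e'. e \<in> AS \<Longrightarrow> e' \<in> AS \<Longrightarrow> (\<forall>i<n. e i = e' i) \<Longrightarrow> ?P e = ?P e'"
    using D_supp[OF assms] by blast
  \<comment> \<open>Variable \<open>n\<close> carries the witness. The value it overwrites is read
    only at position \<open>Suc n\<close>, outside the support.\<close>
  have "Dp B (\<lambda>e. \<exists>a\<in>U. ?P (\<lambda>i. (e(n := a)) (case i of 0 \<Rightarrow> n | Suc j \<Rightarrow> j)))"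
    by (rule D_ex[OF D_ren[OF assms]])
  then show ?thesis
  proof (rule D_cong)
    fix e assume e: "e \<in> AS"
    have "?P (\<lambda>i. (e(n := a)) (case i of 0 \<Rightarrow> n | Suc j \<Rightarrow> j)) = ?P (case_nat a e)" if "a \<in> U" for a
      using e that by (intro n) (auto simp: asg_def split: nat.split)
    then show "(\<exists>a\<in>U. ?P (\<lambda>i. (e(n := a)) (case i of 0 \<Rightarrow> n | Suc j \<Rightarrow> j))) = (\<exists>a\<in>U. Q e a)"
      by simp
  qed
qed

lemma D_alln:
  assumes "Dp B (\<lambda>e. Q (\<lambda>i. e (Suc i)) (e 0))" shows "Dp B (\<lambda>e. \<forall>a\<in>U. Q e a)"
  using D_neg[OF D_exn[of B "\<lambda>e a. \<not> Q e a", OF D_neg[OF assms]]] by simp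

lemma D_disj: "Dp B P \<Longrightarrow> Dp B Q \<Longrightarrow> Dp B (\<lambda>e. P e \<or> Q e)"
  using D_neg[OF D_conj[OF D_neg D_neg, of B P Q]] by simp

lemma D_imp: "Dp B P \<Longrightarrow> Dp B Q \<Longrightarrow> Dp B (\<lambda>e. P e \<longrightarrow> Q e)"
  by (rule D_cong[OF D_disj[OF D_neg]]) auto

lemma D_true: "B \<subseteq> U \<Longrightarrow> Dp B (\<lambda>e. True)"
  using D_eq[of B 0 0] by simp

lemma D_less: "B \<subseteq> U \<Longrightarrow> tmd B s \<Longrightarrow> tmd B t \<Longrightarrow> Dp B (\<lambda>e. r (s e) < r (t e))"
  using D2[of B "\<lambda>x y. r x < r y"] D_lt[of B 0 1] by blast

lemma D_le: "B \<subseteq> U \<Longrightarrow> tmd B s \<Longrightarrow> tmd B t \<Longrightarrow> Dp B (\<lambda>e. r (s e) \<le> r (t e))"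
  using D_neg[OF D_less, of B t s] by (simp add: not_less)

lemma D_equal: "B \<subseteq> U \<Longrightarrow> tmd B s \<Longrightarrow> tmd B t \<Longrightarrow> Dp B (\<lambda>e. s e = t e)"
  using D2[of B "\<lambda>x y. x = y"] D_eq[of B 0 1] by blast

lemma D_Ball: "finite F \<Longrightarrow> B \<subseteq> U \<Longrightarrow> (\<And>x. x \<in> F \<Longrightarrow> Dp B (Q x)) \<Longrightarrow> Dp B (\<lambda>e. \<forall>x\<in>F. Q x e)"
proof (induction F rule: finite_induct)
  case empty then show ?case by (simp add: D_true)
next
  case (insert x F) then show ?case using D_conj[of B "Q x" "\<lambda>e. \<forall>x\<in>F. Q x e"] by simp
qed

lemma r_eq: "a \<in> U \<Longrightarrow> b \<in> U \<Longrightarrow> r a = r b \<longleftrightarrow> a = b"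
  using r_inj by (auto dest: inj_onD)

text \<open>Equality of the types over \<open>B\<close> of two tuples, the tuples being extended periodically.\<close>

definition same :: "'m set \<Rightarrow> 'm list \<Rightarrow> 'm list \<Rightarrow> bool" where
  "same B xs ys \<longleftrightarrow> length xs = length ys \<and> xs \<noteq> [] \<and> set xs \<subseteq> U \<and> set ys \<subseteq> U \<and>
     (\<forall>P. Dp B P \<longrightarrow> P (cyc xs) = P (cyc ys))"

definition eqv :: "'m set \<Rightarrow> 'm \<Rightarrow> 'm \<Rightarrow> bool" where
  "eqv B a b \<longleftrightarrow> a \<in> U \<and> b \<in> U \<and> (\<forall>P. Dp B P \<longrightarrow> P (\<lambda>_. a) = P (\<lambda>_. b))"

lemma same_sym: "same B xs ys \<Longrightarrow> same B ys xs"
  by (auto simp: same_def)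

text \<open>Only finitely many variables matter, so the periodic extensions may be replaced by any
  assignments that read the same entries through \<open>g\<close>.\<close>

lemma same_nth:
  assumes "same B xs ys" "Dp B P" "\<And>i. i < n \<Longrightarrow> g i < length xs"
    and "\<And>e e'. e \<in> AS \<Longrightarrow> e' \<in> AS \<Longrightarrow> (\<forall>i<n. e i = e' i) \<Longrightarrow> P e = P e'"
    and "e \<in> AS" "e' \<in> AS" "\<And>i. i < n \<Longrightarrow> e i = xs ! g i" "\<And>i. i < n \<Longrightarrow> e' i = ys ! g i"
  shows "P e = P e'"
proof -
  have *: "Dp B (\<lambda>e. P (\<lambda>i. e (g i)))" by (rule D_ren[OF assms(2)])
  have "ys \<noteq> []" using assms(1) by (auto simp: same_def)
  then have a: "cyc xs \<in> AS" "cyc ys \<in> AS" "length xs = length ys"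
    using assms(1) by (auto simp: same_def)
  have "P e = P (\<lambda>i. cyc xs (g i))"
    using assms a by (intro assms(4) asg_comp[OF a(1)]) (auto simp: cyc_def)
  also have "\<dots> = P (\<lambda>i. cyc ys (g i))"
    using assms(1) * by (auto simp: same_def)
  also have "\<dots> = P e'"
    using assms a by (intro assms(4) asg_comp[OF a(2)]) (auto simp: cyc_def)
  finally show ?thesis .
qed

text \<open>The forth step: the type of \<open>a\<close> over \<open>xs\<close>, carried to
  \<open>ys\<close>, is finitely satisfiable, because the existence of a solution of finitely many
  of its members is a definable property of the tuple. Saturation is used over \<open>B\<close> and
  the entries of \<open>ys\<close>.\<close>

lemma same_extend:
  assumes B: "finite B" "B \<subseteq> U" and s: "same B xs ys" and a: "a \<in> U"
  shows "\<exists>a'\<in>U. same B (xs @ [a]) (ys @ [a'])"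
proof -
  define n where "n = length xs"
  have n: "length ys = n" "length xs = n" "n > 0" "set xs \<subseteq> U" "set ys \<subseteq> U"
    using s by (auto simp: same_def n_def)
  \<comment> \<open>\<open>w zs c\<close> is the periodic extension of \<open>zs @ [c]\<close>,
    written so that the last entry can become a variable.\<close>
  define w where "w = (\<lambda>zs (c::'m) i. let k = i mod Suc n in if k < n then zs ! k else c)"
  have cyc_w: "cyc (zs @ [c]) = w zs c" if "length zs = n" for zs c
    using that by (auto simp: cyc_def w_def nth_append Let_def fun_eq_iff less_Suc_eq)
  define Q where "Q = (\<lambda>(P::(nat \<Rightarrow> 'm) \<Rightarrow> bool) (e::nat \<Rightarrow> 'm). P (w ys (e 0)))"
  define \<P> where "\<P> = {P. Dp B P \<and> P (w xs a)}"
  have BU: "finite (B \<union> set ys)" "B \<union> set ys \<subseteq> U" using B n by auto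
  have DQ: "Dp (B \<union> set ys) (Q P)" if "Dp B P" for P
  proof -
    have "Dp (B \<union> set ys) P" using D_mono[OF that] BU by blast
    then have "Dp (B \<union> set ys) (\<lambda>e. P (\<lambda>i. (if i mod Suc n < n then (\<lambda>e. ys ! (i mod Suc n)) else (\<lambda>e. e 0)) e))"
      by (rule D_terms) (auto simp: tmv intro!: tmc simp: n)
    then show ?thesis unfolding Q_def w_def Let_def
      by (rule D_cong) (auto intro!: arg_cong[of _ _ P])
  qed
  have "\<exists>a'\<in>U. \<forall>R\<in>Q ` \<P>. R (\<lambda>_. a')"
  proof (rule D_sat[OF BU])
    fix R assume "R \<in> Q ` \<P>" then show "Dp (B \<union> set ys) R" using DQ by (auto simp: \<P>_def)
  next
    fix F assume "F \<subseteq> Q ` \<P>" "finite F"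
    then obtain G where G: "G \<subseteq> \<P>" "finite G" "F = Q ` G" by (meson finite_subset_image)
    define P where "P = (\<lambda>e. \<forall>P\<in>G. P e)"
    have DP: "Dp B P" unfolding P_def using G B by (intro D_Ball) (auto simp: \<P>_def)
    have "Dp B (\<lambda>e. \<exists>c\<in>U. P (\<lambda>i. if i mod Suc n < n then e (i mod Suc n) else c))"
      by (rule D_exn, rule D_cong[OF D_ren[OF DP, of "\<lambda>i. if i mod Suc n < n then Suc (i mod Suc n) else 0"]])
        (auto intro!: arg_cong[of _ _ P])
    have "(\<lambda>i. if i mod Suc n < n then cyc zs (i mod Suc n) else c) = w zs c" if "length zs = n" for zs c
      using that by (auto simp: w_def cyc_def)
    note wc = this
    have "(\<exists>c\<in>U. P (w xs c)) = (\<exists>c\<in>U. P (w ys c))"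
      using s \<open>Dp B (\<lambda>e. \<exists>c\<in>U. P (\<lambda>i. if i mod Suc n < n then e (i mod Suc n) else c))\<close>
      unfolding same_def wc[OF n(1), symmetric] wc[OF n(2), symmetric] by blast
    moreover have "P (w xs a)" using G by (auto simp: P_def \<P>_def)
    ultimately obtain c where "c \<in> U" "P (w ys c)" using a by blast
    then show "\<exists>a\<in>U. \<forall>Q\<in>F. Q (\<lambda>_. a)" using G by (auto simp: Q_def P_def)
  qed
  then obtain a' where a': "a' \<in> U" "\<And>P. Dp B P \<Longrightarrow> P (w xs a) \<Longrightarrow> P (w ys a')"
    by (auto simp: Q_def \<P>_def)
  have "P (w xs a) = P (w ys a')" if "Dp B P" for P
    using a'(2)[OF that] a'(2)[OF D_neg[OF that]] by blast
  then have "same B (xs @ [a]) (ys @ [a'])"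
    using n a a' by (simp add: same_def cyc_w)
  then show ?thesis using a' by blast
qed

section \<open>Automorphisms and homogeneity\<close>

definition Gr :: "('m \<Rightarrow> 'm) set" where
  "Gr = {\<sigma>. bij_betw \<sigma> U U \<and> (\<forall>P. Dp {} P \<longrightarrow> (\<forall>e\<in>AS. P (\<lambda>i. \<sigma> (e i)) = P e))}"

definition Au :: "'m set \<Rightarrow> ('m \<Rightarrow> 'm) set" where
  "Au B = {\<sigma>\<in>Gr. \<forall>b\<in>B. \<sigma> b = b}"

lemma Gr_U [simp]: "\<sigma> \<in> Gr \<Longrightarrow> a \<in> U \<Longrightarrow> \<sigma> a \<in> U"
  by (auto simp: Gr_def bij_betw_def)

lemma Au_U [simp]: "\<sigma> \<in> Au B \<Longrightarrow> a \<in> U \<Longrightarrow> \<sigma> a \<in> U"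
  by (auto simp: Au_def)

text \<open>Induction on the parameters: each one is traded for a variable by \<open>D_abs\<close>
  and is fixed by \<sigma>.\<close>

lemma Au_Dp:
  assumes "finite B" "\<sigma> \<in> Au B" "Dp B P" "e \<in> AS" shows "P (\<lambda>i. \<sigma> (e i)) = P e"
  using assms
proof (induction B arbitrary: P e rule: finite_induct)
  case empty then show ?case by (auto simp: Au_def Gr_def)
next
  case (insert b B)
  obtain Q j where Q: "Dp B Q" "\<And>e. e \<in> AS \<Longrightarrow> P e = Q (e(j := b))" using D_abs[OF insert.prems(2)] by blast
  have b: "b \<in> U" "\<sigma> b = b" "\<sigma> \<in> Au B" using D_par[OF insert.prems(2)] insert.prems(1) by (auto simp: Au_def)
  have "P (\<lambda>i. \<sigma> (e i)) = Q ((\<lambda>i. \<sigma> (e i))(j := b))" using insert.prems b by (intro Q(2)) (auto simp: asg_def)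
  also have "(\<lambda>i. \<sigma> (e i))(j := b) = (\<lambda>i. \<sigma> ((e(j := b)) i))" using b by auto
  also have "Q \<dots> = Q (e(j := b))"
    by (rule insert.IH[OF b(3) Q(1) asg_upd[OF insert.prems(3) b(1)]])
  also have "\<dots> = P e" using Q insert.prems by simp
  finally show ?case .
qed

text \<open>Back-and-forth along an enumeration \<open>u\<close> of the structure: at each step
  \<open>u n\<close> enters both lists, each time with a partner supplied by
  \<open>same_extend\<close>.\<close>

lemma same_homog:
  assumes B: "finite B" "B \<subseteq> U" and s: "same B xs ys"
  shows "\<exists>\<sigma>\<in>Au B. map \<sigma> xs = ys"
proof -
  define u where "u = from_nat_into U"
  have u: "range u = U" unfolding u_def using U_ne U_cnt by (rule range_from_nat_into)
  define Q where "Q = (\<lambda>n (p::'m list \<times> 'm list) (q::'m list \<times> 'm list).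
     \<exists>a b. fst q = fst p @ [u n, b] \<and> snd q = snd p @ [a, u n])"
  have "\<exists>f. \<forall>n. (same B (fst (f n)) (snd (f n)) \<and> (n = 0 \<longrightarrow> f n = (xs, ys))) \<and> Q n (f n) (f (Suc n))"
  proof (rule dependent_nat_choice)
    show "\<exists>x. same B (fst x) (snd x) \<and> (0 = (0::nat) \<longrightarrow> x = (xs, ys))" using s by auto
  next
    fix p and n :: nat
    assume "same B (fst p) (snd p) \<and> (n = 0 \<longrightarrow> p = (xs, ys))"
    then have s1: "same B (fst p) (snd p)" by simp
    have un: "u n \<in> U" using u by auto
    obtain a where a: "a \<in> U" "same B (fst p @ [u n]) (snd p @ [a])"
      using same_extend[OF B s1 un] by blast
    obtain b where b: "b \<in> U" "same B (snd p @ [a] @ [u n]) (fst p @ [u n] @ [b])"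
      using same_extend[OF B same_sym[OF a(2)] un] by auto
    then have "same B (fst p @ [u n, b]) (snd p @ [a, u n])" using same_sym by auto
    then show "\<exists>q. (same B (fst q) (snd q) \<and> (Suc n = 0 \<longrightarrow> q = (xs, ys))) \<and> Q n p q"
      by (intro exI[of _ "(fst p @ [u n, b], snd p @ [a, u n])"]) (auto simp: Q_def)
  qed
  then obtain f where f: "\<And>n. same B (fst (f n)) (snd (f n))" "f 0 = (xs, ys)" "\<And>n. Q n (f n) (f (Suc n))"
    by blast
  \<comment> \<open>The lists only grow at the end, so an entry never changes once it is present;
    the automorphism takes \<open>X i\<close> to \<open>Y i\<close>.\<close>
  define X Y where "X = (\<lambda>i. fst (f (Suc i)) ! i)" and "Y = (\<lambda>i. snd (f (Suc i)) ! i)"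
  have len: "length (fst (f n)) = length xs + 2 * n \<and> length (snd (f n)) = length xs + 2 * n" for n
  proof (induction n)
    case 0 then show ?case using f(2) s by (simp add: same_def)
  next
    case (Suc n) then show ?case using f(3)[of n] by (auto simp: Q_def)
  qed
  have xs0: "length xs > 0" using s by (auto simp: same_def)
  have pre: "n \<le> m \<Longrightarrow> i < length xs + 2 * n \<Longrightarrow> fst (f m) ! i = fst (f n) ! i \<and> snd (f m) ! i = snd (f n) ! i" for n m i
  proof (induction m rule: nat_induct_at_least)
    case base then show ?case by simp
  next
    case (Suc m) then show ?case using f(3)[of m] len[of m] by (auto simp: Q_def nth_append)
  qed
  have XY: "X i = fst (f m) ! i" "Y i = snd (f m) ! i" if "i < length xs + 2 * m" for i m
    using pre[of "Suc i" "max (Suc i) m" i] pre[of m "max (Suc i) m" i] that by (auto simp: X_def Y_def)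
  have U: "set (fst (f n)) \<subseteq> U" "set (snd (f n)) \<subseteq> U" for n using f(1)[of n] by (auto simp: same_def)
  have XU: "X i \<in> U" and YU: "Y i \<in> U" for i
    using U[of "Suc i"] len[of "Suc i"] by (auto simp: X_def Y_def subset_iff)
  have rX: "range X = U" and rY: "range Y = U"
  proof -
    have "u n \<in> range X" for n
    proof -
      have "fst (f (Suc n)) ! (length xs + 2 * n) = u n" using f(3)[of n] len[of n] by (auto simp: Q_def nth_append)
      then show ?thesis using XY(1)[of "length xs + 2 * n" "Suc n"] by (metis (no_types) add_less_cancel_left lessI mult_less_cancel2 mult.commute rangeI zero_less_numeral)
    qed
    then show "range X = U" using XU u by auto
    have "u n \<in> range Y" for n
    proof -
      have "snd (f (Suc n)) ! (length xs + 2 * n + 1) = u n" using f(3)[of n] len[of n] by (auto simp: Q_def nth_append)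
      moreover have "length xs + 2 * n + 1 < length xs + 2 * Suc n" by simp
      ultimately show ?thesis using XY(2)[of "length xs + 2 * n + 1" "Suc n"] by (metis rangeI)
    qed
    then show "range Y = U" using YU u by auto
  qed
  have tr: "P (\<lambda>i. X (g i)) = P (\<lambda>i. Y (g i))" if P: "Dp B P" for P g
  proof -
    obtain n where n: "\<And>e e'. e \<in> AS \<Longrightarrow> e' \<in> AS \<Longrightarrow> (\<forall>i<n. e i = e' i) \<Longrightarrow> P e = P e'"
      using D_supp[OF P] by blast
    define N where "N = Max (insert 0 (g ` {..<n}))"
    have N: "g i \<le> N" if "i < n" for i using that by (auto simp: N_def)
    have gl: "g i < length xs + 2 * Suc N" if "i < n" for i using N[OF that] by simp
    show ?thesis
    proof (rule same_nth[OF f(1)[of "Suc N"] P, of n g])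
      show "g i < length (fst (f (Suc N)))" if "i < n" for i using gl[OF that] len[of "Suc N"] by simp
      show "P e = P e'" if "e \<in> AS" "e' \<in> AS" "\<forall>i<n. e i = e' i" for e e' using n that by blast
      show "(\<lambda>i. X (g i)) \<in> AS" "(\<lambda>i. Y (g i)) \<in> AS" using XU YU by (auto simp: asg_def)
      show "X (g i) = fst (f (Suc N)) ! g i" "Y (g i) = snd (f (Suc N)) ! g i" if "i < n" for i
        using XY[OF gl[OF that]] by auto
    qed
  qed
  have BU: "B \<subseteq> U" by fact
  have inj: "X i = X j \<longleftrightarrow> Y i = Y j" for i j
    using tr[OF D_eq[OF BU, of i j], of "\<lambda>i. i"] by simp
  define \<sigma> where "\<sigma> = (\<lambda>x. Y (SOME i. X i = x))"
  have \<sigma>X: "\<sigma> (X i) = Y i" for i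
  proof -
    have "X (SOME j. X j = X i) = X i" by (rule someI[of _ i]) simp
    then show ?thesis by (simp add: \<sigma>_def inj)
  qed
  have bij: "bij_betw \<sigma> U U"
    unfolding bij_betw_def
  proof
    show "inj_on \<sigma> U" using rX inj \<sigma>X by (auto simp: inj_on_def)
    show "\<sigma> ` U = U" using rX rY \<sigma>X by (metis (no_types, lifting) image_cong image_image)
  qed
  have inv: "P (\<lambda>i. \<sigma> (e i)) = P e" if P: "Dp B P" and e: "e \<in> AS" for P e
  proof -
    have "\<forall>i. \<exists>j. e i = X j" using e rX by (metis asgD image_iff)
    then obtain g where g: "\<And>i. e i = X (g i)" by metis
    have "P (\<lambda>i. \<sigma> (e i)) = P (\<lambda>i. Y (g i))" by (simp add: g \<sigma>X)
    also have "\<dots> = P (\<lambda>i. X (g i))" using tr[OF P] by simp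
    also have "\<dots> = P e" by (simp add: g[symmetric])
    finally show ?thesis .
  qed
  have fixB: "\<sigma> b = b" if b: "b \<in> B" for b
  proof -
    have "Dp B (\<lambda>e. e 0 = b)" using D_equal[OF BU tmv tmc[OF b]] .
    from inv[OF this, of "\<lambda>_. b"] show ?thesis using b BU by auto
  qed
  have "\<sigma> \<in> Au B" using bij fixB inv D_mono[of "{}" _ B] BU by (auto simp: Au_def Gr_def)
  moreover have "map \<sigma> xs = ys"
  proof (rule nth_equalityI)
    show "length (map \<sigma> xs) = length ys" using s by (simp add: same_def)
    fix i assume "i < length (map \<sigma> xs)"
    then show "map \<sigma> xs ! i = ys ! i" using XY[of i 0] f(2) \<sigma>X[of i] by simp
  qed
  ultimately show ?thesis by blast
qed

lemma eqv_same: "eqv B a b \<longleftrightarrow> same B [a] [b]"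
  by (auto simp: eqv_def same_def)

text \<open>Types over a finite set are orbits of its automorphisms; from here on, realizing a type
  means moving a point.\<close>

lemma eqv_iff: "finite B \<Longrightarrow> B \<subseteq> U \<Longrightarrow> eqv B a b \<longleftrightarrow> a \<in> U \<and> (\<exists>\<sigma>\<in>Au B. \<sigma> a = b)"
proof
  assume B: "finite B" "B \<subseteq> U" and "eqv B a b"
  then show "a \<in> U \<and> (\<exists>\<sigma>\<in>Au B. \<sigma> a = b)"
    using same_homog[OF B, of "[a]" "[b]"] by (auto simp: eqv_same same_def)
next
  assume B: "finite B" "B \<subseteq> U" and "a \<in> U \<and> (\<exists>\<sigma>\<in>Au B. \<sigma> a = b)"
  then obtain \<sigma> where \<sigma>: "\<sigma> \<in> Au B" "a \<in> U" "b = \<sigma> a" by blast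
  then have "P (\<lambda>_. a) = P (\<lambda>_. b)" if "Dp B P" for P
    using Au_Dp[OF B(1) \<sigma>(1) that, of "\<lambda>_. a"] by simp
  then show "eqv B a b" using \<sigma> by (simp add: eqv_def)
qed

lemma Au_id: "id \<in> Au B"
  by (auto simp: Au_def Gr_def)

lemma Au_comp:
  assumes "\<sigma> \<in> Au B" "\<tau> \<in> Au B" shows "\<sigma> \<circ> \<tau> \<in> Au B"
proof -
  have "P (\<lambda>i. (\<sigma> \<circ> \<tau>) (e i)) = P e" if P: "Dp {} P" and e: "e \<in> AS" for P e
  proof -
    have "(\<lambda>i. \<tau> (e i)) \<in> AS" using e assms by (simp add: asg_def)
    moreover have "\<forall>e\<in>AS. P (\<lambda>i. \<sigma> (e i)) = P e" using assms(1) P by (simp add: Au_def Gr_def)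
    ultimately have "P (\<lambda>i. \<sigma> (\<tau> (e i))) = P (\<lambda>i. \<tau> (e i))" by (rule bspec[of AS "\<lambda>e. P (\<lambda>i. \<sigma> (e i)) = P e", rotated])
    also have "\<dots> = P e" using assms(2) P e by (simp add: Au_def Gr_def)
    finally show ?thesis by simp
  qed
  then show ?thesis using assms by (auto simp: Au_def Gr_def intro: bij_betw_trans)
qed

lemma Au_inv:
  assumes "\<sigma> \<in> Au B" "B \<subseteq> U"
  shows "\<exists>\<tau>\<in>Au B. (\<forall>a\<in>U. \<tau> (\<sigma> a) = a) \<and> (\<forall>a\<in>U. \<sigma> (\<tau> a) = a)"
proof -
  have b: "bij_betw \<sigma> U U" using assms by (auto simp: Au_def Gr_def)
  define \<tau> where "\<tau> = the_inv_into U \<sigma>"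
  have t: "bij_betw \<tau> U U" "\<And>a. a \<in> U \<Longrightarrow> \<tau> (\<sigma> a) = a" "\<And>a. a \<in> U \<Longrightarrow> \<sigma> (\<tau> a) = a"
    using b bij_betw_the_inv_into[OF b] unfolding \<tau>_def
    by (auto simp: the_inv_into_f_f f_the_inv_into_f bij_betw_def)
  have "P (\<lambda>i. \<tau> (e i)) = P e" if "Dp {} P" "e \<in> AS" for P e
  proof -
    have "(\<lambda>i. \<tau> (e i)) \<in> AS" using that t(1) by (auto simp: asg_def bij_betw_def)
    then have "P (\<lambda>i. \<sigma> (\<tau> (e i))) = P (\<lambda>i. \<tau> (e i))" using assms(1) that by (auto simp: Au_def Gr_def)
    then show ?thesis using t(3) that by (simp add: asg_def)
  qed
  moreover have "\<tau> b = b" if "b \<in> B" for b using t(2)[of b] assms that by (auto simp: Au_def)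
  ultimately have "\<tau> \<in> Au B" using t(1) by (auto simp: Au_def Gr_def)
  then show ?thesis using t by blast
qed

lemma Au_mono: "\<sigma> \<in> Au B \<Longrightarrow> C \<subseteq> B \<Longrightarrow> \<sigma> \<in> Au C"
  by (auto simp: Au_def)

lemma Au_insert: "\<sigma> \<in> Au B \<Longrightarrow> \<sigma> c = c \<Longrightarrow> \<sigma> \<in> Au (insert c B)"
  by (auto simp: Au_def)

lemma Au_lt: "\<sigma> \<in> Au B \<Longrightarrow> a \<in> U \<Longrightarrow> b \<in> U \<Longrightarrow> r (\<sigma> a) < r (\<sigma> b) \<longleftrightarrow> r a < r b"
  using Au_Dp[of "{}" \<sigma> "\<lambda>e. r (e 0) < r (e 1)" "case_nat a (\<lambda>_. b)"] D_lt[of "{}" 0 1]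
  by (auto intro: Au_mono)

lemma Au_le: "\<sigma> \<in> Au B \<Longrightarrow> a \<in> U \<Longrightarrow> b \<in> U \<Longrightarrow> r (\<sigma> a) \<le> r (\<sigma> b) \<longleftrightarrow> r a \<le> r b"
  using Au_lt[of \<sigma> B b a] by (auto simp: not_less[symmetric])

lemma Au_2: "finite B \<Longrightarrow> \<sigma> \<in> Au B \<Longrightarrow> Dp B (\<lambda>e. X (e 0) (e 1)) \<Longrightarrow> a \<in> U \<Longrightarrow> b \<in> U \<Longrightarrow>
    X (\<sigma> a) (\<sigma> b) = X a b"
  using Au_Dp[of B \<sigma> "\<lambda>e. X (e 0) (e 1)" "case_nat a (\<lambda>_. b)"] by simp

lemma eqv_refl [simp]: "a \<in> U \<Longrightarrow> eqv B a a" by (auto simp: eqv_def)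
lemma eqv_sym: "eqv B a b \<Longrightarrow> eqv B b a" by (auto simp: eqv_def)
lemma eqv_trans [trans]: "eqv B a b \<Longrightarrow> eqv B b c \<Longrightarrow> eqv B a c" by (auto simp: eqv_def)
lemma eqv_U: "eqv B a b \<Longrightarrow> a \<in> U \<and> b \<in> U" by (auto simp: eqv_def)
lemma eqv_mono: "eqv B a b \<Longrightarrow> C \<subseteq> B \<Longrightarrow> B \<subseteq> U \<Longrightarrow> eqv C a b"
  by (auto simp: eqv_def intro: D_mono)

lemma eqv_Au: "finite B \<Longrightarrow> B \<subseteq> U \<Longrightarrow> \<sigma> \<in> Au B \<Longrightarrow> a \<in> U \<Longrightarrow> eqv B a (\<sigma> a)"
  by (auto simp: eqv_iff)

lemma eqv_1: "eqv B a b \<Longrightarrow> Dp B (\<lambda>e. X (e 0)) \<Longrightarrow> X a = X b"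
  by (auto simp: eqv_def dest: spec[of _ "\<lambda>e. X (e 0)"])

text \<open>An automorphism moves types over \<open>C\<close> to types over the image of \<open>C\<close>.\<close>

lemma eqv_move:
  assumes C: "finite C" "C \<subseteq> U" and \<sigma>: "\<sigma> \<in> Gr" and e: "eqv C a b"
  shows "eqv (\<sigma> ` C) (\<sigma> a) (\<sigma> b)"
proof -
  have C': "finite (\<sigma> ` C)" "\<sigma> ` C \<subseteq> U" using C \<sigma> by auto
  have ab: "a \<in> U" "b \<in> U" using e by (auto simp: eqv_def)
  obtain \<tau> where \<tau>: "\<tau> \<in> Au C" "\<tau> a = b" using e C by (auto simp: eqv_iff)
  have "\<sigma> \<in> Au {}" using \<sigma> by (simp add: Au_def)
  then obtain \<rho> where \<rho>: "\<rho> \<in> Au {}" "\<And>x. x \<in> U \<Longrightarrow> \<rho> (\<sigma> x) = x" "\<And>x. x \<in> U \<Longrightarrow> \<sigma> (\<rho> x) = x"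
    using Au_inv[of \<sigma> "{}"] by auto
  have "\<sigma> \<circ> (\<tau> \<circ> \<rho>) \<in> Au {}" using \<open>\<sigma> \<in> Au {}\<close> \<rho> \<tau> by (intro Au_comp) (auto intro: Au_mono)
  then have "\<sigma> \<circ> (\<tau> \<circ> \<rho>) \<in> Au (\<sigma> ` C)" using \<rho> \<tau> C by (auto simp: Au_def subset_iff)
  moreover have "(\<sigma> \<circ> (\<tau> \<circ> \<rho>)) (\<sigma> a) = \<sigma> b" using \<rho> \<tau> ab by simp
  ultimately show ?thesis unfolding eqv_iff[OF C'] using Gr_U[OF \<sigma> ab(1)] by blast
qed

end

section \<open>Compactness for types, and definable convex sets\<close>

context definability
begin

lemmas Dintros = D_conj D_disj D_imp D_neg D_le D_less D_equal D_exn D_alln tmv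

text \<open>Otherwise the type of \<open>z\<close> over \<open>B\<close> together with the negation
  of \<open>X\<close> is finitely satisfiable, and a realization contradicts the last assumption.
  This replaces a whole type by one of its formulas, over fewer parameters than \<open>X\<close>
  has.\<close>

lemma type_compact:
  assumes C: "finite C" "C \<subseteq> U" "B \<subseteq> C" and X: "Dp C (\<lambda>e. X (e 0))" and z: "z \<in> U"
    and "\<And>y. eqv B z y \<Longrightarrow> X y"
  shows "\<exists>Q. Dp B (\<lambda>e. Q (e 0)) \<and> Q z \<and> (\<forall>y\<in>U. Q y \<longrightarrow> X y)"
proof (rule ccontr)
  assume "\<not> ?thesis"
  then have neg: "\<And>Q. Dp B (\<lambda>e. Q (e 0)) \<Longrightarrow> Q z \<Longrightarrow> \<exists>y\<in>U. Q y \<and> \<not> X y" by blast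
  define \<P> where "\<P> = {P. Dp B P \<and> P (\<lambda>_. z)}"
  have "\<exists>a\<in>U. \<forall>Q\<in>insert (\<lambda>e. \<not> X (e 0)) \<P>. Q (\<lambda>_. a)"
  proof (rule D_sat[OF C(1,2)])
    fix Q assume "Q \<in> insert (\<lambda>e. \<not> X (e 0)) \<P>"
    then show "Dp C Q" using D_neg[OF X] D_mono[OF _ C(3,2)] by (auto simp: \<P>_def)
  next
    fix F assume F: "F \<subseteq> insert (\<lambda>e. \<not> X (e 0)) \<P>" "finite F"
    have D: "Dp B (\<lambda>e. \<forall>Q\<in>F \<inter> \<P>. Q (\<lambda>_. e 0))"
      using F C by (intro D_Ball) (auto simp: \<P>_def intro: D_ren)
    obtain y where "y \<in> U" "\<forall>Q\<in>F \<inter> \<P>. Q (\<lambda>_. y)" "\<not> X y"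
      using neg[of "\<lambda>y. \<forall>Q\<in>F \<inter> \<P>. Q (\<lambda>_. y)", OF D] by (auto simp: \<P>_def)
    then show "\<exists>a\<in>U. \<forall>Q\<in>F. Q (\<lambda>_. a)" using F by blast
  qed
  then obtain a where a: "a \<in> U" "\<not> X a" "\<And>P. Dp B P \<Longrightarrow> P (\<lambda>_. z) \<Longrightarrow> P (\<lambda>_. a)"
    by (auto simp: \<P>_def)
  have "P (\<lambda>_. z) = P (\<lambda>_. a)" if "Dp B P" for P using a(3)[OF that] a(3)[OF D_neg[OF that]] by blast
  then have "eqv B z a" using a z by (simp add: eqv_def)
  then show False using a assms by blast
qed

lemma binary_abs:
  assumes "Dp (insert b B) (\<lambda>e. Q (e 0))"
  shows "\<exists>S. Dp B (\<lambda>e. S (e 0) (e 1)) \<and> (\<forall>y\<in>U. Q y = S y b)"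
proof -
  obtain R j where R: "Dp B R" "\<And>e. e \<in> AS \<Longrightarrow> Q (e 0) = R (e(j := b))" using D_abs[OF assms] by blast
  have "Dp B (\<lambda>e. R (\<lambda>i. (if i = j then (\<lambda>e. e 1) else (\<lambda>e. e 0)) e))"
    by (rule D_terms[OF R(1)]) (auto simp: tmv)
  then have "Dp B (\<lambda>e. R ((\<lambda>_. e 0)(j := e 1)))"
    by (rule D_cong) (auto intro!: arg_cong[of _ _ R])
  then show ?thesis using R(2)[of "\<lambda>_. y" for y]
    by (intro exI[of _ "\<lambda>y c. R ((\<lambda>_. y)(j := c))"]) auto
qed

lemma eqv_neq:
  assumes "\<not> eqv B x y" "x \<in> U" "y \<in> U"
  shows "\<exists>D. Dp B (\<lambda>e. D (e 0)) \<and> D y \<and> (\<forall>w. eqv B x w \<longrightarrow> \<not> D w)"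
proof -
  obtain P where P: "Dp B P" "P (\<lambda>_. x) \<noteq> P (\<lambda>_. y)" using assms by (auto simp: eqv_def)
  have d: "Dp B (\<lambda>e. P (\<lambda>_. e 0))" by (rule D_ren[OF P(1)])
  have n: "Dp B (\<lambda>e. \<not> P (\<lambda>_. e 0))" by (rule D_neg[OF d])
  have e: "P (\<lambda>_. w) = P (\<lambda>_. x)" if "eqv B x w" for w using that P by (auto simp: eqv_def)
  show ?thesis
  proof (cases "P (\<lambda>_. x)")
    case True
    then show ?thesis using P n e by (intro exI[of _ "\<lambda>w. \<not> P (\<lambda>_. w)"]) simp
  next
    case False
    then show ?thesis using P d e by (intro exI[of _ "\<lambda>w. P (\<lambda>_. w)"]) simp
  qed
qed

definition cvx :: "('m \<Rightarrow> bool) \<Rightarrow> bool" where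
  "cvx C \<longleftrightarrow> (\<forall>a\<in>U. \<forall>b\<in>U. \<forall>c\<in>U. C a \<and> C b \<and> r a \<le> r c \<and> r c \<le> r b \<longrightarrow> C c)"

lemma cvxD: "cvx C \<Longrightarrow> C a \<Longrightarrow> C b \<Longrightarrow> a \<in> U \<Longrightarrow> b \<in> U \<Longrightarrow> c \<in> U \<Longrightarrow> r a \<le> r c \<Longrightarrow> r c \<le> r b \<Longrightarrow> C c"
  unfolding cvx_def by (drule bspec[of U _ a], assumption, drule bspec[of U _ b], assumption,
    drule bspec[of U _ c], assumption, simp)

text \<open>Reversing the order changes only the rank, so a statement about one direction transfers
  to the other by interpretation at \<open>- r\<close>.\<close>

lemma dual0: "definability U (\<lambda>a. - r a) Dp"
proof
  show "inj_on (\<lambda>a. - r a) U" using r_inj by (auto simp: inj_on_def)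
  show "Dp B (\<lambda>e. - r (e i) < - r (e j))" if "B \<subseteq> U" for B i j using D_lt[OF that, of j i] by simp
qed (fact U_inf U_cnt D_par D_cong D_sub D_neg D_conj D_ex D_supp D_abs D_mono D_eq D_cnt D_sat)+

lemma cvx_minus: "definability.cvx U (\<lambda>a. - r a) C = cvx C"
  unfolding definability.cvx_def[OF dual0] cvx_def by auto

text \<open>If the convex set contains \<open>y\<close>, it has members at or above \<open>a\<close>
  and members at or below \<open>b\<close>. Both one-sided properties depend only on the type, so
  \<open>x\<close> has them too and lies between two members.\<close>

lemma eqv_cut:
  assumes B: "B \<subseteq> U" and e: "eqv B x a" "eqv B x b" and y: "y \<in> U" "r a \<le> r y" "r y \<le> r b"
    and C: "Dp B (\<lambda>e. C (e 0))" "cvx C"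
  shows "C x = C y"
proof
  assume "C x"
  then have "C a" "C b" using eqv_1[OF e(1) C(1)] eqv_1[OF e(2) C(1)] by auto
  then show "C y" using cvxD[OF C(2), of a b y] y eqv_U[OF e(1)] eqv_U[OF e(2)] by simp
next
  assume y': "C y"
  let ?L = "\<lambda>v. \<exists>c\<in>U. C c \<and> r v \<le> r c" and ?R = "\<lambda>v. \<exists>c\<in>U. C c \<and> r c \<le> r v"
  have L: "Dp B (\<lambda>e. ?L (e 0))" and R: "Dp B (\<lambda>e. ?R (e 0))"
    by (intro Dintros D1[OF C(1)] B)+
  have "?L a" "?R b" using y y' by auto
  then have "?L x" "?R x" using eqv_1[OF e(1) L] eqv_1[OF e(2) R] by auto
  then obtain c d where "c \<in> U" "C c" "r x \<le> r c" "d \<in> U" "C d" "r d \<le> r x" by auto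
  then show "C x" using cvxD[OF C(2), of d c x] eqv_U[OF e(1)] by simp
qed

text \<open>For \<open>s = r\<close> this is the property that right-convex formulas on a type are
  equivalence-generating, for \<open>s = - r\<close> the one about left-convex formulas.\<close>

definition P3 :: "('m \<Rightarrow> real) \<Rightarrow> bool" where
  "P3 s \<longleftrightarrow> (\<forall>B R q. finite B \<and> B \<subseteq> U \<and> Dp B (\<lambda>e. R (e 0) (e 1)) \<and> q \<in> U \<and> R q q \<and>
     (\<forall>x\<in>U. R x q \<longrightarrow> s q \<le> s x) \<and> (\<exists>y. eqv B q y \<and> y \<noteq> q \<and> R y q) \<and>
     (\<exists>g. eqv B q g \<and> s g < s q) \<and> (\<exists>g. eqv B q g \<and> (\<forall>x\<in>U. R x q \<longrightarrow> s x < s g)) \<and>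
     (\<forall>a b c. eqv B q a \<and> eqv B q b \<and> eqv B q c \<and> R a q \<and> R b q \<and> s a < s c \<and> s c < s b \<longrightarrow> R c q)
     \<longrightarrow> (\<forall>a b x. eqv B q a \<and> eqv B q b \<and> R b a \<and> x \<in> U \<and> s b \<le> s x \<longrightarrow> R x a = R x b))"

lemma P3D:
  assumes "P3 s" "finite B" "B \<subseteq> U" "Dp B (\<lambda>e. R (e 0) (e 1))" "R q q"
    "\<And>x. x \<in> U \<Longrightarrow> R x q \<Longrightarrow> s q \<le> s x" "eqv B q y" "y \<noteq> q" "R y q"
    "eqv B q g" "s g < s q" "eqv B q g'" "\<And>x. x \<in> U \<Longrightarrow> R x q \<Longrightarrow> s x < s g'"
    "\<And>a b c. eqv B q a \<Longrightarrow> eqv B q b \<Longrightarrow> eqv B q c \<Longrightarrow> R a q \<Longrightarrow> R b q \<Longrightarrow> s a < s c \<Longrightarrow> s c < s b \<Longrightarrow> R c q"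
    "eqv B q a" "eqv B q b" "R b a" "x \<in> U" "s b \<le> s x"
  shows "R x a = R x b"
proof -
  have q: "q \<in> U" using assms(7) by (auto dest: eqv_U)
  have "finite B \<and> B \<subseteq> U \<and> Dp B (\<lambda>e. R (e 0) (e 1)) \<and> q \<in> U \<and> R q q \<and>
     (\<forall>x\<in>U. R x q \<longrightarrow> s q \<le> s x) \<and> (\<exists>y. eqv B q y \<and> y \<noteq> q \<and> R y q) \<and>
     (\<exists>g. eqv B q g \<and> s g < s q) \<and> (\<exists>g. eqv B q g \<and> (\<forall>x\<in>U. R x q \<longrightarrow> s x < s g)) \<and>
     (\<forall>a b c. eqv B q a \<and> eqv B q b \<and> eqv B q c \<and> R a q \<and> R b q \<and> s a < s c \<and> s c < s b \<longrightarrow> R c q)"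
  proof (intro conjI)
    show "\<exists>y. eqv B q y \<and> y \<noteq> q \<and> R y q" using assms(7-9) by blast
    show "\<exists>g. eqv B q g \<and> s g < s q" using assms(10,11) by blast
    show "\<exists>g. eqv B q g \<and> (\<forall>x\<in>U. R x q \<longrightarrow> s x < s g)" using assms(12,13) by blast
    show "\<forall>a b c. eqv B q a \<and> eqv B q b \<and> eqv B q c \<and> R a q \<and> R b q \<and> s a < s c \<and> s c < s b \<longrightarrow> R c q"
      using assms(14) by blast
    show "\<forall>x\<in>U. R x q \<longrightarrow> s q \<le> s x" using assms(6) by blast
  qed (use assms(2-5) q in simp_all)
  then have "\<forall>a b x. eqv B q a \<and> eqv B q b \<and> R b a \<and> x \<in> U \<and> s b \<le> s x \<longrightarrow> R x a = R x b"
    by (rule assms(1)[unfolded P3_def, THEN spec[of _ B], THEN spec[of _ R], THEN spec[of _ q], THEN mp])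
  then show ?thesis using assms(15-19) by blast
qed

end

section \<open>The Restriction and the chain of equivalence relations\<close>

text \<open>The clauses in terms of orbits. \<open>R2\<close> is the finiteness of the set of types
  with a given convex closure, as a pigeonhole: points that no convex \<open>B\<close>-definable set
  separates from \<open>z\<close> share its closure, so two of infinitely many have the same type.
  In \<open>R1\<close> the descending relations are one predicate with varying parameters, compared
  only on the realizations of a type.\<close>

locale restricted = definability +
  assumes R3r: "P3 r" and R3l: "P3 (\<lambda>a. - r a)"
    and R2: "finite B \<Longrightarrow> B \<subseteq> U \<Longrightarrow> z \<in> U \<Longrightarrow> range \<beta> \<subseteq> U \<Longrightarrow> infinite J \<Longrightarrow>
      (\<And>C j. Dp B (\<lambda>e. C (e 0)) \<Longrightarrow> cvx C \<Longrightarrow> j \<in> J \<Longrightarrow> C z = C (\<beta> j)) \<Longrightarrow>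
      \<exists>j\<in>J. \<exists>l\<in>J. j < l \<and> eqv B (\<beta> j) (\<beta> (l::nat))"
    and R1: "finite B \<Longrightarrow> B \<subseteq> U \<Longrightarrow> q \<in> U \<Longrightarrow> Dp B (\<lambda>e. \<epsilon> (e 0) (e 1) (\<lambda>i. e (Suc (Suc i)))) \<Longrightarrow>
      (\<And>i. b i \<in> asg U) \<Longrightarrow>
      (\<And>i x. eqv B q x \<Longrightarrow> \<epsilon> x x (b i)) \<Longrightarrow>
      (\<And>i x y. eqv B q x \<Longrightarrow> eqv B q y \<Longrightarrow> \<epsilon> x y (b i) \<Longrightarrow> \<epsilon> y x (b i)) \<Longrightarrow>
      (\<And>i x y z. eqv B q x \<Longrightarrow> eqv B q y \<Longrightarrow> eqv B q z \<Longrightarrow> \<epsilon> x y (b i) \<Longrightarrow> \<epsilon> y z (b i) \<Longrightarrow> \<epsilon> x z (b i)) \<Longrightarrow>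
      (\<And>i x y z. eqv B q x \<Longrightarrow> eqv B q y \<Longrightarrow> eqv B q z \<Longrightarrow> r x < r y \<Longrightarrow> r y < r z \<Longrightarrow> \<epsilon> x z (b i) \<Longrightarrow> \<epsilon> x y (b i)) \<Longrightarrow>
      (\<And>i x y. eqv B q x \<Longrightarrow> eqv B q y \<Longrightarrow> r x < r y \<Longrightarrow> \<not> \<epsilon> x y (b i) \<Longrightarrow>
         \<exists>z. eqv B q z \<and> r x < r z \<and> r z < r y \<and> \<not> \<epsilon> x z (b i) \<and> \<not> \<epsilon> z y (b i)) \<Longrightarrow>
      (\<And>i x y. eqv B q x \<Longrightarrow> eqv B q y \<Longrightarrow> \<epsilon> x y (b (Suc i)) \<Longrightarrow> \<epsilon> x y (b i)) \<Longrightarrow>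
      (\<And>i x. eqv B q x \<Longrightarrow> infinite ((\<lambda>y. {z. eqv B q z \<and> \<epsilon> y z (b (Suc i))}) ` {y. eqv B q y \<and> \<epsilon> x y (b i)})) \<Longrightarrow>
      (\<And>i x. eqv B q x \<Longrightarrow> infinite {y. eqv B q y \<and> \<epsilon> x y (b (Suc i))}) \<Longrightarrow> False"

text \<open>By \<open>E_P\<close> a class never leaves the type of \<open>p0\<close>, so the classes
  act as balls that are definable from their centre and consist of realizations. \<open>E_up\<close>
  and \<open>E_down\<close> leave room between consecutive levels on both sides of every
  point.\<close>

locale echain = restricted +
  fixes A :: "'a set" and p0 :: 'a and E :: "nat \<Rightarrow> 'a \<Rightarrow> 'a \<Rightarrow> bool"
  assumes A: "finite A" "A \<subseteq> U" and p0: "p0 \<in> U"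
    and E_D: "Dp A (\<lambda>e. E k (e 0) (e 1))"
    and E_P: "eqv A p0 a \<Longrightarrow> E k a b \<Longrightarrow> eqv A p0 b"
    and E_refl: "eqv A p0 a \<Longrightarrow> E k a a"
    and E_sym: "eqv A p0 a \<Longrightarrow> E k a b \<Longrightarrow> E k b a"
    and E_trans: "eqv A p0 a \<Longrightarrow> E k a b \<Longrightarrow> E k b c \<Longrightarrow> E k a c"
    and E_cvx: "eqv A p0 a \<Longrightarrow> eqv A p0 c \<Longrightarrow> E k a b \<Longrightarrow> r a \<le> r c \<Longrightarrow> r c \<le> r b \<Longrightarrow> E k a c"
    and E_Suc: "eqv A p0 a \<Longrightarrow> E (Suc k) a b \<Longrightarrow> E k a b"
    and E_up: "eqv A p0 a \<Longrightarrow> \<exists>b. r a < r b \<and> E k a b \<and> \<not> E (Suc k) a b"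
    and E_down: "eqv A p0 a \<Longrightarrow> \<exists>b. r b < r a \<and> E k a b \<and> \<not> E (Suc k) a b"
    and out_up: "eqv A p0 a \<Longrightarrow> \<exists>b. eqv A p0 b \<and> r a < r b \<and> \<not> E 0 a b"
    and out_down: "eqv A p0 a \<Longrightarrow> \<exists>b. eqv A p0 b \<and> r b < r a \<and> \<not> E 0 a b"
begin

section \<open>Points free or closed over a parameter set\<close>

abbreviation "P \<equiv> eqv A p0"

definition Einf :: "'a \<Rightarrow> 'a \<Rightarrow> bool" where
  "Einf x y \<longleftrightarrow> (\<forall>k. E k x y)"

text \<open>The \<open>E k\<close>-classes are shrinking balls around \<open>x\<close>; freeness
  means that one of them is contained in the type of \<open>x\<close> over \<open>B\<close>.\<close>

definition free :: "'a set \<Rightarrow> 'a \<Rightarrow> bool" where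
  "free B x \<longleftrightarrow> (\<exists>J. \<forall>y. E J x y \<longrightarrow> eqv B x y)"

text \<open>The opposite extreme: \<open>B\<close> determines \<open>x\<close> up to its
  \<open>Einf\<close>-class.\<close>

definition closed :: "'a set \<Rightarrow> 'a \<Rightarrow> bool" where
  "closed B x \<longleftrightarrow> (\<forall>y k. eqv B x y \<longrightarrow> E k x y)"

lemma P_U: "P a \<Longrightarrow> a \<in> U" by (simp add: eqv_def)

lemma P_eqv: "P a \<Longrightarrow> eqv B a b \<Longrightarrow> A \<subseteq> B \<Longrightarrow> B \<subseteq> U \<Longrightarrow> P b"
  using eqv_mono eqv_trans by blast

lemma P_Au: "P a \<Longrightarrow> \<sigma> \<in> Au B \<Longrightarrow> A \<subseteq> B \<Longrightarrow> P (\<sigma> a)"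
  using eqv_Au[OF A, of \<sigma> a] Au_mono[of \<sigma> B A] eqv_trans P_U by blast

lemma E_D': "A \<subseteq> B \<Longrightarrow> B \<subseteq> U \<Longrightarrow> tmd B s \<Longrightarrow> tmd B t \<Longrightarrow> Dp B (\<lambda>e. E k (s e) (t e))"
  by (rule D2[OF D_mono[OF E_D]])

lemma E_mono: "j \<le> k \<Longrightarrow> P a \<Longrightarrow> E k a b \<Longrightarrow> E j a b"
proof (induction k rule: dec_induct)
  case (step n) then show ?case using E_Suc by blast
qed

lemma E_Au: "\<sigma> \<in> Au B \<Longrightarrow> A \<subseteq> B \<Longrightarrow> a \<in> U \<Longrightarrow> b \<in> U \<Longrightarrow> E k (\<sigma> a) (\<sigma> b) = E k a b"
  by (rule Au_2[OF A(1) Au_mono E_D])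

lemma E_U: "P a \<Longrightarrow> E k a b \<Longrightarrow> b \<in> U" using E_P P_U by blast

lemma E_btw: "P a \<Longrightarrow> P c \<Longrightarrow> P b \<Longrightarrow> r b \<le> r c \<Longrightarrow> r c \<le> r d \<Longrightarrow> E k a b \<Longrightarrow> E k a d \<Longrightarrow> E k a c"
  using E_cvx[of b c k d] E_trans[of b k a d] E_trans[of a k b c] E_sym[of a k b] by blast

lemma E_btw2: "P a \<Longrightarrow> P c \<Longrightarrow> r b \<le> r c \<Longrightarrow> r c \<le> r a \<Longrightarrow> E k a b \<Longrightarrow> E k a c"
  using E_btw[of a c b a k] E_P E_refl by blast

text \<open>If \<sigma> carries \<open>x\<close> to \<open>y\<close>, its inverse carries
  \<open>x\<close> to the other side, at the same levels of closeness.\<close>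

lemma swap_side:
  assumes "finite B" "A \<subseteq> B" "B \<subseteq> U" "P x" "eqv B x y"
  shows "\<exists>y'. eqv B x y' \<and> (\<forall>k. E k x y' = E k x y) \<and> (r x < r y \<longrightarrow> r y' < r x) \<and> (r y < r x \<longrightarrow> r x < r y')"
proof -
  have x: "x \<in> U" "y \<in> U" using assms(5) by (auto dest: eqv_U)
  obtain \<sigma> where \<sigma>: "\<sigma> \<in> Au B" "\<sigma> x = y" using assms eqv_iff by blast
  obtain \<tau> where \<tau>: "\<tau> \<in> Au B" "\<And>a. a \<in> U \<Longrightarrow> \<sigma> (\<tau> a) = a" using Au_inv[OF \<sigma>(1) assms(3)] by blast
  have t: "\<tau> x \<in> U" using \<tau> x by simp
  have "eqv B x (\<tau> x)" using assms \<tau> x by (intro eqv_Au) auto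
  moreover have "E k x (\<tau> x) = E k x y" for k
  proof -
    have "E k (\<tau> x) x = E k (\<sigma> (\<tau> x)) (\<sigma> x)" using E_Au[OF \<sigma>(1) assms(2) t x(1)] by simp
    also have "\<dots> = E k x y" using \<tau> \<sigma> x by simp
    finally show ?thesis using E_sym assms(4) P_Au[OF assms(4) \<tau>(1) assms(2)] by blast
  qed
  moreover have "r (\<tau> x) < r x \<longleftrightarrow> r x < r y" "r x < r (\<tau> x) \<longleftrightarrow> r y < r x"
    using Au_lt[OF \<sigma>(1), of "\<tau> x" x] Au_lt[OF \<sigma>(1), of x "\<tau> x"] \<sigma> \<tau> x t by auto
  ultimately show ?thesis by blast
qed

lemma both_sides:
  assumes "finite B" "A \<subseteq> B" "B \<subseteq> U" "P x" "eqv B x y" "\<not> E k x y"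
  shows "\<exists>a b. eqv B x a \<and> \<not> E k x a \<and> r a < r x \<and> eqv B x b \<and> \<not> E k x b \<and> r x < r b"
proof -
  obtain y' where y': "eqv B x y'" "\<not> E k x y'" "r x < r y \<longrightarrow> r y' < r x" "r y < r x \<longrightarrow> r x < r y'"
    using swap_side[OF assms(1-5)] assms(6) by blast
  have "y \<noteq> x" using assms E_refl by blast
  then have "r x < r y \<or> r y < r x" using r_eq[of x y] assms(5) by (auto dest: eqv_U)
  then show ?thesis using y' assms by blast
qed

text \<open>Two clauses of the Restriction combine. By \<open>R2\<close>, from some level on, every
  point of the ball of level \<open>j\<close> around \<open>x\<close> has a conjugate of
  \<open>x\<close> within level \<open>Suc j\<close>. If such a ball contained a point of another
  type, a formula isolating that difference would yield a right-convex formula violating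
  \<open>R3r\<close>.\<close>

lemma free_or_closed:
  assumes B: "finite B" "A \<subseteq> B" "B \<subseteq> U" and x: "P x" and nc: "\<not> closed B x"
  shows "free B x"
proof -
  obtain d y0 where d: "eqv B x y0" "\<not> E d x y0" using nc by (auto simp: closed_def)
  obtain a b where a: "eqv B x a" "\<not> E d x a" "r a < r x" and b: "eqv B x b" "\<not> E d x b" "r x < r b"
    using both_sides[OF B x d] by blast
  have Pq: "P w" if "eqv B x w" for w using P_eqv[OF x that] B by blast
  have xU: "x \<in> U" using x P_U by blast
  have ball: "r a < r y \<and> r y < r b" if "E j x y" "j \<ge> d" for y j
  proof -
    have y: "P y" "E d x y" using that x E_P E_mono by blast+
    show ?thesis
    proof (rule ccontr)
      assume "\<not> ?thesis"
      then consider "r y \<le> r a" | "r b \<le> r y" by linarith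
      then show False
        using E_btw2[OF x Pq[OF a(1)], of y d] E_cvx[OF x Pq[OF b(1)], of d y] a b y by cases auto
    qed
  qed
  \<comment> \<open>Were there infinitely many bad levels with bad points \<open>\<beta> j\<close>,
    two of them with j < l would be conjugate; carrying \<open>\<beta> l\<close> to
    \<open>\<beta> j\<close> moves \<open>x\<close> to a conjugate within level \<open>Suc j\<close>
    of \<open>\<beta> j\<close>.\<close>
  have "\<exists>J\<ge>d. \<forall>j\<ge>J. \<forall>y. E j x y \<longrightarrow> (\<exists>w. eqv B x w \<and> E (Suc j) y w)"
  proof (rule ccontr)
    assume neg: "\<not> ?thesis"
    define bad where "bad = (\<lambda>j y. E j x y \<and> (\<forall>w. eqv B x w \<longrightarrow> \<not> E (Suc j) y w))"
    define Js where "Js = {j. j \<ge> d \<and> (\<exists>y. bad j y)}"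
    have "\<exists>j\<ge>J. \<exists>y. bad j y" if "d \<le> J" for J using neg that unfolding bad_def by meson
    then have "\<exists>j>n. j \<in> Js" for n
      unfolding Js_def using le_trans[OF max.cobounded1[of d "Suc n"]] max.cobounded2[of "Suc n" d] Suc_le_lessD
      by (metis (no_types, lifting) max.bounded_iff max.cobounded1 mem_Collect_eq)
    then have "infinite Js" by (meson finite_nat_set_iff_bounded not_less_iff_gr_or_eq)
    have "\<exists>y\<in>U. j \<in> Js \<longrightarrow> bad j y" for j
    proof (cases "\<exists>y. bad j y")
      case True
      then obtain y where "bad j y" by blast
      moreover have "y \<in> U" using calculation E_U[OF x] unfolding bad_def by blast
      ultimately show ?thesis by blast
    next
      case False
      then show ?thesis using xU by (auto simp: Js_def)
    qed
    then obtain \<beta> where "\<And>j. \<beta> j \<in> U \<and> (j \<in> Js \<longrightarrow> bad j (\<beta> j))" by metis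
    then obtain \<beta> where \<beta>: "\<And>j. \<beta> j \<in> U" "\<And>j. j \<in> Js \<Longrightarrow> E j x (\<beta> j)"
      "\<And>j w. j \<in> Js \<Longrightarrow> eqv B x w \<Longrightarrow> \<not> E (Suc j) (\<beta> j) w"
      unfolding bad_def by blast
    have "\<exists>j\<in>Js. \<exists>l\<in>Js. j < l \<and> eqv B (\<beta> j) (\<beta> l)"
    proof (rule R2[OF B(1,3) xU _ \<open>infinite Js\<close>])
      show "range \<beta> \<subseteq> U" using \<beta> by auto
      fix C j assume C: "Dp B (\<lambda>e. C (e 0))" "cvx C" "j \<in> Js"
      then have "r a < r (\<beta> j) \<and> r (\<beta> j) < r b" using ball[of j "\<beta> j"] \<beta> by (auto simp: Js_def)
      then show "C x = C (\<beta> j)" using eqv_cut[OF B(3) a(1) b(1) \<beta>(1)[of j] _ _ C(1,2)] by auto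
    qed
    then obtain j l where jl: "j \<in> Js" "l \<in> Js" "j < l" "eqv B (\<beta> l) (\<beta> j)" using eqv_sym by blast
    then obtain \<sigma> where \<sigma>: "\<sigma> \<in> Au B" "\<sigma> (\<beta> l) = \<beta> j" using eqv_iff B by blast
    have "E (Suc j) x (\<beta> l)" using E_mono[of "Suc j" l x "\<beta> l"] jl \<beta> x by auto
    then have "E (Suc j) (\<sigma> x) (\<beta> j)" using E_Au[OF \<sigma>(1) B(2) xU \<beta>(1)[of l]] \<sigma> by simp
    then have "E (Suc j) (\<beta> j) (\<sigma> x)" using P_Au[OF x \<sigma>(1) B(2)] E_sym by blast
    moreover have "eqv B x (\<sigma> x)" using eqv_Au B \<sigma> xU by blast
    ultimately show False using \<beta>(3) jl by blast
  qed
  then obtain J where J: "J \<ge> d" "\<And>j y. j \<ge> J \<Longrightarrow> E j x y \<Longrightarrow> \<exists>w. eqv B x w \<and> E (Suc j) y w" by blast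
  have J': "\<exists>w. eqv B x w \<and> E (Suc j) y w" if h: "eqv B x x'" "j \<ge> J" "E j x' y" for x' j y
  proof -
    obtain \<sigma> where \<sigma>: "\<sigma> \<in> Au B" "\<sigma> x' = x" using eqv_iff B eqv_sym[OF h(1)] by blast
    have U: "x' \<in> U" "y \<in> U" using h Pq P_U E_U by blast+
    have "E j x (\<sigma> y)" using E_Au[OF \<sigma>(1) B(2) U] \<sigma> h by simp
    then obtain w where w: "eqv B x w" "E (Suc j) (\<sigma> y) w" using J h by blast
    obtain \<tau> where \<tau>: "\<tau> \<in> Au B" "\<And>a. a \<in> U \<Longrightarrow> \<tau> (\<sigma> a) = a" using Au_inv[OF \<sigma>(1) B(3)] by blast
    have "E (Suc j) y (\<tau> w)" using E_Au[OF \<tau>(1) B(2), of "\<sigma> y" w] w \<tau> U \<sigma> eqv_U[OF w(1)] by simp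
    moreover have "eqv B x (\<tau> w)" using eqv_Au[OF B(1,3) \<tau>(1), of w] eqv_trans[OF w(1)] eqv_U[OF w(1)] by blast
    ultimately show ?thesis by blast
  qed
  have "eqv B x y" if y: "E J x y" for y
  proof (rule ccontr)
    assume neq: "\<not> eqv B x y"
    have Py: "P y" "y \<in> U" using x y E_P P_U by blast+
    obtain D where D: "Dp B (\<lambda>e. D (e 0))" "D y" "\<And>w. eqv B x w \<Longrightarrow> \<not> D w"
      using eqv_neq[OF neq xU Py(2)] by blast
    obtain w where w: "eqv B x w" "E (Suc J) y w" using J(2)[of J y] y by blast
    \<comment> \<open>Conjugates of \<open>x\<close> are needed left of \<open>y\<close> in two
      positions: \<alpha>' within level \<open>Suc J\<close> of \<open>y\<close>, and \<alpha>
      within level \<open>J\<close> but not within \<open>Suc J\<close>. Each is found next to an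
      auxiliary point \<open>y2\<close> or \<open>y3\<close> at the wanted distance, one level
      closer to it than \<open>y\<close> is, which keeps it left of \<open>y\<close>.\<close>
    obtain y2 where y2: "r y2 < r y" "E (Suc J) y y2" "\<not> E (Suc (Suc J)) y y2" using E_down[OF Py(1)] by blast
    have "E (Suc J) w y2" using w y2 Py E_sym E_trans E_P by blast
    then obtain \<alpha>' where \<alpha>': "eqv B x \<alpha>'" "E (Suc (Suc J)) y2 \<alpha>'" using J'[OF w(1), of "Suc J"] by auto
    have P2: "P y2" using y2 Py E_P by blast
    have P\<alpha>': "P \<alpha>'" using \<alpha>' Pq by blast
    have 1: "E (Suc J) y \<alpha>'" using E_trans[OF Py(1) y2(2)] E_Suc[OF P2 \<alpha>'(2)] by blast
    have 2: "r \<alpha>' < r y"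
    proof (rule ccontr)
      assume "\<not> r \<alpha>' < r y"
      then have "E (Suc (Suc J)) y2 y" using E_cvx[OF P2 Py(1) \<alpha>'(2)] y2 by simp
      then show False using y2 E_sym P2 by blast
    qed
    obtain y3 where y3: "r y3 < r y" "E J y y3" "\<not> E (Suc J) y y3" using E_down[OF Py(1)] by blast
    have P3: "P y3" using y3 Py E_P by blast
    have "E J x y3" using y y3 x E_trans by blast
    then obtain \<alpha> where \<alpha>: "eqv B x \<alpha>" "E (Suc J) y3 \<alpha>" using J by blast
    have P\<alpha>: "P \<alpha>" using \<alpha> Pq by blast
    have 3: "E J y \<alpha>" using E_trans[OF Py(1) y3(2)] E_Suc[OF P3 \<alpha>(2)] by blast
    have 4: "\<not> E (Suc J) y \<alpha>" using \<alpha> y3 E_trans E_sym P3 Py P\<alpha> by blast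
    have 5: "r \<alpha> < r y"
    proof (rule ccontr)
      assume "\<not> r \<alpha> < r y"
      then have "E (Suc J) y3 y" using E_cvx[OF P3 Py(1) \<alpha>(2)] y3 by simp
      then show False using y3 E_sym P3 by blast
    qed
    have 6: "r \<alpha> < r \<alpha>'"
    proof (rule ccontr)
      assume "\<not> r \<alpha> < r \<alpha>'"
      then have "E (Suc J) y \<alpha>" using E_btw2[OF Py(1) P\<alpha> _ _ 1] 5 by simp
      then show False using 4 by blast
    qed
    \<comment> \<open>\<open>R\<close> drops from the right half of the ball those points of
      \<open>D\<close> that are not within level \<open>Suc J\<close>. The type of \<open>x\<close>
      avoids \<open>D\<close>, so on it the trace is the full half ball; but \<open>y\<close> is in
      \<open>R\<close> at \<alpha>' and not at \<alpha>, although \<alpha>' is in \<open>R\<close>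
      at \<alpha> and lies below \<open>y\<close>.\<close>
    define R where "R = (\<lambda>u c. r c \<le> r u \<and> E J c u \<and> (D u \<longrightarrow> E (Suc J) c u))"
    have ex: "E J x \<alpha>" "E J \<alpha> \<alpha>'" using 1 3 y x E_trans E_sym P\<alpha> P\<alpha>' Py E_Suc by blast+
    have "R y \<alpha> = R y \<alpha>'"
    proof (rule P3D[OF R3r B(1,3), where q = \<alpha> and y = \<alpha>'])
      show "Dp B (\<lambda>e. R (e 0) (e 1))" unfolding R_def
        by (intro Dintros E_D' D1[OF D(1)] B(2,3))
      show "R \<alpha> \<alpha>" using D(3)[OF \<alpha>(1)] E_refl P\<alpha> by (simp add: R_def)
      show "r \<alpha> \<le> r x" if "R x \<alpha>" for x using that by (simp add: R_def)
      show "eqv B \<alpha> \<alpha>'" using \<alpha> \<alpha>' eqv_trans eqv_sym by blast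
      show "\<alpha>' \<noteq> \<alpha>" using 6 by auto
      show "R \<alpha>' \<alpha>" using 6 ex D(3)[OF \<alpha>'(1)] by (simp add: R_def)
      show "eqv B \<alpha> a" "eqv B \<alpha> b" using \<alpha> a b eqv_trans eqv_sym by blast+
      show "r a < r \<alpha>" using ball[OF ex(1) J(1)] by simp
      show "r u < r b" if "u \<in> U" "R u \<alpha>" for u
        using that ball[of J u] E_trans[OF x ex(1), of u] J(1) by (simp add: R_def)
      show "R c \<alpha>" if "eqv B \<alpha> a" "eqv B \<alpha> b" "eqv B \<alpha> c" "R a \<alpha>" "R b \<alpha>" "r a < r c" "r c < r b" for a b c
      proof -
        have e: "eqv B x c" "eqv B x b" using that \<alpha> eqv_trans by blast+
        have "E J \<alpha> c" using E_cvx[OF P\<alpha> Pq[OF e(1)], of J b] that by (auto simp: R_def)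
        then show ?thesis using that D(3)[OF e(1)] by (auto simp: R_def)
      qed
      show "eqv B \<alpha> \<alpha>" using P\<alpha> P_U by simp
      show "eqv B \<alpha> \<alpha>'" by fact
      show "R \<alpha>' \<alpha>" by fact
      show "y \<in> U" "r \<alpha>' \<le> r y" using Py 2 by auto
    qed
    moreover have "R y \<alpha>'" using 1 2 Py E_Suc[OF Py(1) 1] E_sym[OF Py(1)] by (simp add: R_def)
    moreover have "\<not> R y \<alpha>" using 4 D(2) E_sym[OF P\<alpha>] by (auto simp: R_def)
    ultimately show False by blast
  qed
  then show ?thesis by (auto simp: free_def)
qed

text \<open>If the type of \<open>z\<close> over \<open>D\<close> and \<open>b\<close> is confined to \<open>E\<^sub>\<infinity>\<close> because of \<open>b\<close>, then an
  automorphism over \<open>D\<close> moving \<open>z\<close> slightly moves the left end of a formula convex to the left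
  on the type of \<open>b\<close>; this formula would not be equivalence-generating.\<close>

lemma closed_left:
  assumes D: "finite D" "A \<subseteq> D" "D \<subseteq> U" and P: "P b" "P z" and fb: "free D b"
    and b: "eqv D b b'" "r b' < r z" "r z < r b"
    and c: "closed (insert b D) z" "\<not> closed D z"
  shows "Einf z b"
proof (rule ccontr)
  assume "\<not> Einf z b"
  then obtain k where k: "\<not> E k z b" by (auto simp: Einf_def)
  obtain J where J: "\<And>y. E J z y \<Longrightarrow> eqv D z y" using free_or_closed[OF D P(2) c(2)] by (auto simp: free_def)
  obtain J' where J': "\<And>y. E J' b y \<Longrightarrow> eqv D b y" using fb by (auto simp: free_def)
  define m where "m = max k (max J J')"
  have m: "k \<le> m" "J \<le> m" "J' \<le> m" by (auto simp: m_def)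
  have U: "b \<in> U" "z \<in> U" using P P_U by blast+
  \<comment> \<open>Compactness turns closedness into a formula over \<open>D\<close> and
    \<open>b\<close> that holds at \<open>z\<close> and whose solutions are all within level
    \<open>Suc m\<close> of \<open>z\<close>.\<close>
  have "Dp (insert z (insert b D)) (\<lambda>e. E (Suc m) z (e 0))"
    using D U by (intro E_D' tmv tmc) auto
  then obtain Q0 where Q0: "Dp (insert b D) (\<lambda>e. Q0 (e 0))" "Q0 z" "\<And>y. y \<in> U \<Longrightarrow> Q0 y \<Longrightarrow> E (Suc m) z y"
    using type_compact[of "insert z (insert b D)" "insert b D" "E (Suc m) z" z] D U c(1)
      subset_insertI2[OF subset_insertI[of D b], of z]
    by (auto simp: closed_def)
  obtain Q where Q: "Dp D (\<lambda>e. Q (e 0) (e 1))" "\<And>y. y \<in> U \<Longrightarrow> Q0 y = Q y b"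
    using binary_abs[OF Q0(1)] by blast
  have Qz: "Q z b" "\<And>y. y \<in> U \<Longrightarrow> Q y b \<Longrightarrow> E (Suc m) z y" using Q(2) Q0 U by auto
  obtain z' where z': "r z < r z'" "E m z z'" "\<not> E (Suc m) z z'" using E_up[OF P(2)] by blast
  have "eqv D z z'" using J E_mono[OF m(2) P(2) z'(2)] by blast
  then obtain \<sigma> where \<sigma>: "\<sigma> \<in> Au D" "\<sigma> z = z'" using eqv_iff D by blast
  have Pz': "P z'" using z' P E_P by blast
  have z'U: "z' \<in> U" using Pz' P_U by blast
  define c where "c = \<sigma> b"
  have cU: "c \<in> U" using \<sigma> U by (simp add: c_def)
  have bc: "eqv D b c" unfolding c_def using eqv_Au D \<sigma> U by blast
  have Pc: "P c" using P_eqv P bc D by blast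
  have zb: "\<not> E k z' c" using E_Au[OF \<sigma>(1) D(2) U(2) U(1), of k] k \<sigma> by (simp add: c_def)
  have z'c: "r z' < r c" using Au_lt[OF \<sigma>(1) U(2) U(1)] b \<sigma> by (simp add: c_def)
  have kzz': "E k z z'" "E k z' z" using E_mono[OF m(1) P(2) z'(2)] E_sym P(2) by blast+
  have z'b: "r z' < r b"
  proof (rule ccontr)
    assume "\<not> r z' < r b"
    then show False using E_cvx[OF P(2) P(1) kzz'(1)] k b by simp
  qed
  have Qz': "Q z' c" "\<And>y. y \<in> U \<Longrightarrow> Q y c \<Longrightarrow> E (Suc m) z' y"
  proof -
    show "Q z' c" using Au_2[OF D(1) \<sigma>(1) Q(1) U(2) U(1)] Qz(1) \<sigma> by (simp add: c_def)
    fix y assume y: "y \<in> U" "Q y c"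
    obtain \<tau> where \<tau>: "\<tau> \<in> Au D" "\<And>a. a \<in> U \<Longrightarrow> \<tau> (\<sigma> a) = a" "\<And>a. a \<in> U \<Longrightarrow> \<sigma> (\<tau> a) = a"
      using Au_inv[OF \<sigma>(1) D(3)] by blast
    have t: "\<tau> y \<in> U" using \<tau> y by simp
    have "Q (\<tau> y) b" using Au_2[OF D(1) \<sigma>(1) Q(1) t U(1)] y \<tau> by (simp add: c_def)
    then have "E (Suc m) z (\<tau> y)" using Qz t by blast
    then show "E (Suc m) z' y" using E_Au[OF \<sigma>(1) D(2) U(2) t, of "Suc m"] \<tau> \<sigma> y by simp
  qed
  \<comment> \<open>The points left of \<open>c\<close> that are at or above a solution of
    \<open>Q\<close>. The left end of this set at \<open>b\<close> is known up to level
    \<open>Suc m\<close>, and \<sigma> moves \<open>z\<close> farther than that, so \<open>z\<close>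
    is in \<open>R\<close> at \<open>b\<close> but not at \<open>c\<close>.\<close>
  define R where "R = (\<lambda>y c. r y \<le> r c \<and> (\<exists>q\<in>U. Q q c \<and> r q \<le> r y))"
  have R1: "R z b" "R z' b" "R z' c" using b Qz Qz' U z'U z' z'b z'c by (auto simp: R_def)
  have nR: "\<not> R z c"
  proof
    assume "R z c"
    then obtain q where q: "q \<in> U" "E (Suc m) z' q" "r q \<le> r z" using Qz' by (auto simp: R_def)
    then have "E (Suc m) z' z" using E_btw2[OF Pz' P(2)] z' by simp
    then show False using z' E_sym Pz' by blast
  qed
  obtain y where y: "r y < r b" "E m b y" "\<not> E (Suc m) b y" using E_down[OF P(1)] by blast
  have ye: "eqv D b y" using J' E_mono[OF m(3) P(1) y(2)] by blast
  have zy: "r z \<le> r y"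
  proof (rule ccontr)
    assume "\<not> r z \<le> r y"
    then have "E m b z" using E_btw2[OF P(1) P(2) _ _ y(2)] b by simp
    then show False using k E_sym P E_mono m by blast
  qed
  obtain g where g: "r b < r g" "E m b g" using E_up[OF P(1)] by blast
  have ge: "eqv D b g" using J' E_mono[OF m(3) P(1) g(2)] by blast
  obtain \<rho> where \<rho>: "\<rho> \<in> Au D" "\<rho> b = b'" using eqv_iff D b by blast
  have b'U: "b' \<in> U" "P b'" using b eqv_U P_eqv P D by blast+
  have \<rho>U: "\<rho> b' \<in> U" "\<rho> z \<in> U" "P (\<rho> z)" using \<rho> b'U U P_Au P D by auto
  have \<rho>e: "eqv D b (\<rho> b')" using eqv_Au[OF D(1,3) \<rho>(1) b'U(1)] b eqv_trans by blast
  have \<rho>k: "\<not> E k (\<rho> z) b'" using E_Au[OF \<rho>(1) D(2) U(2) U(1), of k] k \<rho> by simp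
  have \<rho>r: "r (\<rho> b') < r (\<rho> z)" "r (\<rho> z) < r b'"
    using Au_lt[OF \<rho>(1) b'U(1) U(2)] Au_lt[OF \<rho>(1) U(2) U(1)] \<rho> b by auto
  \<comment> \<open>Preservation asks for a conjugate of \<open>b\<close> below the set. If the set
    reached down to \<open>\<rho> b'\<close>, then \<open>\<rho> z\<close> and \<open>b'\<close>,
    which lie above it and at or below \<open>z\<close>, would be within level \<open>Suc m\<close>
    of each other, contrary to the distance of \<open>z\<close> and \<open>b\<close>.\<close>
  have low: "r (\<rho> b') < r x" if x: "R x b" for x
  proof (rule ccontr)
    assume n: "\<not> r (\<rho> b') < r x"
    obtain q where q: "E (Suc m) z q" "r q \<le> r x" using x Qz by (auto simp: R_def)
    have "E (Suc m) z (\<rho> z)" "E (Suc m) z b'"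
      using E_btw2[OF P(2) _ _ _ q(1)] \<rho>U b'U q n \<rho>r b by auto
    then have "E (Suc m) (\<rho> z) b'" using E_sym E_trans P \<rho>U by blast
    then show False using \<rho>k E_mono[of k "Suc m"] m \<rho>U by auto
  qed
  have gen: "R x a = R x a'" if h: "eqv D b a" "eqv D b a'" "R a' a" "x \<in> U" "r x \<le> r a'" for x a a'
  proof (rule P3D[OF R3l D(1,3), where q = b and y = y and g = g and g' = "\<rho> b'"])
    show "Dp D (\<lambda>e. R (e 0) (e 1))" unfolding R_def
      by (intro Dintros D2[OF Q(1)] D(3))
    show "R b b" using U b Qz by (auto simp: R_def)
    show "- r b \<le> - r x" if "R x b" for x using that by (simp add: R_def)
    show "eqv D b y" "y \<noteq> b" "eqv D b g" "- r g < - r b" "eqv D b (\<rho> b')" using ye y ge g \<rho>e by auto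
    show "R y b" using y zy Qz U by (auto simp: R_def)
    show "- r x < - r (\<rho> b')" if "R x b" for x using low that by simp
    show "R c b" if "R a b" "R a' b" "- r a < - r c" "- r c < - r a'" for a a' c
      using that by (force simp: R_def)
  qed (use h in auto)
  show False
  \<comment> \<open>Whichever of \<open>b\<close> and \<open>c\<close> is larger, the smaller one
    lies in its \<open>R\<close>; generating then makes the two sets agree at
    \<open>z\<close>.\<close>
  proof (cases "r b \<le> r c")
    case True
    then have "R b c" using Qz' z'b z'U by (auto simp: R_def)
    then have "R z c = R z b" using gen[OF bc _ _ U(2)] U b by simp
    then show False using nR R1 by blast
  next
    case False
    then have "R c b" using Qz z'c z' U by (auto simp: R_def)
    then have "R z b = R z c" using gen[OF _ bc _ U(2)] U z'c z' by simp
    then show False using nR R1 by blast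
  qed
qed

text \<open>Negation exchanges the two generating clauses and the conditions \<open>E_up\<close> and
  \<open>E_down\<close>; the relations stay the same.\<close>

lemma dual: "echain U (\<lambda>a. - r a) Dp A p0 E"
proof -
  interpret d: definability U "\<lambda>a. - r a" Dp by (rule dual0)
  have "restricted U (\<lambda>a. - r a) Dp"
  proof (unfold_locales, goal_cases)
    case 1 then show ?case using R3l .
  next
    case 2 then show ?case using R3r by simp
  next
    case (3 B z \<beta> J) then show ?case unfolding cvx_minus by (intro R2) auto
  next
    case (4 B q \<epsilon> b)
    show ?case
    proof (rule R1[where B = B and q = q and \<epsilon> = \<epsilon> and b = b, OF 4(1-8) _ _ 4(11-13)])
      fix i x y z assume h: "eqv B q x" "eqv B q y" "eqv B q z" "r x < r y" "r y < r z" "\<epsilon> x z (b i)"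
      then have "\<epsilon> z y (b i)" using 4(7)[of x z i] 4(9)[of z y x i] by simp
      then show "\<epsilon> x y (b i)" using 4(8)[of x z y i] h by blast
    next
      fix i x y assume h: "eqv B q x" "eqv B q y" "r x < r y" "\<not> \<epsilon> x y (b i)"
      then have n: "\<not> \<epsilon> y x (b i)" using 4(7)[of y x i] by blast
      obtain z where z: "eqv B q z" "- r y < - r z" "- r z < - r x" "\<not> \<epsilon> y z (b i)" "\<not> \<epsilon> z x (b i)"
        using 4(10)[OF h(2,1) _ n] h by force
      have "\<not> \<epsilon> x z (b i)" "\<not> \<epsilon> z y (b i)"
        using z 4(7)[OF h(1) z(1)] 4(7)[OF z(1) h(2)] by blast+
      then show "\<exists>z. eqv B q z \<and> r x < r z \<and> r z < r y \<and> \<not> \<epsilon> x z (b i) \<and> \<not> \<epsilon> z y (b i)"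
        using z by (intro exI[of _ z]) simp
    qed
  qed
  then interpret d: restricted U "\<lambda>a. - r a" Dp .
  show ?thesis
  proof (unfold_locales, goal_cases)
    case (9 a c k b)
    then have "P b" using E_P by blast
    then show ?case using E_btw2[of a c b k] 9 by simp
  next
    case 1 show ?case by (rule A)
  next
    case 2 show ?case by (rule A)
  next
    case 3 show ?case by (rule p0)
  next
    case (4 k) show ?case by (rule E_D)
  next
    case (5 a k b) then show ?case by (rule E_P)
  next
    case (6 a k) then show ?case by (rule E_refl)
  next
    case (7 a k b) then show ?case by (rule E_sym)
  next
    case (8 a k b c) then show ?case by (rule E_trans)
  next
    case (10 a k b) then show ?case by (rule E_Suc)
  next
    case (11 a k) then show ?case using E_down[of a k] by simp
  next
    case (12 a k) then show ?case using E_up[of a k] by simp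
  next
    case (13 a) then show ?case using out_down[of a] by simp
  next
    case (14 a) then show ?case using out_up[of a] by simp
  qed
qed

text \<open>With conjugates of \<open>b\<close> on both sides of \<open>z\<close>,
  \<open>closed_left\<close> applies in the given or in the reversed order, according to the side of
  \<open>b\<close> on which \<open>z\<close> lies.\<close>

lemma closed_between:
  assumes D: "finite D" "A \<subseteq> D" "D \<subseteq> U" and P: "P b" "P z" and fb: "free D b"
    and b: "eqv D b b'" "eqv D b b''" "r b' < r z" "r z < r b''"
    and c: "closed (insert b D) z" "\<not> closed D z"
  shows "Einf z b"
proof -
  interpret d: echain U "\<lambda>a. - r a" Dp A p0 E by (rule dual)
  show ?thesis
  proof (cases "r z < r b")
    case True
    then show ?thesis using closed_left[OF D P fb b(1,3) _ c] by blast
  next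
    case False
    show ?thesis
    proof (cases "z = b")
      case True then show ?thesis using E_refl P by (auto simp: Einf_def)
    next
      case False
      then have "r b < r z" using \<open>\<not> r z < r b\<close> r_eq[of z b] P P_U by (metis linorder_neqE_linordered_idom)
      then show ?thesis using d.closed_left[OF D P fb b(2) _ _ c] b by simp
    qed
  qed
qed

text \<open>By \<open>type_compact\<close> each point of the set described by \<open>X\<close>
  satisfies a formula over \<open>B\<close> that stays within its \<open>E j\<close>-class. If no
  finitely many of these formulas covered the set, saturation would give a point of it outside its
  own formula.\<close>

lemma closed_finite:
  assumes B: "finite B" "A \<subseteq> B" "B \<subseteq> U" and X: "\<And>Q. Q \<in> X \<Longrightarrow> Dp B Q"
    and c: "\<And>z. z \<in> U \<Longrightarrow> (\<forall>Q\<in>X. Q (\<lambda>_. z)) \<Longrightarrow> P z \<and> (\<forall>y. eqv B z y \<longrightarrow> E j z y)"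
  shows "\<exists>F. finite F \<and> (\<forall>z\<in>F. P z \<and> (\<forall>Q\<in>X. Q (\<lambda>_. z))) \<and> (\<forall>z\<in>U. (\<forall>Q\<in>X. Q (\<lambda>_. z)) \<longrightarrow> (\<exists>f\<in>F. E j f z))"
proof -
  define S where "S = {z\<in>U. \<forall>Q\<in>X. Q (\<lambda>_. z)}"
  have "\<exists>Q. Dp B (\<lambda>e. Q (e 0)) \<and> Q z \<and> (\<forall>y\<in>U. Q y \<longrightarrow> E j z y)" if z: "z \<in> S" for z
  proof (rule type_compact[of "insert z B"])
    show "Dp (insert z B) (\<lambda>e. E j z (e 0))" using B z by (intro E_D' tmv tmc) (auto simp: S_def)
    show "E j z y" if "eqv B z y" for y using c z that by (auto simp: S_def)
  qed (use B z in \<open>auto simp: S_def\<close>)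
  then obtain Q where Q: "\<And>z. z \<in> S \<Longrightarrow> Dp B (\<lambda>e. Q z (e 0))" "\<And>z. z \<in> S \<Longrightarrow> Q z z"
    "\<And>z y. z \<in> S \<Longrightarrow> y \<in> U \<Longrightarrow> Q z y \<Longrightarrow> E j z y" by metis
  define N where "N = (\<lambda>z e. \<not> Q z (e (0::nat)))"
  have "\<exists>F\<subseteq>X \<union> N ` S. finite F \<and> \<not> (\<exists>a\<in>U. \<forall>Q\<in>F. Q (\<lambda>_. a))"
  proof (rule ccontr)
    assume neg: "\<not> ?thesis"
    have "\<exists>a\<in>U. \<forall>Q\<in>X \<union> N ` S. Q (\<lambda>_. a)"
    proof (rule D_sat[OF B(1,3)])
      show "Dp B R" if "R \<in> X \<union> N ` S" for R using that X D_neg[OF Q(1)] by (auto simp: N_def)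
      show "\<exists>a\<in>U. \<forall>Q\<in>F. Q (\<lambda>_. a)" if "F \<subseteq> X \<union> N ` S" "finite F" for F using neg that by blast
    qed
    then obtain a where a: "a \<in> U" "\<forall>Q\<in>X \<union> N ` S. Q (\<lambda>_. a)" by blast
    then have "a \<in> S" by (auto simp: S_def)
    then have "N a (\<lambda>_. a)" using a by blast
    then show False using Q(2)[OF \<open>a \<in> S\<close>] by (simp add: N_def)
  qed
  then obtain F where F: "F \<subseteq> X \<union> N ` S" "finite F" "\<not> (\<exists>a\<in>U. \<forall>Q\<in>F. Q (\<lambda>_. a))" by blast
  obtain G where G: "G \<subseteq> S" "finite G" "F \<inter> N ` S = N ` G"
    using finite_subset_image[of "F \<inter> N ` S" N S] F by auto
  have "\<exists>f\<in>G. E j f z" if z: "z \<in> U" "\<forall>Q\<in>X. Q (\<lambda>_. z)" for z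
  proof -
    obtain R where R: "R \<in> F" "\<not> R (\<lambda>_. z)" using F z by blast
    then have "R \<in> N ` G" using F(1) z G(3) by blast
    then obtain g where g: "g \<in> G" "Q g z" using R by (auto simp: N_def)
    then show ?thesis using Q(3)[of g z] G z by blast
  qed
  then show ?thesis using G c by (intro exI[of _ G]) (auto simp: S_def)
qed

end

section \<open>Quantifying over tuples and realizing types in infinitely many variables\<close>

context definability
begin

lemma D_iff: "Dp B P \<Longrightarrow> Dp B Q \<Longrightarrow> Dp B (\<lambda>e. P e = Q e)"
  by (rule D_cong[OF D_conj[OF D_imp[of B P Q] D_imp[of B Q P]]]) auto

lemma D_ex_upto:
  assumes "Dp B P"
  shows "Dp B (\<lambda>e. \<exists>u\<in>AS. P (\<lambda>i. if m \<le> i \<and> i < m + k then u i else e i))"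
proof (induction k)
  case 0
  have ne: "AS \<noteq> {}" using U_ne asg_const by (metis empty_iff ex_in_conv)
  have "(\<lambda>i. if m \<le> i \<and> i < m + 0 then u i else e i) = e" for u e :: "nat \<Rightarrow> 'm" by (auto simp: fun_eq_iff)
  then show ?case using ne by (intro D_cong[OF assms]) auto
next
  case (Suc k)
  show ?case
  proof (rule D_cong[OF D_ex[OF Suc, of "m + k"]])
    fix e assume e: "e \<in> AS"
    show "(\<exists>a\<in>U. \<exists>u\<in>AS. P (\<lambda>i. if m \<le> i \<and> i < m + k then u i else (e(m + k := a)) i)) =
      (\<exists>u\<in>AS. P (\<lambda>i. if m \<le> i \<and> i < m + Suc k then u i else e i))"
    proof
      assume "\<exists>a\<in>U. \<exists>u\<in>AS. P (\<lambda>i. if m \<le> i \<and> i < m + k then u i else (e(m + k := a)) i)"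
      then obtain a u where u: "a \<in> U" "u \<in> AS" "P (\<lambda>i. if m \<le> i \<and> i < m + k then u i else (e(m + k := a)) i)"
        by blast
      have "(\<lambda>i. if m \<le> i \<and> i < m + k then u i else (e(m + k := a)) i) =
        (\<lambda>i. if m \<le> i \<and> i < m + Suc k then (u(m + k := a)) i else e i)" by (rule ext) auto
      then show "\<exists>u\<in>AS. P (\<lambda>i. if m \<le> i \<and> i < m + Suc k then u i else e i)"
        using u by (intro bexI[of _ "u(m + k := a)"]) auto
    next
      assume "\<exists>u\<in>AS. P (\<lambda>i. if m \<le> i \<and> i < m + Suc k then u i else e i)"
      then obtain u where u: "u \<in> AS" "P (\<lambda>i. if m \<le> i \<and> i < m + Suc k then u i else e i)" by blast
      have "(\<lambda>i. if m \<le> i \<and> i < m + Suc k then u i else e i) =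
        (\<lambda>i. if m \<le> i \<and> i < m + k then u i else (e(m + k := u (m + k))) i)" by (rule ext) auto
      then show "\<exists>a\<in>U. \<exists>u\<in>AS. P (\<lambda>i. if m \<le> i \<and> i < m + k then u i else (e(m + k := a)) i)"
        using u by (intro bexI[of _ "u (m + k)"] bexI[of _ u]) (auto simp: asg_def)
    qed
  qed
qed

text \<open>A quantifier over whole assignments is a finite block of ordinary quantifiers, since
  only variables below the support bound matter.\<close>

lemma D_exu:
  assumes "Dp B P"
  shows "Dp B (\<lambda>e. \<exists>u\<in>AS. P (\<lambda>i. if i < m then e i else u i))"
proof -
  obtain n where n: "\<And>e e'. e \<in> AS \<Longrightarrow> e' \<in> AS \<Longrightarrow> (\<forall>i<n. e i = e' i) \<Longrightarrow> P e = P e'"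
    using D_supp[OF assms] by blast
  show ?thesis
  proof (rule D_cong[OF D_ex_upto[OF assms, of m n]])
    fix e assume e: "e \<in> AS"
    have "P (\<lambda>i. if m \<le> i \<and> i < m + n then u i else e i) = P (\<lambda>i. if i < m then e i else u i)"
      if "u \<in> AS" for u using e that by (intro n) (auto simp: asg_def)
    then show "(\<exists>u\<in>AS. P (\<lambda>i. if m \<le> i \<and> i < m + n then u i else e i)) =
       (\<exists>u\<in>AS. P (\<lambda>i. if i < m then e i else u i))" by blast
  qed
qed

text \<open>Coordinates are chosen one at a time. The invariant says that the prefix still extends
  to a solution of every finite part of \<Gamma>; adding a coordinate is an instance of
  \<open>D_sat\<close> over the entries chosen so far, the later coordinates being quantified
  away.\<close>

lemma omega_sat:
  assumes B: "finite B" "B \<subseteq> U" and D: "\<And>P. P \<in> \<Gamma> \<Longrightarrow> Dp B P"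
    and fs: "\<And>G. G \<subseteq> \<Gamma> \<Longrightarrow> finite G \<Longrightarrow> \<exists>e\<in>AS. \<forall>P\<in>G. P e"
  shows "\<exists>e\<in>AS. \<forall>P\<in>\<Gamma>. P e"
proof -
  define mg where "mg = (\<lambda>(xs::'m list) u i. if i < length xs then xs ! i else (u i :: 'm))"
  define Inv where "Inv = (\<lambda>xs. set xs \<subseteq> U \<and> (\<forall>G\<subseteq>\<Gamma>. finite G \<longrightarrow> (\<exists>u\<in>AS. \<forall>P\<in>G. P (mg xs u))))"
  have step: "\<exists>a. Inv (xs @ [a])" if xs: "Inv xs" for xs
  proof -
    have xsU: "set xs \<subseteq> U" using xs by (simp add: Inv_def)
    define \<R> where "\<R> = (\<lambda>G (e::nat \<Rightarrow> 'm). \<exists>u\<in>AS. \<forall>P\<in>G. P (mg (xs @ [e 0]) u))"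
    have "\<exists>a\<in>U. \<forall>Q\<in>\<R> ` {G. G \<subseteq> \<Gamma> \<and> finite G}. Q (\<lambda>_. a)"
    proof (rule D_sat)
      show BU: "finite (B \<union> set xs)" "B \<union> set xs \<subseteq> U" using B xsU by auto
      fix Q assume "Q \<in> \<R> ` {G. G \<subseteq> \<Gamma> \<and> finite G}"
      then obtain G where G: "G \<subseteq> \<Gamma>" "finite G" "Q = \<R> G" by blast
      have "Dp (B \<union> set xs) (\<lambda>e. \<forall>P\<in>G. P e)"
        using G BU by (intro D_Ball D_mono[OF D]) auto
      from D_exu[OF this, of "Suc (length xs)"]
      have "Dp (B \<union> set xs) (\<lambda>e. \<exists>u\<in>AS. \<forall>P\<in>G. P (\<lambda>i. if i < Suc (length xs) then e i else u i))" .
      then have D: "Dp (B \<union> set xs) (\<lambda>e. \<exists>u\<in>AS. \<forall>P\<in>G. P (\<lambda>i. if i < Suc (length xs) then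
          (if i < length xs then (\<lambda>e. xs ! i) else (\<lambda>e. e 0)) e else u i))"
        by (rule D_terms) (auto simp: tmv intro!: tmc)
      have "(\<lambda>i. if i < Suc (length xs) then
          (if i < length xs then (\<lambda>e. xs ! i) else (\<lambda>e. e 0)) e else u i) = mg (xs @ [e 0]) u" for e u
        by (auto simp: mg_def nth_append)
      note eq = this
      show "Dp (B \<union> set xs) Q" unfolding G(3) \<R>_def by (rule D_cong[OF D]) (simp only: eq)
    next
      fix F assume F: "F \<subseteq> \<R> ` {G. G \<subseteq> \<Gamma> \<and> finite G}" "finite F"
      then obtain GG where GG: "GG \<subseteq> {G. G \<subseteq> \<Gamma> \<and> finite G}" "finite GG" "F = \<R> ` GG"
        by (meson finite_subset_image)
      have sub: "\<Union>GG \<subseteq> \<Gamma>" "finite (\<Union>GG)" using GG by auto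
      have "\<forall>G. G \<subseteq> \<Gamma> \<longrightarrow> finite G \<longrightarrow> (\<exists>u\<in>AS. \<forall>P\<in>G. P (mg xs u))" using xs unfolding Inv_def by (rule conjunct2)
      from mp[OF mp[OF spec[OF this] sub(1)] sub(2)]
      have "\<exists>u\<in>AS. \<forall>P\<in>\<Union>GG. P (mg xs u)" .
      then obtain u where u: "u \<in> AS" "\<forall>P\<in>\<Union>GG. P (mg xs u)" by (rule bexE)
      have eq: "mg (xs @ [u (length xs)]) u = mg xs u" by (auto simp: mg_def nth_append less_Suc_eq)
      show "\<exists>a\<in>U. \<forall>Q\<in>F. Q (\<lambda>_. a)"
      proof (intro bexI ballI)
        show "u (length xs) \<in> U" using u(1) by (rule asgD)
        fix Q assume "Q \<in> F"
        then obtain G where "G \<in> GG" "Q = \<R> G" using GG(3) by blast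
        moreover have "\<forall>P\<in>G. P (mg xs u)" using u(2) calculation(1) by blast
        ultimately have "\<forall>P\<in>G. P (mg (xs @ [u (length xs)]) u)" by (simp only: eq)
        then have "\<R> G (\<lambda>_. u (length xs))" unfolding \<R>_def using u(1) by (rule bexI)
        then show "Q (\<lambda>_. u (length xs))" by (simp only: \<open>Q = \<R> G\<close>)
      qed
    qed
    then obtain a where a: "a \<in> U" "\<forall>Q\<in>\<R> ` {G. G \<subseteq> \<Gamma> \<and> finite G}. Q (\<lambda>_. a)" by blast
    have "\<exists>u\<in>AS. \<forall>P\<in>G. P (mg (xs @ [a]) u)" if "G \<subseteq> \<Gamma>" "finite G" for G
    proof -
      have "\<R> G (\<lambda>_. a)" using a(2) that by (rule_tac bspec[of "\<R> ` {G. G \<subseteq> \<Gamma> \<and> finite G}" _ "\<R> G"]) auto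
      then show ?thesis by (simp only: \<R>_def)
    qed
    then have "Inv (xs @ [a])" using xsU a(1) by (simp add: Inv_def)
    then show ?thesis by blast
  qed
  have "\<exists>f. \<forall>m. (Inv (f m) \<and> length (f m) = m) \<and> (\<exists>a. f (Suc m) = f m @ [a])"
  proof (rule dependent_nat_choice)
    have "Inv []" using fs by (simp add: Inv_def mg_def)
    then show "\<exists>xs. Inv xs \<and> length xs = 0" by auto
    show "\<exists>ys. (Inv ys \<and> length ys = Suc m) \<and> (\<exists>a. ys = xs @ [a])" if "Inv xs \<and> length xs = m" for xs m
      using step[of xs] that by auto
  qed
  then obtain f where f: "\<And>m. Inv (f m)" "\<And>m. length (f m) = m" "\<And>m. \<exists>a. f (Suc m) = f m @ [a]" by blast
  define e where "e = (\<lambda>i. f (Suc i) ! i)"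
  have pre: "n \<le> m \<Longrightarrow> i < n \<Longrightarrow> f m ! i = f n ! i" for n m i
  proof (induction m rule: nat_induct_at_least)
    case base then show ?case by simp
  next
    case (Suc m) then show ?case using f(3)[of m] f(2)[of m] by (auto simp: nth_append)
  qed
  have e: "i < m \<Longrightarrow> e i = f m ! i" for i m using pre[of "Suc i" m i] by (simp add: e_def)
  have eU: "e \<in> AS"
  proof (rule asgI)
    fix i show "e i \<in> U" using f(1)[of "Suc i"] f(2)[of "Suc i"] nth_mem[of i "f (Suc i)"] by (auto simp: Inv_def e_def)
  qed
  have "P e" if P: "P \<in> \<Gamma>" for P
  proof -
    obtain n where n: "\<And>e e'. e \<in> AS \<Longrightarrow> e' \<in> AS \<Longrightarrow> (\<forall>i<n. e i = e' i) \<Longrightarrow> P e = P e'"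
      using D_supp[OF D[OF P]] by blast
    have "\<exists>u\<in>AS. \<forall>P\<in>{P}. P (mg (f n) u)" using f(1)[of n] P by (simp add: Inv_def del: ball_simps)
    then obtain u where u: "u \<in> AS" "P (mg (f n) u)" by auto
    have "P e = P (mg (f n) u)"
    proof (rule n[OF eU])
      show "mg (f n) u \<in> AS"
        using u f(1)[of n] by (auto simp: asg_def mg_def Inv_def)
      show "\<forall>i<n. e i = mg (f n) u i" using e f(2) by (simp add: mg_def)
    qed
    then show ?thesis using u by simp
  qed
  then show ?thesis using eU by blast
qed

text \<open>Tuples of length \<open>n + 1\<close>, as assignments that are constant from \<open>n\<close> on.\<close>

definition Tup :: "nat \<Rightarrow> (nat \<Rightarrow> 'm) set" where
  "Tup n = {u \<in> AS. \<forall>i. u i = u (min i n)}"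

lemma TupD: "u \<in> Tup n \<Longrightarrow> u \<in> AS" "u \<in> Tup n \<Longrightarrow> u (min i n) = u i"
  by (simp_all add: Tup_def)

lemma Tup_trunc: "u \<in> AS \<Longrightarrow> (\<lambda>i. u (min i n)) \<in> Tup n"
  by (simp add: Tup_def asg_def)

lemma Tup_fin: "u \<in> Tup n \<Longrightarrow> finite (range u)" "u \<in> Tup n \<Longrightarrow> range u \<subseteq> U"
proof -
  assume u: "u \<in> Tup n"
  have "range u \<subseteq> u ` {..n}" using TupD(2)[OF u] by (metis atMost_iff image_eqI image_subsetI min.cobounded2)
  then show "finite (range u)" by (rule finite_subset) simp
  show "range u \<subseteq> U" using TupD(1)[OF u] by (auto simp: asg_def)
qed

lemma Tup_Au: "u \<in> Tup n \<Longrightarrow> \<sigma> \<in> Au B \<Longrightarrow> (\<lambda>i. \<sigma> (u i)) \<in> Tup n"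
  using TupD(2)[of u n] TupD(1)[of u n] by (simp add: Tup_def asg_def)

lemma Tup_countable: "countable (Tup n)"
proof -
  have "inj_on (\<lambda>u. map u [0..<Suc n]) (Tup n)"
  proof (rule inj_onI)
    fix u v assume h: "u \<in> Tup n" "v \<in> Tup n" "map u [0..<Suc n] = map v [0..<Suc n]"
    then have "u i = v i" if "i < Suc n" for i using that by (auto simp: map_eq_conv simp del: upt_Suc)
    then have "u (min i n) = v (min i n)" for i by simp
    then show "u = v" using TupD(2)[OF h(1)] TupD(2)[OF h(2)] by (simp add: fun_eq_iff)
  qed
  moreover have "countable ((\<lambda>u. map u [0..<Suc n]) ` Tup n)"
    by (rule countable_subset[OF _ countable_lists[OF U_cnt]]) (auto simp: Tup_def asg_def)
  ultimately show ?thesis by (rule countable_image_inj_on[rotated])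
qed

lemma Tup_homog:
  assumes B: "finite B" "B \<subseteq> U" and u: "u \<in> Tup n" "v \<in> Tup n" and e: "\<And>P. Dp B P \<Longrightarrow> P u = P v"
  shows "\<exists>\<sigma>\<in>Au B. \<forall>i. \<sigma> (u i) = v i"
proof -
  have c: "cyc (map w [0..<Suc n]) = (\<lambda>i. w (i mod Suc n))" for w :: "nat \<Rightarrow> 'm"
    by (simp add: cyc_def fun_eq_iff del: upt_Suc)
  have "same B (map u [0..<Suc n]) (map v [0..<Suc n])"
    unfolding same_def c
  proof (intro conjI allI impI)
    fix P assume "Dp B P"
    then have "Dp B (\<lambda>e. P (\<lambda>i. e (i mod Suc n)))" by (rule D_ren)
    then show "P (\<lambda>i. u (i mod Suc n)) = P (\<lambda>i. v (i mod Suc n))" by (rule e)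
  qed (use u in \<open>auto simp: Tup_def asg_def\<close>)
  then obtain \<sigma> where s: "\<sigma> \<in> Au B" "map \<sigma> (map u [0..<Suc n]) = map v [0..<Suc n]"
    using same_homog[OF B] by blast
  have "\<sigma> (u (min i n)) = v (min i n)" for i
    using arg_cong[OF s(2), of "\<lambda>xs. xs ! (min i n)"] by (simp del: upt_Suc)
  then have "\<forall>i. \<sigma> (u i) = v i" unfolding TupD(2)[OF u(1)] TupD(2)[OF u(2)] by blast
  then show ?thesis using s by blast
qed

text \<open>Otherwise all of the countably many tuples could be excluded one after another while a
  member of \<open>Y\<close> survives at each stage, and the limit type would be realized by a tuple
  that had been excluded. \<open>Y\<close> may be any set of tuples, definable or not; the isolation
  is relative to \<open>Y\<close>.\<close>

lemma isolated_tuple: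
  assumes B: "finite B" "B \<subseteq> U" and Y: "Y \<subseteq> Tup n" "Y \<noteq> {}"
  shows "\<exists>\<tau> u0. Dp B \<tau> \<and> u0 \<in> Y \<and> \<tau> u0 \<and> (\<forall>u\<in>Y. \<tau> u \<longrightarrow> (\<forall>P. Dp B P \<longrightarrow> P u0 = P u))"
proof (rule ccontr)
  assume neg: "\<not> ?thesis"
  define w where "w = from_nat_into (Tup n)"
  have w: "range w = Tup n" unfolding w_def using Y Tup_countable by (intro range_from_nat_into) auto
  define Inv where "Inv = (\<lambda>\<tau>. Dp B \<tau> \<and> (\<exists>u\<in>Y. \<tau> u))"
  have step: "\<exists>\<tau>'. Inv \<tau>' \<and> \<not> \<tau>' (w k) \<and> (\<forall>u. \<tau>' u \<longrightarrow> \<tau> u)" if t: "Inv \<tau>" for \<tau> k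
  proof -
    obtain u0 where u0: "u0 \<in> Y" "\<tau> u0" "Dp B \<tau>" using t by (auto simp: Inv_def)
    then have "\<not> (\<forall>u\<in>Y. \<tau> u \<longrightarrow> (\<forall>P. Dp B P \<longrightarrow> P u0 = P u))" using neg by blast
    then obtain u P where u: "u \<in> Y" "\<tau> u" "Dp B P" "P u0 \<noteq> P u" by blast
    \<comment> \<open>\<open>P\<close> splits two members of \<open>Y\<close>, so the side that does
      not contain \<open>w k\<close> still meets \<open>Y\<close>.\<close>
    define X where "X = (if P (w k) then (\<lambda>e. \<not> P e) else P)"
    have "Dp B X" using u D_neg[OF u(3)] by (simp add: X_def)
    then have "Dp B (\<lambda>e. \<tau> e \<and> X e)" using u0 D_conj by blast
    moreover have "X u0 \<or> X u" "\<not> X (w k)" using u by (auto simp: X_def)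
    ultimately show ?thesis using u u0 by (intro exI[of _ "\<lambda>e. \<tau> e \<and> X e"]) (auto simp: Inv_def)
  qed
  have "\<exists>f. \<forall>k. Inv (f k) \<and> (\<not> f (Suc k) (w k) \<and> (\<forall>u. f (Suc k) u \<longrightarrow> f k u))"
  proof (rule dependent_nat_choice)
    show "\<exists>\<tau>. Inv \<tau>" using D_true[OF B(2)] Y by (auto simp: Inv_def)
    show "\<exists>\<tau>'. Inv \<tau>' \<and> \<not> \<tau>' (w k) \<and> (\<forall>u. \<tau>' u \<longrightarrow> \<tau> u)" if "Inv \<tau>" for \<tau> k using step[OF that] .
  qed
  then obtain f where f: "\<And>k. Inv (f k)" "\<And>k. \<not> f (Suc k) (w k)" "\<And>k u. f (Suc k) u \<Longrightarrow> f k u" by blast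
  have mono: "l \<le> k \<Longrightarrow> f k u \<Longrightarrow> f l u" for l k u by (induction k rule: dec_induct) (use f(3) in auto)
  \<comment> \<open>The equalities make the realization constant from \<open>n\<close> on, hence one
    of the enumerated tuples.\<close>
  define \<Gamma> where "\<Gamma> = range f \<union> range (\<lambda>i e. e i = e (min i n))"
  have "\<exists>e\<in>AS. \<forall>P\<in>\<Gamma>. P e"
  proof (rule omega_sat[OF B])
    show "Dp B P" if "P \<in> \<Gamma>" for P using that f(1) D_eq[OF B(2)] by (auto simp: \<Gamma>_def Inv_def)
    fix G assume G: "G \<subseteq> \<Gamma>" "finite G"
    obtain K where K: "finite K" "G \<inter> range f = f ` K"
      using finite_subset_image[of "G \<inter> range f" f UNIV] G by auto
    define m where "m = Max (insert 0 K)"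
    have m: "k \<le> m" if "k \<in> K" for k using K that by (auto simp: m_def)
    obtain u where u: "u \<in> Y" "f m u" using f(1)[of m] by (auto simp: Inv_def)
    have "P u" if h: "P \<in> G" for P
    proof (cases "P \<in> range f")
      case True
      then have "P \<in> f ` K" using K h by blast
      then show ?thesis using m mono u by blast
    next
      case False
      then obtain i where "P = (\<lambda>e. e i = e (min i n))" using h G(1) unfolding \<Gamma>_def by blast
      moreover have "u \<in> Tup n" using u Y by blast
      ultimately show ?thesis using TupD(2)[of u n i] by simp
    qed
    then have "\<forall>P\<in>G. P u" by (rule ballI)
    moreover have "u \<in> AS" using u Y TupD(1)[of u n] by blast
    ultimately show "\<exists>e\<in>AS. \<forall>P\<in>G. P e" by (rule bexI)
  qed
  then obtain e where e: "e \<in> AS" and \<Gamma>: "\<forall>P\<in>\<Gamma>. P e" by (rule bexE)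
  have fe: "f k e" for k using bspec[OF \<Gamma>, of "f k"] by (simp add: \<Gamma>_def)
  have "e i = e (min i n)" for i using bspec[OF \<Gamma>, of "\<lambda>e. e i = e (min i n)"] by (simp add: \<Gamma>_def)
  then have "e \<in> Tup n" using e by (simp add: Tup_def)
  then obtain k where "e = w k" using w by blast
  then show False using f(2)[of k] fe[of "Suc k"] by simp
qed

lemma abs_case:
  assumes "Dp (insert b B) P"
  shows "\<exists>Q. Dp B Q \<and> (\<forall>e\<in>AS. P e = Q (case_nat b e))"
proof -
  obtain R j where R: "Dp B R" "\<And>e. e \<in> AS \<Longrightarrow> P e = R (e(j := b))" using D_abs[OF assms] by blast
  have "Dp B (\<lambda>e. R (\<lambda>i. (if i = j then (\<lambda>e. e 0) else (\<lambda>e. e (Suc i))) e))"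
    by (rule D_terms[OF R(1)]) (auto simp: tmv)
  moreover have "(\<lambda>i. (if i = j then (\<lambda>e. e 0) else (\<lambda>e. e (Suc i))) (case_nat b e)) = e(j := b)" for e
    by auto
  ultimately show ?thesis using R(2)
    by (intro exI[of _ "\<lambda>e. R (\<lambda>i. (if i = j then (\<lambda>e. e 0) else (\<lambda>e. e (Suc i))) e)"]) auto
qed

lemma abs_many:
  assumes "finite C" "Dp (A \<union> C) P"
  shows "\<exists>Q m. Dp A Q \<and> finite (dom m) \<and> ran m \<subseteq> C \<and> (\<forall>e\<in>AS. P e = Q (\<lambda>i. case m i of Some c \<Rightarrow> c | None \<Rightarrow> e i))"
  using assms
proof (induction C arbitrary: P rule: finite_induct)
  case empty then show ?case by (intro exI[of _ P] exI[of _ Map.empty]) auto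
next
  case (insert c C)
  have c: "c \<in> U" using D_par[OF insert.prems] by auto
  have "Dp (insert c (A \<union> C)) P" using insert.prems by simp
  then obtain R j where R: "Dp (A \<union> C) R" "\<And>e. e \<in> AS \<Longrightarrow> P e = R (e(j := c))" using D_abs by blast
  obtain Q m where Q: "Dp A Q" "finite (dom m)" "ran m \<subseteq> C"
    "\<And>e. e \<in> AS \<Longrightarrow> R e = Q (\<lambda>i. case m i of Some c \<Rightarrow> c | None \<Rightarrow> e i)"
    using insert.IH[OF R(1)] by blast
  define m' where "m' = (\<lambda>i. case m i of Some c \<Rightarrow> Some c | None \<Rightarrow> if i = j then Some c else None)"
  have "dom m' \<subseteq> insert j (dom m)" by (auto simp: m'_def dom_def split: option.splits if_splits)
  then have "finite (dom m')" using Q(2) finite_subset by blast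
  moreover have "ran m' \<subseteq> insert c C" using Q(3) by (auto simp: m'_def ran_def split: option.splits if_splits)
  moreover have "P e = Q (\<lambda>i. case m' i of Some c \<Rightarrow> c | None \<Rightarrow> e i)" if "e \<in> AS" for e
  proof -
    have "(\<lambda>i. case m i of Some c \<Rightarrow> c | None \<Rightarrow> (e(j := c)) i) = (\<lambda>i. case m' i of Some c \<Rightarrow> c | None \<Rightarrow> e i)"
      by (auto simp: m'_def split: option.splits)
    then show ?thesis using R(2)[OF that] Q(4)[of "e(j := c)"] that c by simp
  qed
  ultimately show ?case using Q(1) by blast
qed

end

context definability
begin

lemma D_exu2:
  assumes "Dp B (\<lambda>e. \<Phi> (e 0) (e 1) (\<lambda>i. e (Suc (Suc i))))"
  shows "Dp B (\<lambda>e. \<exists>u\<in>AS. \<Phi> (e 0) (e 1) u)"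
proof (rule D_cong[OF D_exu[OF assms, of 2]])
  fix e :: "nat \<Rightarrow> 'm" assume "e \<in> AS"
  have "(\<exists>u\<in>AS. \<Phi> (e 0) (e 1) (\<lambda>i. u (Suc (Suc i)))) = (\<exists>u\<in>AS. \<Phi> (e 0) (e 1) u)"
  proof
    assume "\<exists>u\<in>AS. \<Phi> (e 0) (e 1) (\<lambda>i. u (Suc (Suc i)))"
    then obtain u where u: "u \<in> AS" "\<Phi> (e 0) (e 1) (\<lambda>i. u (Suc (Suc i)))" by (rule bexE)
    from u(2) asg_comp[OF u(1)] show "\<exists>u\<in>AS. \<Phi> (e 0) (e 1) u" by (rule bexI)
  next
    assume "\<exists>u\<in>AS. \<Phi> (e 0) (e 1) u"
    then obtain u where u: "u \<in> AS" "\<Phi> (e 0) (e 1) u" by (rule bexE)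
    have "case_nat (u 0) (case_nat (u 0) u) \<in> AS" using u(1) asgD[OF u(1)] by simp
    then show "\<exists>u\<in>AS. \<Phi> (e 0) (e 1) (\<lambda>i. u (Suc (Suc i)))"
      using u(2) by (intro bexI[of _ "case_nat (u 0) (case_nat (u 0) u)"]) simp_all
  qed
  then show "(\<exists>u\<in>AS. \<Phi> (if 0 < (2::nat) then e 0 else u 0) (if 1 < (2::nat) then e 1 else u 1)
       (\<lambda>i. if Suc (Suc i) < 2 then e (Suc (Suc i)) else u (Suc (Suc i)))) = (\<exists>u\<in>AS. \<Phi> (e 0) (e 1) u)"
    by simp
qed

lemma D_case:
  assumes "Dp B T" "tmd B s" "\<And>i. tmd B (v i)"
  shows "Dp B (\<lambda>e. T (case_nat (s e) (\<lambda>i. v i e)))"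
proof -
  have "Dp B (\<lambda>e. T (\<lambda>i. (case i of 0 \<Rightarrow> s | Suc j \<Rightarrow> v j) e))"
    by (rule D_terms[OF assms(1)]) (use assms in \<open>auto split: nat.split\<close>)
  moreover have "(\<lambda>i. (case i of 0 \<Rightarrow> s | Suc j \<Rightarrow> v j) e) = case_nat (s e) (\<lambda>i. v i e)" for e
    by (rule ext) (auto split: nat.split)
  ultimately show ?thesis by (simp only:)
qed

end

section \<open>Hulls of classes and finite covers\<close>

context echain
begin

text \<open>The right half of the convex hull of the \<open>E k\<close>-class of \<open>x\<close>.
  Unlike the class it may contain points outside the type, so it can bound an arbitrary definable
  set.\<close>

definition H :: "nat \<Rightarrow> 'a \<Rightarrow> 'a \<Rightarrow> bool" where
  "H k x y \<longleftrightarrow> r x \<le> r y \<and> (\<exists>b\<in>U. E k x b \<and> r y \<le> r b)"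

lemma H_D0: "Dp A (\<lambda>e. H k (e 0) (e 1))"
  unfolding H_def by (intro D_conj D_le D_exn E_D' tmv A(2) subset_refl)

lemma H_D': "A \<subseteq> B \<Longrightarrow> B \<subseteq> U \<Longrightarrow> tmd B s \<Longrightarrow> tmd B t \<Longrightarrow> Dp B (\<lambda>e. H k (s e) (t e))"
  by (rule D2[OF D_mono[OF H_D0]])

lemma H_Au: "\<sigma> \<in> Au A \<Longrightarrow> a \<in> U \<Longrightarrow> b \<in> U \<Longrightarrow> H k (\<sigma> a) (\<sigma> b) = H k a b"
  by (rule Au_2[OF A(1) _ H_D0])

lemma H_E: "P x \<Longrightarrow> P y \<Longrightarrow> H k x y \<Longrightarrow> E k x y"
  unfolding H_def using E_cvx[of x y k] by blast

lemma H_mono: "j \<le> k \<Longrightarrow> P x \<Longrightarrow> H k x y \<Longrightarrow> H j x y"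
  unfolding H_def using E_mono[of j k x] by blast

text \<open>Two members of the sequence in the class of one \<open>f\<close> would, by convexity,
  put consecutive members into one class.\<close>

lemma pigeon:
  assumes c: "\<And>n. P (c n)" "\<And>n. r (c n) < r (c (Suc n))" "\<And>n. \<not> E k (c n) (c (Suc n))"
    and F: "finite F" "\<And>f. f \<in> F \<Longrightarrow> P f"
  shows "\<exists>n. \<forall>f\<in>F. \<not> E k f (c (n::nat))"
proof (rule ccontr)
  assume "\<not> ?thesis"
  then have "\<forall>n. \<exists>f\<in>F. E k f (c n)" by blast
  then obtain g where g: "\<And>n. g n \<in> F" "\<And>n. E k (g n) (c n)" by metis
  have "\<not> inj g" using F(1) g(1) by (metis finite_imageD finite_subset image_subsetI infinite_UNIV_nat)
  then obtain m n where mn: "m < n" "g m = g n" by (metis injI linorder_neqE_nat)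
  have "E k (g n) (c m)" using g(2)[of m] mn by simp
  then have "E k (c m) (c n)" using E_trans[OF c(1) E_sym[OF F(2)[OF g(1)]] g(2)] by blast
  moreover have "strict_mono (\<lambda>n. r (c n))" using c(2) by (simp add: strict_mono_Suc_iff)
  from strict_mono_less_eq[OF this] have "r (c (Suc m)) \<le> r (c n)" using mn(1) by simp
  ultimately have "E k (c m) (c (Suc m))" using E_cvx[OF c(1) c(1)] c(2)[of m] by simp
  then show False using c(3) by blast
qed

lemma chain_in:
  assumes "P a"
  shows "\<exists>c. \<forall>n. E k a (c n) \<and> r (c n) < r (c (Suc n)) \<and> \<not> E (Suc k) (c n) (c (Suc n))"
proof -
  have "\<exists>c. \<forall>n. E k a (c n) \<and> (r (c n) < r (c (Suc n)) \<and> \<not> E (Suc k) (c n) (c (Suc n)))"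
  proof (rule dependent_nat_choice)
    show "\<exists>x. E k a x" using E_refl assms by blast
    show "\<exists>y. E k a y \<and> r x < r y \<and> \<not> E (Suc k) x y" if "E k a x" for x
      using E_up[of x k] E_P E_trans that assms by blast
  qed
  then show ?thesis by blast
qed

lemma chain_strict:
  assumes "\<And>n. P (c n)" "\<And>n. r (c n) < r (c (Suc n))" "\<And>n. \<not> E k (c n) (c (Suc n))" "m < n"
  shows "r (c m) < r (c n)" "\<not> E k (c m) (c n)"
proof -
  have sm: "strict_mono (\<lambda>n. r (c n))" using assms(2) by (simp add: strict_mono_Suc_iff)
  show "r (c m) < r (c n)" using strict_mono_less[OF sm] assms(4) by simp
  have "r (c (Suc m)) \<le> r (c n)" using strict_mono_less_eq[OF sm] assms(4) by simp
  then show "\<not> E k (c m) (c n)" using E_cvx[OF assms(1)[of m] assms(1)[of "Suc m"], of k "c n"] assms(2,3)[of m] by auto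
qed

lemma no_finite_cover:
  assumes "P z" "finite F" "\<And>f. f \<in> F \<Longrightarrow> P f" "\<And>v. E k z v \<Longrightarrow> \<exists>f\<in>F. E (Suc k) f v"
  shows False
proof -
  obtain c where c: "\<And>n. E k z (c n)" "\<And>n. r (c n) < r (c (Suc n))" "\<And>n. \<not> E (Suc k) (c n) (c (Suc n))"
    using chain_in[OF assms(1)] by blast
  have "P (c n)" for n using c(1) assms(1) E_P by blast
  from pigeon[where c = c and k = "Suc k", OF this c(2,3) assms(2,3)] show False using assms(4) c(1) by blast
qed

lemma closed_finite_family:
  assumes B: "finite B" "A \<subseteq> B" "B \<subseteq> U" and C: "\<And>i::nat. Dp B (\<lambda>e. C i (e 0))"
    and c: "\<And>z y. z \<in> U \<Longrightarrow> (\<And>i. C i z) \<Longrightarrow> P z \<and> (eqv B z y \<longrightarrow> E j z y)"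
  shows "\<exists>F. finite F \<and> (\<forall>z\<in>F. P z) \<and> (\<forall>z\<in>U. (\<forall>i. C i z) \<longrightarrow> (\<exists>f\<in>F. E j f z))"
proof -
  have "\<exists>F. finite F \<and> (\<forall>z\<in>F. P z \<and> (\<forall>Q\<in>range (\<lambda>i e. C i (e (0::nat))). Q (\<lambda>_. z))) \<and>
     (\<forall>z\<in>U. (\<forall>Q\<in>range (\<lambda>i e. C i (e (0::nat))). Q (\<lambda>_. z)) \<longrightarrow> (\<exists>f\<in>F. E j f z))"
  proof (rule closed_finite[OF B, where X = "range (\<lambda>i e. C i (e (0::nat)))"])
    show "Dp B Q" if "Q \<in> range (\<lambda>i e. C i (e (0::nat)))" for Q using that C by blast
    show "P z \<and> (\<forall>y. eqv B z y \<longrightarrow> E j z y)" if "z \<in> U" "\<forall>Q\<in>range (\<lambda>i e. C i (e (0::nat))). Q (\<lambda>_. z)" for z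
      using c[OF that(1)] that(2) by simp
  qed
  then show ?thesis by (simp add: image_iff) blast
qed

text \<open>Pushing conjugates of \<open>z\<close> to the right again and again gives an increasing
  sequence in its type whose members are inequivalent at level \<open>k\<close>; finitely many
  classes miss one of them.\<close>

lemma conj_many:
  assumes B: "finite B" "A \<subseteq> B" "B \<subseteq> U" and z: "P z" "eqv B z y" "\<not> E k z y"
    and F: "finite F" "\<And>f. f \<in> F \<Longrightarrow> P f"
  shows "\<exists>\<sigma>\<in>Au B. \<forall>f\<in>F. \<not> E k f (\<sigma> z)"
proof -
  have zU: "z \<in> U" using z P_U by blast
  have st: "\<exists>b. eqv B z b \<and> r x < r b \<and> \<not> E k x b" if x: "eqv B z x" for x
  proof -
    obtain \<sigma> where \<sigma>: "\<sigma> \<in> Au B" "\<sigma> z = x" using x eqv_iff B by blast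
    have "\<not> E k x (\<sigma> y)" using E_Au[OF \<sigma>(1) B(2), of z y k] z \<sigma> eqv_U[OF z(2)] by simp
    moreover have "eqv B x (\<sigma> y)"
      using eqv_sym[OF x] eqv_trans[OF z(2)] eqv_Au[OF B(1,3) \<sigma>(1), of y] eqv_U[OF z(2)] eqv_trans by blast
    ultimately obtain b where "eqv B x b" "\<not> E k x b" "r x < r b"
      using both_sides[OF B P_eqv[OF z(1) x B(2,3)]] by blast
    then show ?thesis using x eqv_trans by blast
  qed
  have "\<exists>c. \<forall>n. eqv B z (c n) \<and> (r (c n) < r (c (Suc n)) \<and> \<not> E k (c n) (c (Suc n)))"
  proof (rule dependent_nat_choice)
    show "\<exists>x. eqv B z x" by (rule exI[of _ z]) (simp add: zU)
  qed (use st in blast)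
  then obtain c where c: "\<And>n. eqv B z (c n)" "\<And>n. r (c n) < r (c (Suc n))" "\<And>n. \<not> E k (c n) (c (Suc n))"
    by blast
  have "P (c n)" for n using P_eqv[OF z(1) c(1) B(2,3)] .
  from pigeon[where c = c and k = k, OF this c(2,3) F] obtain n where n: "\<forall>f\<in>F. \<not> E k f (c n)" by blast
  obtain \<sigma> where "\<sigma> \<in> Au B" "\<sigma> z = c n" using c(1)[of n] eqv_iff B by blast
  then show ?thesis using n by (intro bexI[of _ \<sigma>]) simp_all
qed

text \<open>A ball inside the type over \<open>B\<close> goes to a ball inside the type over the
  image of \<open>B\<close>; used to compare balls over conjugate parameter tuples.\<close>

lemma ball_move:
  assumes \<sigma>: "\<sigma> \<in> Au A" and B: "finite B" "B \<subseteq> U" and z: "P z" and b: "\<And>y. E J z y \<Longrightarrow> eqv B z y"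
    and y: "E J (\<sigma> z) y"
  shows "eqv (\<sigma> ` B) (\<sigma> z) y"
proof -
  obtain \<tau> where \<tau>: "\<tau> \<in> Au A" "\<And>a. a \<in> U \<Longrightarrow> \<tau> (\<sigma> a) = a" "\<And>a. a \<in> U \<Longrightarrow> \<sigma> (\<tau> a) = a"
    using Au_inv[OF \<sigma> A(2)] by blast
  have zU: "z \<in> U" using z P_U by blast
  have "P (\<sigma> z)" using P_Au z \<sigma> by blast
  then have yU: "y \<in> U" using y E_U by blast
  have "E J z (\<tau> y)" using E_Au[OF \<tau>(1) order_refl, of "\<sigma> z" y J] y \<tau> \<sigma> zU yU by simp
  from eqv_move[OF B _ b[OF this], of \<sigma>] show ?thesis using \<tau> \<sigma> yU by (simp add: Au_def)
qed

end

section \<open>Parametrized segments inside a class\<close>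

text \<open>\<open>coinit\<close> ties the chain to the formulas: every right-convex formula over
  \<open>A\<close> contains, at each realization, the right half of some ball.\<close>

locale chain = echain +
  assumes coinit: "eqv A p0 a \<Longrightarrow> Dp A (\<lambda>e. R (e 0) (e 1)) \<Longrightarrow> R a a \<Longrightarrow>
    (\<And>x. x \<in> U \<Longrightarrow> R x a \<Longrightarrow> r a \<le> r x) \<Longrightarrow> eqv A p0 y \<Longrightarrow> y \<noteq> a \<Longrightarrow> R y a \<Longrightarrow>
    eqv A p0 g \<Longrightarrow> (\<And>x. x \<in> U \<Longrightarrow> R x a \<Longrightarrow> r x < r g) \<Longrightarrow>
    (\<And>b c d. eqv A p0 b \<Longrightarrow> eqv A p0 c \<Longrightarrow> eqv A p0 d \<Longrightarrow> R b a \<Longrightarrow> R d a \<Longrightarrow> r b < r c \<Longrightarrow> r c < r d \<Longrightarrow> R c a) \<Longrightarrow>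
    \<exists>j. \<forall>b. E j a b \<and> r a \<le> r b \<longrightarrow> R b a"

text \<open>\<open>Sc y x u\<close> places \<open>y\<close> in a right segment at \<open>x\<close>
  that is cut out with parameters \<open>u\<close>. By \<open>Sc_tr\<close> only \<open>u 0\<close>
  to \<open>u n\<close> matter, so parameters can be taken in \<open>Tup n\<close>.\<close>

locale segments = chain +
  fixes Sc :: "'a \<Rightarrow> 'a \<Rightarrow> (nat \<Rightarrow> 'a) \<Rightarrow> bool" and n :: nat
  assumes Sc_D: "Dp A (\<lambda>e. Sc (e 0) (e 1) (\<lambda>i. e (Suc (Suc i))))"
    and Sc_ge: "Sc y x u \<Longrightarrow> r x \<le> r y"
    and Sc_down: "Sc y x u \<Longrightarrow> z \<in> U \<Longrightarrow> r x \<le> r z \<Longrightarrow> r z \<le> r y \<Longrightarrow> Sc z x u"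
    and Sc_tr: "Sc y x (\<lambda>i. u (min i n)) = Sc y x u"
begin

lemma Sc_D':
  assumes "A \<subseteq> B" "B \<subseteq> U" "tmd B s" "tmd B t" "\<And>i. tmd B (v i)"
  shows "Dp B (\<lambda>e. Sc (s e) (t e) (\<lambda>i. v i e))"
proof -
  have "Dp B (\<lambda>e. Sc (e 0) (e 1) (\<lambda>i. e (Suc (Suc i))))" by (rule D_mono[OF Sc_D assms(1,2)])
  from D_terms[OF this, of "\<lambda>i. if i = 0 then s else if i = 1 then t else v (i - 2)"] show ?thesis
    using assms by auto
qed

lemma Au_Sc:
  assumes "\<sigma> \<in> Au A" "x \<in> U" "y \<in> U" "u \<in> AS"
  shows "Sc (\<sigma> y) (\<sigma> x) (\<lambda>i. \<sigma> (u i)) = Sc y x u"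
  using Au_Dp[OF A(1) assms(1) Sc_D, of "case_nat y (case_nat x u)"] assms by simp

text \<open>The symmetrized segment relation; where \<open>good\<close> applies it is transitive and
  reflexive, hence an equivalence relation.\<close>

definition rho :: "'a \<Rightarrow> 'a \<Rightarrow> (nat \<Rightarrow> 'a) \<Rightarrow> bool" where
  "rho a b u \<longleftrightarrow> (r a \<le> r b \<and> Sc b a u) \<or> (r b \<le> r a \<and> Sc a b u)"

text \<open>Generating, nontriviality and density of the segments, demanded on the ball of level
  \<open>J\<close> around \<open>x\<close>. A ball is used in place of a type so that the condition
  is definable from \<open>x\<close> and \<open>u\<close>.\<close>

definition good :: "nat \<Rightarrow> 'a \<Rightarrow> (nat \<Rightarrow> 'a) \<Rightarrow> bool" where
  "good J x u \<longleftrightarrow>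
     (\<forall>a\<in>U. E J x a \<longrightarrow> (\<forall>b\<in>U. E J x b \<longrightarrow> Sc b a u \<longrightarrow> (\<forall>y\<in>U. r b \<le> r y \<longrightarrow> Sc y a u = Sc y b u))) \<and>
     (\<forall>a\<in>U. E J x a \<longrightarrow> (\<exists>b\<in>U. E J x b \<and> r a < r b \<and> Sc b a u)) \<and>
     (\<forall>a\<in>U. E J x a \<longrightarrow> (\<forall>b\<in>U. E J x b \<longrightarrow> r a < r b \<longrightarrow> \<not> Sc b a u \<longrightarrow>
        (\<exists>c\<in>U. E J x c \<and> r a < r c \<and> r c < r b \<and> \<not> Sc c a u \<and> \<not> Sc b c u)))"

definition bdd :: "nat \<Rightarrow> nat \<Rightarrow> 'a \<Rightarrow> (nat \<Rightarrow> 'a) \<Rightarrow> bool" where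
  "bdd i J x u \<longleftrightarrow> (\<forall>a\<in>U. E J x a \<longrightarrow> (\<forall>y\<in>U. Sc y a u \<longrightarrow> H i a y))"

text \<open>The situation that \<open>tame\<close> refutes: at a point free over the parameters, a
  nontrivial segment that stays within the hulls of all levels.\<close>

definition hyp :: "'a \<Rightarrow> (nat \<Rightarrow> 'a) \<Rightarrow> bool" where
  "hyp x u \<longleftrightarrow> P x \<and> free (A \<union> range u) x \<and> (\<exists>w. Einf x w \<and> r x < r w \<and> Sc w x u) \<and>
     (\<forall>y\<in>U. \<forall>k. Sc y x u \<longrightarrow> H k x y)"

lemma good_D:
  assumes "A \<subseteq> B" "B \<subseteq> U" "tmd B s" "\<And>i. tmd B (v i)"
  shows "Dp B (\<lambda>e. good J (s e) (\<lambda>i. v i e))"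
proof -
  have "Dp B (\<lambda>e. good J (e 0) (\<lambda>i. e (Suc i)))" unfolding good_def
    by (intro Dintros D_iff E_D' Sc_D' assms(1,2))
  from D_terms[OF this, of "\<lambda>i. if i = 0 then s else v (i - 1)"] show ?thesis using assms by auto
qed

lemma bdd_D:
  assumes "A \<subseteq> B" "B \<subseteq> U" "tmd B s" "\<And>i. tmd B (v i)"
  shows "Dp B (\<lambda>e. bdd k J (s e) (\<lambda>i. v i e))"
proof -
  have "Dp B (\<lambda>e. bdd k J (e 0) (\<lambda>i. e (Suc i)))" unfolding bdd_def
    by (intro Dintros E_D' Sc_D' H_D' assms(1,2))
  from D_terms[OF this, of "\<lambda>i. if i = 0 then s else v (i - 1)"] show ?thesis using assms by auto
qed

lemma Au_good:
  assumes "\<sigma> \<in> Au A" "x \<in> U" "u \<in> AS"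
  shows "good J (\<sigma> x) (\<lambda>i. \<sigma> (u i)) = good J x u" "bdd k J (\<sigma> x) (\<lambda>i. \<sigma> (u i)) = bdd k J x u"
  using Au_Dp[OF A(1) assms(1) good_D[OF order_refl A(2) tmv tmv], of "case_nat x u" J 0 Suc]
    Au_Dp[OF A(1) assms(1) bdd_D[OF order_refl A(2) tmv tmv], of "case_nat x u" k J 0 Suc] assms by simp_all

lemma good_tr: "good J x (\<lambda>i. u (min i n)) = good J x u" "bdd k J x (\<lambda>i. u (min i n)) = bdd k J x u"
  unfolding good_def bdd_def Sc_tr by auto

text \<open>Generating is \<open>R3r\<close> for the segment formula over \<open>A\<close> and
  \<open>u\<close>; nontriviality spreads from \<open>x\<close> by automorphisms. For density: if
  \<open>b\<close> lay in the class next after that of \<open>a\<close>, then "the same class or the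
  next one" would itself be right-convex and generating, so that two steps would amount to
  one.\<close>

lemma hyp_good:
  assumes u: "u \<in> Tup n" and h: "hyp x u" and J: "\<And>y. E J x y \<Longrightarrow> eqv (A \<union> range u) x y"
  shows "good J x u"
proof -
  define B where "B = A \<union> range u"
  have B: "finite B" "A \<subseteq> B" "B \<subseteq> U" using Tup_fin[OF u] A by (auto simp: B_def)
  have ub: "u i \<in> B" for i by (simp add: B_def)
  note J = J[folded B_def]
  have x: "P x" "x \<in> U" using h P_U by (auto simp: hyp_def)
  have DS: "Dp B (\<lambda>e. Sc (e 0) (e 1) u)" by (intro Sc_D' B tmv tmc ub)
  have inv: "Sc (\<sigma> b) (\<sigma> a) u = Sc b a u" if "\<sigma> \<in> Au B" "a \<in> U" "b \<in> U" for \<sigma> a b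
    using Au_2[OF B(1) that(1) DS that(3,2)] .
  have Pq: "P a" if "eqv B x a" for a using P_eqv[OF x(1) that B(2,3)] .
  have bnd: "H k a y" if a: "eqv B x a" and y: "y \<in> U" "Sc y a u" for a y k
  proof -
    obtain \<sigma> where \<sigma>: "\<sigma> \<in> Au B" "\<sigma> a = x" using eqv_iff B eqv_sym[OF a] by blast
    have aU: "a \<in> U" using a eqv_U by blast
    have "Sc (\<sigma> y) x u" using inv[OF \<sigma>(1) aU y(1)] y \<sigma> by simp
    then have "H k x (\<sigma> y)" using h \<sigma> y by (auto simp: hyp_def)
    then show ?thesis using H_Au[OF Au_mono[OF \<sigma>(1) B(2)] aU y(1)] \<sigma> by simp
  qed
  obtain w where w: "Einf x w" "r x < r w" "Sc w x u" using h by (auto simp: hyp_def)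
  have wU: "w \<in> U" using w x E_U by (auto simp: Einf_def)
  have nt: "\<exists>b. Einf a b \<and> r a < r b \<and> Sc b a u" if a: "eqv B x a" for a
  proof -
    obtain \<sigma> where \<sigma>: "\<sigma> \<in> Au B" "\<sigma> x = a" using eqv_iff B a by blast
    have "Einf a (\<sigma> w)" using E_Au[OF \<sigma>(1) B(2) x(2) wU] w \<sigma> by (auto simp: Einf_def)
    moreover have "r a < r (\<sigma> w)" "Sc (\<sigma> w) a u"
      using Au_lt[OF \<sigma>(1) x(2) wU] inv[OF \<sigma>(1) x(2) wU] w \<sigma> by auto
    ultimately show ?thesis by blast
  qed
  have up: "\<exists>g. eqv B x g \<and> \<not> E (Suc J) a g \<and> E J a g \<and> r a < r g"
    and dn: "\<exists>g. eqv B x g \<and> r g < r a" if a: "E J x a" for a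
    using E_up[of a J] E_down[of a J] J E_trans[OF x(1) a] E_P[OF x(1) a] by blast+
  have below: "r y < r g" if "P a" "P g" "H k a y" "r a < r g" "\<not> E k a g" for a g y k
    using that E_cvx[of a g k] by (fastforce simp: H_def)
  have gen: "Sc y a u = Sc y b u" if hh: "eqv B x a" "eqv B x b" "Sc b a u" "y \<in> U" "r b \<le> r y" for a b y
  proof -
    obtain g where g: "eqv B x g" "\<not> E (Suc J) x g" "r x < r g" using up E_refl x by blast
    obtain g' where g': "eqv B x g'" "r g' < r x" using dn E_refl x by blast
    show ?thesis
    proof (rule P3D[OF R3r B(1,3) DS, where q = x and y = w and g = g' and g' = g])
      show "Sc x x u" using Sc_down[OF w(3) x(2)] w by simp
      show "eqv B x w" "w \<noteq> x" using J w by (auto simp: Einf_def)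
      show "r z < r g" if "z \<in> U" "Sc z x u" for z
        using below[OF x(1) Pq[OF g(1)] bnd[OF _ that]] g x by simp
      show "Sc c x u" if "eqv B x c" "Sc a x u" "Sc b x u" "r a < r c" "r c < r b" for a b c
        using Sc_down[OF that(3), of c] Sc_ge[OF that(2)] that eqv_U by auto
    qed (use w g g' hh Sc_ge in auto)
  qed
  have dense: "\<exists>c\<in>U. E J x c \<and> r a < r c \<and> r c < r b \<and> \<not> Sc c a u \<and> \<not> Sc b c u"
    if ab: "E J x a" "E J x b" "r a < r b" "\<not> Sc b a u" for a b
  proof (rule ccontr)
    assume neg: "\<not> ?thesis"
    have ea: "eqv B x a" and eb: "eqv B x b" using J ab by blast+
    have Pab: "P a" "P b" "a \<in> U" "b \<in> U" using Pq ea eb eqv_U by blast+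
    have Jab: "E J a b" using ab x E_sym E_trans E_P by blast
    have near: "E (Suc J) a b"
    proof (rule ccontr)
      assume nn: "\<not> E (Suc J) a b"
      obtain c where c: "r a < r c" "E (Suc J) a c" "\<not> E (Suc (Suc J)) a c" using E_up Pab by blast
      have Pc: "P c" "c \<in> U" using c Pab E_P E_U by blast+
      have cb: "r c < r b" using E_cvx[OF Pab(1,2) c(2)] nn ab by force
      have "E J x c" using E_trans[OF x(1) ab(1)] E_Suc[OF Pab(1) c(2)] by blast
      moreover have "\<not> Sc c a u" using bnd[OF ea Pc(2)] H_E[OF Pab(1) Pc(1)] c by blast
      moreover have "\<not> Sc b c u"
      proof
        assume "Sc b c u"
        then have "E (Suc J) c b" using bnd[OF J[OF \<open>E J x c\<close>] Pab(4)] H_E[OF Pc(1) Pab(2)] by blast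
        then show False using nn E_trans[OF Pab(1) c(2)] by blast
      qed
      ultimately show False using neg c cb Pc by blast
    qed
    \<comment> \<open>\<open>R y a\<close> says that \<open>y\<close> is at or below some
      \<open>c\<close> in the class of \<open>a\<close> or the next one: no \<open>m\<close>
      strictly between \<open>a\<close> and \<open>c\<close> is beyond the segment of
      \<open>a\<close> with \<open>c\<close> beyond the segment of \<open>m\<close>. Level
      \<open>Suc J\<close> keeps the relevant points inside the type.\<close>
    define R where "R = (\<lambda>y a. r a \<le> r y \<and> (\<exists>c\<in>U. E (Suc J) a c \<and> r y \<le> r c \<and>
      (\<forall>m\<in>U. E (Suc J) a m \<longrightarrow> r a < r m \<longrightarrow> r m < r c \<longrightarrow> Sc m a u \<or> Sc c m u)))"
    have DR: "Dp B (\<lambda>e. R (e 0) (e 1))" unfolding R_def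
      by (intro Dintros E_D' Sc_D' B tmc ub)
    have Rba: "R b a" unfolding R_def
    proof (intro conjI bexI[of _ b] ballI impI)
      fix m assume m: "m \<in> U" "E (Suc J) a m" "r a < r m" "r m < r b"
      have "E J x m" using E_trans[OF x(1) ab(1)] E_Suc[OF Pab(1) m(2)] by blast
      then show "Sc m a u \<or> Sc b m u" using neg m by blast
    qed (use ab near Pab in auto)
    obtain g where g: "eqv B x g" "\<not> E (Suc J) a g" "r a < r g" using up[OF ab(1)] by blast
    \<comment> \<open>Next, \<sigma> takes \<open>a\<close> to \<open>b\<close>, so that
      \<open>d\<close> is one step beyond \<open>b\<close>. Generating puts \<open>d\<close> into
      \<open>R\<close> at \<open>a\<close>, where \<open>b\<close> is a forbidden intermediate
      point.\<close>
    obtain g' where g': "eqv B x g'" "r g' < r a" using dn[OF ab(1)] by blast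
    obtain \<sigma> where \<sigma>: "\<sigma> \<in> Au B" "\<sigma> a = b" using eqv_iff[OF B(1,3)] ea eb eqv_trans eqv_sym by metis
    define d where "d = \<sigma> b"
    have dU: "d \<in> U" using \<sigma> Pab by (simp add: d_def)
    have d: "r b < r d" "\<not> Sc d b u" "R d b"
      using Au_lt[OF \<sigma>(1) Pab(3,4)] inv[OF \<sigma>(1) Pab(3,4)] Au_2[OF B(1) \<sigma>(1) DR Pab(4,3)] ab Rba \<sigma>
      by (auto simp: d_def)
    have eq: "eqv B a y" if "eqv B x y" for y using ea that eqv_trans eqv_sym by blast
    have "R d a = R d b"
    proof (rule P3D[OF R3r B(1,3) DR, where q = a and y = b and g = g' and g' = g])
      show "R a a" unfolding R_def using Pab E_refl[OF Pab(1)] by (intro conjI bexI[of _ a]) auto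
      show "r z < r g" if "z \<in> U" "R z a" for z
        using below[OF Pab(1) Pq[OF g(1)], of "Suc J" z] g that by (auto simp: R_def H_def)
      show "R c a" if "eqv B a c" "R a' a" "R b' a" "r a' < r c" "r c < r b'" for a' b' c
        using that by (force simp: R_def)
      show "b \<noteq> a" using ab by auto
      show "eqv B a b" "eqv B a a" "eqv B a g" "eqv B a g'" "eqv B a b" using eq ea eb g g' by blast+
    qed (use Rba dU d g g' in \<open>auto simp: R_def\<close>)
    then have "R d a" using d by blast
    then obtain c where c: "c \<in> U" "r d \<le> r c" "Sc b a u \<or> Sc c b u"
      using near ab d Pab unfolding R_def by (metis order_less_le_trans)
    then have "Sc d b u" using ab Sc_down[of c b u d] dU d by auto
    then show False using d by blast
  qed
  show ?thesis unfolding good_def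
  proof (intro conjI ballI impI)
    fix a b y assume "a \<in> U" "E J x a" "b \<in> U" "E J x b" "Sc b a u" "y \<in> U" "r b \<le> r y"
    then show "Sc y a u = Sc y b u" using gen J by blast
  next
    fix a assume a: "a \<in> U" "E J x a"
    then obtain b where b: "Einf a b" "r a < r b" "Sc b a u" using nt J by blast
    then have "E J x b" "b \<in> U" using E_trans[OF x(1) a(2)] E_U[OF E_P[OF x(1) a(2)]] by (auto simp: Einf_def)
    then show "\<exists>b\<in>U. E J x b \<and> r a < r b \<and> Sc b a u" using b by blast
  next
    fix a b assume "a \<in> U" "E J x a" "b \<in> U" "E J x b" "r a < r b" "\<not> Sc b a u"
    then show "\<exists>c\<in>U. E J x c \<and> r a < r c \<and> r c < r b \<and> \<not> Sc c a u \<and> \<not> Sc b c u" using dense by blast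
  qed
qed

text \<open>This is where \<open>R1\<close> is contradicted. The relation given by
  \<open>us i\<close> is contained in level \<open>i\<close> and, near \<open>z\<close>, contains
  level \<open>\<kappa> i\<close>; a subsequence with interleaving levels gives relations each of
  which refines the previous one infinitely. They are taken on the type of a free point
  \<open>v\<close> near \<open>z\<close>, on which \<open>good\<close> supplies transitivity and
  density.\<close>

lemma tame_core:
  assumes x: "P x" and us: "\<And>i. us i \<in> Tup n" and g: "\<And>i. good J x (us i)" and bd: "\<And>i. bdd i J x (us i)"
    and z: "E J x z"
    and big: "\<And>i v b. E (Suc J) z v \<Longrightarrow> E (\<kappa> i) v b \<Longrightarrow> r v \<le> r b \<Longrightarrow> Sc b v (us i)"
  shows False
proof -
  define B where "B = insert z (insert x A)"
  have Pz: "P z" using x z E_P by blast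
  have B: "finite B" "A \<subseteq> B" "B \<subseteq> U" using A x Pz P_U by (auto simp: B_def)
  have zB: "z \<in> B" by (simp add: B_def)
  have DZ: "Dp B (\<lambda>e. E (Suc J) z (e 0))" by (intro E_D' B tmv tmc zB)
  \<comment> \<open>If every such \<open>v\<close> had conjugates only within level
    \<open>Suc (Suc J)\<close>, finitely many classes of that level would cover the ball of
    \<open>z\<close>, against \<open>no_finite_cover\<close>.\<close>
  have "\<exists>v y. E (Suc J) z v \<and> eqv B v y \<and> \<not> E (Suc (Suc J)) v y"
  proof (rule ccontr)
    assume neg: "\<not> ?thesis"
    obtain F where F: "finite F" "\<And>w. w \<in> F \<Longrightarrow> P w"
      "\<And>w. w \<in> U \<Longrightarrow> E (Suc J) z w \<Longrightarrow> \<exists>f\<in>F. E (Suc (Suc J)) f w"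
      using closed_finite_family[OF B, of "\<lambda>_ w. E (Suc J) z w" "Suc (Suc J)"] DZ neg E_P[OF Pz] by auto
    show False using no_finite_cover[OF Pz F(1,2), of "Suc J"] F(3) E_U[OF Pz] by blast
  qed
  then obtain v y where v: "E (Suc J) z v" "eqv B v y" "\<not> E (Suc (Suc J)) v y" by blast
  have Pv: "P v" "v \<in> U" using v Pz E_P P_U by blast+
  have "free B v" using free_or_closed[OF B Pv(1)] v by (auto simp: closed_def)
  then obtain J3 where J3: "\<And>y. E J3 v y \<Longrightarrow> eqv B v y" by (auto simp: free_def)
  have Pq: "P a" if "eqv B v a" for a using P_eqv[OF Pv(1) that B(2,3)] .
  have qz: "E (Suc J) z a" if "eqv B v a" for a using eqv_1[OF that DZ] v by simp
  have qx: "E J x a" if "eqv B v a" for a using E_trans[OF x z E_Suc[OF Pz qz[OF that]]] .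
  have qball: "eqv B v b" if ab: "eqv B v a" "E J3 a b" for a b
  proof -
    obtain \<sigma> where \<sigma>: "\<sigma> \<in> Au B" "\<sigma> v = a" using ab eqv_iff B by blast
    have "eqv (\<sigma> ` B) (\<sigma> v) b"
      by (rule ball_move[OF Au_mono[OF \<sigma>(1) B(2)] B(1,3) Pv(1) J3]) (use ab \<sigma> in auto)
    moreover have "\<sigma> ` B = B" using \<sigma> by (force simp: Au_def)
    ultimately show ?thesis using ab \<sigma> eqv_trans by auto
  qed
  define K where "K = (\<lambda>i. max (\<kappa> i) J3)"
  \<comment> \<open>The relation number \<open>m\<close> lies between the levels
    \<open>K (idx m)\<close> and \<open>idx m\<close>, and the next one starts one level further
    down. Starting at \<open>Suc J3\<close> makes every relation finer than a step that stays inside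
    the type of \<open>v\<close>.\<close>
  define idx where "idx = rec_nat (Suc J3) (\<lambda>_ i. Suc (K i))"
  have idx: "idx (Suc m) = Suc (K (idx m))" "Suc J3 \<le> idx m" for m
    by (simp add: idx_def, cases m) (auto simp: idx_def K_def)
  define b where "b = (\<lambda>m. us (idx m))"
  have rhoE: "E (idx m) a c" if ac: "eqv B v a" "eqv B v c" "rho a c (b m)" for a c m
  proof -
    have 1: "E (idx m) a' c'" if "eqv B v a'" "eqv B v c'" "Sc c' a' (b m)" for a' c'
      using bd[of "idx m", unfolded bdd_def, THEN bspec, of a'] qx[OF that(1)] eqv_U[OF that(1)] eqv_U[OF that(2)]
        H_E[OF Pq[OF that(1)] Pq[OF that(2)]] that(3) by (auto simp: b_def)
    then show ?thesis using ac E_sym[OF Pq[OF ac(2)]] by (auto simp: rho_def)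
  qed
  have Erho: "rho a c (b m)" if ac: "eqv B v a" "E (K (idx m)) a c" for a c m
  proof -
    have "E J3 a c" "E (\<kappa> (idx m)) a c" using E_mono[OF _ Pq[OF ac(1)] ac(2)] by (auto simp: K_def)
    moreover from this have "eqv B v c" using qball ac by blast
    ultimately show ?thesis unfolding rho_def b_def
      using big[OF qz[OF ac(1)], of "idx m" c] big[OF qz[of c], of "idx m" a] E_sym[OF Pq[OF ac(1)]] by force
  qed
  have sub: "eqv B v c" if "eqv B v a" "E (K (idx m)) a c" for a c m
    using qball[OF that(1)] E_mono[OF _ Pq[OF that(1)] that(2), of J3] by (simp add: K_def)
  define Fam where "Fam = (\<lambda>a m c. (\<forall>k. eqv B v (c k) \<and> E (K (idx m)) a (c k)) \<and>
    (\<forall>k l. k < l \<longrightarrow> \<not> E (Suc (K (idx m))) (c k) (c (l::nat))))"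
  have fam: "\<exists>c. Fam a m c" if a: "eqv B v a" for a m
  proof -
    obtain c where c: "\<And>l. E (K (idx m)) a (c l)" "\<And>l. r (c l) < r (c (Suc l))"
      "\<And>l. \<not> E (Suc (K (idx m))) (c l) (c (Suc l))" using chain_in[OF Pq[OF a]] by blast
    have "P (c l)" for l using Pq[OF sub[OF a c(1)]] .
    from chain_strict(2)[where c = c, OF this c(2,3)] show ?thesis
      unfolding Fam_def using c(1) sub[OF a] by (intro exI[of _ c]) blast
  qed
  have G: "(\<forall>a\<in>U. E J x a \<longrightarrow> (\<forall>c\<in>U. E J x c \<longrightarrow> Sc c a (b m) \<longrightarrow> (\<forall>y\<in>U. r c \<le> r y \<longrightarrow> Sc y a (b m) = Sc y c (b m))))"
      "(\<forall>a\<in>U. E J x a \<longrightarrow> (\<exists>c\<in>U. E J x c \<and> r a < r c \<and> Sc c a (b m)))"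
      "(\<forall>a\<in>U. E J x a \<longrightarrow> (\<forall>c\<in>U. E J x c \<longrightarrow> r a < r c \<longrightarrow> \<not> Sc c a (b m) \<longrightarrow>
        (\<exists>d\<in>U. E J x d \<and> r a < r d \<and> r d < r c \<and> \<not> Sc d a (b m) \<and> \<not> Sc c d (b m))))" for m
    using g[of "idx m"] unfolding good_def b_def by blast+
  have step: "Sc y a (b m) = Sc y c (b m)"
    if "eqv B v a" "eqv B v c" "Sc c a (b m)" "y \<in> U" "r c \<le> r y" for a c y m
    using G(1)[of m] qx that eqv_U by blast
  have inf_sub: "infinite S" if "inj c" "range c \<subseteq> S" for c :: "nat \<Rightarrow> 'z" and S
    using that by (meson finite_imageD finite_subset infinite_UNIV_nat)
  show False
  proof (rule R1[where B = B and q = v and \<epsilon> = rho and b = b])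
    show "finite B" "B \<subseteq> U" "v \<in> U" using B Pv by auto
    show "Dp B (\<lambda>e. rho (e 0) (e 1) (\<lambda>i. e (Suc (Suc i))))" unfolding rho_def
      by (intro Dintros Sc_D' B)
    show "b i \<in> AS" for i using us TupD(1) by (auto simp: b_def)
    show "rho a a (b i)" if a: "eqv B v a" for i a
    proof -
      have aU: "a \<in> U" using a eqv_U by blast
      obtain c where "r a < r c" "Sc c a (b i)" using G(2)[of i] qx[OF a] aU by blast
      then show ?thesis using Sc_down[of c a "b i" a] aU by (simp add: rho_def)
    qed
    show "rho c a (b i)" if "rho a c (b i)" for i a c using that by (auto simp: rho_def)
    show "rho a d (b i)" if h: "eqv B v a" "eqv B v c" "eqv B v d" "rho a c (b i)" "rho c d (b i)" for i a c d
    proof -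
      have Us: "a \<in> U" "c \<in> U" "d \<in> U" using h eqv_U by blast+
      consider "r a \<le> r c" "r c \<le> r d" | "r a \<le> r d" "r d \<le> r c" | "r c \<le> r a" "r a \<le> r d"
        | "r c \<le> r d" "r d \<le> r a" | "r d \<le> r a" "r a \<le> r c" | "r d \<le> r c" "r c \<le> r a" by linarith
      moreover have ac: "r a \<le> r c \<Longrightarrow> Sc c a (b i)" "r c \<le> r a \<Longrightarrow> Sc a c (b i)"
        and cd: "r c \<le> r d \<Longrightarrow> Sc d c (b i)" "r d \<le> r c \<Longrightarrow> Sc c d (b i)"
        using h(4,5) Us r_eq Sc_ge by (force simp: rho_def)+
      ultimately show ?thesis
      proof cases
        case 1 then show ?thesis using step[OF h(1,2) ac(1) Us(3)] cd by (simp add: rho_def)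
      next
        case 2 then show ?thesis using Sc_down[OF ac(1) Us(3)] by (simp add: rho_def)
      next
        case 3 then show ?thesis using step[OF h(2,1) ac(2) Us(3)] cd by (simp add: rho_def)
      next
        case 4 then show ?thesis using step[OF h(2,3) cd(1) Us(1)] ac by (simp add: rho_def)
      next
        case 5 then show ?thesis using Sc_down[OF cd(2) Us(1)] by (simp add: rho_def)
      next
        case 6 then show ?thesis using step[OF h(3,2) cd(2) Us(1)] ac by (simp add: rho_def)
      qed
    qed
    show "rho a c (b i)" if h: "eqv B v c" "r a < r c" "r c < r d" "rho a d (b i)" for i a c d
      using Sc_down[of d a "b i" c] h eqv_U by (auto simp: rho_def)
    show "\<exists>d. eqv B v d \<and> r a < r d \<and> r d < r c \<and> \<not> rho a d (b i) \<and> \<not> rho d c (b i)"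
      if h: "eqv B v a" "eqv B v c" "r a < r c" "\<not> rho a c (b i)" for i a c
    proof -
      have n: "\<not> Sc c a (b i)" using h by (simp add: rho_def)
      have Us: "a \<in> U" "c \<in> U" using h eqv_U by blast+
      show ?thesis
      \<comment> \<open>Within level \<open>J3\<close> the third point comes from
        \<open>good\<close> and stays in the type. Farther apart, a point of the ball of
        \<open>a\<close> that is outside level \<open>Suc J3\<close> separates, since all relations
        are contained in that level.\<close>
      proof (cases "E J3 a c")
        case True
        obtain d where d: "d \<in> U" "E J x d" "r a < r d" "r d < r c" "\<not> Sc d a (b i)" "\<not> Sc c d (b i)"
          using G(3)[of i] qx h(1,2) Us h(3) n by meson
        have "P d" using x d E_P by blast
        then have "E J3 a d" using E_cvx[OF Pq[OF h(1)] _ True, of d] d by simp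
        then show ?thesis using qball[OF h(1)] d by (intro exI[of _ d]) (auto simp: rho_def)
      next
        case False
        obtain d where d: "r a < r d" "E J3 a d" "\<not> E (Suc J3) a d" using E_up Pq[OF h(1)] by blast
        have qd: "eqv B v d" using qball h d by blast
        have "r d < r c" using E_cvx[OF Pq[OF h(1)] Pq[OF h(2)] d(2)] False h by force
        moreover have "\<not> rho a d (b i)" using rhoE[OF h(1) qd] E_mono[OF idx(2) Pq[OF h(1)]] d by blast
        moreover have "\<not> rho d c (b i)"
        proof
          assume "rho d c (b i)"
          then have "E (Suc J3) d c" using rhoE[OF qd h(2)] E_mono[OF idx(2) Pq[OF qd]] by blast
          then show False using False E_trans[OF Pq[OF h(1)] d(2)] E_Suc[OF Pq[OF qd]] by blast
        qed
        ultimately show ?thesis using d qd by blast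
      qed
    qed
    show "rho a c (b i)" if h: "eqv B v a" "eqv B v c" "rho a c (b (Suc i))" for i a c
      using Erho[OF h(1)] rhoE[OF h] E_Suc[OF Pq[OF h(1)]] by (simp add: idx)
    show "infinite ((\<lambda>y. {z. eqv B v z \<and> rho y z (b (Suc i))}) ` {y. eqv B v y \<and> rho a y (b i)})"
      if a: "eqv B v a" for i a
    proof -
      obtain c where "Fam a (i) c" using fam a by blast
      then have c: "\<And>k. eqv B v (c k)" "\<And>k. E (K (idx i)) a (c k)"
        "\<And>k l. k < l \<Longrightarrow> \<not> E (Suc (K (idx i))) (c k) (c l)" unfolding Fam_def by simp_all
      define Z where "Z = (\<lambda>y. {z. eqv B v z \<and> rho y z (b (Suc i))})"
      have "Z (c k) \<noteq> Z (c l)" if kl: "k < l" for k l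
      proof
        assume eq: "Z (c k) = Z (c l)"
        have "E (K (idx (Suc i))) (c l) (c l)" using E_refl Pq[OF c(1)] by blast
        then have "c l \<in> Z (c l)" using Erho[OF c(1)] c(1) by (simp add: Z_def)
        then have "c l \<in> Z (c k)" by (simp only: eq)
        then have "rho (c k) (c l) (b (Suc i))" by (simp add: Z_def)
        then show False using rhoE[OF c(1)[of k] c(1)[of l], of "Suc i"] c(3)[OF kl] by (simp add: idx)
      qed
      then have "inj (\<lambda>k. Z (c k))" by (metis injI linorder_neqE_nat)
      moreover have "range (\<lambda>k. Z (c k)) \<subseteq> Z ` {y. eqv B v y \<and> rho a y (b i)}"
        using c Erho[OF a] by auto
      ultimately have "infinite (Z ` {y. eqv B v y \<and> rho a y (b i)})" by (rule inf_sub)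
      then show ?thesis by (simp add: Z_def)
    qed
    show "infinite {y. eqv B v y \<and> rho a y (b (Suc i))}" if a: "eqv B v a" for i a
    proof -
      obtain c where "Fam a (Suc i) c" using fam a by blast
      then have c: "\<And>k. eqv B v (c k)" "\<And>k. E (K (idx (Suc i))) a (c k)"
        "\<And>k l. k < l \<Longrightarrow> \<not> E (Suc (K (idx (Suc i)))) (c k) (c l)" unfolding Fam_def by simp_all
      have "inj c" using c(3) E_refl Pq[OF c(1)] by (metis injI linorder_neqE_nat)
      moreover have "range c \<subseteq> {y. eqv B v y \<and> rho a y (b (Suc i))}" using c Erho[OF a] by auto
      ultimately show ?thesis by (rule inf_sub)
    qed
  qed
qed

text \<open>The data of \<open>tame_core\<close> are built from one segment within
  \<open>Einf\<close>. Isolating the type of its parameters over \<open>x\<close>, and demanding the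
  isolating formula on a ball, gives definable conditions \<open>OK i\<close>. By
  \<open>coinit\<close> some parameters satisfying \<open>OK i\<close> have a segment at
  \<open>x\<close> containing half a ball. For these, isolation forbids a free point nearby whose
  segment stays in all hulls; closed points with such a segment fall into finitely many classes,
  from which \<open>z\<close> can be moved away.\<close>

lemma tame:
  assumes u0: "u0 \<in> Tup n" and h0: "hyp x u0"
  shows False
proof -
  have x: "P x" "x \<in> U" using h0 P_U by (auto simp: hyp_def)
  define B where "B = insert x A"
  have B: "finite B" "A \<subseteq> B" "B \<subseteq> U" "x \<in> B" using A x by (auto simp: B_def)
  define Y where "Y = {u \<in> Tup n. hyp x u}"
  have "Y \<subseteq> Tup n" "Y \<noteq> {}" using u0 h0 by (auto simp: Y_def)
  from isolated_tuple[OF B(1,3) this] obtain \<tau> us where \<tau>: "Dp B \<tau>" "us \<in> Y" "\<tau> us"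
    "\<And>u P. u \<in> Y \<Longrightarrow> \<tau> u \<Longrightarrow> Dp B P \<Longrightarrow> P us = P u" by blast
  have us: "us \<in> Tup n" "hyp x us" "us \<in> AS" using \<tau>(2) TupD by (auto simp: Y_def)
  obtain T0 where T0: "Dp A T0" "\<And>e. e \<in> AS \<Longrightarrow> \<tau> e = T0 (case_nat x e)"
    using abs_case[OF \<tau>(1)[unfolded B_def]] by blast
  obtain J where J: "\<And>y. E J x y \<Longrightarrow> eqv (A \<union> range us) x y" using us(2) by (auto simp: hyp_def free_def)
  \<comment> \<open>The isolating formula is demanded at all points of the ball, so that it can be
    used at points other than \<open>x\<close>. Truncation at \<open>n\<close> makes it depend on
    the tuple only.\<close>
  define TT where "TT = (\<lambda>x' u. \<forall>a\<in>U. E J x' a \<longrightarrow> T0 (case_nat a (\<lambda>i. u (min i n))))"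
  have TT_D: "Dp A (\<lambda>e. TT (e 0) (\<lambda>i. e (Suc i)))" unfolding TT_def
    by (intro Dintros E_D' D_case[OF T0(1)] A(2) subset_refl)
  have TTs: "TT x us"
    unfolding TT_def
  proof (intro ballI impI)
    fix a assume a: "a \<in> U" "E J x a"
    have F: "finite (A \<union> range us)" "A \<union> range us \<subseteq> U" using Tup_fin[OF us(1)] A by auto
    obtain \<sigma> where \<sigma>: "\<sigma> \<in> Au (A \<union> range us)" "\<sigma> x = a" using J[OF a(2)] eqv_iff[OF F] by blast
    have "(\<lambda>i. \<sigma> (case_nat x us i)) = case_nat a us" using \<sigma> by (auto simp: Au_def split: nat.split)
    then have "T0 (case_nat a us) = T0 (case_nat x us)"
      using Au_Dp[OF A(1) Au_mono[OF \<sigma>(1)] T0(1), of "case_nat x us"] us x by simp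
    moreover have "T0 (case_nat x us)" using T0(2)[OF us(3)] \<tau>(3) by blast
    ultimately show "T0 (case_nat a (\<lambda>i. us (min i n)))" unfolding TupD(2)[OF us(1)] by blast
  qed
  define OK where "OK = (\<lambda>i u. good J x u \<and> bdd i J x u \<and> TT x u)"
  have OKs: "OK i us" for i
    unfolding OK_def
  proof (intro conjI TTs)
    show "good J x us" using hyp_good[OF us(1,2) J] .
    have F: "finite (A \<union> range us)" "A \<union> range us \<subseteq> U" using Tup_fin[OF us(1)] A by auto
    show "bdd i J x us" unfolding bdd_def
    proof (intro ballI impI)
      fix a y assume a: "a \<in> U" "E J x a" "y \<in> U" "Sc y a us"
      obtain \<sigma> where \<sigma>: "\<sigma> \<in> Au (A \<union> range us)" "\<sigma> a = x" using J[OF a(2)] eqv_iff[OF F] eqv_sym by blast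
      have \<sigma>A: "\<sigma> \<in> Au A" using \<sigma> Au_mono by blast
      have "(\<lambda>i. \<sigma> (us i)) = us" using \<sigma> by (auto simp: Au_def)
      then have "Sc (\<sigma> y) x us" using Au_Sc[OF \<sigma>A a(1,3) us(3)] \<sigma> a by simp
      then have "H i x (\<sigma> y)" using us(2) \<sigma> a by (auto simp: hyp_def)
      then show "H i a y" using H_Au[OF \<sigma>A a(1,3)] \<sigma> by simp
    qed
  qed
  \<comment> \<open>The union of the segments over all admissible parameters is a right-convex
    formula over \<open>A\<close>: \<open>bdd i\<close> bounds it and \<open>us\<close> makes it
    nontrivial. \<open>coinit\<close> puts half a ball into it, and a point of that half ball
    selects one tuple.\<close>
  have ex: "\<exists>u j. u \<in> Tup n \<and> OK i u \<and> (\<forall>b. E j x b \<and> r x \<le> r b \<longrightarrow> Sc b x u)" for i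
  proof -
    define \<Phi> where "\<Phi> = (\<lambda>y x' u. r x' \<le> r y \<and> good J x' u \<and> bdd i J x' u \<and> TT x' u \<and> Sc y x' u)"
    have "Dp A (\<lambda>e. TT (e 1) (\<lambda>i. e (Suc (Suc i))))" using D_ren[OF TT_D, of Suc] by simp
    then have "Dp A (\<lambda>e. \<Phi> (e 0) (e 1) (\<lambda>i. e (Suc (Suc i))))" unfolding \<Phi>_def
      by (intro Dintros good_D bdd_D Sc_D' A(2) subset_refl)
    then have D: "Dp A (\<lambda>e. \<exists>u\<in>AS. \<Phi> (e 0) (e 1) u)" by (rule D_exu2)
    define R where "R = (\<lambda>y x'. \<exists>u\<in>AS. \<Phi> y x' u)"
    have R_us: "R y x" if "Sc y x us" for y
      unfolding R_def \<Phi>_def using OKs[of i] us(3) that Sc_ge[OF that] by (auto simp: OK_def)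
    have R_down: "R z x" if h: "R y x" "z \<in> U" "r x \<le> r z" "r z \<le> r y" for y z
    proof -
      obtain u where u: "u \<in> AS" "\<Phi> y x u" using h(1) unfolding R_def by (rule bexE)
      have "\<Phi> z x u" using u(2) Sc_down[OF _ h(2-4)] h unfolding \<Phi>_def by blast
      then show ?thesis unfolding R_def using u(1) by (rule bexI)
    qed
    have R_H: "H i x y" if h: "R y x" "y \<in> U" for y
    proof -
      obtain u where u: "u \<in> AS" "\<Phi> y x u" using h(1) unfolding R_def by (rule bexE)
      then have "bdd i J x u" "Sc y x u" by (auto simp: \<Phi>_def)
      then show ?thesis using h(2) x(2) E_refl[OF x(1)] by (auto simp: bdd_def)
    qed
    obtain w where w: "Einf x w" "r x < r w" "Sc w x us" using us(2) by (auto simp: hyp_def)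
    obtain g where g: "P g" "r x < r g" "\<not> E 0 x g" using out_up x by blast
    have "\<exists>j. \<forall>b. E j x b \<and> r x \<le> r b \<longrightarrow> R b x"
    proof (rule coinit[OF x(1), where y = w and g = g])
      show "Dp A (\<lambda>e. R (e 0) (e 1))" using D by (simp add: R_def)
      show "R x x" using R_down[OF R_us[OF w(3)] x(2)] w by simp
      show "r x \<le> r y" if "R y x" for y using that by (auto simp: R_def \<Phi>_def)
      show "P w" "w \<noteq> x" "R w x" using w E_P[OF x(1)] R_us by (auto simp: Einf_def)
      show "r y < r g" if y: "y \<in> U" "R y x" for y
      proof (rule ccontr)
        assume "\<not> r y < r g"
        moreover obtain b where "E i x b" "r y \<le> r b" using R_H[OF y(2,1)] by (auto simp: H_def)
        ultimately have "E i x g" using E_cvx[OF x(1) g(1)] g by force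
        then show False using g E_mono[of 0 i] x by blast
      qed
      show "R c x" if "P c" "R b x" "R d x" "r b < r c" "r c < r d" for b c d
      proof -
        have "r x \<le> r b" using that(2) by (auto simp: R_def \<Phi>_def)
        then show ?thesis using R_down[OF that(3)] that P_U by auto
      qed
    qed (fact g)
    then obtain j where j: "\<And>b. E j x b \<Longrightarrow> r x \<le> r b \<Longrightarrow> R b x" by blast
    obtain b where b: "r x < r b" "E j x b" "\<not> E (Suc j) x b" using E_up x by blast
    then obtain u where u: "u \<in> AS" "\<Phi> b x u" using j[of b] unfolding R_def by auto
    define u' where "u' = (\<lambda>i. u (min i n))"
    have "TT x u'" using u(2) by (simp add: \<Phi>_def TT_def u'_def)
    then have "OK i u'" using u(2) by (simp add: OK_def \<Phi>_def u'_def good_tr)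
    moreover have "u' \<in> Tup n" using Tup_trunc[OF u(1)] by (simp add: u'_def)
    moreover have "Sc c x u'" if c: "E (Suc j) x c" "r x \<le> r c" for c
    proof -
      have "P c" "c \<in> U" using c x E_P E_U by blast+
      have "P b" using b x E_P by blast
      have "r c \<le> r b"
      proof (rule ccontr)
        assume "\<not> r c \<le> r b"
        then show False using E_cvx[OF x(1) \<open>P b\<close> c(1)] b by simp
      qed
      moreover have "Sc b x u'" using u(2) by (simp add: \<Phi>_def u'_def Sc_tr)
      ultimately show ?thesis using Sc_down c \<open>c \<in> U\<close> by blast
    qed
    ultimately show ?thesis by blast
  qed
  \<comment> \<open>Suppose the segment at \<open>z\<close> stays in all hulls. Carrying
    \<open>z\<close> to \<open>x\<close> carries \<open>u\<close> to some \<open>v\<close> that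
    satisfies \<open>hyp\<close> and the isolating formula, hence is conjugate to \<open>us\<close>
    over \<open>x\<close>. So the ball of level \<open>J\<close> around \<open>x\<close> lies in the
    type over \<open>v\<close>; back at \<open>z\<close>, this makes \<open>x\<close> and
    \<open>z\<close> conjugate over \<open>u\<close>, although the segment at \<open>x\<close>
    contains half a ball and the one at \<open>z\<close> does not.\<close>
  have claim: "\<exists>y\<in>U. \<exists>k. Sc y z u \<and> \<not> H k z y"
    if u: "u \<in> Tup n" "OK i u" and j: "\<And>b. E j x b \<Longrightarrow> r x \<le> r b \<Longrightarrow> Sc b x u"
      and z: "E J x z" "free (A \<union> range u) z" for u i j z
  proof (rule ccontr)
    assume "\<not> ?thesis"
    then have zb: "\<And>y k. y \<in> U \<Longrightarrow> Sc y z u \<Longrightarrow> H k z y" by blast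
    have Pz: "P z" "z \<in> U" using z x E_P P_U by blast+
    have uA: "u \<in> AS" using u TupD by blast
    obtain b where b: "b \<in> U" "E J x b" "r z < r b" "Sc b z u"
      using u(2) Pz z(1) unfolding OK_def good_def by blast
    have Pb: "P b" using b x E_P by blast
    have zw: "Einf z b" unfolding Einf_def using zb[OF b(1,4)] H_E[OF Pz(1) Pb] by blast
    obtain \<sigma> where \<sigma>: "\<sigma> \<in> Au A" "\<sigma> z = x" using eqv_iff[OF A] Pz x eqv_trans eqv_sym by metis
    obtain \<rho> where \<rho>: "\<rho> \<in> Au A" "\<And>a. a \<in> U \<Longrightarrow> \<rho> (\<sigma> a) = a" "\<And>a. a \<in> U \<Longrightarrow> \<sigma> (\<rho> a) = a"
      using Au_inv[OF \<sigma>(1) A(2)] by blast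
    define v where "v = (\<lambda>i. \<sigma> (u i))"
    have v: "v \<in> Tup n" "v \<in> AS" using Tup_Au[OF u(1) \<sigma>(1)] TupD by (auto simp: v_def)
    have Fu: "finite (A \<union> range u)" "A \<union> range u \<subseteq> U" using Tup_fin[OF u(1)] A by auto
    have Fv: "finite (A \<union> range v)" "A \<union> range v \<subseteq> U" using Tup_fin[OF v(1)] A by auto
    have im: "\<sigma> ` (A \<union> range u) = A \<union> range v" using \<sigma> by (force simp: Au_def v_def)
    have im': "\<rho> ` (A \<union> range v) = A \<union> range u"
    proof -
      have "\<rho> (v i) = u i" for i using \<rho>(2) asgD[OF uA] by (simp add: v_def)
      then have "\<rho> ` range v = range u" by (auto simp: image_iff)
      moreover have "\<rho> ` A = A" using \<rho>(1) by (force simp: Au_def)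
      ultimately show ?thesis by (simp add: image_Un)
    qed
    have "hyp x v" unfolding hyp_def
    proof (intro conjI ballI allI impI)
      obtain J1 where J1: "\<And>y. E J1 z y \<Longrightarrow> eqv (A \<union> range u) z y" using z(2) by (auto simp: free_def)
      have "eqv (A \<union> range v) x y" if "E J1 x y" for y
        using ball_move[OF \<sigma>(1) Fu Pz(1), of J1 y, OF J1] that \<sigma> im by simp
      then show "free (A \<union> range v) x" by (auto simp: free_def)
      have "Einf x (\<sigma> b)" using zw E_Au[OF \<sigma>(1) subset_refl Pz(2) b(1)] \<sigma> by (auto simp: Einf_def)
      moreover have "r x < r (\<sigma> b)" "Sc (\<sigma> b) x v"
        using Au_lt[OF \<sigma>(1) Pz(2) b(1)] Au_Sc[OF \<sigma>(1) Pz(2) b(1) uA] b \<sigma> by (auto simp: v_def)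
      ultimately show "\<exists>w. Einf x w \<and> r x < r w \<and> Sc w x v" by blast
      fix y k assume y: "y \<in> U" "Sc y x v"
      have t: "\<rho> y \<in> U" using \<rho> y by simp
      have "Sc (\<rho> y) z u" using Au_Sc[OF \<sigma>(1) Pz(2) t uA] \<rho> \<sigma> y by (simp add: v_def)
      then have "H k z (\<rho> y)" using zb t by blast
      then show "H k x y" using H_Au[OF \<sigma>(1) Pz(2) t] \<rho> \<sigma> y by simp
    qed (fact x)
    then have vY: "v \<in> Y" using v by (simp add: Y_def)
    have "T0 (case_nat z u)" using u(2) z(1) Pz TupD(2)[OF u(1)] by (auto simp: OK_def TT_def)
    moreover have "(\<lambda>i. \<sigma> (case_nat z u i)) = case_nat x v" using \<sigma> by (auto simp: v_def split: nat.split)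
    ultimately have "T0 (case_nat x v)" using Au_Dp[OF A(1) \<sigma>(1) T0(1), of "case_nat z u"] Pz uA by simp
    then have "\<tau> v" using T0(2) v by blast
    then obtain \<theta> where \<theta>: "\<theta> \<in> Au B" "\<And>i. \<theta> (us i) = v i"
      using Tup_homog[OF B(1,3) us(1) v(1) \<tau>(4)[OF vY]] by blast
    have \<theta>A: "\<theta> \<in> Au A" "\<theta> x = x" using \<theta> B Au_mono by (auto simp: Au_def)
    have Fs: "finite (A \<union> range us)" "A \<union> range us \<subseteq> U" using Tup_fin[OF us(1)] A by auto
    have ims: "\<theta> ` (A \<union> range us) = A \<union> range v"
    proof -
      have "\<theta> ` range us = range v" using \<theta>(2) by (auto simp: image_iff)
      moreover have "\<theta> ` A = A" using \<theta>A(1) by (force simp: Au_def)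
      ultimately show ?thesis by (simp add: image_Un)
    qed
    have 1: "eqv (A \<union> range v) x y" if "E J x y" for y
      using ball_move[OF \<theta>A(1) Fs x(1), of J y, OF J] that ims \<theta>A by simp
    have \<rho>x: "\<rho> x = z" using \<rho>(2)[OF Pz(2)] \<sigma> by simp
    have "E J z x" using z x E_sym by blast
    then have "eqv (A \<union> range u) z x"
      using ball_move[OF \<rho>(1) Fv x(1), of J x, OF 1] im' \<rho>x by simp
    then obtain \<kappa> where \<kappa>: "\<kappa> \<in> Au (A \<union> range u)" "\<kappa> x = z" using eqv_iff[OF Fu] eqv_sym by blast
    have \<kappa>A: "\<kappa> \<in> Au A" "(\<lambda>i. \<kappa> (u i)) = u" using \<kappa> Au_mono by (auto simp: Au_def)
    obtain c where c: "r x < r c" "E j x c" "\<not> E (Suc j) x c" using E_up x by blast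
    have Pc: "P c" "c \<in> U" using c x E_P P_U by blast+
    have "Sc c x u" using j c by auto
    then have "Sc (\<kappa> c) z u" using Au_Sc[OF \<kappa>A(1) x(2) Pc(2) uA] \<kappa>A \<kappa> by simp
    then have "H (Suc j) z (\<kappa> c)" using zb \<kappa>A Pc by simp
    then have "H (Suc j) x c" using H_Au[OF \<kappa>A(1) x(2) Pc(2)] \<kappa> by simp
    then show False using H_E[OF x(1) Pc(1)] c by blast
  qed
  have DJ: "Dp B (\<lambda>e. E J x (e 0))" by (intro E_D' B(2,3) tmv tmc B(4))
  have "\<exists>z y. E J x z \<and> eqv B z y \<and> \<not> E (Suc J) z y"
  proof (rule ccontr)
    assume neg: "\<not> ?thesis"
    obtain F where F: "finite F" "\<And>w. w \<in> F \<Longrightarrow> P w"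
      "\<And>w. w \<in> U \<Longrightarrow> E J x w \<Longrightarrow> \<exists>f\<in>F. E (Suc J) f w"
      using closed_finite_family[OF B(1-3), of "\<lambda>_ w. E J x w" "Suc J"] DJ neg E_P[OF x(1)] by auto
    show False using no_finite_cover[OF x(1) F(1,2), of J] F(3) E_U[OF x(1)] by blast
  qed
  then obtain z y where z: "E J x z" "eqv B z y" "\<not> E (Suc J) z y" by blast
  have Pz: "P z" "z \<in> U" using z x E_P P_U by blast+
  have fin: "\<exists>u k. u \<in> Tup n \<and> good J x u \<and> bdd i J x u \<and>
      (\<forall>v b. E (Suc J) z v \<and> E k v b \<and> r v \<le> r b \<longrightarrow> Sc b v u)" for i
  proof -
    obtain u j where u: "u \<in> Tup n" "OK i u" and j: "\<And>b. E j x b \<Longrightarrow> r x \<le> r b \<Longrightarrow> Sc b x u"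
      using ex[of i] by blast
    have uA: "u \<in> AS" using u TupD by blast
    have Fu: "finite (A \<union> range u)" "A \<union> range u \<subseteq> U" using Tup_fin[OF u(1)] A by auto
    define C where "C = A \<union> range u \<union> B"
    have C: "finite C" "A \<subseteq> C" "C \<subseteq> U" "B \<subseteq> C" "A \<union> range u \<subseteq> C" using Fu B by (auto simp: C_def)
    have uC: "u k \<in> C" for k by (auto simp: C_def)
    \<comment> \<open>Points satisfying all \<open>D k\<close> have a segment within every hull. By
      the claim they are not free over \<open>u\<close>, hence closed, and finitely many classes of
      level \<open>Suc J\<close> contain them.\<close>
    define D where "D = (\<lambda>k z. E J x z \<and> (\<forall>y\<in>U. Sc y z u \<longrightarrow> H k z y))"
    have "Dp C (\<lambda>e. D k (e 0))" for k unfolding D_def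
      using B(4) C(4) by (intro Dintros E_D' Sc_D' H_D' C(2,3) tmc uC) auto
    moreover have "P w \<and> (eqv C w y \<longrightarrow> E (Suc J) w y)" if w: "w \<in> U" "\<And>k. D k w" for w y
    proof -
      have "E J x w" using w(2)[of 0] by (simp add: D_def)
      then have Pw: "P w" using E_P x by blast
      have "\<not> free (A \<union> range u) w" using claim[OF u, of j w, OF j] w by (auto simp: D_def)
      then have "closed (A \<union> range u) w" using free_or_closed[OF Fu(1) _ Fu(2) Pw] by blast
      then show ?thesis using Pw eqv_mono[OF _ C(5,3)] by (auto simp: closed_def)
    qed
    ultimately obtain F where F: "finite F" "\<And>w. w \<in> F \<Longrightarrow> P w"
      "\<And>w. w \<in> U \<Longrightarrow> (\<And>k. D k w) \<Longrightarrow> \<exists>f\<in>F. E (Suc J) f w"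
      using closed_finite_family[of C D "Suc J", OF C(1-3)] by auto
    \<comment> \<open>Moving \<open>z\<close> away from these classes by \<sigma>, and
      \<open>u\<close> back by its inverse, makes every segment based in the ball of
      \<open>z\<close> leave some hull.\<close>
    obtain \<sigma> where \<sigma>: "\<sigma> \<in> Au B" "\<And>f. f \<in> F \<Longrightarrow> \<not> E (Suc J) f (\<sigma> z)"
      using conj_many[OF B(1-3) Pz(1) z(2,3) F(1,2)] by blast
    have \<sigma>A: "\<sigma> \<in> Au A" "\<sigma> x = x" using \<sigma> B Au_mono by (auto simp: Au_def)
    obtain \<rho> where \<rho>: "\<rho> \<in> Au B" "\<And>a. a \<in> U \<Longrightarrow> \<rho> (\<sigma> a) = a" "\<And>a. a \<in> U \<Longrightarrow> \<sigma> (\<rho> a) = a"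
      using Au_inv[OF \<sigma>(1) B(3)] by blast
    have \<rho>A: "\<rho> \<in> Au A" "\<rho> x = x" using \<rho> B Au_mono by (auto simp: Au_def)
    define v where "v = (\<lambda>i. \<rho> (u i))"
    have v: "v \<in> Tup n" "v \<in> AS" using Tup_Au[OF u(1) \<rho>(1)] TupD by (auto simp: v_def)
    have gv: "good J x v" "bdd i J x v"
      using Au_good[OF \<rho>A(1) x(2) uA] u(2) \<rho>A(2) by (simp_all add: v_def OK_def)
    have bad: "\<exists>k. \<exists>y\<in>U. Sc y w v \<and> \<not> H k w y" if w: "E (Suc J) z w" for w
    proof -
      have Pw: "P w" "w \<in> U" using w Pz E_P P_U by blast+
      have sw: "E (Suc J) (\<sigma> z) (\<sigma> w)" using E_Au[OF \<sigma>A(1) subset_refl Pz(2) Pw(2)] w by blast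
      have "\<not> (\<forall>k. D k (\<sigma> w))"
      proof
        assume "\<forall>k. D k (\<sigma> w)"
        then obtain f where f: "f \<in> F" "E (Suc J) f (\<sigma> w)" using F(3)[of "\<sigma> w"] \<sigma>A(1) Pw by auto
        have "P (\<sigma> z)" using P_Au Pz \<sigma>A by blast
        then have "E (Suc J) f (\<sigma> z)" using f F(2) E_trans E_sym[OF _ sw] by blast
        then show False using \<sigma>(2) f by blast
      qed
      moreover have "E J x (\<sigma> w)"
        using E_Au[OF \<sigma>A(1) subset_refl x(2) Pw(2), of J] \<sigma>A E_trans[OF x(1) z(1) E_Suc[OF Pz(1) w]] by simp
      ultimately obtain k y where y: "y \<in> U" "Sc y (\<sigma> w) u" "\<not> H k (\<sigma> w) y" by (auto simp: D_def)
      have \<sigma>w: "\<sigma> w \<in> U" using \<sigma>A Pw by simp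
      have "Sc (\<rho> y) w v" using Au_Sc[OF \<rho>A(1) \<sigma>w y(1) uA] y \<rho> Pw by (simp add: v_def)
      moreover have "\<not> H k w (\<rho> y)" using H_Au[OF \<rho>A(1) \<sigma>w y(1)] y \<rho> Pw by simp
      moreover have "\<rho> y \<in> U" using \<rho>A y by simp
      ultimately show ?thesis by blast
    qed
    \<comment> \<open>Compactness makes the level of the hull that is left uniform over the ball of
      \<open>z\<close>.\<close>
    have "\<exists>k. \<forall>w. E (Suc J) z w \<longrightarrow> (\<exists>y\<in>U. Sc y w v \<and> \<not> H k w y)"
    proof (rule ccontr)
      assume neg: "\<not> ?thesis"
      define V where "V = insert z (A \<union> range v)"
      have V: "finite V" "A \<subseteq> V" "V \<subseteq> U" using Tup_fin[OF v(1)] A Pz by (auto simp: V_def)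
      have VV: "z \<in> V" "v k \<in> V" for k by (auto simp: V_def)
      define G where "G = (\<lambda>k (e::nat \<Rightarrow> 'a). E (Suc J) z (e 0) \<and> (\<forall>y\<in>U. Sc y (e 0) v \<longrightarrow> H k (e 0) y))"
      have "\<exists>a\<in>U. \<forall>Q\<in>range G. Q (\<lambda>_. a)"
      proof (rule D_sat[OF V(1,3)])
        have "Dp V (G k)" for k unfolding G_def
          by (intro Dintros E_D' Sc_D' H_D' V(2,3) tmc VV)
        then show "Dp V Q" if "Q \<in> range G" for Q using that by blast
        fix S assume "S \<subseteq> range G" "finite S"
        then obtain K where K: "finite K" "S = G ` K" using finite_subset_image[of S G UNIV] by auto
        define m where "m = Max (insert 0 K)"
        have m: "k \<le> m" if "k \<in> K" for k using K that by (auto simp: m_def)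
        obtain w where w: "E (Suc J) z w" "\<And>y. y \<in> U \<Longrightarrow> Sc y w v \<Longrightarrow> H m w y" using neg by blast
        have Pw: "P w" "w \<in> U" using w Pz E_P P_U by blast+
        have "G k (\<lambda>_. w)" if "k \<in> K" for k
          unfolding G_def using w H_mono[OF m[OF that] Pw(1)] by blast
        then show "\<exists>a\<in>U. \<forall>Q\<in>S. Q (\<lambda>_. a)" using K Pw by (intro bexI[of _ w]) auto
      qed
      then obtain a where a: "a \<in> U" "\<forall>Q\<in>range G. Q (\<lambda>_. a)" by (rule bexE)
      have "G k (\<lambda>_. a)" for k using bspec[OF a(2), of "G k"] by simp
      then show False using bad[of a] unfolding G_def by blast
    qed
    then obtain k where k: "\<And>w. E (Suc J) z w \<Longrightarrow> \<exists>y\<in>U. Sc y w v \<and> \<not> H k w y" by blast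
    have "Sc b w v" if h: "E (Suc J) z w" "E k w b" "r w \<le> r b" for w b
    proof -
      obtain y where y: "y \<in> U" "Sc y w v" "\<not> H k w y" using k h by blast
      have bU: "b \<in> U" using h Pz E_P E_U by blast
      have "r b \<le> r y" using y(3) Sc_ge[OF y(2)] bU h by (auto simp: H_def)
      then show ?thesis using Sc_down[OF y(2) bU h(3)] by simp
    qed
    then show ?thesis using v gv by blast
  qed
  then obtain uu \<kappa> where uu: "\<And>i. uu i \<in> Tup n" "\<And>i. good J x (uu i)" "\<And>i. bdd i J x (uu i)"
    "\<And>i v b. E (Suc J) z v \<Longrightarrow> E (\<kappa> i) v b \<Longrightarrow> r v \<le> r b \<Longrightarrow> Sc b v (uu i)" by metis
  show False by (rule tame_core[OF x(1) uu(1-3) z(1) uu(4)])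
qed

end

section \<open>No definable end inside the class of a free point\<close>

context chain
begin

lemma free_mono: "free B x \<Longrightarrow> C \<subseteq> B \<Longrightarrow> B \<subseteq> U \<Longrightarrow> free C x"
  unfolding free_def using eqv_mono by blast

text \<open>An instance of \<open>tame\<close>: the parameters of \<open>G\<close> from
  \<open>B\<close> become a tuple, and \<open>Sc\<close> consists of the points from the base point
  up to some solution, with these parameters left variable.\<close>

lemma no_segment:
  assumes B: "finite B" "A \<subseteq> B" "B \<subseteq> U" "B \<noteq> {}" and x: "P x" "free B x"
    and G: "Dp (insert x B) (\<lambda>e. G (e 0))"
    and down: "\<And>y z. y \<in> U \<Longrightarrow> G y \<Longrightarrow> z \<in> U \<Longrightarrow> r x \<le> r z \<Longrightarrow> r z \<le> r y \<Longrightarrow> G z"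
    and w: "Einf x w" "r x < r w" "G w"
    and bd: "\<And>y k. y \<in> U \<Longrightarrow> G y \<Longrightarrow> r x \<le> r y \<Longrightarrow> H k x y"
  shows False
proof -
  obtain R where R: "Dp B (\<lambda>e. R (e 0) (e 1))" "\<And>y. y \<in> U \<Longrightarrow> G y = R y x" using binary_abs[OF G] by blast
  have AB: "A \<union> B = B" using B by blast
  obtain Q m where Q: "Dp A Q" "finite (dom m)" "ran m \<subseteq> B"
    and RQ: "\<And>e. e \<in> AS \<Longrightarrow> R (e 0) (e 1) = Q (\<lambda>i. case m i of Some c \<Rightarrow> c | None \<Rightarrow> e i)"
    using abs_many[OF B(1), of A "\<lambda>e. R (e 0) (e 1)"] R(1) unfolding AB by blast
  obtain c0 where c0: "c0 \<in> B" using B by blast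
  define N where "N = Max (insert 0 (dom m))"
  have N: "i \<le> N" if "i \<in> dom m" for i using Q(2) that by (simp add: N_def)
  \<comment> \<open>The default \<open>c0\<close> fills positions that carry no parameter, so that
    the whole tuple lies in \<open>B\<close>.\<close>
  define u where "u = (\<lambda>i. case m i of Some c \<Rightarrow> c | None \<Rightarrow> c0)"
  have "u i \<in> B" for i using Q(3) c0 by (auto simp: u_def ran_def split: option.split)
  then have ru: "range u \<subseteq> B" by blast
  define q where "q = (\<lambda>w x v. Q (\<lambda>i. if i \<in> dom m then v i else if i = 0 then w else (x :: 'a)))"
  define Sc where "Sc = (\<lambda>y x v. r x \<le> r y \<and> (\<exists>w\<in>U. q w x v \<and> r y \<le> r w))"
  have xU: "x \<in> U" using x P_U by blast
  have qG: "q w x u = G w" if "w \<in> U" for w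
  proof -
    have "R w x = Q (\<lambda>i. case m i of Some c \<Rightarrow> c | None \<Rightarrow> if i = 0 then w else x)"
      using RQ[of "\<lambda>i. if i = 0 then w else x"] that xU by (simp add: asg_def)
    also have "(\<lambda>i. case m i of Some c \<Rightarrow> c | None \<Rightarrow> if i = 0 then w else x) =
      (\<lambda>i. if i \<in> dom m then u i else if i = 0 then w else x)"
      by (rule ext) (auto simp: u_def dom_def split: option.split)
    finally show ?thesis using R(2)[OF that] by (simp add: q_def)
  qed
  have ScG: "Sc y x u \<longleftrightarrow> r x \<le> r y \<and> G y" if y: "y \<in> U" for y
  proof
    assume "Sc y x u"
    then obtain w where "r x \<le> r y" "w \<in> U" "G w" "r y \<le> r w" using qG by (auto simp: Sc_def)
    then show "r x \<le> r y \<and> G y" using down y by blast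
  next
    assume "r x \<le> r y \<and> G y"
    then show "Sc y x u" using qG y by (auto simp: Sc_def)
  qed
  interpret segments U r Dp A p0 E Sc N
  proof
    have "Dp A (\<lambda>e. q (e 0) (e (Suc 1)) (\<lambda>i. e (Suc (Suc (Suc i)))))" unfolding q_def
      by (rule D_cong[OF D_ren[OF Q(1), of "\<lambda>i. if i \<in> dom m then Suc (Suc (Suc i)) else if i = 0 then 0 else Suc 1"]])
        (rule arg_cong[of _ _ Q], auto)
    then show "Dp A (\<lambda>e. Sc (e 0) (e 1) (\<lambda>i. e (Suc (Suc i))))" unfolding Sc_def
      by (intro D_conj D_le D_exn tmv A(2))
    show "r x \<le> r y" if "Sc y x u" for y x u using that by (simp add: Sc_def)
    show "Sc z x u" if "Sc y x u" "z \<in> U" "r x \<le> r z" "r z \<le> r y" for y x u z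
      using that order_trans by (auto simp: Sc_def)
    have "q w x (\<lambda>i. u (min i N)) = q w x u" for w x u
      unfolding q_def by (rule arg_cong[of _ _ Q]) (auto simp: fun_eq_iff dest!: N simp: min_absorb1)
    then show "Sc y x (\<lambda>i. u (min i N)) = Sc y x u" for y x u by (simp add: Sc_def)
  qed
  define v where "v = (\<lambda>i. u (min i N))"
  have "u \<in> AS" using ru B by (auto simp: asg_def)
  then have v: "v \<in> Tup N" unfolding v_def by (rule Tup_trunc)
  have Scv: "Sc y x v = Sc y x u" for y unfolding v_def by (rule Sc_tr)
  have "hyp x v" unfolding hyp_def Scv
  proof (intro conjI ballI allI impI)
    have "A \<union> range v \<subseteq> B" using ru B by (auto simp: v_def)
    then show "free (A \<union> range v) x" using free_mono x B by blast
    have "w \<in> U" using w x E_U by (auto simp: Einf_def)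
    then show "\<exists>w. Einf x w \<and> r x < r w \<and> Sc w x u" using ScG w by auto
    show "H k x y" if "y \<in> U" "Sc y x u" for y k using ScG bd that by blast
  qed (fact x)
  then show False using tame v by blast
qed

text \<open>Here \<gamma> would pin down \<open>z\<close> although \<beta> does not. Moving
  \<open>z\<close> over \<beta> and \<open>B\<close> to level \<open>J + k\<close> but no closer
  moves \<gamma> inside the \<open>Einf\<close>-class of \<beta>, where by \<open>no_segment\<close>
  nothing definable over \<beta>, \<open>z\<close> and \<open>B\<close> has an end. So
  \<open>R2\<close> makes two images of \<gamma> conjugate over these parameters, and a composed
  automorphism fixing \<gamma> would still move \<open>z\<close> too far.\<close>

lemma drag:
  assumes B: "finite B" "A \<subseteq> B" "B \<subseteq> U" and P: "P \<beta>" "P z" and fb: "free (insert z B) \<beta>"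
    and g: "Einf \<beta> \<gamma>" "r \<beta> < r \<gamma>"
    and c: "\<not> closed (insert \<beta> B) z" "closed (insert \<gamma> (insert \<beta> B)) z"
  shows False
proof -
  have U: "\<beta> \<in> U" "z \<in> U" "\<gamma> \<in> U" using P P_U g E_U by (auto simp: Einf_def)
  define D where "D = insert \<beta> B"
  have D: "finite D" "A \<subseteq> D" "D \<subseteq> U" "\<beta> \<in> D" using B U by (auto simp: D_def)
  define C where "C = insert \<beta> (insert z B)"
  have C: "finite C" "A \<subseteq> C" "C \<subseteq> U" "D \<subseteq> C" "z \<in> C" "\<beta> \<in> C" using B U by (auto simp: C_def D_def)
  obtain J where J: "\<And>y. E J z y \<Longrightarrow> eqv D z y"
    using free_or_closed[OF D(1-3) P(2)] c by (auto simp: D_def free_def)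
  have "\<exists>\<sigma>\<in>Au D. E (J + k) z (\<sigma> z) \<and> \<not> E (Suc (J + k)) z (\<sigma> z)" for k
  proof -
    obtain y where y: "E (J + k) z y" "\<not> E (Suc (J + k)) z y" using E_up P(2) by blast
    have "eqv D z y" using J E_mono[OF _ P(2) y(1), of J] by simp
    then obtain \<sigma> where "\<sigma> \<in> Au D" "\<sigma> z = y" using eqv_iff D by blast
    then show ?thesis using y by (intro bexI[of _ \<sigma>]) simp_all
  qed
  then obtain \<sigma> where \<sigma>: "\<And>k. \<sigma> k \<in> Au D" "\<And>k. E (J + k) z (\<sigma> k z)" "\<And>k. \<not> E (Suc (J + k)) z (\<sigma> k z)"
    by metis
  define h where "h = (\<lambda>k. \<sigma> k \<gamma>)"
  have h: "h k \<in> U" "Einf \<beta> (h k)" "r \<beta> < r (h k)" for k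
  proof -
    have f: "\<sigma> k \<beta> = \<beta>" using \<sigma>(1)[of k] D by (simp add: Au_def)
    show "h k \<in> U" using \<sigma>(1)[of k] U by (simp add: h_def)
    show "Einf \<beta> (h k)" using g E_Au[OF \<sigma>(1)[of k] D(2) U(1,3)] f by (simp add: Einf_def h_def)
    show "r \<beta> < r (h k)" using g Au_lt[OF \<sigma>(1)[of k] U(1,3)] f by (simp add: h_def)
  qed
  \<comment> \<open>A convex set separating two points of the class above \<beta> has an end between
    them, and the points below that end form a segment of the kind excluded by
    \<open>no_segment\<close>.\<close>
  have nocut: "X g1 = X g2" if X: "Dp C (\<lambda>e. X (e 0))" "cvx X"
    and 1: "g1 \<in> U" "Einf \<beta> g1" "r \<beta> < r g1" and 2: "g2 \<in> U" "Einf \<beta> g2" and 12: "r g1 < r g2" for X g1 g2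
  proof (rule ccontr)
    assume ne: "X g1 \<noteq> X g2"
    have B': "finite (insert z B)" "A \<subseteq> insert z B" "insert z B \<subseteq> U" "insert z B \<noteq> {}" using B U by auto
    have bd: "H k \<beta> y" if "r \<beta> \<le> r y" "r y \<le> r g2" for k y
      using that 2 by (auto simp: H_def Einf_def)
    show False
    proof (cases "X g1")
      case True
      have up: "r w < r g2" if "w \<in> U" "X w" for w
        using cvxD[OF X(2) True that(2) 1(1) that(1) 2(1)] 12 ne True by force
      show False
      proof (rule no_segment[OF B' P(1) fb, of "\<lambda>y. \<exists>w\<in>U. X w \<and> r y \<le> r w" g1])
        show "Dp (insert \<beta> (insert z B)) (\<lambda>e. \<exists>w\<in>U. X w \<and> r (e 0) \<le> r w)"
          by (fold C_def) (intro Dintros D1[OF X(1)] C)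
        show "\<exists>w\<in>U. X w \<and> r y' \<le> r w" if "\<exists>w\<in>U. X w \<and> r y \<le> r w" "r y' \<le> r y" for y y'
          using that order_trans by blast
        show "H k \<beta> y" if "\<exists>w\<in>U. X w \<and> r y \<le> r w" "r \<beta> \<le> r y" for y k
          using that bd up by force
        show "\<exists>w\<in>U. X w \<and> r g1 \<le> r w" using 1 True by auto
      qed (use 1 in auto)
    next
      case False
      then have X2: "X g2" using ne by blast
      have lo: "r g1 < r w" if "w \<in> U" "X w" for w
        using cvxD[OF X(2) that(2) X2 that(1) 2(1) 1(1)] 12 False by force
      show False
      proof (rule no_segment[OF B' P(1) fb, of "\<lambda>y. \<forall>w\<in>U. X w \<longrightarrow> r y < r w" g1])
        show "Dp (insert \<beta> (insert z B)) (\<lambda>e. \<forall>w\<in>U. X w \<longrightarrow> r (e 0) < r w)"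
          by (fold C_def) (intro Dintros D1[OF X(1)] C)
        show "\<forall>w\<in>U. X w \<longrightarrow> r y' < r w" if "\<forall>w\<in>U. X w \<longrightarrow> r y < r w" "r y' \<le> r y" for y y'
          using that order_le_less_trans by blast
        show "H k \<beta> y" if "\<forall>w\<in>U. X w \<longrightarrow> r y < r w" "r \<beta> \<le> r y" for y k
          using that bd X2 2 by (simp add: less_imp_le)
        show "\<forall>w\<in>U. X w \<longrightarrow> r g1 < r w" using lo by blast
      qed (use 1 in auto)
    qed
  qed
  have "\<exists>k\<in>UNIV. \<exists>l\<in>UNIV. k < l \<and> eqv C (h k) (h l)"
  proof (rule R2[OF C(1,3) U(3)])
    show "range h \<subseteq> U" using h by auto
    fix X j assume X: "Dp C (\<lambda>e. X (e 0))" "cvx X"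
    consider "r \<gamma> < r (h j)" | "r (h j) < r \<gamma>" | "\<gamma> = h j" using r_eq[OF U(3) h(1)[of j]] by linarith
    then show "X \<gamma> = X (h j)"
      using nocut[OF X U(3) g h(1,2)] nocut[OF X h(1,2,3) U(3) g(1)] by cases auto
  qed simp
  then obtain k l where kl: "k < l" "eqv C (h k) (h l)" by blast
  obtain \<rho> where \<rho>: "\<rho> \<in> Au C" "\<rho> (h k) = h l" using kl eqv_iff C by blast
  obtain \<tau> where \<tau>: "\<tau> \<in> Au D" "\<And>a. a \<in> U \<Longrightarrow> \<tau> (\<sigma> l a) = a" "\<And>a. a \<in> U \<Longrightarrow> \<sigma> l (\<tau> a) = a"
    using Au_inv[OF \<sigma>(1) D(3)] by blast
  \<comment> \<open>\<open>\<psi>\<close> fixes \<gamma> because \<rho> takes \<open>h k\<close> to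
    \<open>h l\<close>, so closedness bounds its effect on \<open>z\<close>. As \<rho> fixes
    \<open>z\<close> and \<open>\<sigma> l\<close> moves it only within a finer level, the bound
    passes to \<open>\<sigma> k\<close>.\<close>
  define \<psi> where "\<psi> = \<tau> \<circ> (\<rho> \<circ> \<sigma> k)"
  have "\<psi> \<in> Au D" unfolding \<psi>_def by (intro Au_comp \<tau>(1) Au_mono[OF \<rho>(1) C(4)] \<sigma>(1))
  moreover have "\<psi> \<gamma> = \<gamma>" using \<rho>(2) \<tau>(2)[OF U(3)] by (simp add: \<psi>_def h_def)
  ultimately have "\<psi> \<in> Au (insert \<gamma> D)" by (rule Au_insert)
  moreover have gD: "finite (insert \<gamma> D)" "insert \<gamma> D \<subseteq> U" using D U by auto
  ultimately have "eqv (insert \<gamma> D) z (\<psi> z)" using eqv_Au U by blast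
  then have cz: "E (Suc (J + k)) z (\<psi> z)" using c(2) by (auto simp: closed_def D_def)
  have sk: "\<sigma> k z \<in> U" "\<rho> (\<sigma> k z) \<in> U" "\<psi> z \<in> U" using \<sigma>(1)[of k] \<rho>(1) \<tau>(1) U by (auto simp: \<psi>_def)
  have "E (Suc (J + k)) (\<sigma> l z) (\<rho> (\<sigma> k z))"
    using E_Au[OF \<sigma>(1)[of l] D(2) U(2) sk(3)] cz \<tau>(3)[OF sk(2)] by (simp add: \<psi>_def)
  moreover have "E (Suc (J + k)) z (\<sigma> l z)" using E_mono[OF _ P(2) \<sigma>(2)[of l], of "Suc (J + k)"] kl by simp
  ultimately have "E (Suc (J + k)) z (\<rho> (\<sigma> k z))" using E_trans P by blast
  moreover have "\<rho> z = z" using \<rho>(1) C by (simp add: Au_def)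
  ultimately have "E (Suc (J + k)) z (\<sigma> k z)" using E_Au[OF \<rho>(1) C(2) U(2) sk(1), of "Suc (J + k)"] by simp
  then show False using \<sigma>(3) by blast
qed

end

section \<open>Ramsey and indiscernible pairs\<close>

lemma cyc_map: "zs \<noteq> [] \<Longrightarrow> cyc (map e zs) = (\<lambda>i. e (cyc zs i))"
  by (simp add: cyc_def)

lemma concat_pairs_cong:
  "map \<sigma> (concat (map (\<lambda>q. [x q, y q]) qs)) = concat (map (\<lambda>q. [x' q, y' q]) qs) \<Longrightarrow>
    q \<in> set qs \<Longrightarrow> \<sigma> (x q) = x' q \<and> \<sigma> (y q) = y' q"
  by (induction qs) auto

lemma sorted_list_of_set_image:
  fixes h :: "'a::linorder \<Rightarrow> 'b::linorder"
  assumes "finite F" "strict_mono_on F h"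
  shows "sorted_list_of_set (h ` F) = map h (sorted_list_of_set F)"
proof -
  have "sorted_wrt (<) (map h (sorted_list_of_set F))"
    unfolding sorted_wrt_map
    by (rule sorted_wrt_mono_rel[OF _ strict_sorted_list_of_set[of F]])
      (use assms in \<open>auto dest: strict_mono_onD\<close>)
  then show ?thesis
    using assms(1) sorted_list_of_set.idem_if_sorted_distinct[of "map h (sorted_list_of_set F)"]
    by (metis list.set_map set_sorted_list_of_set strict_sorted_iff)
qed

definition homog :: "nat set \<Rightarrow> (nat set \<Rightarrow> bool) \<Rightarrow> nat \<Rightarrow> bool" where
  "homog Y \<Theta> n \<longleftrightarrow> (\<forall>X X'. X \<subseteq> Y \<longrightarrow> X' \<subseteq> Y \<longrightarrow> finite X \<longrightarrow> finite X' \<longrightarrow> card X = n \<longrightarrow> card X' = n \<longrightarrow> \<Theta> X = \<Theta> X')"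

lemma homogD: "homog Y \<Theta> n \<Longrightarrow> X \<subseteq> Y \<Longrightarrow> X' \<subseteq> Y \<Longrightarrow> finite X \<Longrightarrow> finite X' \<Longrightarrow> card X = n \<Longrightarrow> card X' = n \<Longrightarrow> \<Theta> X = \<Theta> X'"
  unfolding homog_def by (elim allE[of _ X] allE[of _ X']) simp

lemma homog_mono: "homog Y \<Theta> n \<Longrightarrow> Z \<subseteq> Y \<Longrightarrow> homog Z \<Theta> n"
  unfolding homog_def[of Z] by (intro allI impI) (rule homogD, assumption, auto)

text \<open>The infinite set is thinned once for every colouring; homogeneity survives further
  thinning.\<close>

lemma ramsey_family:
  assumes "finite C" "infinite Y"
  shows "\<exists>Z\<subseteq>Y. infinite Z \<and> (\<forall>p\<in>C. homog Z (fst p) (snd p))"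
  using assms(1)
proof (induction C rule: finite_induct)
  case empty then show ?case using assms(2) by auto
next
  case (insert p C)
  then obtain Y' where Y: "Y' \<subseteq> Y" "infinite Y'" "\<forall>p\<in>C. homog Y' (fst p) (snd p)" by blast
  define \<chi> where "\<chi> = (\<lambda>X. if fst p X then 1 else (0::nat))"
  have "\<exists>Z t. Z \<subseteq> Y' \<and> infinite Z \<and> t < 2 \<and> (\<forall>X. X \<subseteq> Z \<and> finite X \<and> card X = snd p \<longrightarrow> \<chi> X = t)"
    by (rule Ramsey[OF Y(2)]) (simp add: \<chi>_def)
  then obtain Z t where Z: "Z \<subseteq> Y'" "infinite Z" and
    Z3: "\<forall>X. X \<subseteq> Z \<and> finite X \<and> card X = snd p \<longrightarrow> \<chi> X = t" by blast
  have "homog Z (fst p) (snd p)" unfolding homog_def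
  proof (intro allI impI)
    fix X X' assume "X \<subseteq> Z" "X' \<subseteq> Z" "finite X" "finite X'" "card X = snd p" "card X' = snd p"
    then have "\<chi> X = t" "\<chi> X' = t" using Z3 by simp_all
    then show "fst p X = fst p X'" by (auto simp: \<chi>_def split: if_splits)
  qed
  moreover have "\<forall>p\<in>C. homog Z (fst p) (snd p)" using Y(3) homog_mono Z(1) by blast
  ultimately show ?case using Z Y by (intro exI[of _ Z]) auto
qed

context chain
begin

text \<open>The balls decrease and each contains points to the right of \<open>z\<close>; saturation
  gives one point in all of them.\<close>

lemma Einf_above:
  assumes "P z" shows "\<exists>w. Einf z w \<and> r z < r w"
proof -
  have zU: "z \<in> U" using assms P_U by blast
  define B where "B = insert z A"
  have B: "finite B" "A \<subseteq> B" "B \<subseteq> U" "z \<in> B" using A zU by (auto simp: B_def)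
  define G where "G = (\<lambda>k (e::nat \<Rightarrow> 'a). E k z (e 0) \<and> r z < r (e 0))"
  have "\<exists>a\<in>U. \<forall>Q\<in>range G. Q (\<lambda>_. a)"
  proof (rule D_sat[OF B(1,3)])
    have "Dp B (G k)" for k unfolding G_def by (intro Dintros E_D' B(2,3) tmc B(4))
    then show "Dp B Q" if "Q \<in> range G" for Q using that by blast
    fix S assume "S \<subseteq> range G" "finite S"
    then obtain K where K: "finite K" "S = G ` K" using finite_subset_image[of S G UNIV] by auto
    define m where "m = Max (insert 0 K)"
    have m: "k \<le> m" if "k \<in> K" for k using K that by (auto simp: m_def)
    obtain w where w: "r z < r w" "E m z w" using E_up assms by blast
    have "G k (\<lambda>_. w)" if "k \<in> K" for k unfolding G_def using w E_mono[OF m[OF that] assms] by blast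
    then show "\<exists>a\<in>U. \<forall>Q\<in>S. Q (\<lambda>_. a)" using K w E_U[OF assms] by (intro bexI[of _ w]) auto
  qed
  then obtain a where a: "a \<in> U" "\<forall>Q\<in>range G. Q (\<lambda>_. a)" by (rule bexE)
  have "G k (\<lambda>_. a)" for k using bspec[OF a(2), of "G k"] by simp
  then show ?thesis unfolding G_def Einf_def by blast
qed

text \<open>The companion \<open>y q\<close> is the second point by which the class of
  \<open>x q\<close> is recognized in a submodel.\<close>

definition base :: "rat set \<Rightarrow> (rat \<Rightarrow> 'a) \<Rightarrow> (rat \<Rightarrow> 'a) \<Rightarrow> bool" where
  "base R x y \<longleftrightarrow> (\<forall>q\<in>R. P (x q) \<and> Einf (x q) (y q) \<and> r (x q) < r (y q)) \<and>
     (\<forall>q\<in>R. \<forall>q'\<in>R. q < q' \<longrightarrow> r (x q) < r (x q') \<and> \<not> E 0 (x q) (x q'))"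

definition word :: "(rat \<Rightarrow> 'b) \<Rightarrow> (rat \<Rightarrow> 'b) \<Rightarrow> rat set \<Rightarrow> 'b list" where
  "word x y S = concat (map (\<lambda>q. [x q, y q]) (sorted_list_of_set S))"

lemma word_ne: "finite S \<Longrightarrow> S \<noteq> {} \<Longrightarrow> word x y S \<noteq> []"
  by (simp add: word_def)

lemma word_set: "finite S \<Longrightarrow> set (word x y S) = x ` S \<union> y ` S"
  by (auto simp: word_def)

lemma word_map: "map e (word x y S) = word (\<lambda>q. e (x q)) (\<lambda>q. e (y q)) S"
  by (simp add: word_def map_concat comp_def)

text \<open>An increasing sequence of points in distinct \<open>E 0\<close>-classes, with
  companions, is thinned by Ramsey; the finite set \<open>R\<close> is embedded into the thinned
  index set by counting predecessors.\<close>

lemma finite_indisc: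
  fixes C :: "((nat \<Rightarrow> 'a) \<Rightarrow> bool) set"
  assumes R: "finite R" and C: "finite C"
  shows "\<exists>x y. base R x y \<and> range x \<subseteq> U \<and> range y \<subseteq> U \<and> (\<forall>\<Theta>\<in>C. \<forall>S S'. S \<subseteq> R \<and> S' \<subseteq> R \<and> card S = card S' \<longrightarrow>
    \<Theta> (cyc (word x y S)) = \<Theta> (cyc (word x y S')))"
proof -
  have "\<exists>c. \<forall>n::nat. P (c n) \<and> (r (c n) < r (c (Suc n)) \<and> \<not> E 0 (c n) (c (Suc n)))"
  proof (rule dependent_nat_choice)
    show "\<exists>x. P x" using p0 by (intro exI[of _ p0]) simp
    show "\<exists>y. P y \<and> r x < r y \<and> \<not> E 0 x y" if "P x" for x using out_up[OF that] by blast
  qed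
  then obtain c where c: "\<And>n. P (c n)" "\<And>n. r (c n) < r (c (Suc n))" "\<And>n. \<not> E 0 (c n) (c (Suc n))"
    by blast
  note cs = chain_strict[where c = c, OF c]
  obtain w where w: "\<And>n. Einf (c n) (w n)" "\<And>n. r (c n) < r (w n)" using Einf_above[OF c(1)] by metis
  define nw where "nw = (\<lambda>X. concat (map (\<lambda>n. [c n, w n]) (sorted_list_of_set X)))"
  define C' where "C' = (\<lambda>(\<Theta>, n). ((\<lambda>X. \<Theta> (cyc (nw X))), n)) ` (C \<times> {..card R})"
  have "finite C'" using C by (simp add: C'_def)
  then obtain Y where Y: "infinite Y" "\<And>p. p \<in> C' \<Longrightarrow> homog Y (fst p) (snd p)"
    using ramsey_family[of C' "UNIV :: nat set"] by auto
  define g where "g = (\<lambda>q. enumerate Y (card {q'\<in>R. q' < q}))"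
  have g: "g q < g q'" if "q \<in> R" "q < q'" for q q'
  proof -
    have "card {p\<in>R. p < q} < card {p\<in>R. p < q'}" using R that by (intro psubset_card_mono) auto
    then show ?thesis using enumerate_mono[OF _ Y(1)] by (simp add: g_def)
  qed
  have gY: "g q \<in> Y" for q using enumerate_in_set[OF Y(1)] by (simp add: g_def)
  define x where "x = (\<lambda>q. c (g q))"
  define y where "y = (\<lambda>q. w (g q))"
  have "base R x y" using c(1) w g cs by (simp add: base_def x_def y_def)
  moreover have "w n \<in> U" for n using w(1)[of n] E_U[OF c(1)[of n]] by (auto simp: Einf_def)
  then have "range x \<subseteq> U" "range y \<subseteq> U" using c(1) P_U by (auto simp: x_def y_def)
  moreover have "\<Theta> (cyc (word x y S)) = \<Theta> (cyc (word x y S'))"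
    if h: "\<Theta> \<in> C" "S \<subseteq> R" "S' \<subseteq> R" "card S = card S'" for \<Theta> S S'
  proof -
    have wn: "word x y S = nw (g ` S)" "card (g ` S) = card S" "finite S" "g ` S \<subseteq> Y" if "S \<subseteq> R" for S
    proof -
      show "finite S" using R that finite_subset by blast
      have sm: "strict_mono_on S g" using g that by (auto intro!: strict_mono_onI)
      show "word x y S = nw (g ` S)"
        unfolding word_def nw_def sorted_list_of_set_image[OF \<open>finite S\<close> sm] by (simp add: x_def y_def comp_def)
      show "card (g ` S) = card S" using sm strict_mono_on_imp_inj_on card_image by blast
      show "g ` S \<subseteq> Y" using gY by auto
    qed
    have "card S \<le> card R" using R h card_mono by blast
    then have "((\<lambda>X. \<Theta> (cyc (nw X))), card S) \<in> C'" using h by (auto simp: C'_def)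
    from Y(2)[OF this] have "homog Y (\<lambda>X. \<Theta> (cyc (nw X))) (card S)" by simp
    then have "\<Theta> (cyc (nw (g ` S))) = \<Theta> (cyc (nw (g ` S')))"
      using homogD[of Y "\<lambda>X. \<Theta> (cyc (nw X))" "card S" "g ` S" "g ` S'"] wn[OF h(2)] wn[OF h(3)] h(4) by simp
    then show ?thesis using wn[OF h(2)] wn[OF h(3)] by simp
  qed
  ultimately show ?thesis by blast
qed

text \<open>Compactness glues the finite approximations: \<open>x q\<close> and \<open>y q\<close>
  occupy the even and the odd variable belonging to the code of \<open>q\<close>. Equality of the
  types of index sets of equal size becomes, by homogeneity, an automorphism realizing a given
  finite increasing map of indices.\<close>

lemma indiscernibles:
  "\<exists>x y. base UNIV x y \<and> (\<forall>F h. finite F \<longrightarrow> strict_mono_on F h \<longrightarrow>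
     (\<exists>\<sigma>\<in>Au A. \<forall>q\<in>F. \<sigma> (x q) = x (h q) \<and> \<sigma> (y q) = y (h q)))"
proof -
  define vx where "vx = (\<lambda>q::rat. 2 * to_nat q)"
  define vy where "vy = (\<lambda>q::rat. Suc (2 * to_nat q))"
  define B1 where "B1 = (\<lambda>D q (e::nat \<Rightarrow> 'a). D (e (vx q)) :: bool)"
  define B2 where "B2 = (\<lambda>k q (e::nat \<Rightarrow> 'a). E k (e (vx q)) (e (vy q)) \<and> r (e (vx q)) < r (e (vy q)))"
  define B3 where "B3 = (\<lambda>q q' (e::nat \<Rightarrow> 'a). r (e (vx q)) < r (e (vx q')) \<and> \<not> E 0 (e (vx q)) (e (vx q')))"
  define B4 where "B4 = (\<lambda>\<Theta> S S' (e::nat \<Rightarrow> 'a). \<Theta> (cyc (map e (word vx vy S))) = (\<Theta> (cyc (map e (word vx vy S'))) :: bool))"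
  define G1 where "G1 = (\<lambda>R. {B1 D q |D q. q \<in> R \<and> Dp A (\<lambda>e. D (e 0)) \<and> D p0})"
  define G2 where "G2 = (\<lambda>R. {B2 k q |k q. q \<in> R})"
  define G3 where "G3 = (\<lambda>R. {B3 q q' |q q'. q \<in> R \<and> q' \<in> R \<and> q < q'})"
  define G4 where "G4 = (\<lambda>R. {B4 \<Theta> S S' |\<Theta> S S'. Dp A \<Theta> \<and> S \<subseteq> R \<and> S' \<subseteq> R \<and> card S = card S' \<and> finite S \<and> finite S' \<and> S \<noteq> {} \<and> S' \<noteq> {}})"
  define GG where "GG = (\<lambda>R. G1 R \<union> G2 R \<union> G3 R \<union> G4 R)"
  have mono: "GG R \<subseteq> GG R'" if "R \<subseteq> R'" for R R'
  proof -
    have "G1 R \<subseteq> G1 R'" "G2 R \<subseteq> G2 R'" "G3 R \<subseteq> G3 R'" using that unfolding G1_def G2_def G3_def by blast+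
    moreover have "G4 R \<subseteq> G4 R'"
    proof
      fix Q assume "Q \<in> G4 R"
      then obtain \<Theta> S S' where s: "Q = B4 \<Theta> S S'" "Dp A \<Theta>" "S \<subseteq> R" "S' \<subseteq> R" "card S = card S'"
        "finite S" "finite S'" "S \<noteq> {}" "S' \<noteq> {}" unfolding G4_def by auto
      then have "S \<subseteq> R'" "S' \<subseteq> R'" using that by auto
      then show "Q \<in> G4 R'" using s unfolding G4_def by blast
    qed
    ultimately show ?thesis unfolding GG_def by blast
  qed
  have loc: "\<exists>R. finite R \<and> Q \<in> GG R" if Q: "Q \<in> GG UNIV" for Q
  proof -
    consider "Q \<in> G1 UNIV" | "Q \<in> G2 UNIV" | "Q \<in> G3 UNIV" | "Q \<in> G4 UNIV" using Q unfolding GG_def by blast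
    then show ?thesis
    proof cases
      case 1
      then obtain D q where "Q = B1 D q" "Dp A (\<lambda>e. D (e 0))" "D p0" unfolding G1_def by auto
      then have "Q \<in> G1 {q}" unfolding G1_def by blast
      then show ?thesis unfolding GG_def by (intro exI[of _ "{q}"]) auto
    next
      case 2
      then obtain k q where "Q = B2 k q" unfolding G2_def by auto
      then have "Q \<in> G2 {q}" unfolding G2_def by blast
      then show ?thesis unfolding GG_def by (intro exI[of _ "{q}"]) auto
    next
      case 3
      then obtain q q' where "Q = B3 q q'" "q < q'" unfolding G3_def by auto
      then have "Q \<in> G3 {q, q'}" unfolding G3_def by blast
      then show ?thesis unfolding GG_def by (intro exI[of _ "{q, q'}"]) auto
    next
      case 4
      then obtain \<Theta> S S' where s: "Q = B4 \<Theta> S S'" "Dp A \<Theta>" "card S = card S'" "finite S" "finite S'" "S \<noteq> {}" "S' \<noteq> {}"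
        unfolding G4_def by auto
      then have "Q \<in> G4 (S \<union> S')" unfolding G4_def by blast
      then show ?thesis unfolding GG_def using s by (intro exI[of _ "S \<union> S'"]) auto
    qed
  qed
  have "\<exists>e\<in>AS. \<forall>Q\<in>GG UNIV. Q e"
  proof (rule omega_sat[OF A])
    fix Q assume "Q \<in> GG UNIV"
    then consider "Q \<in> G1 UNIV" | "Q \<in> G2 UNIV" | "Q \<in> G3 UNIV" | "Q \<in> G4 UNIV" unfolding GG_def by blast
    then show "Dp A Q"
    proof cases
      case 1
      then obtain D q where "Q = B1 D q" "Dp A (\<lambda>e. D (e 0))" unfolding G1_def by auto
      then show ?thesis using D1[of A D "\<lambda>e. e (vx q)"] tmv by (simp add: B1_def)
    next
      case 2
      then obtain k q where "Q = B2 k q" unfolding G2_def by auto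
      then show ?thesis unfolding B2_def by (simp only:) (intro Dintros E_D' A(2) subset_refl)
    next
      case 3
      then obtain q q' where "Q = B3 q q'" unfolding G3_def by auto
      then show ?thesis unfolding B3_def by (simp only:) (intro Dintros E_D' A(2) subset_refl)
    next
      case 4
      then obtain \<Theta> S S' where s: "Q = B4 \<Theta> S S'" "Dp A \<Theta>" "finite S" "finite S'" "S \<noteq> {}" "S' \<noteq> {}"
        unfolding G4_def by auto
      show ?thesis unfolding s(1) B4_def cyc_map[OF word_ne[OF s(3,5)]] cyc_map[OF word_ne[OF s(4,6)]]
        by (rule D_iff[OF D_ren[OF s(2)] D_ren[OF s(2)]])
    qed
  next
    fix G assume G: "G \<subseteq> GG UNIV" "finite G"
    have "\<forall>Q\<in>G. \<exists>R. finite R \<and> Q \<in> GG R" using G(1) loc by blast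
    then obtain \<rho> where \<rho>: "\<And>Q. Q \<in> G \<Longrightarrow> finite (\<rho> Q)" "\<And>Q. Q \<in> G \<Longrightarrow> Q \<in> GG (\<rho> Q)" by metis
    define R where "R = \<Union>(\<rho> ` G)"
    have R: "finite R" using G(2) \<rho>(1) by (simp add: R_def)
    have GR: "Q \<in> GG R" if "Q \<in> G" for Q
    proof -
      have "\<rho> Q \<subseteq> R" using that by (auto simp: R_def)
      from mono[OF this] \<rho>(2)[OF that] show ?thesis by blast
    qed
    \<comment> \<open>One predicate is chosen for each indiscernibility condition in
      \<open>G\<close>, so that only finitely many colourings go into Ramsey.\<close>
    define is4 where "is4 = (\<lambda>Q \<theta>. \<exists>S S'. Q = B4 \<theta> S S' \<and> S \<subseteq> R \<and> S' \<subseteq> R \<and> card S = card S')"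
    have "\<exists>\<theta>. Q \<in> G4 R \<longrightarrow> is4 Q \<theta>" for Q unfolding G4_def is4_def by blast
    then obtain \<Theta> where \<Theta>: "\<And>Q. Q \<in> G4 R \<Longrightarrow> is4 Q (\<Theta> Q)" by metis
    have "finite (\<Theta> ` G)" using G(2) by simp
    from finite_indisc[OF R this] obtain x y where xy: "base R x y" "range x \<subseteq> U" "range y \<subseteq> U"
      "\<forall>\<theta>\<in>\<Theta> ` G. \<forall>S S'. S \<subseteq> R \<and> S' \<subseteq> R \<and> card S = card S' \<longrightarrow>
         \<theta> (cyc (word x y S)) = \<theta> (cyc (word x y S'))" by (elim exE conjE)
    define e where "e = (\<lambda>n. if even n then x (from_nat (n div 2)) else y (from_nat (n div 2)))"
    have ev: "e (vx q) = x q" "e (vy q) = y q" for q by (simp_all add: e_def vx_def vy_def)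
    have "e \<in> AS" using xy(2,3) by (auto simp: e_def asg_def)
    moreover have "Q e" if Q: "Q \<in> G" for Q
    proof -
      consider "Q \<in> G1 R" | "Q \<in> G2 R" | "Q \<in> G3 R" | "Q \<in> G4 R" using GR[OF Q] unfolding GG_def by blast
      then show ?thesis
      proof cases
        case 1
        then obtain D q where q: "Q = B1 D q" "q \<in> R" "Dp A (\<lambda>e. D (e 0))" "D p0" unfolding G1_def by auto
        then have "D (x q)" using xy(1) eqv_1[of A p0 "x q" D] by (simp add: base_def)
        then show ?thesis using q ev by (simp add: B1_def)
      next
        case 2
        then obtain k q where "Q = B2 k q" "q \<in> R" unfolding G2_def by auto
        then show ?thesis using xy(1) ev by (simp add: B2_def base_def Einf_def)
      next
        case 3
        then obtain q q' where "Q = B3 q q'" "q \<in> R" "q' \<in> R" "q < q'" unfolding G3_def by auto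
        then show ?thesis using xy(1) ev by (simp add: B3_def base_def)
      next
        case 4
        then obtain S S' where s: "Q = B4 (\<Theta> Q) S S'" "S \<subseteq> R" "S' \<subseteq> R" "card S = card S'"
          using \<Theta>[OF 4] unfolding is4_def by (elim exE conjE)
        have h: "\<forall>S S'. S \<subseteq> R \<and> S' \<subseteq> R \<and> card S = card S' \<longrightarrow>
          \<Theta> Q (cyc (word x y S)) = \<Theta> Q (cyc (word x y S'))" by (rule bspec[OF xy(4) imageI[OF Q]])
        have "B4 (\<Theta> Q) S S' e" unfolding B4_def word_map ev
          by (rule mp[OF spec[OF spec[OF h]]]) (intro conjI s(2-4))
        then show ?thesis by (rule subst[OF s(1)[symmetric], of "\<lambda>Q. Q e"])
      qed
    qed
    ultimately show "\<exists>e\<in>AS. \<forall>Q\<in>G. Q e" by (intro bexI[of _ e] ballI)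
  qed
  then obtain e where e: "e \<in> AS" "\<forall>Q\<in>GG UNIV. Q e" by (rule bexE)
  define x where "x = (\<lambda>q. e (vx q))"
  define y where "y = (\<lambda>q. e (vy q))"
  have U: "x q \<in> U" "y q \<in> U" for q using asgD[OF e(1)] by (simp_all add: x_def y_def)
  have "P (x q)" for q
    unfolding eqv_def
  proof (intro conjI allI impI p0 U)
    have one: "D (\<lambda>_. x q)" if D: "Dp A D" "D (\<lambda>_. p0)" for D
    proof -
      have "Dp A (\<lambda>e. D (\<lambda>_. e 0))" by (rule D_ren[OF D(1)])
      then have "B1 (\<lambda>a. D (\<lambda>_. a)) q \<in> G1 UNIV" using D(2) unfolding G1_def by blast
      then have "B1 (\<lambda>a. D (\<lambda>_. a)) q e" using e(2) unfolding GG_def by blast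
      then show ?thesis by (simp add: B1_def x_def)
    qed
    show "D (\<lambda>_. p0) = D (\<lambda>_. x q)" if "Dp A D" for D using one[OF that] one[OF D_neg[OF that]] by blast
  qed
  moreover have "E k (x q) (y q) \<and> r (x q) < r (y q)" for k q
  proof -
    have "B2 k q \<in> G2 UNIV" unfolding G2_def by blast
    then have "B2 k q e" using e(2) unfolding GG_def by blast
    then show ?thesis by (simp add: B2_def x_def y_def)
  qed
  moreover have "r (x q) < r (x q') \<and> \<not> E 0 (x q) (x q')" if "q < q'" for q q'
  proof -
    have "B3 q q' \<in> G3 UNIV" using that unfolding G3_def by blast
    then have "B3 q q' e" using e(2) unfolding GG_def by blast
    then show ?thesis by (simp add: B3_def x_def)
  qed
  ultimately have "base UNIV x y" by (simp add: base_def Einf_def)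
  moreover have "\<exists>\<sigma>\<in>Au A. \<forall>q\<in>F. \<sigma> (x q) = x (h q) \<and> \<sigma> (y q) = y (h q)"
    if F: "finite F" "strict_mono_on F h" for F h
  proof (cases "F = {}")
    case True then show ?thesis using Au_id by blast
  next
    case False
    have w: "word x y (h ` F) = concat (map (\<lambda>q. [x (h q), y (h q)]) (sorted_list_of_set F))"
      unfolding word_def sorted_list_of_set_image[OF F] by (simp add: comp_def)
    have c: "card F = card (h ` F)" using F strict_mono_on_imp_inj_on card_image by fastforce
    have "same A (word x y F) (word x y (h ` F))"
      unfolding same_def
    proof (intro conjI allI impI)
      show "length (word x y F) = length (word x y (h ` F))" unfolding w by (simp add: word_def length_concat comp_def)
      show "word x y F \<noteq> []" using word_ne F False by blast
      show "set (word x y F) \<subseteq> U" "set (word x y (h ` F)) \<subseteq> U" using U F by (auto simp: word_set)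
      fix \<theta> assume "Dp A \<theta>"
      then have "B4 \<theta> F (h ` F) \<in> G4 UNIV" using F False c unfolding G4_def by blast
      then have "B4 \<theta> F (h ` F) e" using e(2) unfolding GG_def by blast
      then show "\<theta> (cyc (word x y F)) = \<theta> (cyc (word x y (h ` F)))"
        unfolding B4_def word_map by (simp add: x_def y_def)
    qed
    then obtain \<sigma> where \<sigma>: "\<sigma> \<in> Au A" "map \<sigma> (word x y F) = word x y (h ` F)" using same_homog[OF A] by blast
    have "map \<sigma> (concat (map (\<lambda>q. [x q, y q]) (sorted_list_of_set F))) =
      concat (map (\<lambda>q. [x (h q), y (h q)]) (sorted_list_of_set F))"
      using \<sigma>(2) unfolding w by (simp only: word_def)
    from concat_pairs_cong[OF this] show ?thesis using F(1) \<sigma>(1) by auto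
  qed
  ultimately show ?thesis by blast
qed

end

section \<open>Types over indiscernible pairs\<close>

locale indisc = chain +
  fixes x y :: "rat \<Rightarrow> 'a"
  assumes Px: "eqv A p0 (x q)" and x_less: "q < q' \<Longrightarrow> r (x q) < r (x q')" and x_sep: "q < q' \<Longrightarrow> \<not> E 0 (x q) (x q')"
    and xy: "E k (x q) (y q)" "r (x q) < r (y q)"
    and hom: "finite F \<Longrightarrow> strict_mono_on F h \<Longrightarrow> \<exists>\<sigma>\<in>Au A. \<forall>q\<in>F. \<sigma> (x q) = x (h q) \<and> \<sigma> (y q) = y (h q)"
begin

definition dd :: "rat set \<Rightarrow> 'a set" where
  "dd F = A \<union> x ` F \<union> y ` F"

lemma xU: "x q \<in> U" "y q \<in> U"
  using Px P_U E_U[OF Px xy(1)] by blast+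

lemma dd: "finite F \<Longrightarrow> finite (dd F)" "A \<subseteq> dd F" "dd F \<subseteq> U"
  using A xU by (auto simp: dd_def)

lemma dd_insert: "dd (insert j F) = insert (y j) (insert (x j) (dd F))"
  by (auto simp: dd_def)

lemma x_move:
  assumes F: "finite F" "j \<notin> F" and h: "strict_mono_on (insert j F) (\<lambda>q. if q = j then i else q)"
  shows "\<exists>\<sigma>\<in>Au (dd F). \<sigma> (x j) = x i"
proof -
  obtain \<sigma> where \<sigma>: "\<sigma> \<in> Au A" "\<forall>q\<in>insert j F. \<sigma> (x q) = x (if q = j then i else q) \<and> \<sigma> (y q) = y (if q = j then i else q)"
    using hom[OF _ h] F(1) by blast
  have "\<sigma> (x q) = x q \<and> \<sigma> (y q) = y q" if "q \<in> F" for q using bspec[OF \<sigma>(2), of q] that F(2) by auto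
  then have "\<sigma> \<in> Au (dd F)" using \<sigma>(1) by (auto simp: Au_def dd_def)
  moreover have "\<sigma> (x j) = x i" using bspec[OF \<sigma>(2), of j] by simp
  ultimately show ?thesis by blast
qed

lemma gap_up:
  assumes "finite F"
  shows "\<exists>i>j. (\<forall>q\<in>F. j < q \<longrightarrow> i < (q::rat))"
proof (cases "{q\<in>F. j < q} = {}")
  case True
  then show ?thesis by (intro exI[of _ "j + 1"]) auto
next
  case False
  have fin: "finite {q\<in>F. j < q}" using assms by simp
  have "j < Min {q\<in>F. j < q}" using Min_in[OF fin False] by simp
  then obtain i where i: "j < i" "i < Min {q\<in>F. j < q}" using dense by blast
  have "i < q" if "q \<in> F" "j < q" for q using Min_le[OF fin, of q] that i(2) by simp
  then show ?thesis using i by blast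
qed

lemma gap_down:
  assumes "finite F"
  shows "\<exists>i<j. (\<forall>q\<in>F. q < j \<longrightarrow> (q::rat) < i)"
proof -
  obtain i where "i > - j" "\<forall>q\<in>uminus ` F. - j < q \<longrightarrow> i < q" using gap_up[of "uminus ` F" "- j"] assms by blast
  then show ?thesis by (intro exI[of _ "- i"]) force
qed

lemma shift_mono:
  assumes "\<And>q. q \<in> F \<Longrightarrow> q < j \<Longrightarrow> q < i" "\<And>q. q \<in> F \<Longrightarrow> j < q \<Longrightarrow> i < q"
  shows "strict_mono_on (insert j F) (\<lambda>q. if q = j then i else (q::rat))"
  using assms by (auto intro!: strict_mono_onI)

text \<open>Shifting \<open>j\<close> upwards inside its gap in \<open>F\<close> is induced by an
  automorphism over \<open>dd F\<close>, which takes \<open>x j\<close> out of its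
  \<open>E 0\<close>-class.\<close>

lemma x_free:
  assumes F: "finite F" "j \<notin> F"
  shows "free (dd F) (x j)" "\<not> closed (dd F) (x j)"
proof -
  obtain i where i: "i > j" "\<And>q. q \<in> F \<Longrightarrow> j < q \<Longrightarrow> i < q" using gap_up[OF F(1)] by blast
  have "strict_mono_on (insert j F) (\<lambda>q. if q = j then i else q)" using i by (intro shift_mono) auto
  then obtain \<sigma> where "\<sigma> \<in> Au (dd F)" "\<sigma> (x j) = x i" using x_move[OF F] by blast
  then have "eqv (dd F) (x j) (x i)" using eqv_iff[OF dd(1)[OF F(1)] dd(3)] xU by blast
  then show nc: "\<not> closed (dd F) (x j)" using x_sep[OF i(1)] by (auto simp: closed_def)
  show "free (dd F) (x j)" using free_or_closed[OF dd(1)[OF F(1)] dd(2,3) Px nc] .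
qed

text \<open>Take a smallest index set over which \<open>z\<close> is closed, and in it an index
  \<open>j\<close> next to \<open>z\<close>, so that \<open>x j\<close> has conjugates over the
  remaining pairs on both sides of \<open>z\<close>. Over the rest, \<open>z\<close> is not closed.
  If \<open>z\<close> is closed after adding \<open>x j\<close> alone, or \<open>x j\<close> after
  adding \<open>z\<close>, then \<open>closed_between\<close> puts both into one
  \<open>Einf\<close>-class; otherwise the companion \<open>y j\<close> does the pinning, against
  \<open>drag\<close>.\<close>

lemma final_free:
  assumes F: "finite F" "a \<in> F" "b \<in> F" and z: "P z" "r (x a) < r z" "r z < r (x b)"
    and n: "\<And>i. i \<in> F \<Longrightarrow> \<not> Einf z (x i)"
  shows "free (dd F) z"
proof (rule ccontr)
  assume "\<not> free (dd F) z"
  then have "closed (dd F) z" using free_or_closed[OF dd(1)[OF F(1)] dd(2,3) z(1)] by blast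
  then have "\<exists>k. \<exists>G. G \<subseteq> F \<and> closed (dd G) z \<and> card G = k" by blast
  then obtain F0 where F0: "F0 \<subseteq> F" "closed (dd F0) z"
    and min: "\<And>G. G \<subseteq> F \<Longrightarrow> closed (dd G) z \<Longrightarrow> card F0 \<le> card G"
    using ex_has_least_nat[of "\<lambda>G. G \<subseteq> F \<and> closed (dd G) z" F card] \<open>closed (dd F) z\<close> by blast
  have fin: "finite F0" using F0 F finite_subset by blast
  have zU: "z \<in> U" using z P_U by blast
  have ne: "F0 \<noteq> {}"
  proof
    assume "F0 = {}"
    then have c: "closed A z" using F0 by (simp add: dd_def)
    obtain w where "P w" "\<not> E 0 z w" using out_up[OF z(1)] by blast
    then show False using c z(1) eqv_trans eqv_sym unfolding closed_def by metis
  qed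
  have xz: "r (x i) \<noteq> r z" if "i \<in> F0" for i
  proof
    assume "r (x i) = r z"
    then have "z = x i" using r_eq[OF xU(1) zU] by simp
    then show False using n[of i] that F0 E_refl[OF z(1)] by (auto simp: Einf_def)
  qed
  have x_lt: "q < q'" if "r (x q) < r (x q')" for q q' using that x_less[of q' q] by (metis less_asym linorder_neqE_linordered_idom order_less_irrefl)
  define L where "L = {i\<in>F0. r (x i) < r z}"
  define R where "R = {i\<in>F0. r z < r (x i)}"
  have LR: "finite L" "finite R" "F0 = L \<union> R" using fin xz by (auto simp: L_def R_def less_le not_le) 
  have LR_less: "l < m" if "l \<in> L" "m \<in> R" for l m using that x_lt[of l m] by (auto simp: L_def R_def)
  \<comment> \<open>\<open>j\<close> is the last index of \<open>F0\<close> left of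
    \<open>z\<close>. It can be moved a little down, or up to \<open>i'\<close> with
    \<open>x i'\<close> beyond \<open>z\<close>, without passing another index of
    \<open>F0\<close>.\<close>
  have goL: "\<exists>j\<in>F0. \<exists>i i'. r (x i) < r z \<and> r z < r (x i') \<and>
      (\<forall>q\<in>F0 - {j}. (q < j \<longrightarrow> q < i \<and> q < i') \<and> (j < q \<longrightarrow> i < q \<and> i' < q))"
    if h: "L \<noteq> {}" "r z < r (x i')" "\<And>m. m \<in> R \<Longrightarrow> i' < m" for i'
  proof -
    define j where "j = Max L"
    have j: "j \<in> L" "\<And>q. q \<in> L \<Longrightarrow> q \<le> j" using LR h by (auto simp: j_def)
    obtain i where i: "i < j" "\<And>q. q \<in> F0 \<Longrightarrow> q < j \<Longrightarrow> q < i" using gap_down[OF fin] by blast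
    have "r (x i) < r z" using x_less[OF i(1)] j by (auto simp: L_def)
    moreover have "(q < j \<longrightarrow> q < i \<and> q < i') \<and> (j < q \<longrightarrow> i < q \<and> i' < q)" if q: "q \<in> F0" for q
    proof -
      have "j < i'" using x_lt[of j i'] j h by (auto simp: L_def)
      moreover have "i' < q" if "j < q" using q that j(2)[of q] LR h(3) by force
      ultimately show ?thesis using i(2)[OF q] i(1) by (meson less_trans)
    qed
    moreover have "j \<in> F0" using j LR by blast
    ultimately show ?thesis using h(2) by blast
  qed
  have goR: "\<exists>j\<in>F0. \<exists>i i'. r (x i) < r z \<and> r z < r (x i') \<and>
      (\<forall>q\<in>F0 - {j}. (q < j \<longrightarrow> q < i \<and> q < i') \<and> (j < q \<longrightarrow> i < q \<and> i' < q))"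
    if h: "R \<noteq> {}" "r (x i) < r z" "\<And>m. m \<in> L \<Longrightarrow> m < i" for i
  proof -
    define j where "j = Min R"
    have j: "j \<in> R" "\<And>q. q \<in> R \<Longrightarrow> j \<le> q" using LR h by (auto simp: j_def)
    obtain i' where i: "j < i'" "\<And>q. q \<in> F0 \<Longrightarrow> j < q \<Longrightarrow> i' < q" using gap_up[OF fin] by blast
    have "r z < r (x i')" using x_less[OF i(1)] j by (auto simp: R_def)
    moreover have "(q < j \<longrightarrow> q < i \<and> q < i') \<and> (j < q \<longrightarrow> i < q \<and> i' < q)" if q: "q \<in> F0" for q
    proof -
      have "i < j" using x_lt[of i j] j h by (auto simp: R_def)
      moreover have "q < i" if "q < j" using q that j(2)[of q] LR h(3) by force
      ultimately show ?thesis using i(2)[OF q] i(1) by (meson less_trans)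
    qed
    moreover have "j \<in> F0" using j LR by blast
    ultimately show ?thesis using h(2) by blast
  qed
  have "\<exists>j\<in>F0. \<exists>i i'. r (x i) < r z \<and> r z < r (x i') \<and>
      (\<forall>q\<in>F0 - {j}. (q < j \<longrightarrow> q < i \<and> q < i') \<and> (j < q \<longrightarrow> i < q \<and> i' < q))"
  proof -
    consider "R = {}" "L \<noteq> {}" | "L = {}" "R \<noteq> {}" | "L \<noteq> {}" "R \<noteq> {}" using ne LR by blast
    then show ?thesis
    proof cases
      case 1 then show ?thesis using goL[of b] z by blast
    next
      case 2 then show ?thesis using goR[of a] z by blast
    next
      case 3
      have lr: "Max L < Min R" using LR_less LR 3 by simp
      show ?thesis
      \<comment> \<open>Strictly between the two neighbouring indices either some \<open>x i\<close>
        is left of \<open>z\<close>, and the right neighbour can move across \<open>z\<close>, or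
        none is, and the left neighbour can.\<close>
      proof (cases "\<exists>i. Max L < i \<and> i < Min R \<and> r (x i) < r z")
        case True
        then obtain i where i: "Max L < i" "r (x i) < r z" by blast
        have "m < i" if "m \<in> L" for m using i Max_ge[OF LR(1) that] by simp
        then show ?thesis using goR[OF 3(2) i(2)] by blast
      next
        case False
        obtain i where i: "Max L < i" "i < Min R" using dense[OF lr] by blast
        obtain i' where i': "i < i'" "i' < Min R" using dense[OF i(2)] by blast
        have "r z < r (x i')" using False i x_less[OF i'(1)] by force
        moreover have "i' < m" if "m \<in> R" for m using i' Min_le[OF LR(2) that] by simp
        ultimately show ?thesis using goL[OF 3(1)] by blast
      qed
    qed
  qed
  then obtain j i i' where j: "j \<in> F0" and i: "r (x i) < r z" "r z < r (x i')"
    and gap: "\<And>q. q \<in> F0 - {j} \<Longrightarrow> (q < j \<longrightarrow> q < i \<and> q < i') \<and> (j < q \<longrightarrow> i < q \<and> i' < q)" by blast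
  define F1 where "F1 = F0 - {j}"
  have F1: "finite F1" "j \<notin> F1" "F0 = insert j F1" using fin j by (auto simp: F1_def)
  define D where "D = dd F1"
  have D: "finite D" "A \<subseteq> D" "D \<subseteq> U" using dd F1 by (auto simp: D_def)
  have ncD: "\<not> closed D z"
  proof
    assume "closed D z"
    then have "card F0 \<le> card F1" using min[of F1] F1 F0 by (auto simp: D_def)
    then show False using F1 by simp
  qed
  have cD: "closed (insert (y j) (insert (x j) D)) z" using F0(2) unfolding F1(3) dd_insert D_def .
  have xj: "free D (x j)" "\<not> closed D (x j)" using x_free[OF F1(1,2)] by (auto simp: D_def)
  have "strict_mono_on (insert j F1) (\<lambda>q. if q = j then i else q)"
    "strict_mono_on (insert j F1) (\<lambda>q. if q = j then i' else q)"
    using gap by (intro shift_mono; auto simp: F1_def)+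
  then obtain \<sigma> \<sigma>' where \<sigma>: "\<sigma> \<in> Au D" "\<sigma> (x j) = x i" "\<sigma>' \<in> Au D" "\<sigma>' (x j) = x i'"
    using x_move[OF F1(1,2)] unfolding D_def by meson
  have e: "eqv D (x j) (x i)" "eqv D (x j) (x i')" using \<sigma> eqv_iff[OF D(1,3)] xU by blast+
  have nE: "\<not> Einf z (x j)" using n j F0 by blast
  show False
  proof (cases "closed (insert (x j) D) z")
    case True
    then show False using closed_between[OF D Px z(1) xj(1) e i _ ncD] nE by blast
  next
    case False
    have zD: "finite (insert z D)" "A \<subseteq> insert z D" "insert z D \<subseteq> U" using D zU by auto
    show False
    proof (cases "free (insert z D) (x j)")
      case True
      show False by (rule drag[OF D Px z(1) True _ xy(2) False cD]) (simp add: Einf_def xy)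
    next
      case f: False
      then have c: "closed (insert z D) (x j)" using free_or_closed[OF zD Px] by blast
      obtain \<tau> \<tau>' where \<tau>: "\<tau> \<in> Au D" "\<And>u. u \<in> U \<Longrightarrow> \<tau> (\<sigma>' u) = u" "\<tau>' \<in> Au D" "\<And>u. u \<in> U \<Longrightarrow> \<tau>' (\<sigma> u) = u"
        using Au_inv[OF \<sigma>(1) D(3)] Au_inv[OF \<sigma>(3) D(3)] by blast
      have t: "\<tau> (x i') = x j" "\<tau>' (x i) = x j" using \<tau>(2,4)[OF xU(1)[of j]] \<sigma> by auto
      have "r (\<tau> z) < r (x j)" "r (x j) < r (\<tau>' z)"
        using Au_lt[OF \<tau>(1) zU xU(1)[of i']] Au_lt[OF \<tau>(3) xU(1)[of i] zU] t i by auto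
      moreover have "eqv D z (\<tau> z)" "eqv D z (\<tau>' z)" using eqv_Au[OF D(1,3)] \<tau> zU by blast+
      moreover have "free D z" using free_or_closed[OF D z(1) ncD] .
      ultimately have "Einf (x j) z" using closed_between[OF D z(1) Px _ _ _ _ _ c xj(2)] by blast
      then show False using nE E_sym[OF Px] by (auto simp: Einf_def)
    qed
  qed
qed

text \<open>Otherwise \<open>z\<close> is free by \<open>final_free\<close>, and the points at or
  below some \<open>w\<close> with \<open>\<Theta> z w\<close> form a segment at \<open>z\<close>
  within its \<open>Einf\<close>-class, against \<open>no_segment\<close>.\<close>

lemma final_pair:
  assumes F: "finite F" "a \<in> F" "b \<in> F" and \<Theta>: "Dp (dd F) (\<lambda>e. \<Theta> (e 0) (e 1))"
    and z: "z \<in> U" "w \<in> U" "\<Theta> z w"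
    and all: "\<And>z w. z \<in> U \<Longrightarrow> w \<in> U \<Longrightarrow> \<Theta> z w \<Longrightarrow> P z \<and> r (x a) < r z \<and> r z < r (x b) \<and> r z < r w \<and> Einf z w"
  shows "\<exists>z\<in>U. \<exists>w\<in>U. \<Theta> z w \<and> (\<exists>i\<in>F. Einf z (x i))"
proof (rule ccontr)
  assume neg: "\<not> ?thesis"
  have zz: "P z" "r (x a) < r z" "r z < r (x b)" "r z < r w" "Einf z w" using all z by auto
  have fr: "free (dd F) z" using final_free[OF F zz(1-3)] neg z by blast
  have D: "finite (dd F)" "A \<subseteq> dd F" "dd F \<subseteq> U" "dd F \<noteq> {}" using dd F by (auto simp: dd_def)
  have D': "dd F \<subseteq> insert z (dd F)" "insert z (dd F) \<subseteq> U" "z \<in> insert z (dd F)" using D z by auto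
  show False
  proof (rule no_segment[OF D zz(1) fr, of "\<lambda>y. \<exists>w\<in>U. \<Theta> z w \<and> r y \<le> r w" w])
    show "Dp (insert z (dd F)) (\<lambda>e. \<exists>w\<in>U. \<Theta> z w \<and> r (e 0) \<le> r w)"
      by (intro Dintros D2[OF D_mono[OF \<Theta> D'(1,2)]] tmc D'(2,3))
    show "\<exists>w\<in>U. \<Theta> z w \<and> r y' \<le> r w" if "\<exists>w\<in>U. \<Theta> z w \<and> r y \<le> r w" "r y' \<le> r y" for y y'
      using that order_trans by blast
    show "H k z y" if "\<exists>w\<in>U. \<Theta> z w \<and> r y \<le> r w" "r z \<le> r y" for y k
      using that all[OF z(1)] by (auto simp: H_def Einf_def)
  qed (use zz z in auto)
qed

end

section \<open>A submodel omitting unwanted pairs\<close>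

context indisc
begin

text \<open>A Henkin construction in which even variables are reserved for the pairs with index in
  \<open>I\<close> and odd ones serve as witnesses. A condition is a formula consistent with the
  prescribed even part. For each pair of variables the type of an unwanted pair is omitted: either
  some extension of the condition refutes a part of it, or \<open>final_pair\<close> shows that the
  condition already forces the first point close to a chosen point at every level.\<close>

lemma henkin:
  fixes I :: "rat set"
  assumes I: "a \<in> I" "b \<in> I"
  shows "\<exists>N x' y'. N \<subseteq> U \<and>
     (\<forall>Q e c. Dp A Q \<longrightarrow> e \<in> asg N \<longrightarrow> c \<in> U \<longrightarrow> Q (case_nat c e) \<longrightarrow> (\<exists>c\<in>N. Q (case_nat c e))) \<and>
     (\<forall>i\<in>I. P (x' i) \<and> x' i \<in> N \<and> y' i \<in> N \<and> r (x' i) < r (y' i) \<and> Einf (x' i) (y' i)) \<and>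
     (\<forall>i\<in>I. \<forall>j\<in>I. i < j \<longrightarrow> r (x' i) < r (x' j) \<and> \<not> E 0 (x' i) (x' j)) \<and>
     (\<forall>z\<in>N. \<forall>w\<in>N. P z \<and> r (x' a) < r z \<and> r z < r (x' b) \<and> r z < r w \<and> Einf z w \<longrightarrow> (\<exists>i\<in>I. Einf z (x' i)))"
proof -
  \<comment> \<open>Codes of rationals outside \<open>I\<close> get the default index
    \<open>a\<close>.\<close>
  define qq where "qq = (\<lambda>c. if from_nat c \<in> I then from_nat c else a)"
  have qqO: "qq c \<in> I" for c using I by (simp add: qq_def)
  \<comment> \<open>Residue 0 modulo 4 is used for \<open>x\<close> and residue 2 for
    \<open>y\<close>; \<open>mg\<close> reads \<open>s0\<close> at even positions only.\<close>
  define s0 where "s0 = (\<lambda>n. if n mod 4 = 0 then x (qq (n div 4)) else y (qq (n div 4)))"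
  define vx where "vx = (\<lambda>i::rat. 4 * to_nat i)"
  define vy where "vy = (\<lambda>i::rat. 4 * to_nat i + 2)"
  define mg where "mg = (\<lambda>v n. if even n then s0 n else (v n :: 'a))"
  have sv: "mg v (vx i) = x i" "mg v (vy i) = y i" if "i \<in> I" for i v
  proof -
    have "(4 * k + 2) div 4 = k" "(4 * k + 2) mod 4 = 2" for k :: nat by presburger+
    then show "mg v (vx i) = x i" "mg v (vy i) = y i" using that by (simp_all add: mg_def s0_def vx_def vy_def qq_def)
  qed
  have mgA: "mg v \<in> AS" if "v \<in> AS" for v using that xU by (simp add: asg_def mg_def s0_def)
  define FF where "FF = (\<lambda>n. {a, b} \<union> qq ` {..n})"
  have FF: "finite (FF n)" "a \<in> FF n" "b \<in> FF n" "FF n \<subseteq> I" for n using I qqO by (auto simp: FF_def)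
  have s0F: "s0 k \<in> dd (FF n)" if "k \<le> n" for k n
  proof -
    have "qq (k div 4) \<in> FF n" using that by (auto simp: FF_def intro: le_trans[OF div_le_dividend])
    then show ?thesis by (auto simp: s0_def dd_def)
  qed
  define cons where "cons = (\<lambda>\<delta>. Dp A \<delta> \<and> (\<exists>v\<in>AS. \<delta> (mg v)))"
  define wit where "wit = (\<lambda>Q \<delta>. \<exists>m. \<forall>e\<in>AS. \<delta> e \<longrightarrow> (\<exists>c\<in>U. Q (case_nat c e)) \<longrightarrow> Q (case_nat (e (m::nat)) e))"
  \<comment> \<open>Everything true for all choices of the odd variables. The final assignment
    realizes this theory instead of being of the form \<open>mg v\<close>.\<close>
  define \<Gamma>0 where "\<Gamma>0 = {Q. Dp A Q \<and> (\<forall>v\<in>AS. Q (mg v))}"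
  define bad where "bad = (\<lambda>e s t. P (e s) \<and> r (e (vx a)) < r (e s) \<and> r (e s) < r (e (vx b)) \<and> r (e s) < r (e t) \<and>
     Einf (e s) (e t) \<and> (\<forall>i\<in>I. \<not> Einf (e s) (e (vx i))))"
  define omit where "omit = (\<lambda>s t \<delta>. \<forall>e\<in>AS. \<delta> e \<longrightarrow> (\<forall>Q\<in>\<Gamma>0. Q e) \<longrightarrow> \<not> bad e (s::nat) (t::nat))"
  have step1: "\<exists>\<delta>'. cons \<delta>' \<and> (\<forall>e. \<delta>' e \<longrightarrow> \<delta> e) \<and> wit Q \<delta>'" if d: "cons \<delta>" and Q: "Dp A Q" for \<delta> Q
  proof -
    obtain v where v: "Dp A \<delta>" "v \<in> AS" "\<delta> (mg v)" using d unfolding cons_def by (elim conjE bexE)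
    obtain n1 where n1: "\<And>e e'. e \<in> AS \<Longrightarrow> e' \<in> AS \<Longrightarrow> (\<forall>i<n1. e i = e' i) \<Longrightarrow> \<delta> e = \<delta> e'"
      using D_supp[OF v(1)] by blast
    obtain n2 where n2: "\<And>e e'. e \<in> AS \<Longrightarrow> e' \<in> AS \<Longrightarrow> (\<forall>i<n2. e i = e' i) \<Longrightarrow> Q e = Q e'"
      using D_supp[OF Q] by blast
    \<comment> \<open>An odd variable, hence available for a witness, and beyond both
      supports.\<close>
    define m where "m = 2 * (n1 + n2) + 1"
    define \<delta>' where "\<delta>' = (\<lambda>e. \<delta> e \<and> ((\<exists>c\<in>U. Q (case_nat c e)) \<longrightarrow> Q (case_nat (e m) e)))"
    have "Dp A (\<lambda>e. Q (case_nat (e 0) (\<lambda>i. e (Suc i))))" by (rule D_case[OF Q tmv tmv])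
    then have 1: "Dp A (\<lambda>e. \<exists>c\<in>U. Q (case_nat c e))" by (rule D_exn[of A "\<lambda>e c. Q (case_nat c e)"])
    have 2: "Dp A (\<lambda>e. Q (case_nat (e m) e))" using D_case[OF Q tmv[of A m] tmv, of "\<lambda>i. i"] by simp
    have D: "Dp A \<delta>'" unfolding \<delta>'_def by (rule D_conj[OF v(1) D_imp[OF 1 2]])
    have "\<exists>v\<in>AS. \<delta>' (mg v)"
    proof (cases "\<exists>c\<in>U. Q (case_nat c (mg v))")
      case True
      then obtain c where c: "c \<in> U" "Q (case_nat c (mg v))" by (rule bexE)
      have v': "v(m := c) \<in> AS" using v c by simp
      have mv: "mg (v(m := c)) i = (if i = m then c else mg v i)" for i by (simp add: mg_def m_def)
      have mm: "i < n1 \<Longrightarrow> i \<noteq> m" "i < n2 \<Longrightarrow> i \<noteq> m" "Suc i < n2 \<Longrightarrow> i \<noteq> m" for i by (auto simp: m_def)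
      have "\<forall>i<n1. mg (v(m := c)) i = mg v i" unfolding mv using mm(1) by simp
      then have "\<delta> (mg (v(m := c)))" using n1[OF mgA[OF v'] mgA[OF v(2)]] v(3) by blast
      moreover have "Q (case_nat c (mg (v(m := c)))) = Q (case_nat c (mg v))"
        using c by (intro n2 asg_case mgA v' v(2)) (auto simp: mv dest: mm(3) split: nat.split)
      then have "Q (case_nat (mg (v(m := c)) m) (mg (v(m := c))))" using c(2) by (simp add: mv)
      ultimately have "\<delta>' (mg (v(m := c)))" unfolding \<delta>'_def by (intro conjI impI)
      then show ?thesis using v' by (rule bexI)
    next
      case False
      then have "\<delta>' (mg v)" unfolding \<delta>'_def using v(3) by simp
      then show ?thesis using v(2) by (rule bexI)
    qed
    with D have "cons \<delta>'" unfolding cons_def by (rule conjI)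
    moreover have "wit Q \<delta>'" unfolding wit_def \<delta>'_def by (intro exI[of _ m] ballI impI) (elim conjE, erule mp, assumption)
    moreover have "\<forall>e. \<delta>' e \<longrightarrow> \<delta> e" unfolding \<delta>'_def by simp
    ultimately show ?thesis by (intro exI[of _ \<delta>'] conjI)
  qed
  have step2: "\<exists>\<delta>'. cons \<delta>' \<and> (\<forall>e. \<delta>' e \<longrightarrow> \<delta> e) \<and> omit s t \<delta>'" if d: "cons \<delta>" for \<delta> s t
  proof -
    obtain v where v: "Dp A \<delta>" "v \<in> AS" "\<delta> (mg v)" using d unfolding cons_def by (elim conjE bexE)
    define OKp where "OKp = (\<lambda>z w. P z \<and> r (x a) < r z \<and> r z < r (x b) \<and> r z < r w \<and> Einf z w)"
    show ?thesis
    proof (cases "\<exists>v\<in>AS. \<delta> (mg v) \<and> \<not> OKp (mg v s) (mg v t)")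
      case True
      then obtain v where v': "v \<in> AS" "\<delta> (mg v)" "\<not> OKp (mg v s) (mg v t)" by blast
      have "\<exists>\<chi>. Dp A \<chi> \<and> \<chi> (mg v) \<and> (\<forall>e\<in>AS. \<chi> e \<longrightarrow> \<not> bad e s t)"
      proof -
        consider "\<not> P (mg v s)" | "\<not> r (x a) < r (mg v s)" | "\<not> r (mg v s) < r (x b)"
          | "\<not> r (mg v s) < r (mg v t)" | k where "\<not> E k (mg v s) (mg v t)"
          using v'(3) unfolding OKp_def Einf_def by blast
        then show ?thesis
        proof cases
          case 1
          then obtain D where D: "Dp A (\<lambda>e. D (e 0))" "D (mg v s)" "\<And>w. P w \<Longrightarrow> \<not> D w"
            using eqv_neq[OF 1 p0 asgD[OF mgA[OF v'(1)]]] by blast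
          show ?thesis by (rule exI[of _ "\<lambda>e. D (e s)"]) (use D1[OF D(1) tmv[of A s]] D(2,3) in \<open>auto simp: bad_def\<close>)
        next
          case 2
          show ?thesis by (rule exI[of _ "\<lambda>e. \<not> r (e (vx a)) < r (e s)"])
              (use D_neg[OF D_less[OF A(2) tmv[of A "vx a"] tmv[of A s]]] 2 I in \<open>simp add: bad_def sv\<close>)
        next
          case 3
          show ?thesis by (rule exI[of _ "\<lambda>e. \<not> r (e s) < r (e (vx b))"])
              (use D_neg[OF D_less[OF A(2) tmv[of A s] tmv[of A "vx b"]]] 3 I in \<open>simp add: bad_def sv\<close>)
        next
          case 4
          show ?thesis by (rule exI[of _ "\<lambda>e. \<not> r (e s) < r (e t)"])
              (use D_neg[OF D_less[OF A(2) tmv[of A s] tmv[of A t]]] 4 in \<open>simp add: bad_def\<close>)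
        next
          case (5 k)
          show ?thesis by (rule exI[of _ "\<lambda>e. \<not> E k (e s) (e t)"])
              (use D_neg[OF E_D'[OF subset_refl A(2) tmv[of A s] tmv[of A t]]] 5 in \<open>auto simp: bad_def Einf_def\<close>)
        qed
      qed
      then obtain \<chi> where \<chi>: "Dp A \<chi>" "\<chi> (mg v)" "\<forall>e\<in>AS. \<chi> e \<longrightarrow> \<not> bad e s t" by (elim exE conjE)
      have "cons (\<lambda>e. \<delta> e \<and> \<chi> e)" unfolding cons_def
        using D_conj[OF v(1) \<chi>(1)] v' \<chi>(2) by blast
      moreover have "omit s t (\<lambda>e. \<delta> e \<and> \<chi> e)" unfolding omit_def using \<chi>(3) by simp
      ultimately show ?thesis by (intro exI[of _ "\<lambda>e. \<delta> e \<and> \<chi> e"]) simp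
    next
      case False
      then have all: "OKp (mg v s) (mg v t)" if "v \<in> AS" "\<delta> (mg v)" for v using that by blast
      obtain n1 where n1: "\<And>e e'. e \<in> AS \<Longrightarrow> e' \<in> AS \<Longrightarrow> (\<forall>i<n1. e i = e' i) \<Longrightarrow> \<delta> e = \<delta> e'"
        using D_supp[OF v(1)] by blast
      define n where "n = n1 + s + t"
      define F where "F = FF n"
      have F: "finite F" "a \<in> F" "b \<in> F" "F \<subseteq> I" using FF by (auto simp: F_def)
      note ddF = dd(1)[OF F(1)] dd(2,3)[of F]
      define mn where "mn = (\<lambda>i. if even i \<and> i \<le> n then (\<lambda>e. s0 i) else (\<lambda>e::nat \<Rightarrow> 'a. e i))"
      have tm: "tmd (dd F) (mn i)" for i using s0F[of i n] by (auto simp: mn_def F_def intro: tmv tmc)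
      have mn: "mn i e = mg e i" if "i \<le> n" for i e using that by (simp add: mn_def mg_def)
      have mnA: "(\<lambda>i. mn i e) \<in> AS" if "e \<in> AS" for e using that xU by (simp add: asg_def mn_def s0_def)
      have \<delta>mn: "\<delta> (\<lambda>i. mn i e) = \<delta> (mg e)" if e: "e \<in> AS" for e
        by (rule n1[OF mnA[OF e] mgA[OF e]]) (simp add: mn n_def)
      have DF: "Dp (dd F) (\<lambda>e. \<delta> (\<lambda>i. mn i e))" by (rule D_terms[OF D_mono[OF v(1) ddF(2,3)] tm])
      \<comment> \<open>If some solution of the condition were not within level \<open>k\<close> of
        any \<open>x i\<close> with \<open>i\<close> in \<open>F\<close>, then
        \<open>final_pair\<close>, applied to all such solutions, would return one in the
        \<open>Einf\<close>-class of some \<open>x i\<close>.\<close>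
      have "\<forall>v\<in>AS. \<delta> (mg v) \<longrightarrow> (\<exists>i\<in>F. E k (mg v s) (x i))" for k
      proof (rule ccontr)
        assume neg: "\<not> ?thesis"
        define \<Theta>0 where "\<Theta>0 = (\<lambda>z w e. \<delta> (\<lambda>i. mn i e) \<and> z = mn s e \<and> w = mn t e \<and> (\<forall>i\<in>F. \<not> E k z (x i)))"
        define \<Theta> where "\<Theta> = (\<lambda>z w. \<exists>e\<in>AS. \<Theta>0 z w e)"
        have tm2: "tmd (dd F) (\<lambda>e. mn i (\<lambda>i. e (Suc (Suc i))))" for i
          using s0F[of i n] by (auto simp: mn_def F_def intro: tmv tmc)
        have DF2: "Dp (dd F) (\<lambda>e. \<delta> (\<lambda>i. mn i (\<lambda>i. e (Suc (Suc i)))))"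
          using D_ren[OF DF, of "\<lambda>i. Suc (Suc i)"] .
        have xd: "x i \<in> dd F" if "i \<in> F" for i using that by (simp add: dd_def)
        have "Dp (dd F) (\<lambda>e. \<Theta>0 (e 0) (e 1) (\<lambda>i. e (Suc (Suc i))))" unfolding \<Theta>0_def
          by (intro D_conj D_equal DF2 tmv tm2 D_Ball D_neg E_D' tmc xd F(1) ddF(2,3))
        then have D\<Theta>: "Dp (dd F) (\<lambda>e. \<Theta> (e 0) (e 1))" unfolding \<Theta>_def by (rule D_exu2)
        have \<Theta>I: "\<Theta> z w \<longleftrightarrow> (\<exists>v\<in>AS. \<delta> (mg v) \<and> z = mg v s \<and> w = mg v t \<and> (\<forall>i\<in>F. \<not> E k z (x i)))" for z w
          unfolding \<Theta>_def \<Theta>0_def using \<delta>mn mn[of s] mn[of t] by (auto simp: n_def)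
        obtain v1 where v1: "v1 \<in> AS" "\<delta> (mg v1)" "\<forall>i\<in>F. \<not> E k (mg v1 s) (x i)" using neg by blast
        have "\<exists>z\<in>U. \<exists>w\<in>U. \<Theta> z w \<and> (\<exists>i\<in>F. Einf z (x i))"
        proof (rule final_pair[OF F(1-3) D\<Theta>])
          show "mg v1 s \<in> U" "mg v1 t \<in> U" using asgD[OF mgA[OF v1(1)]] by auto
          show "\<Theta> (mg v1 s) (mg v1 t)" using v1 \<Theta>I by blast
          show "P z \<and> r (x a) < r z \<and> r z < r (x b) \<and> r z < r w \<and> Einf z w" if "\<Theta> z w" for z w
            using that all unfolding \<Theta>I OKp_def by blast
        qed
        then show False unfolding \<Theta>I Einf_def by blast
      qed
      note close = this
      have "omit s t \<delta>" unfolding omit_def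
      proof (intro ballI impI notI)
        fix e assume e: "e \<in> AS" "\<delta> e" "\<forall>Q\<in>\<Gamma>0. Q e" "bad e s t"
        have "\<exists>i\<in>F. E k (e s) (e (vx i))" for k
        proof -
          \<comment> \<open>Closeness at level \<open>k\<close> as a formula in which the chosen
            points are variables; it holds for every \<open>mg v\<close> and therefore belongs to
            \<open>\<Gamma>0\<close>.\<close>
          define \<zeta> where "\<zeta> = (\<lambda>e. \<delta> e \<longrightarrow> \<not> (\<forall>i\<in>F. \<not> E k (e s) (e (vx i))))"
          have "Dp A \<zeta>" unfolding \<zeta>_def
            by (intro D_imp v(1) D_neg D_Ball F(1) E_D' tmv A(2) subset_refl)
          moreover have "\<zeta> (mg v)" if "v \<in> AS" for v
          proof -
            have "\<delta> (mg v) \<longrightarrow> (\<exists>i\<in>F. E k (mg v s) (x i))" using close[of k] that by (rule bspec)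
            moreover have "mg v (vx i) = x i" if "i \<in> F" for i using sv(1)[of i v] F(4) that by blast
            ultimately show ?thesis unfolding \<zeta>_def by force
          qed
          ultimately have "\<zeta> \<in> \<Gamma>0" unfolding \<Gamma>0_def by (intro CollectI conjI ballI)
          then have "\<zeta> e" using e(3) by (rule bspec[rotated])
          then show ?thesis using e(2) unfolding \<zeta>_def by blast
        qed
        note ex = this
        have Pe: "P (e s)" using e(4) by (simp add: bad_def)
        have "\<forall>i\<in>F. \<exists>k. \<not> E k (e s) (e (vx i))" using e(4) F(4) unfolding bad_def Einf_def by blast
        then obtain \<kappa> where \<kappa>: "\<And>i. i \<in> F \<Longrightarrow> \<not> E (\<kappa> i) (e s) (e (vx i))" by metis
        \<comment> \<open>\<open>F\<close> is finite, so one level exceeds all levels at which its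
          indices fail; closeness at that level gives the contradiction.\<close>
        obtain i where i: "i \<in> F" "E (Max (\<kappa> ` F)) (e s) (e (vx i))" using ex by blast
        have "\<kappa> i \<le> Max (\<kappa> ` F)" using F(1) i(1) by simp
        then show False using E_mono[OF _ Pe i(2)] \<kappa>[OF i(1)] by blast
      qed
      then show ?thesis using d by (intro exI[of _ \<delta>]) simp
    qed
  qed
  obtain f where f: "\<And>Q. Dp A Q \<Longrightarrow> \<exists>n::nat. Dp A (f n) \<and> (\<forall>e\<in>AS. Q e = f n e)" using D_cnt[OF A] by blast
  define g where "g = (\<lambda>n. if Dp A (f n) then f n else (\<lambda>e. True))"
  have g: "Dp A (g n)" for n using D_true[OF A(2)] by (simp add: g_def)
  \<comment> \<open>Even stages supply a witness for the predicate numbered \<open>n div 2\<close>,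
    odd stages treat the pair of variables coded by that number.\<close>
  define todo where "todo = (\<lambda>n \<delta> \<delta>'. (\<forall>e. \<delta>' e \<longrightarrow> \<delta> e) \<and> (even n \<longrightarrow> wit (g (n div 2)) \<delta>') \<and>
    (odd n \<longrightarrow> omit (fst (prod_decode (n div 2))) (snd (prod_decode (n div 2))) \<delta>'))"
  have "\<exists>\<delta>. \<forall>n. cons (\<delta> n) \<and> todo n (\<delta> n) (\<delta> (Suc n))"
  proof (rule dependent_nat_choice)
    have "v \<in> AS \<Longrightarrow> cons (\<lambda>e. True)" for v unfolding cons_def using D_true[OF A(2)] by blast
    then show "\<exists>\<delta>. cons \<delta>" using asg_const[OF p0] by blast
    fix \<delta> and n :: nat assume d: "cons \<delta>"
    show "\<exists>\<delta>'. cons \<delta>' \<and> todo n \<delta> \<delta>'"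
    proof (cases "even n")
      case True
      obtain \<delta>' where "cons \<delta>'" "\<forall>e. \<delta>' e \<longrightarrow> \<delta> e" "wit (g (n div 2)) \<delta>'"
        using step1[OF d g[of "n div 2"]] by (elim exE conjE)
      then show ?thesis using True by (intro exI[of _ \<delta>']) (simp add: todo_def)
    next
      case False
      obtain \<delta>' where "cons \<delta>'" "\<forall>e. \<delta>' e \<longrightarrow> \<delta> e"
        "omit (fst (prod_decode (n div 2))) (snd (prod_decode (n div 2))) \<delta>'"
        using step2[OF d, of "fst (prod_decode (n div 2))" "snd (prod_decode (n div 2))"] by (elim exE conjE)
      then show ?thesis using False by (intro exI[of _ \<delta>']) (simp add: todo_def)
    qed
  qed
  then obtain \<delta> where \<delta>: "\<And>n. cons (\<delta> n)" "\<And>n. todo n (\<delta> n) (\<delta> (Suc n))" by blast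
  have dm: "\<delta> m e \<Longrightarrow> n \<le> m \<Longrightarrow> \<delta> n e" for n m e
  proof (induction m)
    case (Suc m)
    have "\<delta> m e" using \<delta>(2)[of m] Suc.prems(1) unfolding todo_def by blast
    then show ?case using Suc by (cases "n = Suc m") auto
  qed simp
  have "\<exists>e\<in>AS. \<forall>Q\<in>range \<delta> \<union> \<Gamma>0. Q e"
  proof (rule omega_sat[OF A])
    fix Q assume "Q \<in> range \<delta> \<union> \<Gamma>0"
    then show "Dp A Q" using \<delta>(1) unfolding cons_def \<Gamma>0_def by blast
  next
    fix G assume G: "G \<subseteq> range \<delta> \<union> \<Gamma>0" "finite G"
    obtain K where K: "finite K" "G \<inter> range \<delta> = \<delta> ` K"
      using finite_subset_image[of "G \<inter> range \<delta>" \<delta> UNIV] G by auto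
    define m where "m = Max (insert 0 K)"
    have m: "k \<le> m" if "k \<in> K" for k using K that by (auto simp: m_def)
    obtain v where v: "v \<in> AS" "\<delta> m (mg v)" using \<delta>(1)[of m] unfolding cons_def by blast
    have "Q (mg v)" if Q: "Q \<in> G" for Q
    proof (cases "Q \<in> range \<delta>")
      case True
      then have "Q \<in> \<delta> ` K" using K Q by blast
      then obtain k where "k \<in> K" "Q = \<delta> k" by blast
      then show ?thesis using dm[OF v(2) m] by simp
    next
      case False
      then have "Q \<in> \<Gamma>0" using Q G by blast
      then show ?thesis using v(1) unfolding \<Gamma>0_def by blast
    qed
    then show "\<exists>e\<in>AS. \<forall>Q\<in>G. Q e" using mgA[OF v(1)] by (intro bexI[of _ "mg v"] ballI)
  qed
  then obtain e where e: "e \<in> AS" "\<forall>Q\<in>range \<delta> \<union> \<Gamma>0. Q e" by (rule bexE)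
  have de: "\<delta> n e" for n using bspec[OF e(2), of "\<delta> n"] by simp
  have G0: "\<forall>Q\<in>\<Gamma>0. Q e"
  proof
    fix Q assume "Q \<in> \<Gamma>0"
    then have "Q \<in> range \<delta> \<union> \<Gamma>0" by (rule UnI2)
    then show "Q e" by (rule bspec[OF e(2)])
  qed
  have G0I: "Q e" if Q: "Dp A Q" "\<And>v. v \<in> AS \<Longrightarrow> Q (mg v)" for Q
  proof -
    have "Q \<in> \<Gamma>0" unfolding \<Gamma>0_def using Q by (intro CollectI conjI ballI)
    then show ?thesis using G0 by (rule bspec[rotated])
  qed
  define N where "N = range e"
  define x' where "x' = (\<lambda>i. e (vx i))"
  define y' where "y' = (\<lambda>i. e (vy i))"
  have n1: "N \<subseteq> U" using asgD[OF e(1)] by (auto simp: N_def)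
  have n2: "\<exists>c\<in>N. Q (case_nat c e')" if Q: "Dp A Q" "e' \<in> asg N" "c \<in> U" "Q (case_nat c e')" for Q e' c
  proof -
    have "\<forall>i. \<exists>j. e' i = e j" using asgD[OF Q(2)] by (auto simp: N_def)
    then obtain h where h: "\<And>i. e' i = e (h i)" by metis
    then have e': "e' = (\<lambda>i. e (h i))" by auto
    define Q' where "Q' = (\<lambda>e0. Q (case_nat (e0 0) (\<lambda>i. e0 (Suc (h i)))))"
    have "Dp A Q'" unfolding Q'_def by (rule D_case[OF Q(1) tmv tmv])
    then obtain n where n: "Dp A (f n)" "\<forall>e\<in>AS. Q' e = f n e" using f by blast
    then have gn: "g n = f n" by (simp add: g_def)
    have "wit (g n) (\<delta> (Suc (2 * n)))" using \<delta>(2)[of "2 * n"] by (simp add: todo_def)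
    then obtain m where m: "\<forall>e\<in>AS. \<delta> (Suc (2 * n)) e \<longrightarrow> (\<exists>c\<in>U. g n (case_nat c e)) \<longrightarrow> g n (case_nat (e m) e)"
      unfolding wit_def by (rule exE)
    have q: "f n (case_nat c e) = Q (case_nat c e')" if "c \<in> U" for c
      using bspec[OF n(2), of "case_nat c e"] that e(1) by (simp add: Q'_def e')
    have "\<exists>c\<in>U. g n (case_nat c e)" unfolding gn using q[OF Q(3)] Q(3,4) by (intro bexI[of _ c]) simp_all
    then have "g n (case_nat (e m) e)" using bspec[OF m e(1)] de by blast
    then have "Q (case_nat (e m) e')" using q[OF asgD[OF e(1)], of m] by (simp add: gn)
    then show ?thesis by (rule bexI) (simp add: N_def)
  qed
  have n3: "P (x' i) \<and> x' i \<in> N \<and> y' i \<in> N \<and> r (x' i) < r (y' i) \<and> Einf (x' i) (y' i)" if i: "i \<in> I" for i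
  proof (intro conjI)
    show "x' i \<in> N" "y' i \<in> N" by (simp_all add: x'_def y'_def N_def)
    have "(\<lambda>e. r (e (vx i)) < r (e (vy i))) e"
      by (rule G0I[of "\<lambda>e. r (e (vx i)) < r (e (vy i))"]) (simp_all add: D_less A tmv sv i xy)
    then show "r (x' i) < r (y' i)" by (simp add: x'_def y'_def)
    have "(\<lambda>e. E k (e (vx i)) (e (vy i))) e" for k
      by (rule G0I[of "\<lambda>e. E k (e (vx i)) (e (vy i))"]) (simp_all add: E_D' A tmv sv i xy)
    then show "Einf (x' i) (y' i)" by (simp add: x'_def y'_def Einf_def)
    have one: "D (\<lambda>_. x' i)" if D: "Dp A D" "D (\<lambda>_. p0)" for D
    proof -
      have 1: "Dp A (\<lambda>e. D (\<lambda>_. e (vx i)))" by (rule D_ren[OF D(1)])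
      have "D (\<lambda>_. x i)" using Px[of i] D unfolding eqv_def by blast
      then have "(\<lambda>e. D (\<lambda>_. e (vx i))) e"
        by (intro G0I[of "\<lambda>e. D (\<lambda>_. e (vx i))", OF 1]) (simp add: sv i)
      then show ?thesis by (simp add: x'_def)
    qed
    have "D (\<lambda>_. p0) = D (\<lambda>_. x' i)" if "Dp A D" for D using one[OF that] one[OF D_neg[OF that]] by blast
    then show "P (x' i)" using p0 asgD[OF e(1)] by (simp add: eqv_def x'_def)
  qed
  have n4: "r (x' i) < r (x' j) \<and> \<not> E 0 (x' i) (x' j)" if ij: "i \<in> I" "j \<in> I" "i < j" for i j
  proof -
    have "(\<lambda>e. r (e (vx i)) < r (e (vx j))) e"
      by (rule G0I[of "\<lambda>e. r (e (vx i)) < r (e (vx j))"]) (simp_all add: D_less A tmv sv ij x_less)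
    moreover have "(\<lambda>e. \<not> E 0 (e (vx i)) (e (vx j))) e"
      by (rule G0I[of "\<lambda>e. \<not> E 0 (e (vx i)) (e (vx j))"]) (simp_all add: D_neg E_D' A tmv sv ij x_sep)
    ultimately show ?thesis by (simp add: x'_def)
  qed
  have n5: "\<exists>i\<in>I. Einf z (x' i)"
    if zw: "z \<in> N" "w \<in> N" "P z" "r (x' a) < r z" "r z < r (x' b)" "r z < r w" "Einf z w" for z w
  proof (rule ccontr)
    assume neg: "\<not> ?thesis"
    obtain s t where st: "z = e s" "w = e t" using zw(1,2) by (auto simp: N_def)
    have "omit s t (\<delta> (Suc (2 * prod_encode (s, t) + 1)))"
      using \<delta>(2)[of "2 * prod_encode (s, t) + 1"] by (simp add: todo_def)
    then have "\<not> bad e s t" unfolding omit_def using e(1) de G0 by blast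
    then show False using zw neg unfolding bad_def st x'_def by blast
  qed
  show ?thesis
  proof (intro exI conjI)
    show "N \<subseteq> U" by (rule n1)
    show "\<forall>Q e c. Dp A Q \<longrightarrow> e \<in> asg N \<longrightarrow> c \<in> U \<longrightarrow> Q (case_nat c e) \<longrightarrow> (\<exists>c\<in>N. Q (case_nat c e))"
      by (intro allI impI) (rule n2)
    show "\<forall>i\<in>I. P (x' i) \<and> x' i \<in> N \<and> y' i \<in> N \<and> r (x' i) < r (y' i) \<and> Einf (x' i) (y' i)"
      by (intro ballI) (rule n3)
    show "\<forall>i\<in>I. \<forall>j\<in>I. i < j \<longrightarrow> r (x' i) < r (x' j) \<and> \<not> E 0 (x' i) (x' j)"
      by (intro ballI impI) (rule n4)
    show "\<forall>z\<in>N. \<forall>w\<in>N. P z \<and> r (x' a) < r z \<and> r z < r (x' b) \<and> r z < r w \<and> Einf z w \<longrightarrow> (\<exists>i\<in>I. Einf z (x' i))"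
      using n5 by blast
  qed
qed

end

section \<open>Rigid orders coding sets of natural numbers\<close>

text \<open>Each \<open>n\<close> contributes the neighbours \<open>n\<close> and
  \<open>n + 1/4\<close>, followed, exactly if \<open>n\<close> is in \<open>S\<close>, by a dense
  block without endpoints. So \<open>n + 1/4\<close> has an immediate successor iff \<open>n\<close>
  is not in \<open>S\<close>.\<close>

definition code :: "nat set \<Rightarrow> rat set" where
  "code S = {q. \<exists>n. q = of_nat n \<or> q = of_nat n + 1/4 \<or> (n \<in> S \<and> of_nat n + 1/2 < q \<and> q < of_nat n + 3/4)}"

definition nxt :: "rat set \<Rightarrow> rat \<Rightarrow> rat \<Rightarrow> bool" where
  "nxt Q p q \<longleftrightarrow> p \<in> Q \<and> q \<in> Q \<and> p < q \<and> \<not> (\<exists>s\<in>Q. p < s \<and> s < q)"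

lemma code_cases:
  assumes "q \<in> code S"
  obtains (int) n where "q = of_nat n" | (quarter) n where "q = of_nat n + 1/4"
    | (gap) n where "n \<in> S" "of_nat n + 1/2 < q" "q < of_nat n + 3/4"
  using assms by (auto simp: code_def)

lemma code_mem: "of_nat n \<in> code S" "of_nat n + 1/4 \<in> code S"
  by (auto simp: code_def)

lemma rat_lt_nat: "(of_nat m :: rat) < of_nat n + c \<Longrightarrow> c \<le> 1 \<Longrightarrow> m \<le> n"
proof (rule ccontr)
  assume h: "(of_nat m :: rat) < of_nat n + c" "c \<le> 1" "\<not> m \<le> n"
  then have "of_nat (n + 1) \<le> (of_nat m :: rat)" by (simp only: of_nat_le_iff)
  then show False using h by simp
qed

lemma code_between:
  assumes "q \<in> code S" "of_nat n \<le> q" "q < of_nat (Suc n)"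
  shows "q = of_nat n \<or> q = of_nat n + 1/4 \<or> (n \<in> S \<and> of_nat n + 1/2 < q \<and> q < of_nat n + 3/4)"
  using assms(1)
proof (cases rule: code_cases)
  case (int m)
  then show ?thesis using assms by simp
next
  case (quarter m)
  have "m \<le> n" using assms(3) quarter by (intro rat_lt_nat[of m n 1]) auto
  moreover have "n \<le> m" using assms(2) quarter by (intro rat_lt_nat[of n m 1]) auto
  ultimately show ?thesis using quarter by simp
next
  case (gap m)
  have "m \<le> n" using assms(3) gap by (intro rat_lt_nat[of m n 1]) auto
  moreover have "n \<le> m" using assms(2) gap by (intro rat_lt_nat[of n m 1]) auto
  ultimately show ?thesis using gap by simp
qed

lemma nxt_unique: "nxt Q p q \<Longrightarrow> nxt Q p q' \<Longrightarrow> q = q'"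
  unfolding nxt_def by (metis linorder_neqE_linordered_idom)

lemma nxt_quarter: "nxt (code S) (of_nat n) (of_nat n + 1/4)"
proof -
  have "False" if "s \<in> code S" "of_nat n < s" "s < of_nat n + 1/4" for s
    using code_between[of s S n] that by auto
  then show ?thesis by (auto simp: nxt_def code_mem)
qed

lemma nxt_int: "n \<notin> S \<Longrightarrow> nxt (code S) (of_nat n + 1/4) (of_nat (Suc n))"
proof -
  assume n: "n \<notin> S"
  have "False" if "s \<in> code S" "of_nat n + 1/4 < s" "s < of_nat (Suc n)" for s
    using code_between[of s S n] that n by auto
  then show ?thesis using code_mem(1)[of "Suc n" S] by (auto simp: nxt_def code_mem)
qed

lemma no_nxt_gap:
  assumes n: "n \<in> S" and q: "of_nat n + 1/2 < q" "q < of_nat n + 3/4"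
  shows "\<not> nxt (code S) q q'"
proof
  assume h: "nxt (code S) q q'"
  define t where "t = min q' (of_nat n + 3/4)"
  have "q < t" using h q by (simp add: t_def nxt_def)
  then obtain s where s: "q < s" "s < t" using dense by blast
  then have "s \<in> code S" using n q by (auto simp: code_def t_def)
  then show False using h s by (auto simp: nxt_def t_def)
qed

lemma no_nxt_quarter:
  assumes n: "n \<in> S"
  shows "\<not> nxt (code S) (of_nat n + 1/4) q"
proof
  assume h: "nxt (code S) (of_nat n + 1/4) q"
  have lt: "of_nat n + 1/2 < q"
  proof (rule ccontr)
    assume "\<not> of_nat n + 1/2 < q"
    then show False using code_between[of q S n] h by (auto simp: nxt_def)
  qed
  define t where "t = min q (of_nat n + 3/4)"
  have "of_nat n + 1/2 < t" using lt by (simp add: t_def)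
  then obtain s where s: "of_nat n + 1/2 < s" "s < t" using dense by blast
  then have "s \<in> code S" using n by (auto simp: code_def t_def)
  then show False using h s by (auto simp: nxt_def t_def)
qed

lemma nxt_quarter_iff: "(\<exists>q. nxt (code S) (of_nat n + 1/4) q) \<longleftrightarrow> n \<notin> S"
proof (cases "n \<in> S")
  case True
  then show ?thesis using no_nxt_quarter[OF True] by simp
next
  case False
  then show ?thesis using nxt_int[OF False] by blast
qed

text \<open>Order isomorphisms preserve immediate successors. By induction every \<open>n\<close> is
  fixed: \<open>n + 1\<close> is the first point after \<open>n + 1/4\<close> that has a successor,
  since points of a dense block have none. Membership of \<open>n\<close> is then read off at
  \<open>n + 1/4\<close> on both sides.\<close>

lemma code_rigid:
  assumes f: "bij_betw f (code S) (code S')" and m: "strict_mono_on (code S) f"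
  shows "S = S'"
proof -
  have lt: "f p < f q \<longleftrightarrow> p < q" if "p \<in> code S" "q \<in> code S" for p q
    using strict_mono_on_less[OF m that] .
  have im: "f ` code S = code S'" using f by (simp add: bij_betw_def)
  have nx: "nxt (code S') (f p) (f q) \<longleftrightarrow> nxt (code S) p q" if "p \<in> code S" "q \<in> code S" for p q
  proof -
    have "(\<exists>s\<in>code S'. f p < s \<and> s < f q) \<longleftrightarrow> (\<exists>s\<in>code S. p < s \<and> s < q)"
      unfolding im[symmetric] using lt that by auto
    then show ?thesis using that lt im by (auto simp: nxt_def)
  qed
  have nx': "\<exists>q\<in>code S. nxt (code S) p q \<and> f q = q'" if h: "nxt (code S') (f p) q'" "p \<in> code S" for p q'
  proof -
    have "q' \<in> f ` code S" using h(1) im by (simp add: nxt_def)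
    then obtain q where "q \<in> code S" "q' = f q" by blast
    then show ?thesis using nx[OF h(2)] h(1) by blast
  qed
  have step: "f (of_nat n + 1/4) = of_nat n + 1/4 \<and> (n \<in> S \<longleftrightarrow> n \<in> S')" if h: "f (of_nat n) = of_nat n" for n
  proof -
    have "nxt (code S') (f (of_nat n)) (f (of_nat n + 1/4))" using nx nxt_quarter code_mem by blast
    then have q: "f (of_nat n + 1/4) = of_nat n + 1/4" using nxt_unique nxt_quarter h by metis
    have "(\<exists>q. nxt (code S) (of_nat n + 1/4) q) \<longleftrightarrow> (\<exists>q. nxt (code S') (of_nat n + 1/4) q)"
    proof
      assume "\<exists>q. nxt (code S) (of_nat n + 1/4) q"
      then obtain q' where q': "nxt (code S) (of_nat n + 1/4) q'" by blast
      have "q' \<in> code S" using q' by (simp add: nxt_def)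
      then have "nxt (code S') (f (of_nat n + 1/4)) (f q')" using nx[OF code_mem(2)] q' by blast
      then have "nxt (code S') (of_nat n + 1/4) (f q')" by (simp only: q)
      then show "\<exists>q. nxt (code S') (of_nat n + 1/4) q" by blast
    next
      assume "\<exists>q. nxt (code S') (of_nat n + 1/4) q"
      then obtain q' where "nxt (code S') (of_nat n + 1/4) q'" by blast
      then have "nxt (code S') (f (of_nat n + 1/4)) q'" by (simp only: q)
      from nx'[OF this code_mem(2)] show "\<exists>q. nxt (code S) (of_nat n + 1/4) q" by blast
    qed
    then have "n \<in> S \<longleftrightarrow> n \<in> S'" unfolding nxt_quarter_iff by simp
    then show ?thesis using q by simp
  qed
  have "f (of_nat n) = of_nat n" for n
  proof (induction n)
    case 0
    have pos: "0 \<le> q" if "q \<in> code T" for q T using that by (cases rule: code_cases) (auto intro: order_trans[OF of_nat_0_le_iff] less_imp_le)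
    obtain p where p: "p \<in> code S" "f p = 0" using code_mem(1)[of 0 S'] im by (metis image_iff of_nat_0)
    have "0 \<in> code S" using code_mem(1)[of 0 S] by simp
    then have "f 0 \<le> 0" using lt[of p 0] p pos[OF p(1)] by force
    moreover have "f 0 \<in> code S'" using im \<open>0 \<in> code S\<close> by blast
    ultimately show ?case using pos by force
  next
    case (Suc n)
    note st = step[OF Suc]
    have f1: "f (of_nat (Suc n)) \<in> code S'" using im code_mem(1) by blast
    have gt: "of_nat n + 1/4 < f (of_nat (Suc n))"
      using lt[OF code_mem(2)[of n] code_mem(1)[of "Suc n"]] st by simp
    obtain p where p: "p \<in> code S" "f p = of_nat (Suc n)" using im code_mem(1)[of "Suc n" S'] by (metis image_iff)
    have pn: "\<exists>q. nxt (code S) p q" using nx'[OF _ p(1)] p(2) nxt_quarter[of S' "Suc n"] by metis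
    have "of_nat n + 1/4 < p" using lt[OF code_mem(2)[of n] p(1)] p(2) st by simp
    then have ge: "of_nat (Suc n) \<le> p" using code_between[OF p(1), of n] pn no_nxt_gap by force
    have "\<exists>q. nxt (code S') (f (of_nat (Suc n))) q" using nx[OF code_mem] nxt_quarter by blast
    then have "of_nat (Suc n) \<le> f (of_nat (Suc n))" using code_between[OF f1, of n] gt no_nxt_gap by force
    moreover have "f (of_nat (Suc n)) \<le> of_nat (Suc n)"
      using ge lt[OF p(1) code_mem(1)[of "Suc n"]] p by force
    ultimately show ?case by simp
  qed
  then show ?thesis using step by blast
qed

text \<open>Compresses the nonnegative rationals into the interval from 0 to 1, leaving -1 and 1 as
  indices of the outer points.\<close>

definition squeeze :: "rat \<Rightarrow> rat" where
  "squeeze q = q / (1 + q)"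

lemma squeeze_less: "0 \<le> p \<Longrightarrow> p < q \<Longrightarrow> squeeze p < squeeze q"
  by (simp add: squeeze_def field_simps)

lemma squeeze_range: "0 \<le> q \<Longrightarrow> - 1 < squeeze q \<and> squeeze q < 1"
  by (simp add: squeeze_def field_simps)

lemma code_pos: "q \<in> code S \<Longrightarrow> 0 \<le> q"
  by (cases rule: code_cases) (auto intro: order_trans[OF of_nat_0_le_iff] less_imp_le)

definition index :: "nat set \<Rightarrow> rat set" where
  "index S = insert (- 1) (insert 1 (squeeze ` code S))"

lemma index_rigid:
  assumes f: "bij_betw f (index S - {- 1, 1}) (index S' - {- 1, 1})" and m: "strict_mono_on (index S - {- 1, 1}) f"
  shows "S = S'"
proof -
  have I: "index S - {- 1, 1} = squeeze ` code S" for S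
    using squeeze_range code_pos by (force simp: index_def)
  have sm: "strict_mono_on (code S) squeeze" for S
    using squeeze_less code_pos by (auto intro!: strict_mono_onI)
  have sb: "bij_betw squeeze (code S) (squeeze ` code S)" for S
    using strict_mono_on_imp_inj_on[OF sm] by (simp add: bij_betw_def)
  define g where "g = the_inv_into (code S') squeeze \<circ> (f \<circ> squeeze)"
  have "bij_betw g (code S) (code S')" unfolding g_def
    using f sb[of S] bij_betw_the_inv_into[OF sb[of S']] unfolding I by (blast intro: bij_betw_trans)
  moreover have "strict_mono_on (code S) g"
  proof (rule strict_mono_onI)
    fix p q assume pq: "p \<in> code S" "q \<in> code S" "p < q"
    have sg: "squeeze (g p) = f (squeeze p)" "g p \<in> code S'" if "p \<in> code S" for p
    proof -
      have "f (squeeze p) \<in> squeeze ` code S'" using f that unfolding I by (auto simp: bij_betw_def)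
      then show "squeeze (g p) = f (squeeze p)" "g p \<in> code S'"
        using f_the_inv_into_f_bij_betw[OF sb[of S']] bij_betw_apply[OF bij_betw_the_inv_into[OF sb[of S']]]
        by (auto simp: g_def)
    qed
    have "f (squeeze p) < f (squeeze q)"
      using strict_mono_onD[OF m, of "squeeze p" "squeeze q"] strict_mono_onD[OF sm pq] pq unfolding I by simp
    then show "g p < g q" using sg pq strict_mono_on_less[OF sm sg(2) sg(2)] by metis
  qed
  ultimately show ?thesis by (rule code_rigid)
qed

section \<open>Counting classes of a countable-to-one relation\<close>

text \<open>Enumerating the classes of representatives maps \<open>K\<close> times the naturals onto
  the power set of the naturals. \<open>K\<close> is infinite, as finitely many countable classes
  cannot cover an uncountable set, so the product is no larger than \<open>K\<close>.\<close>

lemma many_classes: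
  fixes R :: "nat set \<Rightarrow> nat set \<Rightarrow> bool"
  assumes R: "equivp R" and c: "\<And>S. countable {S'. R S S'}"
  shows "\<exists>K. K \<approx> (UNIV :: nat set set) \<and> pairwise (\<lambda>S S'. \<not> R S S') K"
proof -
  define rep where "rep = (\<lambda>S. SOME T. R S T)"
  have rep: "R S (rep S)" for S unfolding rep_def by (rule someI[of _ S]) (rule equivp_reflp[OF R])
  have rep_eq: "rep S = rep T" if "R S T" for S T
  proof -
    have "R S = R T" using R that by (simp add: equivp_def)
    then show ?thesis by (simp add: rep_def)
  qed
  define K where "K = range rep"
  have pw: "pairwise (\<lambda>S S'. \<not> R S S') K"
  proof (rule pairwiseI)
    fix k l assume kl: "k \<in> K" "l \<in> K" "k \<noteq> l"
    then obtain S T where ST: "k = rep S" "l = rep T" by (auto simp: K_def)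
    show "\<not> R k l"
    proof
      assume "R k l"
      then have "R S T" using rep[of S] rep[of T] ST equivp_transp[OF R] equivp_symp[OF R] by blast
      then show False using rep_eq ST kl by blast
    qed
  qed
  have cover: "UNIV = (\<Union>k\<in>K. {S. R k S})"
    using rep equivp_symp[OF R] by (auto simp: K_def)
  have unc: "\<not> countable (UNIV :: nat set set)"
    using Cantors_theorem[of "UNIV :: nat set"] uncountable_def
    by (metis Pow_UNIV UNIV_not_empty range_from_nat_into)
  have inf: "infinite K"
  proof
    assume "finite K"
    then have "countable (\<Union>k\<in>K. {S. R k S})" by (rule countable_UN[OF countable_finite c])
    then show False using unc cover by metis
  qed
  define h where "h = (\<lambda>(k, n). from_nat_into {S. R k S} n)"
  have "UNIV \<subseteq> h ` (K \<times> (UNIV :: nat set))"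
  proof
    fix S :: "nat set"
    have k: "rep S \<in> K" "S \<in> {T. R (rep S) T}" using rep equivp_symp[OF R] by (auto simp: K_def)
    then obtain n where "S = from_nat_into {T. R (rep S) T} n"
      using range_from_nat_into[of "{T. R (rep S) T}"] c by (metis empty_iff imageE)
    then show "S \<in> h ` (K \<times> (UNIV :: nat set))" using k(1) by (intro image_eqI[of _ _ "(rep S, n)"]) (auto simp: h_def)
  qed
  then have "(UNIV :: nat set set) \<lesssim> K \<times> (UNIV :: nat set)" by (meson lepoll_iff)
  also have "K \<times> (UNIV :: nat set) \<lesssim> K \<times> K"
    using inf by (intro times_lepoll_mono lepoll_refl) (simp add: infinite_le_lepoll)
  also have "K \<times> K \<lesssim> K" using card_of_Times_same_infinite[OF inf]
    by (intro eqpoll_imp_lepoll) (simp add: eqpoll_def card_of_ordIso)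
  finally have "K \<approx> (UNIV :: nat set set)" by (intro lepoll_antisym) (auto intro: subset_imp_lepoll)
  then show ?thesis using pw by blast
qed

section \<open>Recovering the code from the submodel\<close>

context chain
begin

text \<open>The Tarski-Vaught criterion: position 0 is the witness, the remaining variables carry
  parameters from \<open>N\<close>.\<close>

definition elem :: "'a set \<Rightarrow> bool" where
  "elem N \<longleftrightarrow> N \<noteq> {} \<and> N \<subseteq> U \<and> (\<forall>Q e c. Dp {} Q \<longrightarrow> e \<in> asg N \<longrightarrow> c \<in> U \<longrightarrow> Q (case_nat c e) \<longrightarrow> (\<exists>c\<in>N. Q (case_nat c e)))"

text \<open>For elementary submodels this is an isomorphism, expressed by invariance of the
  parameter-free predicates of the large structure.\<close>

definition emb :: "'a set \<Rightarrow> 'a set \<Rightarrow> ('a \<Rightarrow> 'a) \<Rightarrow> bool" where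
  "emb N N' h \<longleftrightarrow> bij_betw h N N' \<and> (\<forall>Q e. Dp {} Q \<longrightarrow> e \<in> asg N \<longrightarrow> Q (\<lambda>i. h (e i)) = Q e)"

lemma emb_Dp:
  assumes "finite B" "emb N N' h" "N \<subseteq> U" "N' \<subseteq> U" "B \<subseteq> N" "\<And>b. b \<in> B \<Longrightarrow> h b = b" "Dp B Q" "e \<in> asg N"
  shows "Q (\<lambda>i. h (e i)) = Q e"
  using assms
proof (induction B arbitrary: Q e rule: finite_induct)
  case empty then show ?case by (simp add: emb_def)
next
  case (insert b B)
  obtain R j where R: "Dp B R" "\<And>e. e \<in> AS \<Longrightarrow> Q e = R (e(j := b))" using D_abs[OF insert.prems(6)] by blast
  have b: "b \<in> N" "h b = b" using insert.prems by auto
  have hN: "h c \<in> N'" if "c \<in> N" for c using insert.prems(1) that by (auto simp: emb_def bij_betw_def)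
  have eN: "e i \<in> N" for i using insert.prems(7) by (simp add: asg_def)
  have A1: "e \<in> AS" "(\<lambda>i. h (e i)) \<in> AS" using eN hN insert.prems(2,3) by (auto simp: asg_def)
  have A2: "e(j := b) \<in> asg N" using insert.prems(7) b by simp
  have "Q (\<lambda>i. h (e i)) = R ((\<lambda>i. h (e i))(j := b))" by (rule R(2)[OF A1(2)])
  also have "(\<lambda>i. h (e i))(j := b) = (\<lambda>i. h ((e(j := b)) i))" using b by auto
  also have "R \<dots> = R (e(j := b))"
    by (rule insert.IH[OF insert.prems(1-3) _ _ R(1) A2]) (use insert.prems in auto)
  also have "\<dots> = Q e" using R(2)[OF A1(1)] by simp
  finally show ?case .
qed

text \<open>An embedding that fixes \<open>A\<close> and takes outer points to outer points
  preserves the order, all levels and thus the counted classes between the outer points; it induces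
  an order isomorphism of the inner index sets, so the codes agree. In general only the images of
  \<open>A\<close> and of the outer points vary, and these form finite lists over a countable
  set.\<close>

lemma main:
  "\<exists>N. (\<forall>S::nat set. elem (N S)) \<and> (\<forall>S. countable {S'. \<exists>h. emb (N S') (N S) h})"
proof -
  obtain x y where xy: "base UNIV x y" and
    hom: "\<forall>F h. finite F \<longrightarrow> strict_mono_on F h \<longrightarrow> (\<exists>\<sigma>\<in>Au A. \<forall>q\<in>F. \<sigma> (x q) = x (h q) \<and> \<sigma> (y q) = y (h q))"
    using indiscernibles by (elim exE conjE)
  interpret indisc U r Dp A p0 E x y
    by unfold_locales (use xy hom in \<open>auto simp: base_def Einf_def\<close>)
  define Hk where "Hk = (\<lambda>S N x' y'. N \<subseteq> U \<and>
     (\<forall>Q e c. Dp A Q \<longrightarrow> e \<in> asg N \<longrightarrow> c \<in> U \<longrightarrow> Q (case_nat c e) \<longrightarrow> (\<exists>c\<in>N. Q (case_nat c e))) \<and>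
     (\<forall>i\<in>index S. P (x' i) \<and> x' i \<in> N \<and> y' i \<in> N \<and> r (x' i) < r (y' i) \<and> Einf (x' i) (y' i)) \<and>
     (\<forall>i\<in>index S. \<forall>j\<in>index S. i < j \<longrightarrow> r (x' i) < r (x' j) \<and> \<not> E 0 (x' i) (x' j)) \<and>
     (\<forall>z\<in>N. \<forall>w\<in>N. P z \<and> r (x' (- 1)) < r z \<and> r z < r (x' 1) \<and> r z < r w \<and> Einf z w \<longrightarrow> (\<exists>i\<in>index S. Einf z (x' i))))"
  have "\<exists>N x' y'. Hk S N x' y'" for S
    unfolding Hk_def by (rule henkin) (auto simp: index_def)
  then obtain N X Y where Hk: "\<And>S. Hk S (N S) (X S) (Y S)" by metis
  note H = Hk[unfolded Hk_def]
  have N: "N S \<subseteq> U" for S by (rule conjunct1[OF H])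
  note H1 = conjunct2[OF H]
  have TV: "\<forall>Q e c. Dp A Q \<longrightarrow> e \<in> asg (N S) \<longrightarrow> c \<in> U \<longrightarrow> Q (case_nat c e) \<longrightarrow> (\<exists>c\<in>N S. Q (case_nat c e))" for S
    by (rule conjunct1[OF H1])
  note H2 = conjunct2[OF H1]
  have X: "\<forall>i\<in>index S. P (X S i) \<and> X S i \<in> N S \<and> Y S i \<in> N S \<and> r (X S i) < r (Y S i) \<and> Einf (X S i) (Y S i)" for S
    by (rule conjunct1[OF H2])
  note H3 = conjunct2[OF H2]
  have Xl: "\<forall>i\<in>index S. \<forall>j\<in>index S. i < j \<longrightarrow> r (X S i) < r (X S j) \<and> \<not> E 0 (X S i) (X S j)" for S
    by (rule conjunct1[OF H3])
  have om: "\<forall>z\<in>N S. \<forall>w\<in>N S. P z \<and> r (X S (- 1)) < r z \<and> r z < r (X S 1) \<and> r z < r w \<and> Einf z w \<longrightarrow> (\<exists>i\<in>index S. Einf z (X S i))" for S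
    by (rule conjunct2[OF H3])
  have ends: "- 1 \<in> index S" "1 \<in> index S" for S by (simp_all add: index_def)
  have AN: "A \<subseteq> N S" for S
  proof
    fix a assume a: "a \<in> A"
    have "Dp A (\<lambda>e. e 0 = a)" by (rule D_equal[OF A(2) tmv tmc[OF a]])
    moreover have "(\<lambda>_. X S 1) \<in> asg (N S)" using X ends by simp
    ultimately have "\<exists>c\<in>N S. (\<lambda>e. e 0 = a) (case_nat c (\<lambda>_. X S 1))"
      using TV[of S, rule_format, of "\<lambda>e. e 0 = a" "\<lambda>_. X S 1" a] a A(2) by auto
    then show "a \<in> N S" by simp
  qed
  have el: "elem (N S)" for S unfolding elem_def
  proof (intro conjI allI impI N)
    show "N S \<noteq> {}" using X ends by blast
  next
    fix Q e c assume h: "Dp {} Q" "e \<in> asg (N S)" "c \<in> U" "Q (case_nat c e)"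
    have "Dp A Q" by (rule D_mono[OF h(1) _ A(2)]) simp
    then show "\<exists>c\<in>N S. Q (case_nat c e)" using TV[of S, THEN spec, THEN spec, THEN spec, THEN mp] h by blast
  qed
  have mid: "- 1 < i \<and> i < 1" if "i \<in> index S - {- 1, 1}" for i S
    using that squeeze_range code_pos by (auto simp: index_def)
  have rigid: "S = S'" if h: "emb (N S) (N S') h" "\<And>a. a \<in> A \<Longrightarrow> h a = a"
    "h (X S (- 1)) = X S' (- 1)" "h (X S 1) = X S' 1" for S S' h
  proof -
    have hD: "Q (\<lambda>i. h (e i)) = Q e" if "Dp A Q" "e \<in> asg (N S)" for Q e
      by (rule emb_Dp[OF A(1) h(1) N N AN h(2) that])
    have h1: "Q (\<lambda>_. h z) = Q (\<lambda>_. z)" if "Dp A Q" "z \<in> N S" for Q z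
      using hD[OF that(1) asg_const[OF that(2)]] .
    have h2: "Q (h z) (h w) = Q z w" if "Dp A (\<lambda>e. Q (e 0) (e 1))" "z \<in> N S" "w \<in> N S" for Q z w
      using hD[OF that(1), of "case_nat z (\<lambda>_. w)"] that by simp
    have hb: "bij_betw h (N S) (N S')" using h(1) by (simp add: emb_def)
    have hN: "h z \<in> N S'" "h z \<in> U" if "z \<in> N S" for z using hb N that by (auto simp: bij_betw_def)
    have hP: "P (h z) \<longleftrightarrow> P z" if "z \<in> N S" for z
      using h1[OF _ that] hN(2)[OF that] N that p0 by (auto simp: eqv_def)
    have hl: "r (h z) < r (h w) \<longleftrightarrow> r z < r w" if "z \<in> N S" "w \<in> N S" for z w
      using h2[where Q = "\<lambda>z w. r z < r w", OF D_lt[OF A(2)] that] .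
    have hE: "Einf (h z) (h w) \<longleftrightarrow> Einf z w" if "z \<in> N S" "w \<in> N S" for z w
      unfolding Einf_def using h2[where Q = "E k" for k, OF E_D that] by simp
    define I where "I = index S - {- 1, 1}"
    define I' where "I' = index S' - {- 1, 1}"
    have IX: "P (X S i)" "X S i \<in> N S" "Y S i \<in> N S" "r (X S i) < r (Y S i)" "Einf (X S i) (Y S i)"
      if "i \<in> index S" for i S using X[of S] that by auto
    have lt: "r (X S i) < r (X S j)" "\<not> E 0 (X S i) (X S j)" if "i \<in> index S" "j \<in> index S" "i < j" for i j S
      using Xl[of S] that by auto
    have uniq: "i = j" if "i \<in> index S" "j \<in> index S" "E 0 (X S i) (X S j)" for i j S
      using lt[of i S j] lt[of j S i] that E_sym[OF IX(1)] by (meson linorder_neqE_linordered_idom)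
    have iv: "r (X S (- 1)) < r (X S i)" "r (X S i) < r (X S 1)" "i \<in> index S" if "i \<in> index S - {- 1, 1}" for i S
      using lt ends that mid[OF that] by auto
    have find: "\<exists>j\<in>index T - {- 1, 1}. Einf z (X T j)"
      if z: "z \<in> N T" "w \<in> N T" "P z" "r (X T (- 1)) < r z" "r z < r (X T 1)" "r z < r w" "Einf z w"
        "\<not> Einf z (X T (- 1))" "\<not> Einf z (X T 1)" for T z w
      using om[of T] z by blast
    \<comment> \<open>The companion of \<open>X S i\<close> goes to a second point of the image
      class, so the omission property of \<open>N S'\<close> finds a chosen point in that class; the
      outer ones are excluded since \<open>i\<close> is not an end.\<close>
    have "\<exists>j\<in>I'. Einf (h (X S i)) (X S' j)" if i: "i \<in> I" for i
      unfolding I'_def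
    proof (rule find)
      have i': "i \<in> index S - {- 1, 1}" "i \<in> index S" using i by (auto simp: I_def)
      note m = IX[OF i'(2)] IX[OF ends(1)[of S]] IX[OF ends(2)[of S]]
      show "h (X S i) \<in> N S'" "h (Y S i) \<in> N S'" using hN m by auto
      show "P (h (X S i))" using hP m by blast
      show "r (X S' (- 1)) < r (h (X S i))" "r (h (X S i)) < r (X S' 1)"
        using hl[of "X S (- 1)" "X S i"] hl[of "X S i" "X S 1"] m iv[OF i'(1)] h by auto
      show "r (h (X S i)) < r (h (Y S i))" using hl m by blast
      show "Einf (h (X S i)) (h (Y S i))" using hE m by blast
      have "\<not> Einf (X S i) (X S (- 1))" "\<not> Einf (X S i) (X S 1)"
        using uniq[OF i'(2) ends(1)] uniq[OF i'(2) ends(2)] mid[OF i'(1)] by (auto simp: Einf_def)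
      then show "\<not> Einf (h (X S i)) (X S' (- 1))" "\<not> Einf (h (X S i)) (X S' 1)"
        using hE[of "X S i" "X S (- 1)"] hE[of "X S i" "X S 1"] m h by auto
    qed
    then obtain f where f: "\<And>i. i \<in> I \<Longrightarrow> f i \<in> I'" "\<And>i. i \<in> I \<Longrightarrow> Einf (h (X S i)) (X S' (f i))" by metis
    have IS: "i \<in> index S" if "i \<in> I" for i using that by (simp add: I_def)
    have IS': "i \<in> index S'" if "i \<in> I'" for i using that by (simp add: I'_def)
    have Ph: "P (h (X S i))" if "i \<in> I" for i using hP IX[OF IS[OF that]] by blast
    have mono: "f i < f j" if ij: "i \<in> I" "j \<in> I" "i < j" for i j
    proof (rule ccontr)
      assume n: "\<not> f i < f j"
      note f1 = f(1)[OF ij(1)] f(1)[OF ij(2)]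
      have ne: "\<not> E 0 (h (X S i)) (h (X S j))"
        using h2[where Q = "E 0", OF E_D] lt(2)[OF IS[OF ij(1)] IS[OF ij(2)] ij(3)] IX(2)[OF IS[OF ij(1)]] IX(2)[OF IS[OF ij(2)]] by blast
      have l: "r (h (X S i)) < r (h (X S j))"
        using hl lt(1)[OF IS[OF ij(1)] IS[OF ij(2)] ij(3)] IX(2)[OF IS[OF ij(1)]] IX(2)[OF IS[OF ij(2)]] by blast
      have e: "E 0 (h (X S i)) (X S' (f i))" "E 0 (h (X S j)) (X S' (f j))" using f(2) ij by (auto simp: Einf_def)
      have Pf: "P (X S' (f i))" "P (X S' (f j))" using IX(1)[OF IS'[OF f1(1)]] IX(1)[OF IS'[OF f1(2)]] by auto
      have "f j < f i \<or> f i = f j" using n by auto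
      then show False
      proof
        assume "f i = f j"
        then show False using e ne E_trans[OF Ph[OF ij(1)]] E_sym[OF Ph[OF ij(2)]] by metis
      next
        assume "f j < f i"
        then have l2: "r (X S' (f j)) < r (X S' (f i))" "\<not> E 0 (X S' (f j)) (X S' (f i))"
          using lt[OF IS'[OF f1(2)] IS'[OF f1(1)]] by auto
        show False
        proof (cases "r (h (X S j)) \<le> r (X S' (f i))")
          case True
          then show False using E_cvx[OF Ph[OF ij(1)] Ph[OF ij(2)] e(1)] l ne by simp
        next
          case False
          have "E 0 (X S' (f j)) (X S' (f i))"
            using E_cvx[OF Pf(2) Pf(1) E_sym[OF Ph[OF ij(2)] e(2)]] l2(1) False by simp
          then show False using l2 by blast
        qed
      qed
    qed
    have surj: "\<exists>i\<in>I. f i = j" if j: "j \<in> I'" for j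
    proof -
      have j': "j \<in> index S' - {- 1, 1}" "j \<in> index S'" using j by (auto simp: I'_def)
      note m = IX[OF j'(2)] IX[OF ends(1)[of S]] IX[OF ends(2)[of S]]
      obtain z w where zw: "z \<in> N S" "h z = X S' j" "w \<in> N S" "h w = Y S' j"
        using hb m(2,3) by (metis bij_betw_imp_surj_on imageE)
      have ne: "\<not> Einf (X S' j) (X S' (- 1))" "\<not> Einf (X S' j) (X S' 1)"
        using uniq[OF j'(2) ends(1)] uniq[OF j'(2) ends(2)] mid[OF j'(1)] by (auto simp: Einf_def)
      have "\<exists>i\<in>I. Einf z (X S i)" unfolding I_def
      proof (rule find)
        show "z \<in> N S" "w \<in> N S" using zw by auto
        show "P z" using hP[OF zw(1)] m zw by simp
        show "r (X S (- 1)) < r z" "r z < r (X S 1)"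
          using hl[of "X S (- 1)" z] hl[of z "X S 1"] iv[OF j'(1)] h zw m by auto
        show "r z < r w" "Einf z w" using hl[OF zw(1,3)] hE[OF zw(1,3)] zw m by auto
        show "\<not> Einf z (X S (- 1))" "\<not> Einf z (X S 1)"
          using hE[OF zw(1) m(7)] hE[OF zw(1) m(12)] zw h ne by auto
      qed
      then obtain i where i: "i \<in> I" "Einf z (X S i)" by blast
      have "Einf (X S' j) (h (X S i))" using hE[OF zw(1) IX(2)[OF IS[OF i(1)]]] i zw by simp
      then have "E 0 (X S' j) (X S' (f i))" using f(2)[OF i(1)] E_trans[OF m(1)] by (meson Einf_def)
      then have "j = f i" using uniq[OF j'(2) IS'[OF f(1)[OF i(1)]]] by blast
      then show ?thesis using i by blast
    qed
    have sm: "strict_mono_on I f" using mono by (auto intro!: strict_mono_onI)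
    have "f ` I = I'" using f(1) surj by blast
    then have "bij_betw f I I'" using strict_mono_on_imp_inj_on[OF sm] by (simp add: bij_betw_def)
    then show "S = S'" using index_rigid sm unfolding I_def I'_def by blast
  qed
  obtain as where as: "set as = A" using finite_list[OF A(1)] by blast
  have cnt: "countable {S'. \<exists>h. emb (N S') (N S) h}" for S
  proof -
    define h where "h = (\<lambda>S'. SOME h. emb (N S') (N S) h)"
    have h: "emb (N S') (N S) (h S')" if "\<exists>h. emb (N S') (N S) h" for S'
      unfolding h_def using that by (rule someI_ex)
    \<comment> \<open>If two embeddings into \<open>N S\<close> agree on these lists, then one
      followed by the inverse of the other fixes \<open>A\<close> and matches the outer points, so
      \<open>rigid\<close> applies.\<close>
    define t where "t = (\<lambda>S'. map (h S') (X S' (- 1) # X S' 1 # as))"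
    have "inj_on t {S'. \<exists>h. emb (N S') (N S) h}"
    proof (rule inj_onI)
      fix S1 S2 assume s: "S1 \<in> {S'. \<exists>h. emb (N S') (N S) h}" "S2 \<in> {S'. \<exists>h. emb (N S') (N S) h}" "t S1 = t S2"
      then have e: "emb (N S1) (N S) (h S1)" "emb (N S2) (N S) (h S2)" using h by auto
      have b: "bij_betw (h S1) (N S1) (N S)" "bij_betw (h S2) (N S2) (N S)" using e by (auto simp: emb_def)
      define g where "g = the_inv_into (N S2) (h S2) \<circ> h S1"
      have bi: "bij_betw (the_inv_into (N S2) (h S2)) (N S) (N S2)" by (rule bij_betw_the_inv_into[OF b(2)])
      have bg: "bij_betw g (N S1) (N S2)" unfolding g_def by (rule bij_betw_trans[OF b(1) bi])
      have hg: "h S2 (g z) = h S1 z" if "z \<in> N S1" for z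
        using f_the_inv_into_f_bij_betw[OF b(2)] bij_betw_apply[OF b(1) that] by (simp add: g_def)
      have gi: "g z = z'" if "z' \<in> N S2" "h S1 z = h S2 z'" for z z'
        using that the_inv_into_f_f[of "h S2" "N S2" z'] b(2) by (simp add: g_def bij_betw_def)
      have "emb (N S1) (N S2) g" unfolding emb_def
      proof (intro conjI allI impI bg)
        fix Q e' assume Q: "Dp {} Q" "e' \<in> asg (N S1)"
        have ge: "(\<lambda>i. g (e' i)) \<in> asg (N S2)" using Q(2) bij_betw_apply[OF bg] by (simp add: asg_def)
        have "Q (\<lambda>i. g (e' i)) = Q (\<lambda>i. h S2 (g (e' i)))" using e(2) Q(1) ge unfolding emb_def by blast
        also have "(\<lambda>i. h S2 (g (e' i))) = (\<lambda>i. h S1 (e' i))" using hg Q(2) by (simp add: asg_def)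
        also have "Q \<dots> = Q e'" using e(1) Q unfolding emb_def by blast
        finally show "Q (\<lambda>i. g (e' i)) = Q e'" .
      qed
      moreover have tt: "h S1 (X S1 (- 1)) = h S2 (X S2 (- 1))" "h S1 (X S1 1) = h S2 (X S2 1)"
        "\<And>a. a \<in> A \<Longrightarrow> h S1 a = h S2 a" using s(3) as by (auto simp: t_def)
      moreover have "X S2 i \<in> N S2" if "i \<in> index S2" for i using X that by blast
      ultimately show "S1 = S2" using AN ends by (intro rigid[of S1 S2 g]) (blast intro: gi)+
    qed
    moreover have "t ` {S'. \<exists>h. emb (N S') (N S) h} \<subseteq> lists U"
    proof (rule image_subsetI)
      fix S' assume "S' \<in> {S'. \<exists>h. emb (N S') (N S) h}"
      then have "bij_betw (h S') (N S') (N S)" using h by (auto simp: emb_def)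
      then have "h S' z \<in> U" if "z \<in> N S'" for z using bij_betw_apply[of "h S'"] that N by blast
      then show "t S' \<in> lists U" using X[of S'] ends[of S'] subsetD[OF AN[of S']] as by (auto simp: t_def)
    qed
    then have "countable (t ` {S'. \<exists>h. emb (N S') (N S) h})" using countable_lists[OF U_cnt] countable_subset by metis
    ultimately show ?thesis by (rule countable_image_inj_on[rotated])
  qed
  show ?thesis using el cnt by blast
qed

end

section \<open>The chain obtained from right-convex formulas\<close>

context restricted
begin

text \<open>Membership in \<open>CRF\<close> as a property of the predicate, with all conditions
  referred to the single realization \<open>q\<close>.\<close>

definition CR :: "'a set \<Rightarrow> 'a \<Rightarrow> ('a \<Rightarrow> 'a \<Rightarrow> bool) \<Rightarrow> bool" where
  "CR A q R \<longleftrightarrow> Dp A (\<lambda>e. R (e 0) (e 1)) \<and> R q q \<and> (\<forall>x\<in>U. R x q \<longrightarrow> r q \<le> r x) \<and>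
     (\<exists>y. eqv A q y \<and> y \<noteq> q \<and> R y q) \<and> (\<exists>g. eqv A q g \<and> r g < r q) \<and>
     (\<exists>g. eqv A q g \<and> (\<forall>x\<in>U. R x q \<longrightarrow> r x < r g)) \<and>
     (\<forall>a b c. eqv A q a \<and> eqv A q b \<and> eqv A q c \<and> R a q \<and> R b q \<and> r a < r c \<and> r c < r b \<longrightarrow> R c q)"

text \<open>The segment is closed downwards to its base point in the whole structure, not only
  within the type. Full segments at one point are nested.\<close>

definition full :: "('a \<Rightarrow> 'a \<Rightarrow> bool) \<Rightarrow> bool" where
  "full S \<longleftrightarrow> (\<forall>y x. S y x \<longrightarrow> r x \<le> r y \<and> (\<forall>z\<in>U. r x \<le> r z \<and> r z \<le> r y \<longrightarrow> S z x))"

lemma fullD: "full S \<Longrightarrow> S y x \<Longrightarrow> r x \<le> r y" "full S \<Longrightarrow> S y x \<Longrightarrow> z \<in> U \<Longrightarrow> r x \<le> r z \<Longrightarrow> r z \<le> r y \<Longrightarrow> S z x"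
  unfolding full_def by (elim allE[of _ y] allE[of _ x], simp)+

lemma CR_D: "CR A q R \<Longrightarrow> Dp A (\<lambda>e. R (e 0) (e 1))"
  and CR_q: "CR A q R \<Longrightarrow> R q q"
  and CR_ge: "CR A q R \<Longrightarrow> \<forall>x\<in>U. R x q \<longrightarrow> r q \<le> r x"
  and CR_more: "CR A q R \<Longrightarrow> \<exists>y. eqv A q y \<and> y \<noteq> q \<and> R y q"
  and CR_below: "CR A q R \<Longrightarrow> \<exists>g. eqv A q g \<and> r g < r q"
  and CR_above: "CR A q R \<Longrightarrow> \<exists>g. eqv A q g \<and> (\<forall>x\<in>U. R x q \<longrightarrow> r x < r g)"
  unfolding CR_def by (elim conjE, assumption)+

lemma CR_cv:
  assumes "CR A q R" "eqv A q a" "eqv A q b" "eqv A q c" "R a q" "R b q" "r a < r c" "r c < r b"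
  shows "R c q"
proof -
  have "\<forall>a b c. eqv A q a \<and> eqv A q b \<and> eqv A q c \<and> R a q \<and> R b q \<and> r a < r c \<and> r c < r b \<longrightarrow> R c q"
    using assms(1) unfolding CR_def by (elim conjE)
  from this[THEN spec[of _ a], THEN spec[of _ b], THEN spec[of _ c]] show ?thesis using assms(2-8) by simp
qed

lemma CR_gen:
  assumes "finite A" "A \<subseteq> U" "q \<in> U" "CR A q R" "eqv A q a" "eqv A q b" "R b a" "x \<in> U" "r b \<le> r x"
  shows "R x a = R x b"
proof -
  have "\<forall>a b x. eqv A q a \<and> eqv A q b \<and> R b a \<and> x \<in> U \<and> r b \<le> r x \<longrightarrow> R x a = R x b"
    by (rule R3r[unfolded P3_def, THEN spec[of _ A], THEN spec[of _ R], THEN spec[of _ q], THEN mp])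
      (insert assms(1-3) assms(4)[unfolded CR_def], elim conjE, intro conjI, assumption+)
  from this[THEN spec[of _ a], THEN spec[of _ b], THEN spec[of _ x]] show ?thesis using assms(5-9) by simp
qed

text \<open>The trace is convex only in the type, and points outside the type may interrupt it. By
  compactness some formula \<open>D\<close> of the type of \<open>q\<close> already forces convexity
  above \<open>q\<close> among its solutions; \<open>S\<close> consists of the points up to a
  solution of \<open>R\<close> in \<open>D\<close>.\<close>

lemma CR_cut:
  assumes A: "finite A" "A \<subseteq> U" and q: "q \<in> U" and R: "CR A q R"
  shows "\<exists>S. CR A q S \<and> full S \<and> (\<forall>y. eqv A q y \<longrightarrow> S y q = R y q)"
proof -
  note RD = CR_D[OF R] and Rq = CR_q[OF R]
  have Rge: "r q \<le> r x" if "x \<in> U" "R x q" for x using CR_ge[OF R] that by simp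
  have Rcv: "R c q" if "eqv A q b" "eqv A q c" "R b q" "r q < r c" "r c < r b" for b c
    by (rule CR_cv[OF R eqv_refl[OF q] that(1,2) Rq that(3-5)])
  define B where "B = insert q A"
  have B: "finite B" "A \<subseteq> B" "B \<subseteq> U" "q \<in> B" using A q by (auto simp: B_def)
  \<comment> \<open>A violation of convexity by the values of variables 0 and 1. It cannot be
    realized with both values in the type of \<open>q\<close>, and \<open>omega_sat\<close> turns
    this into a finite set of formulas.\<close>
  define b0 where "b0 = (\<lambda>e::nat \<Rightarrow> 'a. r q \<le> r (e 0) \<and> r (e 0) \<le> r (e 1) \<and> R (e 1) q \<and> \<not> R (e 0) q)"
  define pp where "pp = (\<lambda>D (e::nat \<Rightarrow> 'a). D (e 0) \<and> (D (e 1) :: bool))"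
  define DD where "DD = {D. Dp A (\<lambda>e. D (e 0)) \<and> D q}"
  have Dpp: "Dp A (pp D)" if "D \<in> DD" for D
  proof -
    have D: "Dp A (\<lambda>e. D (e 0))" using that by (simp add: DD_def)
    show ?thesis unfolding pp_def by (rule D_conj[OF D1[OF D tmv] D1[OF D tmv]])
  qed
  have "\<not> (\<exists>e\<in>AS. \<forall>Q\<in>insert b0 (pp ` DD). Q e)"
  proof
    assume "\<exists>e\<in>AS. \<forall>Q\<in>insert b0 (pp ` DD). Q e"
    then obtain e where e: "e \<in> AS" "\<forall>Q\<in>insert b0 (pp ` DD). Q e" by (rule bexE)
    have ppe: "pp D e" if "D \<in> DD" for D using bspec[OF e(2), of "pp D"] that by simp
    have "eqv A q (e i)" if i: "i = 0 \<or> i = 1" for i :: nat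
      unfolding eqv_def
    proof (intro conjI allI impI q asgD[OF e(1)])
      have one: "D (\<lambda>_. e i)" if D: "Dp A D" "D (\<lambda>_. q)" for D
      proof -
        have "(\<lambda>a. D (\<lambda>_. a)) \<in> DD" using D_ren[OF D(1), of "\<lambda>_. 0"] D(2) by (simp add: DD_def)
        from ppe[OF this] show ?thesis using i by (auto simp: pp_def)
      qed
      show "D (\<lambda>_. q) = D (\<lambda>_. e i)" if "Dp A D" for D using one[OF that] one[OF D_neg[OF that]] by blast
    qed
    then have P: "eqv A q (e 0)" "eqv A q (e 1)" by auto
    have b: "r q \<le> r (e 0)" "r (e 0) \<le> r (e 1)" "R (e 1) q" "\<not> R (e 0) q"
      using bspec[OF e(2), of b0] by (simp_all add: b0_def)
    have "r q \<noteq> r (e 0)" "r (e 0) \<noteq> r (e 1)" using r_eq[OF q asgD[OF e(1), of 0]] r_eq[OF asgD[OF e(1)] asgD[OF e(1)], of 0 1] b Rq by auto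
    then show False using Rcv[OF P(2,1) b(3)] b by simp
  qed
  moreover have "Dp B Q" if "Q \<in> insert b0 (pp ` DD)" for Q
  proof -
    have "Dp B b0" unfolding b0_def by (intro Dintros D2[OF D_mono[OF RD B(2,3)]] tmc B(3,4))
    then show ?thesis using that D_mono[OF Dpp B(2,3)] by blast
  qed
  ultimately have "\<not> (\<forall>G. G \<subseteq> insert b0 (pp ` DD) \<longrightarrow> finite G \<longrightarrow> (\<exists>e\<in>AS. \<forall>Q\<in>G. Q e))"
    using omega_sat[OF B(1,3), of "insert b0 (pp ` DD)"] by (elim contrapos_nn) simp
  then obtain G where G: "G \<subseteq> insert b0 (pp ` DD)" "finite G" "\<not> (\<exists>e\<in>AS. \<forall>Q\<in>G. Q e)" by blast
  obtain K where K: "K \<subseteq> DD" "finite K" "G \<inter> pp ` DD = pp ` K"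
    using finite_subset_image[of "G \<inter> pp ` DD" pp DD] G by auto
  define D where "D = (\<lambda>a. \<forall>D\<in>K. D a)"
  have DD: "Dp A (\<lambda>e. D (e 0))" unfolding D_def using K A by (intro D_Ball) (auto simp: DD_def)
  have Dq: "D q" using K(1) by (auto simp: D_def DD_def)
  have key: "R v q" if h: "v \<in> U" "y \<in> U" "D v" "D y" "r q \<le> r v" "r v \<le> r y" "R y q" for v y
  proof (rule ccontr)
    assume n: "\<not> R v q"
    define e where "e = (\<lambda>i::nat. if i = 0 then v else y)"
    have "e \<in> AS" using h by (simp add: e_def asg_def)
    moreover have "Q e" if Q: "Q \<in> G" for Q
    proof (cases "Q = b0")
      case True then show ?thesis using h n by (simp add: b0_def e_def)
    next
      case False
      then have "Q \<in> pp ` K" using Q G(1) K(3) by blast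
      then obtain D' where "D' \<in> K" "Q = pp D'" by blast
      moreover have "D' v" "D' y" using bspec[OF h(3)[unfolded D_def] calculation(1)] bspec[OF h(4)[unfolded D_def] calculation(1)] .
      ultimately show ?thesis by (simp add: pp_def e_def)
    qed
    ultimately show False using G(3) by blast
  qed
  have PD: "D y" if "eqv A q y" for y using eqv_1[OF that DD] Dq by simp
  define S where "S = (\<lambda>y x. r x \<le> r y \<and> (\<exists>w\<in>U. D w \<and> R w x \<and> r y \<le> r w))"
  have SR: "S y q = R y q" if y: "eqv A q y" for y
  proof
    assume "S y q"
    then obtain w where "r q \<le> r y" "w \<in> U" "D w" "R w q" "r y \<le> r w" by (auto simp: S_def)
    then show "R y q" using key[of y w] PD[OF y] eqv_U[OF y] by blast
  next
    assume "R y q"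
    then show "S y q" using Rge eqv_U[OF y] PD[OF y] by (auto simp: S_def)
  qed
  have fS: "full S" unfolding full_def S_def using order_trans by blast
  have "CR A q S" unfolding CR_def
  proof (intro conjI)
    show "Dp A (\<lambda>e. S (e 0) (e 1))" unfolding S_def
      by (intro Dintros D2[OF RD] D1[OF DD] A(2))
    show "S q q" using SR[of q] q Rq by simp
    show "\<forall>x\<in>U. S x q \<longrightarrow> r q \<le> r x" by (simp add: S_def)
    show "\<exists>y. eqv A q y \<and> y \<noteq> q \<and> S y q" using CR_more[OF R] SR by blast
    show "\<exists>g. eqv A q g \<and> r g < r q" by (rule CR_below[OF R])
    obtain g where "eqv A q g" "\<forall>x\<in>U. R x q \<longrightarrow> r x < r g" using CR_above[OF R] by blast
    then show "\<exists>g. eqv A q g \<and> (\<forall>x\<in>U. S x q \<longrightarrow> r x < r g)"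
      by (intro exI[of _ g]) (auto simp: S_def intro: order_le_less_trans)
    show "\<forall>a b c. eqv A q a \<and> eqv A q b \<and> eqv A q c \<and> S a q \<and> S b q \<and> r a < r c \<and> r c < r b \<longrightarrow> S c q"
    proof (intro allI impI, elim conjE)
      fix a b c assume "eqv A q c" "S a q" "S b q" "r a < r c" "r c < r b"
      then show "S c q" using fullD(2)[OF fS, of b q c] fullD(1)[OF fS, of a q] eqv_U by simp
    qed
  qed
  then show ?thesis using fS SR by blast
qed

text \<open>Nontriviality survives because the lower of the two witnesses above \<open>q\<close>
  lies in both segments.\<close>

lemma CR_conj:
  assumes R: "CR A q R" "full R" and S: "CR A q S" "full S"
  shows "CR A q (\<lambda>y x. R y x \<and> S y x)" "full (\<lambda>y x. R y x \<and> S y x)"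
proof -
  show "full (\<lambda>y x. R y x \<and> S y x)" using R(2) S(2) unfolding full_def by blast
  note g = CR_above[OF R(1)] and c = CR_q[OF R(1)] CR_q[OF S(1)] CR_ge[OF R(1)]
    and d = CR_below[OF R(1)] and D = CR_D[OF R(1)] CR_D[OF S(1)]
  obtain y where y: "eqv A q y" "y \<noteq> q" "R y q" using CR_more[OF R(1)] by blast
  obtain z where z: "eqv A q z" "z \<noteq> q" "S z q" using CR_more[OF S(1)] by blast
  show "CR A q (\<lambda>y x. R y x \<and> S y x)" unfolding CR_def
  proof (intro conjI D_conj D c d)
    show "\<forall>x\<in>U. R x q \<and> S x q \<longrightarrow> r q \<le> r x" using c(3) by blast
    show "\<exists>y. eqv A q y \<and> y \<noteq> q \<and> R y q \<and> S y q"
    proof (cases "r y \<le> r z")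
      case True
      then have "S y q" using fullD[OF S(2)] fullD(1)[OF R(2) y(3)] z(3) eqv_U[OF y(1)] by blast
      then show ?thesis using y by blast
    next
      case False
      then have "R z q" using fullD(2)[OF R(2) y(3), of z] fullD(1)[OF S(2) z(3)] eqv_U[OF z(1)] by simp
      then show ?thesis using z by blast
    qed
    show "\<exists>g. eqv A q g \<and> (\<forall>x\<in>U. R x q \<and> S x q \<longrightarrow> r x < r g)" using g by blast
    show "\<forall>a b c. eqv A q a \<and> eqv A q b \<and> eqv A q c \<and> (R a q \<and> S a q) \<and> (R b q \<and> S b q) \<and> r a < r c \<and> r c < r b \<longrightarrow> R c q \<and> S c q"
    proof (intro allI impI, elim conjE)
      fix a b c assume h: "eqv A q a" "eqv A q b" "eqv A q c" "R a q" "S a q" "R b q" "S b q" "r a < r c" "r c < r b"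
      show "R c q \<and> S c q" using CR_cv[OF R(1) h(1-3,4,6,8,9)] CR_cv[OF S(1) h(1-3,5,7,8,9)] by (rule conjI)
    qed
  qed
qed

text \<open>Full segments are chosen along an enumeration \<open>an\<close> of the structure: step
  \<open>n\<close> shrinks the trace and, if some right-convex formula omits the point
  \<open>an n\<close> of the type, omits it too. Coinitiality follows: a given formula is not least,
  so another one omits some point \<open>z\<close> of it, and once \<open>z\<close> has been
  enumerated the segments end before \<open>z\<close>, inside the given formula. The relations are
  the symmetrized segments from the second level on, since the first levels are spent on keeping
  both halves of a class inside the type.\<close>

theorem chain_exists:
  assumes A: "finite A" "A \<subseteq> U" and q: "q \<in> U" and ne: "CR A q R0"
    and noleast: "\<And>R. CR A q R \<Longrightarrow> \<exists>R'. CR A q R' \<and> (\<exists>y. eqv A q y \<and> R y q \<and> \<not> R' y q)"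
  shows "\<exists>E. chain U r Dp A q E"
proof -
  let ?P = "eqv A q"
  define an where "an = from_nat_into U"
  have an: "range an = U" unfolding an_def using U_ne U_cnt by (rule range_from_nat_into)
  define ok where "ok = (\<lambda>S. CR A q S \<and> full S)"
  define nx where "nx = (\<lambda>n S S'. (\<forall>y x. S' y x \<longrightarrow> S y x) \<and> (\<exists>y. ?P y \<and> S y q \<and> \<not> S' y q) \<and>
    ((\<exists>R. CR A q R \<and> ?P (an n) \<and> \<not> R (an n) q) \<longrightarrow> \<not> S' (an n) q))"
  have cut: "\<exists>S. ok S \<and> (\<forall>y. ?P y \<longrightarrow> S y q = R y q)" if "CR A q R" for R
    using CR_cut[OF A q that] unfolding ok_def by blast
  have step: "\<exists>S'. ok S' \<and> nx n S S'" if S: "ok S" for n S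
  proof -
    obtain R1 y where R1: "CR A q R1" "?P y" "S y q" "\<not> R1 y q" using noleast[of S] S unfolding ok_def by blast
    obtain S1 where S1: "ok S1" "\<forall>y. ?P y \<longrightarrow> S1 y q = R1 y q" using cut[OF R1(1)] by blast
    define R2 where "R2 = (if \<exists>R. CR A q R \<and> ?P (an n) \<and> \<not> R (an n) q then SOME R. CR A q R \<and> ?P (an n) \<and> \<not> R (an n) q else R1)"
    have R2: "CR A q R2 \<and> ((\<exists>R. CR A q R \<and> ?P (an n) \<and> \<not> R (an n) q) \<longrightarrow> ?P (an n) \<and> \<not> R2 (an n) q)"
    proof (cases "\<exists>R. CR A q R \<and> ?P (an n) \<and> \<not> R (an n) q")
      case True
      then show ?thesis unfolding R2_def if_P[OF True] using someI_ex[OF True] by blast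
    next
      case False
      then show ?thesis unfolding R2_def if_not_P[OF False] using R1(1) False by blast
    qed
    obtain S2 where S2: "ok S2" "\<forall>y. ?P y \<longrightarrow> S2 y q = R2 y q" using cut[of R2] R2 by blast
    define S' where "S' = (\<lambda>y x. S y x \<and> (S1 y x \<and> S2 y x))"
    have "ok (\<lambda>y x. S1 y x \<and> S2 y x)" using CR_conj[of A q S1 S2] S1(1) S2(1) unfolding ok_def by blast
    then have "ok S'" using CR_conj[of A q S "\<lambda>y x. S1 y x \<and> S2 y x"] S unfolding ok_def S'_def by blast
    moreover have "nx n S S'" unfolding nx_def
    proof (intro conjI)
      show "\<forall>y x. S' y x \<longrightarrow> S y x" by (simp add: S'_def)
      show "\<exists>y. ?P y \<and> S y q \<and> \<not> S' y q" using R1 S1(2) by (intro exI[of _ y]) (simp add: S'_def)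
      show "(\<exists>R. CR A q R \<and> ?P (an n) \<and> \<not> R (an n) q) \<longrightarrow> \<not> S' (an n) q"
      proof
        assume ex: "\<exists>R. CR A q R \<and> ?P (an n) \<and> \<not> R (an n) q"
        note R2an = mp[OF conjunct2[OF R2] ex]
        have "\<not> S2 (an n) q" using S2(2)[rule_format, OF conjunct1[OF R2an]] conjunct2[OF R2an] by simp
        then show "\<not> S' (an n) q" by (simp add: S'_def)
      qed
    qed
    ultimately show ?thesis by blast
  qed
  have "\<exists>S. \<forall>n. ok (S n) \<and> nx n (S n) (S (Suc n))"
    by (rule dependent_nat_choice) (use cut[OF ne] step in blast)+
  then obtain S where S: "\<And>n. ok (S n)" "\<And>n. nx n (S n) (S (Suc n))" by blast
  have CS: "CR A q (S k)" and fS: "full (S k)" for k using S(1)[of k] by (simp_all add: ok_def)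
  note SD = CR_D[OF CS]
  note f1 = fullD(1)[OF fS] and f2 = fullD(2)[OF fS]
  have dec: "S k y x" if "S (Suc k) y x" for k y x using S(2)[of k] that unfolding nx_def by blast
  have PU: "a \<in> U" if "?P a" for a using that eqv_U by blast
  have PP: "eqv A a b" if "?P a" "?P b" for a b using that eqv_trans eqv_sym by blast
  have mv: "\<exists>\<sigma>\<in>Au A. \<sigma> a = b" if "?P a" "?P b" for a b using PP[OF that] eqv_iff[OF A] by blast
  have SA: "S k (\<sigma> y) (\<sigma> x) = S k y x" if "\<sigma> \<in> Au A" "y \<in> U" "x \<in> U" for \<sigma> k x y
    using Au_2[OF A(1) that(1) SD that(2,3)] .
  have PA: "?P (\<sigma> a)" if "\<sigma> \<in> Au A" "?P a" for \<sigma> a using eqv_Au[OF A that(1) PU[OF that(2)]] that(2) eqv_trans by blast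
  have Sr: "S k a a" if h: "?P a" for k a
  proof -
    obtain \<sigma> where \<sigma>: "\<sigma> \<in> Au A" "\<sigma> q = a" using mv[OF eqv_refl[OF q] h] by blast
    have "S k q q" by (rule CR_q[OF CS])
    then show ?thesis using SA[OF \<sigma>(1) q q] \<sigma> by simp
  qed
  have gen: "S k x a = S k x b" if "?P a" "?P b" "S k b a" "x \<in> U" "r b \<le> r x" for k a b x
    using CR_gen[OF A q CS that] .
  have up1: "\<exists>b. ?P b \<and> r a < r b \<and> S k b a \<and> \<not> S (Suc k) b a"
    and dn1: "\<exists>b. ?P b \<and> r b < r a \<and> S k a b \<and> \<not> S (Suc k) a b" if a: "?P a" for a k
  proof -
    obtain y where y: "?P y" "S k y q" "\<not> S (Suc k) y q" using S(2)[of k] unfolding nx_def by blast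
    have "y \<noteq> q" using y Sr[of q] q by auto
    then have yq: "r q < r y" using f1[OF y(2)] r_eq[OF q PU[OF y(1)]] by force
    obtain \<sigma> where \<sigma>: "\<sigma> \<in> Au A" "\<sigma> q = a" using mv[OF eqv_refl[OF q] a] by blast
    obtain \<tau> where \<tau>: "\<tau> \<in> Au A" "\<tau> y = a" using mv[OF y(1) a] by blast
    show "\<exists>b. ?P b \<and> r a < r b \<and> S k b a \<and> \<not> S (Suc k) b a"
      using SA[OF \<sigma>(1) PU[OF y(1)] q] Au_lt[OF \<sigma>(1) q PU[OF y(1)]] PA[OF \<sigma>(1) y(1)] y yq \<sigma>
      by (intro exI[of _ "\<sigma> y"]) auto
    show "\<exists>b. ?P b \<and> r b < r a \<and> S k a b \<and> \<not> S (Suc k) a b"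
      using SA[OF \<tau>(1) PU[OF y(1)] q] Au_lt[OF \<tau>(1) q PU[OF y(1)]] PA[OF \<tau>(1) eqv_refl[OF q]] y yq \<tau>
      by (intro exI[of _ "\<tau> q"]) auto
  qed
  have out: "\<exists>g. ?P g \<and> (\<forall>x\<in>U. S k x a \<longrightarrow> r x < r g)"
    and outd: "\<exists>g. ?P g \<and> r g < r a \<and> \<not> S k a g" if a: "?P a" for a k
  proof -
    obtain g where g: "?P g" "\<forall>x\<in>U. S k x q \<longrightarrow> r x < r g" using CR_above[OF CS[of k]] by blast
    obtain \<sigma> where \<sigma>: "\<sigma> \<in> Au A" "\<sigma> a = q" using mv[OF a eqv_refl[OF q]] by blast
    obtain \<sigma>' where \<sigma>': "\<sigma>' \<in> Au A" "\<And>u. u \<in> U \<Longrightarrow> \<sigma>' (\<sigma> u) = u" "\<And>u. u \<in> U \<Longrightarrow> \<sigma> (\<sigma>' u) = u"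
      using Au_inv[OF \<sigma>(1) A(2)] by blast
    have "r x < r (\<sigma>' g)" if x: "x \<in> U" "S k x a" for x
    proof -
      have "r (\<sigma> x) < r (\<sigma> (\<sigma>' g))" using g(2) SA[OF \<sigma>(1) x(1) PU[OF a]] x \<sigma> \<sigma>'(3)[OF PU[OF g(1)]] by simp
      then show ?thesis using Au_lt[OF \<sigma>(1) x(1)] \<sigma>'(1) PU[OF g(1)] by simp
    qed
    then show "\<exists>g. ?P g \<and> (\<forall>x\<in>U. S k x a \<longrightarrow> r x < r g)" using PA[OF \<sigma>'(1) g(1)] by blast
    obtain \<tau> where \<tau>: "\<tau> \<in> Au A" "\<tau> g = a" using mv[OF g(1) a] by blast
    have qg: "r q < r g" using g(2) q Sr[OF eqv_refl[OF q]] by blast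
    have "\<not> S k g q" using g PU by blast
    then show "\<exists>g. ?P g \<and> r g < r a \<and> \<not> S k a g"
      using SA[OF \<tau>(1) PU[OF g(1)] q] Au_lt[OF \<tau>(1) q PU[OF g(1)]] PA[OF \<tau>(1) eqv_refl[OF q]] qg \<tau>
      by (intro exI[of _ "\<tau> q"]) auto
  qed
  have below: "\<exists>g. ?P g \<and> r g < r q" by (rule CR_below[OF CS[of 0]])
  \<comment> \<open>If \<open>y\<close> has another type, a formula \<open>D\<close> separates it,
    and \<open>R\<close> agrees with \<open>S k\<close> on the type. Then \<open>a\<close> is in
    \<open>R\<close> at \<alpha> and \<open>y\<close> is in \<open>R\<close> at \<open>a\<close>,
    but not at \<alpha>, as the segment \<open>S (Suc k)\<close> at \<alpha> ends before
    \<open>a\<close>; this violates \<open>R3r\<close>.\<close>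
  have up: "?P y" if y: "S (Suc k) y a" "?P a" "y \<in> U" for k y a
  proof (rule ccontr)
    assume n: "\<not> ?P y"
    obtain D where D: "Dp A (\<lambda>e. D (e 0))" "D y" "\<And>w. ?P w \<Longrightarrow> \<not> D w" using eqv_neq[OF n q y(3)] by blast
    define R where "R = (\<lambda>u c. S k u c \<and> (D u \<longrightarrow> S (Suc k) u c))"
    obtain \<alpha> where \<alpha>: "?P \<alpha>" "r \<alpha> < r a" "S k a \<alpha>" "\<not> S (Suc k) a \<alpha>" using dn1[OF y(2)] by blast
    obtain y0 where y0: "?P y0" "r q < r y0" "S k y0 q" using up1[OF eqv_refl[OF q]] by blast
    obtain g where g: "?P g" "r g < r q" using below by blast
    obtain g' where g': "?P g'" "\<forall>x\<in>U. S k x q \<longrightarrow> r x < r g'" using out[OF eqv_refl[OF q]] by blast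
    have "R y \<alpha> = R y a"
    proof (rule P3D[OF R3r A, where q = q and y = y0 and g = g and g' = g'])
      show "Dp A (\<lambda>e. R (e 0) (e 1))" unfolding R_def by (intro D_conj D_imp SD D1[OF D(1)] tmv)
      show "R q q" using Sr[OF eqv_refl[OF q]] by (simp add: R_def)
      show "r q \<le> r x" if h: "R x q" for x using f1[of k x q] h by (simp add: R_def)
      show "?P y0" "y0 \<noteq> q" "R y0 q" using y0 D(3) by (auto simp: R_def)
      show "?P g" "r g < r q" "?P g'" by fact+
      show "r x < r g'" if "x \<in> U" "R x q" for x using that g' by (simp add: R_def)
      show "R c q" if "?P c" "R a' q" "R b q" "r a' < r c" "r c < r b" for a' b c
        using that D(3) f2[of k b q c] f1[of k a' q] PU by (auto simp: R_def)
      show "?P \<alpha>" "?P a" "R a \<alpha>" "y \<in> U" "r a \<le> r y" using \<alpha> y D(3) f1[OF y(1)] by (auto simp: R_def)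
    qed
    moreover have "R y a" using y(1) dec by (simp add: R_def)
    ultimately have "S (Suc k) y \<alpha>" using D(2) by (simp add: R_def)
    then show False using f2[of "Suc k" y \<alpha> a] \<alpha> PU[OF y(2)] f1[OF y(1)] by simp
  qed
  \<comment> \<open>The segment relation seen from its upper end. All points \<open>v\<close> from
    \<open>b\<close> up to \<open>a\<close>, also those outside the type, must have \<open>a\<close>
    in their segment; this makes the solutions \<open>b\<close> for fixed \<open>a\<close> a convex
    set with right end \<open>a\<close>.\<close>
  define psi where "psi = (\<lambda>k b a. r b \<le> r a \<and> (\<forall>v\<in>U. r b \<le> r v \<longrightarrow> r v \<le> r a \<longrightarrow> S k a v))"
  have psiD: "Dp A (\<lambda>e. psi k (e 0) (e 1))" for k unfolding psi_def
    by (intro Dintros D2[OF SD] A(2))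
  have psiS: "S k a b" if "psi k b a" "b \<in> U" for k a b using that by (simp add: psi_def)
  have Spsi: "psi (Suc k) b a" if "S (Suc k) a b" "?P a" "?P b" for k a b
    unfolding psi_def
  proof (intro conjI ballI impI)
    show "r b \<le> r a" using f1[OF that(1)] .
    fix v assume v: "v \<in> U" "r b \<le> r v" "r v \<le> r a"
    have vb: "S (Suc k) v b" using f2[OF that(1)] v by blast
    have Pv: "?P v" using up[OF vb that(3) v(1)] .
    show "S (Suc k) a v" using gen[OF that(3) Pv vb PU[OF that(2)] v(3)] that(1) by simp
  qed
  have psi_dec: "psi k b a" if "psi (Suc k) b a" for k a b using that dec unfolding psi_def by blast
  have psi_cv: "psi k c a" if "psi k b a" "r b \<le> r c" "r c \<le> r a" for k a b c
    using that order_trans unfolding psi_def by blast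
  have down: "?P y" if y: "psi (Suc (Suc k)) y a" "?P a" "y \<in> U" for k y a
  proof (rule ccontr)
    assume n: "\<not> ?P y"
    obtain D where D: "Dp A (\<lambda>e. D (e 0))" "D y" "\<And>w. ?P w \<Longrightarrow> \<not> D w" using eqv_neq[OF n q y(3)] by blast
    define R where "R = (\<lambda>u c. psi (Suc k) u c \<and> (D u \<longrightarrow> psi (Suc (Suc k)) u c))"
    obtain \<alpha> where \<alpha>: "?P \<alpha>" "r a < r \<alpha>" "S (Suc k) \<alpha> a" "\<not> S (Suc (Suc k)) \<alpha> a" using up1[OF y(2)] by blast
    obtain y0 where y0: "?P y0" "r y0 < r q" "S (Suc k) q y0" using dn1[OF eqv_refl[OF q]] by blast
    obtain g where g: "?P g" "r q < r g" using up1[OF eqv_refl[OF q]] by blast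
    obtain g' where g': "?P g'" "r g' < r q" "\<not> S (Suc k) q g'" using outd[OF eqv_refl[OF q]] by blast
    have Pq: "?P q" using q by simp
    have "R y \<alpha> = R y a"
    proof (rule P3D[OF R3l A, where q = q and y = y0 and g = g and g' = g'])
      show "Dp A (\<lambda>e. R (e 0) (e 1))" unfolding R_def by (intro D_conj D_imp psiD D1[OF D(1)] tmv)
      show "R q q" using Spsi[OF Sr[OF Pq] Pq Pq] by (simp add: R_def)
      show "- r q \<le> - r x" if "R x q" for x using that by (simp add: R_def psi_def)
      show "?P y0" "y0 \<noteq> q" "R y0 q" using y0 D(3) Spsi[OF y0(3) Pq y0(1)] by (auto simp: R_def)
      show "?P g" "- r g < - r q" "?P g'" using g g' by auto
      show "- r x < - r g'" if x: "R x q" for x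
      proof (rule ccontr)
        assume "\<not> - r x < - r g'"
        then have "S (Suc k) q g'" using x g' PU[OF g'(1)] by (simp add: R_def psi_def)
        then show False using g' by blast
      qed
      show "R c q" if "?P c" "R a' q" "R b q" "- r a' < - r c" "- r c < - r b" for a' b c
      proof -
        have "r a' \<le> r q" using that(2) by (simp add: R_def psi_def)
        then show ?thesis using that D(3) psi_cv[of "Suc k" b q c] by (auto simp: R_def)
      qed
      show "?P \<alpha>" "?P a" "y \<in> U" "- r a \<le> - r y" using \<alpha> y by (auto simp: psi_def)
      show "R a \<alpha>" using Spsi[OF \<alpha>(3,1) y(2)] D(3)[OF y(2)] by (simp add: R_def)
    qed
    moreover have "R y a" using y(1) psi_dec by (simp add: R_def)
    ultimately have "psi (Suc (Suc k)) y \<alpha>" using D(2) by (simp add: R_def)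
    then show False using \<alpha> y PU[OF y(2)] by (simp add: psi_def)
  qed
  \<comment> \<open>At level \<open>Suc (Suc k)\<close> both \<open>up\<close> and
    \<open>down\<close> apply, so classes stay inside the type on both sides.\<close>
  define E where "E = (\<lambda>k a b. a \<in> U \<and> b \<in> U \<and> (psi (Suc (Suc k)) a b \<or> psi (Suc (Suc k)) b a))"
  have EP: "E k a b \<longleftrightarrow> S (Suc (Suc k)) b a" if ab: "?P a" "?P b" "r a \<le> r b" for k a b
  proof
    assume "E k a b"
    then consider "psi (Suc (Suc k)) a b" | "psi (Suc (Suc k)) b a" by (auto simp: E_def)
    then show "S (Suc (Suc k)) b a"
    proof cases
      case 1 then show ?thesis using psiS PU ab by blast
    next
      case 2
      then have "a = b" using ab r_eq PU unfolding psi_def by force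
      then show ?thesis using Sr ab by blast
    qed
  next
    assume "S (Suc (Suc k)) b a"
    then show "E k a b" using Spsi ab PU by (simp add: E_def)
  qed
  have Esym: "E k a b \<Longrightarrow> E k b a" for k a b by (auto simp: E_def)
  have EinP: "?P b" if "?P a" "E k a b" for k a b
  proof -
    from that(2) consider "psi (Suc (Suc k)) a b" | "psi (Suc (Suc k)) b a" by (auto simp: E_def)
    then show ?thesis
    proof cases
      case 1 then show ?thesis using up[of "Suc k" b a] psiS that PU by (auto simp: E_def)
    next
      case 2 then show ?thesis using down that by (auto simp: E_def)
    qed
  qed
  have Etr: "E k a c" if h: "?P a" "E k a b" "E k b c" for k a b c
  proof -
    have P: "?P a" "?P b" "?P c" using h EinP by blast+
    note U3 = PU[OF P(1)] PU[OF P(2)] PU[OF P(3)]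
    let ?S = "S (Suc (Suc k))"
    have ab: "r a \<le> r b \<Longrightarrow> ?S b a" "r b \<le> r a \<Longrightarrow> ?S a b" using EP[OF P(1,2)] EP[OF P(2,1)] h Esym by blast+
    have bc: "r b \<le> r c \<Longrightarrow> ?S c b" "r c \<le> r b \<Longrightarrow> ?S b c" using EP[OF P(2,3)] EP[OF P(3,2)] h Esym by blast+
    consider "r a \<le> r b" "r b \<le> r c" | "r a \<le> r c" "r c \<le> r b" | "r b \<le> r a" "r a \<le> r c"
      | "r b \<le> r c" "r c \<le> r a" | "r c \<le> r a" "r a \<le> r b" | "r c \<le> r b" "r b \<le> r a" by linarith
    then show ?thesis
    proof cases
      case 1 then show ?thesis using EP[OF P(1,3)] gen[OF P(1,2) ab(1) U3(3)] bc by simp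
    next
      case 2 then show ?thesis using EP[OF P(1,3)] f2[OF ab(1) U3(3)] by simp
    next
      case 3 then show ?thesis using EP[OF P(1,3)] gen[OF P(2,1) ab(2) U3(3)] bc by simp
    next
      case 4 then show ?thesis using EP[OF P(3,1)] gen[OF P(2,3) bc(1) U3(1)] ab Esym by simp
    next
      case 5 then show ?thesis using EP[OF P(3,1)] f2[OF bc(2) U3(1)] Esym by simp
    next
      case 6 then show ?thesis using EP[OF P(3,1)] gen[OF P(3,2) bc(2) U3(1)] ab Esym by simp
    qed
  qed
  have "chain U r Dp A q E"
  proof (unfold_locales, goal_cases)
    case 1 show ?case by (rule A)
  next
    case 2 show ?case by (rule A)
  next
    case 3 show ?case by (rule q)
  next
    case (4 k)
    have "Dp A (\<lambda>e. psi (Suc (Suc k)) (e 0) (e 1) \<or> psi (Suc (Suc k)) (e 1) (e 0))"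
      by (intro D_disj D2[OF psiD] tmv)
    then show ?case by (rule D_cong) (use asgD in \<open>auto simp: E_def\<close>)
  next
    case (5 a k b) then show ?case by (rule EinP)
  next
    case (6 a k) then show ?case using EP[of a a k] Sr by simp
  next
    case (7 a k b) then show ?case using Esym by blast
  next
    case (8 a k b c) then show ?case by (rule Etr)
  next
    case (9 a c k b)
    have Pb: "?P b" using EinP 9 by blast
    then show ?case using EP[OF 9(1,2,4), of k] EP[OF 9(1) Pb, of k] f2[of "Suc (Suc k)" b a c] 9 PU by simp
  next
    case (10 a k b)
    have "E (Suc k) a b \<Longrightarrow> E k a b" using psi_dec by (auto simp: E_def)
    then show ?case using 10 by blast
  next
    case (11 a k)
    obtain b where b: "?P b" "r a < r b" "S (Suc (Suc k)) b a" "\<not> S (Suc (Suc (Suc k))) b a" using up1[OF 11] by blast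
    then show ?case using EP[OF 11 b(1), of k] EP[OF 11 b(1), of "Suc k"] by (intro exI[of _ b]) simp
  next
    case (12 a k)
    obtain b where b: "?P b" "r b < r a" "S (Suc (Suc k)) a b" "\<not> S (Suc (Suc (Suc k))) a b" using dn1[OF 12] by blast
    then show ?case using EP[OF b(1) 12, of k] EP[OF b(1) 12, of "Suc k"] Esym by (intro exI[of _ b]) auto
  next
    case (13 a)
    obtain g where g: "?P g" "\<forall>x\<in>U. S (Suc (Suc 0)) x a \<longrightarrow> r x < r g" using out[OF 13] by blast
    have "r a < r g" "\<not> S (Suc (Suc 0)) g a" using g Sr[OF 13] PU 13 by blast+
    then show ?case using EP[OF 13 g(1), of 0] g by (intro exI[of _ g]) simp
  next
    case (14 a)
    obtain g where g: "?P g" "r g < r a" "\<not> S (Suc (Suc 0)) a g" using outd[OF 14] by blast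
    then show ?case using EP[OF g(1) 14, of 0] Esym by (intro exI[of _ g]) auto
  next
    case (15 a R y g)
    obtain \<sigma> where \<sigma>: "\<sigma> \<in> Au A" "\<sigma> q = a" using mv[OF eqv_refl[OF q] 15(1)] by blast
    obtain \<tau> where \<tau>: "\<tau> \<in> Au A" "\<And>u. u \<in> U \<Longrightarrow> \<tau> (\<sigma> u) = u" "\<And>u. u \<in> U \<Longrightarrow> \<sigma> (\<tau> u) = u"
      using Au_inv[OF \<sigma>(1) A(2)] by blast
    have \<tau>a: "\<tau> a = q" using \<tau>(2)[OF q] \<sigma> by simp
    have aU: "a \<in> U" using 15(1) PU by blast
    have RA: "R (\<tau> x) q = R x a" if "x \<in> U" for x using Au_2[OF A(1) \<tau>(1) 15(2) that aU] \<tau>a by simp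
    have RA': "R x q = R (\<sigma> x) a" if "x \<in> U" for x using Au_2[OF A(1) \<sigma>(1) 15(2) that q] \<sigma> by simp
    have tU: "\<tau> x \<in> U" if "x \<in> U" for x using \<tau>(1) that by simp
    have sU: "\<sigma> x \<in> U" if "x \<in> U" for x using \<sigma>(1) that by simp
    have "CR A q R" unfolding CR_def
    proof (intro conjI)
      show "Dp A (\<lambda>e. R (e 0) (e 1))" by (rule 15(2))
      show "R q q" using RA'[OF q] 15(3) \<sigma> by simp
      show "\<forall>x\<in>U. R x q \<longrightarrow> r q \<le> r x"
        using RA' 15(4)[OF sU] Au_le[OF \<sigma>(1) q] \<sigma> by simp
      have "\<tau> y \<noteq> q" using \<tau>(3)[OF PU[OF 15(5)]] \<sigma> 15(6) by auto
      then show "\<exists>y. ?P y \<and> y \<noteq> q \<and> R y q"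
        using PA[OF \<tau>(1) 15(5)] RA[OF PU[OF 15(5)]] 15(7) by blast
      show "\<exists>g. ?P g \<and> r g < r q" by (rule below)
      have "r x < r (\<tau> g)" if x: "x \<in> U" "R x q" for x
      proof -
        have "r (\<sigma> x) < r g" using 15(9)[OF sU] RA' x by blast
        then show ?thesis using Au_lt[OF \<sigma>(1) x(1) tU[OF PU[OF 15(8)]]] \<tau>(3)[OF PU[OF 15(8)]] by simp
      qed
      then show "\<exists>g. ?P g \<and> (\<forall>x\<in>U. R x q \<longrightarrow> r x < r g)" using PA[OF \<tau>(1) 15(8)] by blast
      show "\<forall>b d c. ?P b \<and> ?P d \<and> ?P c \<and> R b q \<and> R d q \<and> r b < r c \<and> r c < r d \<longrightarrow> R c q"
      proof (intro allI impI, elim conjE)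
        fix b d c assume h: "?P b" "?P d" "?P c" "R b q" "R d q" "r b < r c" "r c < r d"
        have "R (\<sigma> c) a"
          by (rule 15(10)[OF PA[OF \<sigma>(1) h(1)] PA[OF \<sigma>(1) h(3)] PA[OF \<sigma>(1) h(2)]])
            (use RA'[OF PU] h Au_lt[OF \<sigma>(1) PU PU] in auto)
        then show "R c q" using RA'[OF PU[OF h(3)]] by simp
      qed
    qed
    note CR = this
    \<comment> \<open>\<open>z\<close> is in \<open>R\<close> and omitted by \<open>R'\<close>. When
      its number \<open>n\<close> comes up, the segments stop short of it, and up to
      \<open>z\<close> the trace of \<open>R\<close> is convex.\<close>
    obtain R' z where R': "CR A q R'" "?P z" "R z q" "\<not> R' z q" using noleast[OF CR] by blast
    obtain n where n: "z = an n" using an PU[OF R'(2)] by (metis imageE)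
    have nz: "\<not> S (Suc n) z q" using S(2)[of n] R' unfolding nx_def n by blast
    have sub: "R b q" if b: "S (Suc n) b q" "?P b" for b
    proof -
      have qz: "r q \<le> r z" using CR_ge[OF CR] R'(3) PU[OF R'(2)] by blast
      have bz: "r b < r z"
      proof (rule ccontr)
        assume "\<not> r b < r z"
        then show False using f2[OF b(1) PU[OF R'(2)] qz] nz by simp
      qed
      show ?thesis
      proof (cases "b = q")
        case True then show ?thesis using CR_q[OF CR] by simp
      next
        case False
        then have "r q < r b" using f1[OF b(1)] r_eq[OF q PU[OF b(2)]] by force
        then show ?thesis using CR_cv[OF CR eqv_refl[OF q] R'(2) b(2) CR_q[OF CR] R'(3)] bz by blast
      qed
    qed
    show ?case
    proof (intro exI[of _ n] allI impI, elim conjE)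
      fix b assume b: "E n a b" "r a \<le> r b"
      have Pb: "?P b" using EinP[OF 15(1) b(1)] .
      have "S (Suc (Suc n)) b a" using EP[OF 15(1) Pb b(2)] b(1) by blast
      then have "S (Suc n) b a" by (rule dec)
      then have "S (Suc n) (\<tau> b) q" using SA[OF \<tau>(1) PU[OF Pb] aU] \<tau>a by simp
      then have "R (\<tau> b) q" using sub PA[OF \<tau>(1) Pb] by blast
      then show "R b a" using RA[OF PU[OF Pb]] by simp
    qed
  qed
  then show ?thesis by blast
qed

end

section \<open>Countability of formulas, substitution, abstraction of constants\<close>

instance tm :: (countable) countable
  by countable_datatype

instance fm :: (countable, countable) countable
  by countable_datatype

lemma wf_tm_set: "wf_tm L t \<Longrightarrow> set_tm t \<subseteq> funs L"
  by (induction t) auto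

lemma wf_fm_set: "wf_fm L \<phi> \<Longrightarrow> set1_fm \<phi> \<subseteq> funs L \<and> set2_fm \<phi> \<subseteq> rels L"
  by (induction \<phi>) (use wf_tm_set in fastforce)+

text \<open>The types of symbols may be uncountable, but only symbols of the language occur in a
  well-formed formula, and numbering these is injective on such formulas.\<close>

lemma countable_wf_fm:
  assumes "countable (funs L)" "countable (rels L)"
  shows "countable {\<phi>. wf_fm L \<phi>}"
proof -
  have "inj_on (map_fm (to_nat_on (funs L)) (to_nat_on (rels L))) {\<phi>. wf_fm L \<phi>}"
  proof (rule inj_onI)
    fix \<phi> \<psi> assume h: "\<phi> \<in> {\<phi>. wf_fm L \<phi>}" "\<psi> \<in> {\<phi>. wf_fm L \<phi>}"
      "map_fm (to_nat_on (funs L)) (to_nat_on (rels L)) \<phi> = map_fm (to_nat_on (funs L)) (to_nat_on (rels L)) \<psi>"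
    have s: "set1_fm \<phi> \<subseteq> funs L" "set2_fm \<phi> \<subseteq> rels L" "set1_fm \<psi> \<subseteq> funs L" "set2_fm \<psi> \<subseteq> rels L"
      using wf_fm_set h(1,2) by blast+
    show "\<phi> = \<psi>"
    proof (rule fm.inj_map_strong[OF _ _ h(3)])
      fix a b assume ab: "a \<in> set1_fm \<phi>" "b \<in> set1_fm \<psi>" "to_nat_on (funs L) a = to_nat_on (funs L) b"
      show "a = b" using to_nat_on_inj[OF assms(1) subsetD[OF s(1) ab(1)] subsetD[OF s(3) ab(2)]] ab(3) by simp
    next
      fix a b assume ab: "a \<in> set2_fm \<phi>" "b \<in> set2_fm \<psi>" "to_nat_on (rels L) a = to_nat_on (rels L) b"
      show "a = b" using to_nat_on_inj[OF assms(2) subsetD[OF s(2) ab(1)] subsetD[OF s(4) ab(2)]] ab(3) by simp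
    qed
  qed
  then show ?thesis by (rule countable_image_inj_on[rotated]) (rule countableI_type)
qed

lemma eval_cong: "(\<And>i. i \<in> tm_vars t \<Longrightarrow> e i = e' i) \<Longrightarrow> eval_tm N e t = eval_tm N e' t"
proof (induction t)
  case (Fn f ts)
  then have "map (eval_tm N e) ts = map (eval_tm N e') ts" by auto
  then show ?case by (simp del: map_eq_conv)
qed simp

lemma sat_cong: "(\<And>i. i \<in> free_vars \<phi> \<Longrightarrow> e i = e' i) \<Longrightarrow> sat N e \<phi> = sat N e' \<phi>"
proof (induction \<phi> arbitrary: e e')
  case (Eq s t)
  then show ?case using eval_cong[of s e e' N] eval_cong[of t e e' N] by simp
next
  case (Rel r ts)
  have "map (eval_tm N e) ts = map (eval_tm N e') ts"
    by (intro map_cong refl eval_cong) (use Rel.prems in auto)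
  then show ?case by (simp del: map_eq_conv)
next
  case (Ex i \<phi>)
  have "sat N (e(i := a)) \<phi> = sat N (e'(i := a)) \<phi>" for a by (rule Ex.IH) (use Ex.prems in auto)
  then show ?case by simp
next
  case (Conj \<phi> \<psi>)
  have "sat N e \<phi> = sat N e' \<phi>" by (rule Conj.IH(1)) (use Conj.prems in auto)
  moreover have "sat N e \<psi> = sat N e' \<psi>" by (rule Conj.IH(2)) (use Conj.prems in auto)
  ultimately show ?case by simp
next
  case (Neg \<phi>)
  have "sat N e \<phi> = sat N e' \<phi>" by (rule Neg.IH) (use Neg.prems in simp)
  then show ?case by simp
qed

lemma finite_tm_vars: "finite (tm_vars t)"
  by (induction t) auto

lemma finite_free_vars: "finite (free_vars \<phi>)"
  by (induction \<phi>) (auto simp: finite_tm_vars)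

fun subst_tm :: "(nat \<Rightarrow> 'f tm) \<Rightarrow> 'f tm \<Rightarrow> 'f tm" where
  "subst_tm \<sigma> (Var i) = \<sigma> i"
| "subst_tm \<sigma> (Fn f ts) = Fn f (map (subst_tm \<sigma>) ts)"

lemma subst_tm_eval: "eval_tm N e (subst_tm \<sigma> t) = eval_tm N (\<lambda>j. eval_tm N e (\<sigma> j)) t"
proof (induction t)
  case (Fn f ts)
  then have "map (eval_tm N e \<circ> subst_tm \<sigma>) ts = map (eval_tm N (\<lambda>j. eval_tm N e (\<sigma> j))) ts" by auto
  then show ?case by (simp del: map_eq_conv)
qed simp

lemma subst_tm_wf: "(\<And>j. wf_tm L (\<sigma> j)) \<Longrightarrow> wf_tm L t \<Longrightarrow> wf_tm L (subst_tm \<sigma> t)"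
  by (induction t) auto

lemma subst_tm_vars: "tm_vars (subst_tm \<sigma> t) = (\<Union>j\<in>tm_vars t. tm_vars (\<sigma> j))"
  by (induction t) auto

text \<open>An equivalent of the substituted formula suffices, so it is obtained by induction with
  an arbitrary renaming: at a quantifier the bound variable becomes one that does not occur in the
  substituted terms.\<close>

lemma subst_fm:
  "(\<And>j. wf_tm L (\<sigma> j)) \<Longrightarrow> wf_fm L \<phi> \<Longrightarrow>
    \<exists>\<psi>. wf_fm L \<psi> \<and> free_vars \<psi> \<subseteq> (\<Union>j\<in>free_vars \<phi>. tm_vars (\<sigma> j)) \<and>
      (\<forall>e. sat N e \<psi> = sat N (\<lambda>j. eval_tm N e (\<sigma> j)) \<phi>)"
proof (induction \<phi> arbitrary: \<sigma>)
  case (Eq s t)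
  then show ?case by (intro exI[of _ "Eq (subst_tm \<sigma> s) (subst_tm \<sigma> t)"])
      (auto simp: subst_tm_eval subst_tm_wf subst_tm_vars)
next
  case (Rel r ts)
  have *: "eval_tm N e \<circ> subst_tm \<sigma> = eval_tm N (\<lambda>j. eval_tm N e (\<sigma> j))" for e
    by (rule ext) (simp add: subst_tm_eval)
  show ?case using Rel by (intro exI[of _ "Rel r (map (subst_tm \<sigma>) ts)"])
      (auto simp: * subst_tm_wf subst_tm_vars)
next
  case (Neg \<phi>)
  have "wf_fm L \<phi>" using Neg.prems(2) by simp
  from Neg.IH[of \<sigma>, OF Neg.prems(1) this] obtain \<psi> where "wf_fm L \<psi>" "free_vars \<psi> \<subseteq> (\<Union>j\<in>free_vars \<phi>. tm_vars (\<sigma> j))"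
      "\<forall>e. sat N e \<psi> = sat N (\<lambda>j. eval_tm N e (\<sigma> j)) \<phi>" by (elim exE conjE)
  then show ?case by (intro exI[of _ "Neg \<psi>"]) simp
next
  case (Conj \<phi> \<chi>)
  have wf: "wf_fm L \<phi>" "wf_fm L \<chi>" using Conj.prems(2) by simp_all
  obtain \<psi> where "wf_fm L \<psi>" "free_vars \<psi> \<subseteq> (\<Union>j\<in>free_vars \<phi>. tm_vars (\<sigma> j))"
      "\<forall>e. sat N e \<psi> = sat N (\<lambda>j. eval_tm N e (\<sigma> j)) \<phi>" using Conj.IH(1)[of \<sigma>, OF Conj.prems(1) wf(1)] by (elim exE conjE)
  moreover obtain \<psi>' where "wf_fm L \<psi>'" "free_vars \<psi>' \<subseteq> (\<Union>j\<in>free_vars \<chi>. tm_vars (\<sigma> j))"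
      "\<forall>e. sat N e \<psi>' = sat N (\<lambda>j. eval_tm N e (\<sigma> j)) \<chi>" using Conj.IH(2)[of \<sigma>, OF Conj.prems(1) wf(2)] by (elim exE conjE)
  ultimately show ?case by (intro exI[of _ "Conj \<psi> \<psi>'"]) auto
next
  case (Ex i \<phi>)
  have "finite (\<Union>j\<in>free_vars \<phi>. tm_vars (\<sigma> j))" by (simp add: finite_free_vars finite_tm_vars)
  then obtain k where k: "k \<notin> (\<Union>j\<in>free_vars \<phi>. tm_vars (\<sigma> j))" using ex_new_if_finite[OF infinite_UNIV_nat] by blast
  have w: "wf_tm L ((\<sigma>(i := Var k)) j)" for j using Ex.prems(1) by simp
  have "wf_fm L \<phi>" using Ex.prems(2) by simp
  from Ex.IH[of "\<sigma>(i := Var k)", OF w this] obtain \<psi> where \<psi>: "wf_fm L \<psi>"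
    "free_vars \<psi> \<subseteq> (\<Union>j\<in>free_vars \<phi>. tm_vars ((\<sigma>(i := Var k)) j))"
    "\<And>e. sat N e \<psi> = sat N (\<lambda>j. eval_tm N e ((\<sigma>(i := Var k)) j)) \<phi>" by blast
  have "sat N (e(k := a)) \<psi> = sat N ((\<lambda>j. eval_tm N e (\<sigma> j))(i := a)) \<phi>" for e a
    unfolding \<psi>(3)
  proof (rule sat_cong)
    fix j assume j: "j \<in> free_vars \<phi>"
    have "eval_tm N (e(k := a)) (\<sigma> j) = eval_tm N e (\<sigma> j)" by (rule eval_cong) (use j k in auto)
    then show "eval_tm N (e(k := a)) ((\<sigma>(i := Var k)) j) = ((\<lambda>j. eval_tm N e (\<sigma> j))(i := a)) j" by simp
  qed
  moreover have "free_vars (Ex k \<psi>) \<subseteq> (\<Union>j\<in>free_vars (Ex i \<phi>). tm_vars (\<sigma> j))"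
    using \<psi>(2) by (auto split: if_splits)
  ultimately show ?case using \<psi>(1) by (intro exI[of _ "Ex k \<psi>"]) simp
qed

text \<open>Bound variables are included: a constant may be replaced under a quantifier, where the
  new variable must not be captured.\<close>

fun all_vars :: "('f, 'r) fm \<Rightarrow> nat set" where
  "all_vars (Eq s t) = tm_vars s \<union> tm_vars t"
| "all_vars (Rel r ts) = (\<Union>t\<in>set ts. tm_vars t)"
| "all_vars (Neg \<phi>) = all_vars \<phi>"
| "all_vars (Conj \<phi> \<psi>) = all_vars \<phi> \<union> all_vars \<psi>"
| "all_vars (Ex i \<phi>) = insert i (all_vars \<phi>)"

lemma finite_all_vars: "finite (all_vars \<phi>)"
  by (induction \<phi>) (auto simp: finite_tm_vars)

fun abs_tm :: "'m \<Rightarrow> nat \<Rightarrow> ('f + 'm) tm \<Rightarrow> ('f + 'm) tm" where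
  "abs_tm b j (Var i) = Var i"
| "abs_tm b j (Fn f ts) = (if f = Inr b then Var j else Fn f (map (abs_tm b j) ts))"

fun abs_fm :: "'m \<Rightarrow> nat \<Rightarrow> ('f + 'm, 'r) fm \<Rightarrow> ('f + 'm, 'r) fm" where
  "abs_fm b j (Eq s t) = Eq (abs_tm b j s) (abs_tm b j t)"
| "abs_fm b j (Rel r ts) = Rel r (map (abs_tm b j) ts)"
| "abs_fm b j (Neg \<phi>) = Neg (abs_fm b j \<phi>)"
| "abs_fm b j (Conj \<phi> \<psi>) = Conj (abs_fm b j \<phi>) (abs_fm b j \<psi>)"
| "abs_fm b j (Ex i \<phi>) = Ex i (abs_fm b j \<phi>)"

lemma struct_with_simps [simp]: "univ (struct_with M) = univ M" "rint (struct_with M) = rint M"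
  "fint (struct_with M) (Inl f) = fint M f" "fint (struct_with M) (Inr b) xs = b"
  by (simp_all add: struct_with_def)

lemma lang_with_simps [simp]: "funs (lang_with L B) = Inl ` funs L \<union> Inr ` B" "rels (lang_with L B) = rels L"
  "far (lang_with L B) (Inl f) = far L f" "far (lang_with L B) (Inr b) = 0" "rar (lang_with L B) = rar L"
  by (simp_all add: lang_with_def)

lemma abs_tm_eval:
  assumes e': "\<And>i. e' i = (if i = j then b else e i)"
  shows "j \<notin> tm_vars t \<Longrightarrow> eval_tm (struct_with M) e' (abs_tm b j t) = eval_tm (struct_with M) e t"
proof (induction t)
  case (Var i) then show ?case by (simp add: e')
next
  case (Fn f ts)
  have m: "map (eval_tm (struct_with M) e') (map (abs_tm b j) ts) = map (eval_tm (struct_with M) e) ts"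
    using Fn by auto
  show ?case
  proof (cases "f = Inr b")
    case True then show ?thesis by (simp add: e')
  next
    case False then show ?thesis using m by (simp del: map_map map_eq_conv)
  qed
qed

lemma abs_fm_sat:
  "j \<notin> all_vars \<phi> \<Longrightarrow> (\<And>i. e' i = (if i = j then b else e i)) \<Longrightarrow>
    sat (struct_with M) e' (abs_fm b j \<phi>) = sat (struct_with M) e \<phi>"
proof (induction \<phi> arbitrary: e e')
  case (Eq s t) show ?case using Eq.prems(1) by (simp add: abs_tm_eval[OF Eq.prems(2)])
next
  case (Rel r ts)
  have "map (eval_tm (struct_with M) e') (map (abs_tm b j) ts) = map (eval_tm (struct_with M) e) ts"
    using Rel.prems(1) abs_tm_eval[OF Rel.prems(2)] by auto
  then show ?case by (simp del: map_map map_eq_conv)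
next
  case (Neg \<phi>)
  have "sat (struct_with M) e' (abs_fm b j \<phi>) = sat (struct_with M) e \<phi>"
    by (rule Neg.IH[OF _ Neg.prems(2)]) (use Neg.prems(1) in simp)
  then show ?case by simp
next
  case (Conj \<phi> \<psi>)
  have "sat (struct_with M) e' (abs_fm b j \<phi>) = sat (struct_with M) e \<phi>"
    by (rule Conj.IH(1)[OF _ Conj.prems(2)]) (use Conj.prems(1) in simp)
  moreover have "sat (struct_with M) e' (abs_fm b j \<psi>) = sat (struct_with M) e \<psi>"
    by (rule Conj.IH(2)[OF _ Conj.prems(2)]) (use Conj.prems(1) in simp)
  ultimately show ?case by simp
next
  case (Ex i \<phi>)
  have "sat (struct_with M) (e'(i := a)) (abs_fm b j \<phi>) = sat (struct_with M) (e(i := a)) \<phi>" for a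
    by (rule Ex.IH) (use Ex.prems in auto)
  then show ?case by simp
qed

lemma abs_tm_wf: "wf_tm (lang_with L (insert b B)) t \<Longrightarrow> wf_tm (lang_with L B) (abs_tm b j t)"
proof (induction t)
  case (Fn f ts) then show ?case by (cases f) auto
qed simp

lemma abs_fm_wf: "wf_fm (lang_with L (insert b B)) \<phi> \<Longrightarrow> wf_fm (lang_with L B) (abs_fm b j \<phi>)"
  by (induction \<phi>) (auto simp: abs_tm_wf)

lemma wf_tm_mono: "wf_tm (lang_with L B) t \<Longrightarrow> B \<subseteq> C \<Longrightarrow> wf_tm (lang_with L C) t"
proof (induction t)
  case (Fn f ts) then show ?case by (cases f) auto
qed simp

lemma wf_fm_mono: "wf_fm (lang_with L B) \<phi> \<Longrightarrow> B \<subseteq> C \<Longrightarrow> wf_fm (lang_with L C) \<phi>"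
  by (induction \<phi>) (auto simp: wf_tm_mono)

section \<open>The model as an instance of definability\<close>

locale lo_model =
  fixes L :: "('f, 'r) lang" and M :: "('f, 'r, 'm) struct"
  assumes cl: "countable_lang L" and str: "is_struct L M"
    and lt: "lt L \<in> rels L" "rar L (lt L) = 2"
    and slo: "strict_linear_order_on (univ M) {(a, b) \<in> univ M \<times> univ M. less_in L M a b}"
    and cu: "countable (univ M)" and iu: "infinite (univ M)" and satd: "saturated L M"
begin

abbreviation "W \<equiv> univ M"
abbreviation "S \<equiv> struct_with M"

definition Dm :: "'m set \<Rightarrow> ((nat \<Rightarrow> 'm) \<Rightarrow> bool) \<Rightarrow> bool" where
  "Dm B P \<longleftrightarrow> B \<subseteq> W \<and> (\<exists>\<phi>. wf_fm (lang_with L B) \<phi> \<and> (\<forall>e\<in>asg W. P e = sat S e \<phi>))"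

text \<open>An embedding of the countable linear order into the reals.\<close>

definition rk :: "'m \<Rightarrow> real" where
  "rk a = (\<Sum>n. if less_in L M (from_nat_into W n) a then (1/2) ^ n else 0)"

lemma W_ne: "W \<noteq> {}" using iu by auto

lemma less_trans: "a \<in> W \<Longrightarrow> b \<in> W \<Longrightarrow> c \<in> W \<Longrightarrow> less_in L M a b \<Longrightarrow> less_in L M b c \<Longrightarrow> less_in L M a c"
  using slo unfolding strict_linear_order_on_def by (auto dest: transD[of _ a b c])

lemma less_irrefl: "a \<in> W \<Longrightarrow> \<not> less_in L M a a"
  using slo unfolding strict_linear_order_on_def by (auto dest: irreflD[of _ a])

lemma less_total: "a \<in> W \<Longrightarrow> b \<in> W \<Longrightarrow> a \<noteq> b \<Longrightarrow> less_in L M a b \<or> less_in L M b a"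
  using slo unfolding strict_linear_order_on_def total_on_def by auto

text \<open>By transitivity every term of the sum for \<open>a\<close> occurs in the sum for
  \<open>b\<close>, and the term belonging to \<open>a\<close> itself occurs only there.\<close>

lemma rk_mono:
  assumes "a \<in> W" "b \<in> W" "less_in L M a b" shows "rk a < rk b"
proof -
  define f where "f = (\<lambda>c n. if less_in L M (from_nat_into W n) c then (1/2 :: real) ^ n else 0)"
  have s: "summable (f c)" for c
    by (rule summable_comparison_test'[of "\<lambda>n. (1/2::real) ^ n" 0]) (auto simp: f_def)
  have u: "from_nat_into W n \<in> W" for n by (rule from_nat_into[OF W_ne])
  have le: "f a n \<le> f b n" for n using less_trans[OF u assms(1,2) _ assms(3)] by (auto simp: f_def)
  obtain n where n: "from_nat_into W n = a" using from_nat_into_surj[OF cu assms(1)] by blast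
  have "0 < (\<Sum>n. f b n - f a n)"
    using le n assms less_irrefl by (intro suminf_pos2[where i = n] summable_diff s) (auto simp: f_def)
  also have "\<dots> = suminf (f b) - suminf (f a)" by (rule suminf_diff[OF s s, symmetric])
  also have "\<dots> = rk b - rk a" by (simp only: rk_def f_def)
  finally show ?thesis by simp
qed

lemma rk_less: "a \<in> W \<Longrightarrow> b \<in> W \<Longrightarrow> less_in L M a b \<longleftrightarrow> rk a < rk b"
  using rk_mono[of a b] rk_mono[of b a] less_total[of a b] less_irrefl[of a] by fastforce

lemma rk_inj: "inj_on rk W"
  using rk_mono less_total by (fastforce simp: inj_on_def)

lemma rk_le: "a \<in> W \<Longrightarrow> b \<in> W \<Longrightarrow> le_in L M a b \<longleftrightarrow> rk a \<le> rk b"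
  using rk_less[of a b] rk_inj by (auto simp: le_in_def order_le_less dest: inj_onD)

lemma DmI: "B \<subseteq> W \<Longrightarrow> wf_fm (lang_with L B) \<phi> \<Longrightarrow> (\<And>e. e \<in> asg W \<Longrightarrow> P e = sat S e \<phi>) \<Longrightarrow> Dm B P"
  unfolding Dm_def by blast

lemma DmE:
  assumes "Dm B P"
  obtains \<phi> where "B \<subseteq> W" "wf_fm (lang_with L B) \<phi>" "\<And>e. e \<in> asg W \<Longrightarrow> P e = sat S e \<phi>"
  using assms unfolding Dm_def by blast

text \<open>Substituting \<open>Var 0\<close> for every variable turns a predicate read at constant
  assignments into a formula in one variable.\<close>

lemma unary_fm:
  assumes "Dm B P"
  shows "\<exists>\<psi>\<in>pformulas L B 1. \<forall>a\<in>W. a \<in> sol M \<psi> [] \<longleftrightarrow> P (\<lambda>_. a)"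
proof -
  obtain \<phi> where \<phi>: "B \<subseteq> W" "wf_fm (lang_with L B) \<phi>" "\<And>e. e \<in> asg W \<Longrightarrow> P e = sat S e \<phi>"
    using assms by (rule DmE) blast
  obtain \<psi> where \<psi>: "wf_fm (lang_with L B) \<psi>" "free_vars \<psi> \<subseteq> (\<Union>j\<in>free_vars \<phi>. tm_vars ((\<lambda>_. Var 0) j))"
    "\<And>e. sat S e \<psi> = sat S (\<lambda>j. eval_tm S e ((\<lambda>_. Var 0) j)) \<phi>"
    using subst_fm[of "lang_with L B" "\<lambda>_. Var 0" \<phi> S] \<phi>(2) by auto
  have fv: "free_vars \<psi> \<subseteq> {..<1}" by (rule subset_trans[OF \<psi>(2)], rule UN_least, simp)
  have "a \<in> sol M \<psi> [] \<longleftrightarrow> P (\<lambda>_. a)" if a: "a \<in> W" for a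
  proof -
    have "sat S (\<lambda>i. [a] ! i) \<psi> = sat S (\<lambda>_. a) \<psi>" by (rule sat_cong) (use fv in auto)
    then show ?thesis using \<psi>(3) \<phi>(3)[of "\<lambda>_. a"] a by (simp add: sol_def holds_def)
  qed
  moreover have "\<psi> \<in> pformulas L B 1" using \<psi>(1) fv by (simp add: formulas_def)
  ultimately show ?thesis by blast
qed

lemma binary_fm:
  assumes "Dm B (\<lambda>e. R (e 0) (e 1))"
  shows "\<exists>\<psi>\<in>pformulas L B 2. \<forall>a\<in>W. \<forall>b\<in>W. pholds M \<psi> [a, b] \<longleftrightarrow> R a b"
proof -
  obtain \<phi> where \<phi>: "B \<subseteq> W" "wf_fm (lang_with L B) \<phi>" "\<And>e. e \<in> asg W \<Longrightarrow> R (e 0) (e 1) = sat S e \<phi>"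
    using assms by (rule DmE) blast
  define \<sigma> where "\<sigma> = (\<lambda>j::nat. Var (if j = 1 then 1 else 0) :: ('f + 'm) tm)"
  obtain \<psi> where \<psi>: "wf_fm (lang_with L B) \<psi>" "free_vars \<psi> \<subseteq> (\<Union>j\<in>free_vars \<phi>. tm_vars (\<sigma> j))"
    "\<And>e. sat S e \<psi> = sat S (\<lambda>j. eval_tm S e (\<sigma> j)) \<phi>"
    using subst_fm[of "lang_with L B" \<sigma> \<phi> S] \<phi>(2) by (auto simp: \<sigma>_def)
  have fv: "free_vars \<psi> \<subseteq> {..<2}" using \<psi>(2) by (auto simp: \<sigma>_def split: if_splits)
  have "pholds M \<psi> [a, b] \<longleftrightarrow> R a b" if ab: "a \<in> W" "b \<in> W" for a b
  proof -
    define e where "e = (\<lambda>i::nat. if i = 1 then b else a)"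
    have "sat S (\<lambda>i. [a, b] ! i) \<psi> = sat S e \<psi>"
      by (rule sat_cong) (use fv in \<open>force simp: e_def less_2_cases_iff\<close>)
    also have "(\<lambda>j. eval_tm S e (\<sigma> j)) = e" by (auto simp: e_def \<sigma>_def)
    then have "sat S e \<psi> = R a b" using \<psi>(3) \<phi>(3)[of e] ab by (simp add: e_def asg_def)
    finally show ?thesis by (simp add: holds_def)
  qed
  moreover have "\<psi> \<in> pformulas L B 2" using \<psi>(1) fv by (simp add: formulas_def)
  ultimately show ?thesis by blast
qed

lemma Dm_unary: "B \<subseteq> W \<Longrightarrow> \<phi> \<in> pformulas L B 1 \<Longrightarrow> Dm B (\<lambda>e. e 0 \<in> sol M \<phi> [])"
proof (rule DmI)
  assume h: "B \<subseteq> W" "\<phi> \<in> pformulas L B 1"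
  show "wf_fm (lang_with L B) \<phi>" using h by (simp add: formulas_def)
  fix e :: "nat \<Rightarrow> 'm" assume e: "e \<in> asg W"
  have "sat S (\<lambda>i. [e 0] ! i) \<phi> = sat S e \<phi>" by (rule sat_cong) (use h in \<open>auto simp: formulas_def\<close>)
  then show "(e 0 \<in> sol M \<phi> []) = sat S e \<phi>" using e by (simp add: sol_def holds_def asg_def)
qed

lemma Dm_binary: "B \<subseteq> W \<Longrightarrow> \<phi> \<in> pformulas L B 2 \<Longrightarrow> Dm B (\<lambda>e. pholds M \<phi> [e 0, e 1])"
proof (rule DmI)
  assume h: "B \<subseteq> W" "\<phi> \<in> pformulas L B 2"
  show "wf_fm (lang_with L B) \<phi>" using h by (simp add: formulas_def)
  fix e :: "nat \<Rightarrow> 'm" assume e: "e \<in> asg W"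
  have "sat S (\<lambda>i. [e 0, e 1] ! i) \<phi> = sat S e \<phi>"
    by (rule sat_cong) (use h in \<open>force simp: formulas_def less_2_cases_iff\<close>)
  then show "pholds M \<phi> [e 0, e 1] = sat S e \<phi>" by (simp add: holds_def)
qed

text \<open>Lindenbaum's lemma through Zorn: a maximal finitely satisfiable set decides every
  formula. It connects \<open>D_sat\<close>, which starts from an arbitrary set of predicates, with
  saturation, which speaks of complete types.\<close>

lemma complete_type:
  assumes \<Gamma>: "\<Gamma> \<subseteq> pformulas L B 1" and fs: "\<And>F. F \<subseteq> \<Gamma> \<Longrightarrow> finite F \<Longrightarrow> \<exists>a\<in>W. \<forall>\<phi>\<in>F. a \<in> sol M \<phi> []"
  shows "\<exists>p\<in>S1 L M B. \<Gamma> \<subseteq> p"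
proof -
  define fsat where "fsat = (\<lambda>p. \<forall>F. F \<subseteq> p \<and> finite F \<longrightarrow> (\<exists>a\<in>W. \<forall>\<phi>\<in>F. a \<in> sol M \<phi> []))"
  define Z where "Z = {p. \<Gamma> \<subseteq> p \<and> p \<subseteq> pformulas L B 1 \<and> fsat p}"
  have "\<exists>p\<in>Z. \<forall>X\<in>Z. p \<subseteq> X \<longrightarrow> X = p"
  proof (rule subset_Zorn_nonempty)
    have "\<Gamma> \<in> Z" using \<Gamma> fs by (auto simp: Z_def fsat_def)
    then show "Z \<noteq> {}" by blast
    fix C assume C: "C \<noteq> {}" "subset.chain Z C"
    have CZ: "C \<subseteq> Z" using C(2) by (simp add: subset.chain_def)
    have "fsat (\<Union>C)" unfolding fsat_def
    proof (intro allI impI, elim conjE)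
      fix F assume F: "F \<subseteq> \<Union>C" "finite F"
      then obtain X where "X \<in> C" "F \<subseteq> X" using finite_subset_Union_chain[OF F(2,1) C(1)] C(2) by blast
      then show "\<exists>a\<in>W. \<forall>\<phi>\<in>F. a \<in> sol M \<phi> []" using CZ F(2) by (auto simp: Z_def fsat_def)
    qed
    then show "\<Union>C \<in> Z" using CZ C(1) by (auto simp: Z_def)
  qed
  then obtain p where p: "p \<in> Z" "\<And>X. X \<in> Z \<Longrightarrow> p \<subseteq> X \<Longrightarrow> X = p" by blast
  have pf: "\<Gamma> \<subseteq> p" "p \<subseteq> pformulas L B 1" "fsat p" using p(1) by (auto simp: Z_def)
  have ins: "\<exists>F\<subseteq>p. finite F \<and> (\<forall>a\<in>W. (\<forall>\<psi>\<in>F. a \<in> sol M \<psi> []) \<longrightarrow> a \<notin> sol M \<phi> [])"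
    if h: "\<phi> \<in> pformulas L B 1" "\<phi> \<notin> p" for \<phi>
  proof -
    have "insert \<phi> p \<notin> Z" using p(2)[of "insert \<phi> p"] h by blast
    then have "\<not> fsat (insert \<phi> p)" using pf h by (auto simp: Z_def)
    then obtain F where F: "F \<subseteq> insert \<phi> p" "finite F" "\<not> (\<exists>a\<in>W. \<forall>\<psi>\<in>F. a \<in> sol M \<psi> [])"
      unfolding fsat_def by blast
    then show ?thesis by (intro exI[of _ "F - {\<phi>}"]) auto
  qed
  have "p \<in> S1 L M B" unfolding S1_def
  proof (intro CollectI conjI ballI pf)
    show "\<forall>F. F \<subseteq> p \<and> finite F \<longrightarrow> (\<exists>a\<in>W. \<forall>\<phi>\<in>F. a \<in> sol M \<phi> [])" using pf(3) by (simp add: fsat_def)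
    fix \<phi> assume \<phi>: "\<phi> \<in> pformulas L B 1"
    show "\<phi> \<in> p \<or> Neg \<phi> \<in> p"
    proof (rule ccontr)
      assume n: "\<not> ?thesis"
      have "Neg \<phi> \<in> pformulas L B 1" using \<phi> by (simp add: formulas_def)
      have n': "\<phi> \<notin> p" "Neg \<phi> \<notin> p" using n by simp_all
      obtain F where F: "F \<subseteq> p" "finite F" "\<forall>a\<in>W. (\<forall>\<psi>\<in>F. a \<in> sol M \<psi> []) \<longrightarrow> a \<notin> sol M \<phi> []"
        using ins[OF \<phi> n'(1)] by (elim exE conjE)
      obtain F' where F': "F' \<subseteq> p" "finite F'" "\<forall>a\<in>W. (\<forall>\<psi>\<in>F'. a \<in> sol M \<psi> []) \<longrightarrow> a \<notin> sol M (Neg \<phi>) []"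
        using ins[OF \<open>Neg \<phi> \<in> pformulas L B 1\<close> n'(2)] by (elim exE conjE)
      have "F \<union> F' \<subseteq> p \<and> finite (F \<union> F')" using F F' by simp
      then have "\<exists>a\<in>W. \<forall>\<psi>\<in>F \<union> F'. a \<in> sol M \<psi> []"
        by (rule pf(3)[unfolded fsat_def, THEN spec[of _ "F \<union> F'"], THEN mp])
      then obtain a where a: "a \<in> W" "\<forall>\<psi>\<in>F \<union> F'. a \<in> sol M \<psi> []" by (rule bexE)
      have "a \<notin> sol M \<phi> []" by (rule bspec[OF F(3) a(1), THEN mp]) (use a(2) in simp)
      moreover have "a \<notin> sol M (Neg \<phi>) []" by (rule bspec[OF F'(3) a(1), THEN mp]) (use a(2) in simp)
      ultimately show False using a(1) by (simp add: sol_def holds_def)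
    qed
  qed
  then show ?thesis using pf(1) by blast
qed

lemma realized:
  assumes "finite B" "B \<subseteq> W" "p \<in> S1 L M B" shows "realizations M p \<noteq> {}"
  using satd assms finite_lesspoll_infinite[OF iu assms(1)] unfolding saturated_def saturated_at_def by blast

end

sublocale lo_model \<subseteq> definability "univ M" rk Dm
proof
  show "infinite W" "countable W" "inj_on rk W" by (fact iu cu rk_inj)+
  show "B \<subseteq> W" if "Dm B P" for B P using that by (simp add: Dm_def)
  show "Dm B Q" if h: "Dm B P" "\<And>e. e \<in> asg W \<Longrightarrow> P e = Q e" for B P Q
  proof -
    obtain \<phi> where \<phi>: "B \<subseteq> W" "wf_fm (lang_with L B) \<phi>" "\<And>e. e \<in> asg W \<Longrightarrow> P e = sat S e \<phi>"
      using h(1) by (rule DmE) blast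
    show ?thesis by (rule DmI[OF \<phi>(1,2)]) (use \<phi>(3) h(2) in simp)
  qed
  show "Dm B (\<lambda>e. P (\<lambda>i. case t i of Inl j \<Rightarrow> e j | Inr b \<Rightarrow> b))"
    if h: "Dm B P" "\<And>i b. t i = Inr b \<Longrightarrow> b \<in> B" for B P t
  proof -
    obtain \<phi> where \<phi>: "B \<subseteq> W" "wf_fm (lang_with L B) \<phi>" "\<And>e. e \<in> asg W \<Longrightarrow> P e = sat S e \<phi>"
      using h(1) by (rule DmE) blast
    define \<sigma> where "\<sigma> = (\<lambda>i::nat. case t i of Inl j \<Rightarrow> Var j | Inr b \<Rightarrow> Fn (Inr b :: 'f + 'm) [])"
    have "wf_tm (lang_with L B) (\<sigma> i)" for i using h(2)[of i] by (auto simp: \<sigma>_def split: sum.split)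
    from subst_fm[of "lang_with L B" \<sigma> \<phi> S, OF this \<phi>(2)] obtain \<psi> where \<psi>: "wf_fm (lang_with L B) \<psi>"
      "\<And>e. sat S e \<psi> = sat S (\<lambda>j. eval_tm S e (\<sigma> j)) \<phi>" by blast
    show ?thesis
    proof (rule DmI[OF \<phi>(1) \<psi>(1)])
      fix e :: "nat \<Rightarrow> 'm" assume e: "e \<in> asg W"
      have 1: "(\<lambda>j. eval_tm S e (\<sigma> j)) = (\<lambda>i. case t i of Inl j \<Rightarrow> e j | Inr b \<Rightarrow> b)"
        by (rule ext) (simp add: \<sigma>_def split: sum.split)
      have "(\<lambda>i. case t i of Inl j \<Rightarrow> e j | Inr b \<Rightarrow> b) \<in> asg W"
        using e h(2) \<phi>(1) by (auto simp: asg_def split: sum.split)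
      then show "P (\<lambda>i. case t i of Inl j \<Rightarrow> e j | Inr b \<Rightarrow> b) = sat S e \<psi>"
        using \<phi>(3) unfolding \<psi>(2) 1 by blast
    qed
  qed
  show "Dm B (\<lambda>e. \<not> P e)" if h: "Dm B P" for B P
  proof -
    obtain \<phi> where \<phi>: "B \<subseteq> W" "wf_fm (lang_with L B) \<phi>" "\<And>e. e \<in> asg W \<Longrightarrow> P e = sat S e \<phi>"
      using h by (rule DmE) blast
    show ?thesis by (rule DmI[of B "Neg \<phi>"]) (use \<phi> in auto)
  qed
  show "Dm B (\<lambda>e. P e \<and> Q e)" if h: "Dm B P" "Dm B Q" for B P Q
  proof -
    obtain \<phi> where \<phi>: "B \<subseteq> W" "wf_fm (lang_with L B) \<phi>" "\<And>e. e \<in> asg W \<Longrightarrow> P e = sat S e \<phi>"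
      using h(1) by (rule DmE) blast
    obtain \<psi> where \<psi>: "wf_fm (lang_with L B) \<psi>" "\<And>e. e \<in> asg W \<Longrightarrow> Q e = sat S e \<psi>"
      using h(2) by (rule DmE) blast
    show ?thesis by (rule DmI[of B "Conj \<phi> \<psi>"]) (use \<phi> \<psi> in auto)
  qed
  show "Dm B (\<lambda>e. \<exists>a\<in>W. P (e(i := a)))" if h: "Dm B P" for B P i
  proof -
    obtain \<phi> where \<phi>: "B \<subseteq> W" "wf_fm (lang_with L B) \<phi>" "\<And>e. e \<in> asg W \<Longrightarrow> P e = sat S e \<phi>"
      using h by (rule DmE) blast
    show ?thesis by (rule DmI[of B "Ex i \<phi>"]) (use \<phi> in auto)
  qed
  show "\<exists>n. \<forall>e\<in>asg W. \<forall>e'\<in>asg W. (\<forall>i<n. e i = e' i) \<longrightarrow> P e = P e'" if h: "Dm B P" for B P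
  proof -
    obtain \<phi> where \<phi>: "B \<subseteq> W" "wf_fm (lang_with L B) \<phi>" "\<And>e. e \<in> asg W \<Longrightarrow> P e = sat S e \<phi>"
      using h by (rule DmE) blast
    have "\<exists>n. \<forall>i\<in>free_vars \<phi>. i < n" using finite_free_vars[of \<phi>] by (simp add: finite_nat_set_iff_bounded)
    then obtain n where n: "\<forall>i\<in>free_vars \<phi>. i < n" by (rule exE)
    show ?thesis
    proof (intro exI[of _ n] ballI impI)
      fix e e' assume e: "e \<in> asg W" "e' \<in> asg W" "\<forall>i<n. e i = e' i"
      have "sat S e \<phi> = sat S e' \<phi>" by (rule sat_cong) (use e n in auto)
      then show "P e = P e'" using \<phi>(3) e by simp
    qed
  qed
  show "\<exists>Q j. Dm B Q \<and> (\<forall>e\<in>asg W. P e = Q (e(j := b)))" if h: "Dm (insert b B) P" for b B P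
  proof -
    obtain \<phi> where \<phi>: "insert b B \<subseteq> W" "wf_fm (lang_with L (insert b B)) \<phi>" "\<And>e. e \<in> asg W \<Longrightarrow> P e = sat S e \<phi>"
      using h by (rule DmE) blast
    obtain j where j: "j \<notin> all_vars \<phi>" using ex_new_if_finite[OF infinite_UNIV_nat finite_all_vars] by blast
    have "Dm B (\<lambda>e. sat S e (abs_fm b j \<phi>))" using \<phi>(1) by (intro DmI[OF _ abs_fm_wf[OF \<phi>(2)]]) auto
    moreover have "P e = sat S (e(j := b)) (abs_fm b j \<phi>)" if e: "e \<in> asg W" for e
      unfolding \<phi>(3)[OF e] by (rule abs_fm_sat[OF j, symmetric]) simp
    ultimately show ?thesis by (intro exI[of _ "\<lambda>e. sat S e (abs_fm b j \<phi>)"] exI[of _ j] conjI ballI)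
  qed
  show "Dm C P" if h: "Dm B P" "B \<subseteq> C" "C \<subseteq> W" for B P C
  proof -
    obtain \<phi> where \<phi>: "wf_fm (lang_with L B) \<phi>" "\<And>e. e \<in> asg W \<Longrightarrow> P e = sat S e \<phi>"
      using h(1) by (rule DmE) blast
    show ?thesis by (rule DmI[OF h(3) wf_fm_mono[OF \<phi>(1) h(2)]]) (rule \<phi>(2))
  qed
  show "Dm B (\<lambda>e. e i = e j)" if "B \<subseteq> W" for B i j
    by (rule DmI[of B "Eq (Var i) (Var j)"]) (use that in auto)
  show "Dm B (\<lambda>e. rk (e i) < rk (e j))" if "B \<subseteq> W" for B i j
    by (rule DmI[of B "Rel (lt L) [Var i, Var j]"])
      (use that lt rk_less in \<open>auto simp: asg_def less_in_def\<close>)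
  show "\<exists>f. \<forall>P. Dm B P \<longrightarrow> (\<exists>n::nat. Dm B (f n) \<and> (\<forall>e\<in>asg W. P e = f n e))" if B: "finite B" "B \<subseteq> W" for B
  proof -
    have "countable {\<phi>. wf_fm (lang_with L B) \<phi>}"
      by (rule countable_wf_fm) (use cl B in \<open>auto simp: countable_lang_def intro: countable_finite\<close>)
    define f where "f = (\<lambda>n e. sat S e (from_nat_into {\<phi>. wf_fm (lang_with L B) \<phi>} n))"
    show ?thesis
    proof (intro exI[of _ f] allI impI)
      fix P assume "Dm B P"
      then obtain \<phi> where \<phi>: "wf_fm (lang_with L B) \<phi>" "\<And>e. e \<in> asg W \<Longrightarrow> P e = sat S e \<phi>" by (rule DmE) blast
      obtain n where n: "from_nat_into {\<phi>. wf_fm (lang_with L B) \<phi>} n = \<phi>"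
        using from_nat_into_surj[OF \<open>countable {\<phi>. wf_fm (lang_with L B) \<phi>}\<close>] \<phi>(1) by blast
      have "f n e = sat S e \<phi>" for e by (simp add: f_def n)
      then show "\<exists>n. Dm B (f n) \<and> (\<forall>e\<in>asg W. P e = f n e)"
        using \<phi> B by (intro exI[of _ n]) (auto intro: DmI[of B \<phi>])
    qed
  qed
  show "\<exists>a\<in>W. \<forall>Q\<in>\<Q>. Q (\<lambda>_. a)"
    if h: "finite B" "B \<subseteq> W" "\<And>Q. Q \<in> \<Q> \<Longrightarrow> Dm B Q"
      "\<And>F. F \<subseteq> \<Q> \<Longrightarrow> finite F \<Longrightarrow> \<exists>a\<in>W. \<forall>Q\<in>F. Q (\<lambda>_. a)" for B \<Q>
  proof -
    define fr where "fr = (\<lambda>Q :: (nat \<Rightarrow> 'm) \<Rightarrow> bool. SOME \<psi>. \<psi> \<in> pformulas L B 1 \<and> (\<forall>a\<in>W. a \<in> sol M \<psi> [] \<longleftrightarrow> Q (\<lambda>_. a)))"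
    have fr: "fr Q \<in> pformulas L B 1 \<and> (\<forall>a\<in>W. a \<in> sol M (fr Q) [] \<longleftrightarrow> Q (\<lambda>_. a))" if "Q \<in> \<Q>" for Q
      unfolding fr_def by (rule someI_ex) (use unary_fm[OF h(3)[OF that]] in \<open>simp only: Bex_def\<close>)
    have "\<exists>p\<in>S1 L M B. fr ` \<Q> \<subseteq> p"
    proof (rule complete_type)
      show "fr ` \<Q> \<subseteq> pformulas L B 1" using fr by blast
      fix F assume "F \<subseteq> fr ` \<Q>" "finite F"
      then obtain G where G: "G \<subseteq> \<Q>" "finite G" "F = fr ` G" by (meson finite_subset_image)
      obtain a where a: "a \<in> W" "\<forall>Q\<in>G. Q (\<lambda>_. a)" using h(4)[OF G(1,2)] by (rule bexE)
      have "a \<in> sol M (fr Q) []" if "Q \<in> G" for Q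
        using fr[of Q] that G(1) a(1) bspec[OF a(2) that] by blast
      then show "\<exists>a\<in>W. \<forall>\<phi>\<in>F. a \<in> sol M \<phi> []" using a(1) G(3) by blast
    qed
    then obtain p where p: "p \<in> S1 L M B" "fr ` \<Q> \<subseteq> p" by blast
    obtain a where a: "a \<in> realizations M p" using realized[OF h(1,2) p(1)] by blast
    then have aW: "a \<in> W" by (simp add: realizations_def)
    have "Q (\<lambda>_. a)" if "Q \<in> \<Q>" for Q
    proof -
      have "a \<in> sol M (fr Q) []" using a p(2) that by (auto simp: realizations_def)
      then show ?thesis using fr[OF that] aW by blast
    qed
    then show ?thesis using aW by (intro bexI[of _ a] ballI)
  qed
qed

section \<open>Types and convex formulas in the model\<close>

context lo_model
begin

definition tpm :: "'m set \<Rightarrow> 'm \<Rightarrow> ('f + 'm, 'r) fm set" where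
  "tpm B a = {\<phi> \<in> pformulas L B 1. a \<in> sol M \<phi> []}"

lemma tpm_S1: "B \<subseteq> W \<Longrightarrow> a \<in> W \<Longrightarrow> tpm B a \<in> S1 L M B"
  unfolding S1_def tpm_def by (auto simp: formulas_def sol_def holds_def)

lemma S1_tpm:
  assumes "p \<in> S1 L M B" "a \<in> realizations M p" shows "p = tpm B a"
proof -
  have "\<phi> \<in> p" if "\<phi> \<in> pformulas L B 1" "a \<in> sol M \<phi> []" for \<phi>
  proof (rule ccontr)
    assume "\<phi> \<notin> p"
    then have "Neg \<phi> \<in> p" using assms(1) that(1) by (auto simp: S1_def)
    then have "a \<in> sol M (Neg \<phi>) []" using assms(2) by (auto simp: realizations_def)
    then show False using that(2) by (simp add: sol_def holds_def)
  qed
  then show ?thesis using assms by (auto simp: tpm_def S1_def realizations_def)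
qed

lemma real_tpm:
  assumes B: "B \<subseteq> W" and a: "a \<in> W"
  shows "realizations M (tpm B a) = {b. eqv B a b}"
proof (intro set_eqI iffI)
  fix b assume "b \<in> realizations M (tpm B a)"
  then have b: "b \<in> W" "\<And>\<phi>. \<phi> \<in> pformulas L B 1 \<Longrightarrow> a \<in> sol M \<phi> [] \<Longrightarrow> b \<in> sol M \<phi> []"
    by (auto simp: realizations_def tpm_def)
  have one: "P (\<lambda>_. b)" if P: "Dm B P" "P (\<lambda>_. a)" for P
  proof -
    obtain \<psi> where "\<psi> \<in> pformulas L B 1" "\<forall>a\<in>W. a \<in> sol M \<psi> [] \<longleftrightarrow> P (\<lambda>_. a)" using unary_fm[OF P(1)] by blast
    then show ?thesis using b P(2) a by blast
  qed
  have "P (\<lambda>_. a) = P (\<lambda>_. b)" if "Dm B P" for P using one[OF that] one[OF D_neg[OF that]] by blast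
  then show "b \<in> {b. eqv B a b}" using a b(1) by (simp add: eqv_def)
next
  fix b assume "b \<in> {b. eqv B a b}"
  then have e: "eqv B a b" by simp
  have "b \<in> sol M \<phi> []" if "\<phi> \<in> tpm B a" for \<phi>
    using eqv_1[OF e Dm_unary[OF B]] that by (auto simp: tpm_def)
  then show "b \<in> realizations M (tpm B a)" using eqv_U[OF e] by (simp add: realizations_def)
qed

text \<open>The witnesses demanded by preservation and by convexity to the right are all taken at
  \<open>q\<close>; the conditions on \<open>R\<close> are exactly the premises in
  \<open>P3\<close>.\<close>

lemma convex_right_of:
  assumes B: "B \<subseteq> W" "q \<in> W" and \<psi>: "\<forall>a\<in>W. \<forall>b\<in>W. pholds M \<psi> [a, b] \<longleftrightarrow> R a b"
    and R: "R q q" "\<forall>x\<in>W. R x q \<longrightarrow> rk q \<le> rk x" "\<exists>y. eqv B q y \<and> y \<noteq> q \<and> R y q"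
      "\<exists>g. eqv B q g \<and> rk g < rk q" "\<exists>g. eqv B q g \<and> (\<forall>x\<in>W. R x q \<longrightarrow> rk x < rk g)"
      "\<forall>a b c. eqv B q a \<and> eqv B q b \<and> eqv B q c \<and> R a q \<and> R b q \<and> rk a < rk c \<and> rk c < rk b \<longrightarrow> R c q"
  shows "convex_right L M (tpm B q) \<psi>"
proof -
  obtain y g g' where y: "eqv B q y" "y \<noteq> q" "R y q" and g: "eqv B q g" "rk g < rk q"
    and g': "eqv B q g'" "\<forall>x\<in>W. R x q \<longrightarrow> rk x < rk g'" using R(3-5) by blast
  note U = eqv_U[OF y(1)] eqv_U[OF g(1)] eqv_U[OF g'(1)]
  have s: "sol M \<psi> [q] = {x \<in> W. R x q}" using \<psi> B by (auto simp: sol_def)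
  have P: "realizations M (tpm B q) = {b. eqv B q b}" by (rule real_tpm[OF B])
  have qP: "q \<in> {b. eqv B q b}" using B by simp
  have "preserving L M (tpm B q) \<psi>" unfolding preserving_def P s
  proof (rule bexI[of _ q], rule bexI[of _ g], rule bexI[of _ g'], intro conjI)
    show "{b. eqv B q b} \<inter> (sol M \<psi> [q] - {q}) \<noteq> {}" unfolding s using y U by blast
    show "set_less L M {g} (sol M \<psi> [q])" unfolding s
      using rk_less U R(2) g(2) by (auto simp: set_less_def intro: order_less_le_trans)
    show "set_less L M (sol M \<psi> [q]) {g'}" unfolding s using rk_less U g'(2) by (auto simp: set_less_def)
  qed (use g g' qP in auto)
  moreover have "convex_in L M ({x \<in> W. R x q} \<inter> {b. eqv B q b}) {b. eqv B q b}"
    unfolding convex_in_def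
  proof (intro conjI ballI impI)
    fix a b c assume h: "a \<in> {x \<in> W. R x q} \<inter> {b. eqv B q b}" "b \<in> {x \<in> W. R x q} \<inter> {b. eqv B q b}"
      "c \<in> {b. eqv B q b}" "less_in L M a c \<and> less_in L M c b"
    have "c \<in> W" using h(3) eqv_U by blast
    then show "c \<in> {x \<in> W. R x q} \<inter> {b. eqv B q b}"
      using R(6)[THEN spec[of _ a], THEN spec[of _ b], THEN spec[of _ c]] h rk_less by simp
  qed simp
  ultimately show ?thesis unfolding convex_right_def trace_def P
    using qP B R(1,2) rk_le s by (intro conjI bexI[of _ q]) simp_all
qed

lemma convex_left_of:
  assumes B: "B \<subseteq> W" "q \<in> W" and \<psi>: "\<forall>a\<in>W. \<forall>b\<in>W. pholds M \<psi> [a, b] \<longleftrightarrow> R a b"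
    and R: "R q q" "\<forall>x\<in>W. R x q \<longrightarrow> rk x \<le> rk q" "\<exists>y. eqv B q y \<and> y \<noteq> q \<and> R y q"
      "\<exists>g. eqv B q g \<and> rk q < rk g" "\<exists>g. eqv B q g \<and> (\<forall>x\<in>W. R x q \<longrightarrow> rk g < rk x)"
      "\<forall>a b c. eqv B q a \<and> eqv B q b \<and> eqv B q c \<and> R a q \<and> R b q \<and> rk c < rk a \<and> rk b < rk c \<longrightarrow> R c q"
  shows "convex_left L M (tpm B q) \<psi>"
proof -
  obtain y g g' where y: "eqv B q y" "y \<noteq> q" "R y q" and g: "eqv B q g" "rk q < rk g"
    and g': "eqv B q g'" "\<forall>x\<in>W. R x q \<longrightarrow> rk g' < rk x" using R(3-5) by blast
  note U = eqv_U[OF y(1)] eqv_U[OF g(1)] eqv_U[OF g'(1)]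
  have s: "sol M \<psi> [q] = {x \<in> W. R x q}" using \<psi> B by (auto simp: sol_def)
  have P: "realizations M (tpm B q) = {b. eqv B q b}" by (rule real_tpm[OF B])
  have qP: "q \<in> {b. eqv B q b}" using B by simp
  have "preserving L M (tpm B q) \<psi>" unfolding preserving_def P s
  proof (rule bexI[of _ q], rule bexI[of _ g'], rule bexI[of _ g], intro conjI)
    show "{b. eqv B q b} \<inter> (sol M \<psi> [q] - {q}) \<noteq> {}" unfolding s using y U by blast
    show "set_less L M (sol M \<psi> [q]) {g}" unfolding s
      using rk_less U R(2) g(2) by (auto simp: set_less_def intro: order_le_less_trans)
    show "set_less L M {g'} (sol M \<psi> [q])" unfolding s using rk_less U g'(2) by (auto simp: set_less_def)
  qed (use g g' qP in auto)
  moreover have "convex_in L M ({x \<in> W. R x q} \<inter> {b. eqv B q b}) {b. eqv B q b}"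
    unfolding convex_in_def
  proof (intro conjI ballI impI)
    fix a b c assume h: "a \<in> {x \<in> W. R x q} \<inter> {b. eqv B q b}" "b \<in> {x \<in> W. R x q} \<inter> {b. eqv B q b}"
      "c \<in> {b. eqv B q b}" "less_in L M a c \<and> less_in L M c b"
    have "c \<in> W" using h(3) eqv_U by blast
    then show "c \<in> {x \<in> W. R x q} \<inter> {b. eqv B q b}"
      using R(6)[THEN spec[of _ b], THEN spec[of _ a], THEN spec[of _ c]] h rk_less by simp
  qed simp
  ultimately show ?thesis unfolding convex_left_def trace_def P
    using qP B R(1,2) rk_le s by (intro conjI bexI[of _ q]) simp_all
qed

lemma cc_fm: "\<phi> \<in> pformulas L B 1 \<Longrightarrow> convex_closure L \<phi> \<in> pformulas L B 1"
  using lt by (auto simp: formulas_def convex_closure_def inst_at_def le_fm_def)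

lemma inst_sat:
  assumes "\<phi> \<in> pformulas L B 1" "i \<noteq> 0" "e i \<in> W"
  shows "sat S e (inst_at i \<phi>) \<longleftrightarrow> e i \<in> sol M \<phi> []"
proof -
  have "sat S (e(0 := a)) \<phi> = sat S (\<lambda>k. [a] ! k) \<phi>" for a
    by (rule sat_cong) (use assms(1) in \<open>auto simp: formulas_def\<close>)
  then show ?thesis using assms(2,3) by (auto simp: inst_at_def sol_def holds_def)
qed

lemma sol_cc:
  assumes "\<phi> \<in> pformulas L B 1"
  shows "sol M (convex_closure L \<phi>) [] = {x \<in> W. \<exists>a\<in>sol M \<phi> []. \<exists>b\<in>sol M \<phi> []. rk a \<le> rk x \<and> rk x \<le> rk b}"
proof -
  have "pholds M (convex_closure L \<phi>) [x] \<longleftrightarrow> (\<exists>a\<in>sol M \<phi> []. \<exists>b\<in>sol M \<phi> []. rk a \<le> rk x \<and> rk x \<le> rk b)"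
    if x: "x \<in> W" for x
  proof -
    define e where "e = (\<lambda>a b. (\<lambda>i. [x] ! i)(1 := a, 2 := b))"
    have e: "e a b 0 = x" "e a b 1 = a" "e a b 2 = b" for a b by (simp_all add: e_def)
    have "pholds M (convex_closure L \<phi>) [x] \<longleftrightarrow> (\<exists>a\<in>W. \<exists>b\<in>W.
       (sat S (e a b) (inst_at 1 \<phi>) \<and> sat S (e a b) (inst_at 2 \<phi>)) \<and>
       sat S (e a b) (le_fm L 1 0) \<and> sat S (e a b) (le_fm L 0 2))"
      by (simp add: holds_def convex_closure_def e_def)
    also have "\<dots> \<longleftrightarrow> (\<exists>a\<in>W. \<exists>b\<in>W. (a \<in> sol M \<phi> [] \<and> b \<in> sol M \<phi> []) \<and> rk a \<le> rk x \<and> rk x \<le> rk b)"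
    proof (intro bex_cong refl)
      fix a b assume ab: "a \<in> W" "b \<in> W"
      have "sat S (e a b) (inst_at 1 \<phi>) \<longleftrightarrow> a \<in> sol M \<phi> []" "sat S (e a b) (inst_at 2 \<phi>) \<longleftrightarrow> b \<in> sol M \<phi> []"
        using inst_sat[OF assms, of 1 "e a b"] inst_sat[OF assms, of 2 "e a b"] ab by (simp_all add: e e[simplified])
      moreover have "sat S (e a b) (le_fm L 1 0) \<longleftrightarrow> rk a \<le> rk x" "sat S (e a b) (le_fm L 0 2) \<longleftrightarrow> rk x \<le> rk b"
        using rk_le[OF ab(1) x] rk_le[OF x ab(2)] by (auto simp: le_fm_def le_in_def less_in_def e e[simplified])
      ultimately show "((sat S (e a b) (inst_at 1 \<phi>) \<and> sat S (e a b) (inst_at 2 \<phi>)) \<and>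
       sat S (e a b) (le_fm L 1 0) \<and> sat S (e a b) (le_fm L 0 2)) \<longleftrightarrow>
        ((a \<in> sol M \<phi> [] \<and> b \<in> sol M \<phi> []) \<and> rk a \<le> rk x \<and> rk x \<le> rk b)" by simp
    qed
    also have "\<dots> \<longleftrightarrow> (\<exists>a\<in>sol M \<phi> []. \<exists>b\<in>sol M \<phi> []. rk a \<le> rk x \<and> rk x \<le> rk b)" by (auto simp: sol_def)
    finally show ?thesis .
  qed
  then show ?thesis by (auto simp: sol_def[of M "convex_closure L \<phi>"])
qed

end

section \<open>The clauses of the Restriction\<close>

text \<open>The Restriction enters with the whole universe as the definable set from which the
  parameters of the descending relations are drawn.\<close>

locale lo_restricted = lo_model L M
  for L :: "('f, 'r) lang" and M :: "('f, 'r, 'm) struct" +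
  assumes RR: "A \<subseteq> univ M \<Longrightarrow> finite A \<Longrightarrow> no_descending_equivs L M A (univ M) \<and>
    (\<forall>p\<in>S1 L M A. finite {q \<in> S1 L M A. type_closure L M q = type_closure L M p}) \<and>
    (\<forall>p\<in>S1 L M A. \<forall>\<phi>\<in>pformulas L A 2.
      (convex_right L M p \<phi> \<longrightarrow> eq_generating_right L M p \<phi>) \<and>
      (convex_left L M p \<phi> \<longrightarrow> eq_generating_left L M p \<phi>))"
begin

lemma gen_right: "P3 rk"
  unfolding P3_def
proof (intro allI impI, elim conjE)
  fix B R q a b x
  assume B: "finite B" "B \<subseteq> W" and R: "Dm B (\<lambda>e. R (e 0) (e 1))" and q: "q \<in> W"
    and h: "R q q" "\<forall>x\<in>W. R x q \<longrightarrow> rk q \<le> rk x" "\<exists>y. eqv B q y \<and> y \<noteq> q \<and> R y q"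
      "\<exists>g. eqv B q g \<and> rk g < rk q" "\<exists>g. eqv B q g \<and> (\<forall>x\<in>W. R x q \<longrightarrow> rk x < rk g)"
      "\<forall>a b c. eqv B q a \<and> eqv B q b \<and> eqv B q c \<and> R a q \<and> R b q \<and> rk a < rk c \<and> rk c < rk b \<longrightarrow> R c q"
    and ab: "eqv B q a" "eqv B q b" "R b a" "x \<in> W" "rk b \<le> rk x"
  obtain \<psi> where \<psi>: "\<psi> \<in> pformulas L B 2" "\<forall>a\<in>W. \<forall>b\<in>W. pholds M \<psi> [a, b] \<longleftrightarrow> R a b"
    using binary_fm[OF R] by blast
  have "eq_generating_right L M (tpm B q) \<psi>"
    using RR[OF B(2,1)] tpm_S1[OF B(2) q] \<psi>(1) convex_right_of[OF B(2) q \<psi>(2) h] by blast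
  moreover have "a \<in> realizations M (tpm B q)" "b \<in> trace M (tpm B q) \<psi> a"
    using ab \<psi>(2) eqv_U[OF ab(1)] eqv_U[OF ab(2)] by (auto simp: trace_def sol_def real_tpm[OF B(2) q])
  ultimately have "pholds M \<psi> [x, a] \<longleftrightarrow> pholds M \<psi> [x, b]"
    using ab(4,5) rk_le eqv_U[OF ab(2)] unfolding eq_generating_right_def by blast
  then show "R x a = R x b" using \<psi>(2) ab(4) eqv_U[OF ab(1)] eqv_U[OF ab(2)] by simp
qed

lemma gen_left: "P3 (\<lambda>a. - rk a)"
  unfolding P3_def neg_le_iff_le neg_less_iff_less
proof (intro allI impI, elim conjE)
  fix B R q a b x
  assume B: "finite B" "B \<subseteq> W" and R: "Dm B (\<lambda>e. R (e 0) (e 1))" and q: "q \<in> W"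
    and h: "R q q" "\<forall>x\<in>W. R x q \<longrightarrow> rk x \<le> rk q" "\<exists>y. eqv B q y \<and> y \<noteq> q \<and> R y q"
      "\<exists>g. eqv B q g \<and> rk q < rk g" "\<exists>g. eqv B q g \<and> (\<forall>x\<in>W. R x q \<longrightarrow> rk g < rk x)"
      "\<forall>a b c. eqv B q a \<and> eqv B q b \<and> eqv B q c \<and> R a q \<and> R b q \<and> rk c < rk a \<and> rk b < rk c \<longrightarrow> R c q"
    and ab: "eqv B q a" "eqv B q b" "R b a" "x \<in> W" "rk x \<le> rk b"
  obtain \<psi> where \<psi>: "\<psi> \<in> pformulas L B 2" "\<forall>a\<in>W. \<forall>b\<in>W. pholds M \<psi> [a, b] \<longleftrightarrow> R a b"
    using binary_fm[OF R] by blast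
  have "eq_generating_left L M (tpm B q) \<psi>"
    using RR[OF B(2,1)] tpm_S1[OF B(2) q] \<psi>(1) convex_left_of[OF B(2) q \<psi>(2) h] by blast
  moreover have "a \<in> realizations M (tpm B q)" "b \<in> trace M (tpm B q) \<psi> a"
    using ab \<psi>(2) eqv_U[OF ab(1)] eqv_U[OF ab(2)] by (auto simp: trace_def sol_def real_tpm[OF B(2) q])
  ultimately have "pholds M \<psi> [x, a] \<longleftrightarrow> pholds M \<psi> [x, b]"
    using ab(4,5) rk_le eqv_U[OF ab(2)] unfolding eq_generating_left_def by blast
  then show "R x a = R x b" using \<psi>(2) ab(4) eqv_U[OF ab(1)] eqv_U[OF ab(2)] by simp
qed

text \<open>The convex closure of a formula defines a convex set and is its own closure up to
  equivalence, so points that convex definable sets do not separate have types with equal closure.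
  Only finitely many types have a given closure, hence two of the points share one.\<close>

lemma same_closure_eqv:
  assumes B: "finite B" "B \<subseteq> W" and z: "z \<in> W" and \<beta>: "range \<beta> \<subseteq> W" and J: "infinite J"
    and C: "\<And>C j. Dm B (\<lambda>e. C (e 0)) \<Longrightarrow> cvx C \<Longrightarrow> j \<in> J \<Longrightarrow> C z = C (\<beta> j)"
  shows "\<exists>j\<in>J. \<exists>l\<in>J. j < l \<and> eqv B (\<beta> j) (\<beta> (l::nat))"
proof -
  have \<beta>W: "\<beta> j \<in> W" for j using \<beta> by blast
  have sub: "type_closure L M (tpm B a) \<subseteq> type_closure L M (tpm B b)"
    if ab: "a \<in> W" "b \<in> W" "\<And>C. Dm B (\<lambda>e. C (e 0)) \<Longrightarrow> cvx C \<Longrightarrow> C a = C b" for a b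
  proof
    fix Y assume "Y \<in> type_closure L M (tpm B a)"
    then obtain \<phi> where \<phi>: "\<phi> \<in> pformulas L B 1" "a \<in> sol M \<phi> []" "Y = sol M (convex_closure L \<phi>) []"
      by (auto simp: type_closure_def tpm_def)
    define \<psi> where "\<psi> = convex_closure L \<phi>"
    have \<psi>: "\<psi> \<in> pformulas L B 1" unfolding \<psi>_def by (rule cc_fm[OF \<phi>(1)])
    have Ys: "Y = sol M \<psi> []" by (simp add: \<phi>(3) \<psi>_def)
    have "cvx (\<lambda>x. x \<in> sol M \<psi> [])" unfolding cvx_def \<psi>_def sol_cc[OF \<phi>(1)]
      by (auto intro: order_trans)
    from ab(3)[OF Dm_unary[OF B(2) \<psi>] this] have "b \<in> sol M \<psi> []"
      using \<phi>(2) ab(1) unfolding \<psi>_def sol_cc[OF \<phi>(1)] by auto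
    moreover have "sol M (convex_closure L \<psi>) [] = sol M \<psi> []"
      unfolding sol_cc[OF \<psi>] unfolding \<psi>_def sol_cc[OF \<phi>(1)] by (auto intro: order_trans)
    ultimately show "Y \<in> type_closure L M (tpm B b)"
      using \<psi> Ys unfolding type_closure_def tpm_def by blast
  qed
  have "type_closure L M (tpm B (\<beta> j)) = type_closure L M (tpm B z)" if "j \<in> J" for j
    using sub[OF z \<beta>W C] sub[OF \<beta>W z C[symmetric]] that by blast
  then have "(\<lambda>j. tpm B (\<beta> j)) ` J \<subseteq> {q \<in> S1 L M B. type_closure L M q = type_closure L M (tpm B z)}"
    using tpm_S1[OF B(2) \<beta>W] by auto
  moreover have "finite {q \<in> S1 L M B. type_closure L M q = type_closure L M (tpm B z)}"
    using RR[OF B(2,1)] tpm_S1[OF B(2) z] by blast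
  ultimately have "finite ((\<lambda>j. tpm B (\<beta> j)) ` J)" by (rule finite_subset)
  then have "\<not> inj_on (\<lambda>j. tpm B (\<beta> j)) J" using J finite_imageD by blast
  then obtain j l where jl: "j \<in> J" "l \<in> J" "j \<noteq> l" "tpm B (\<beta> j) = tpm B (\<beta> l)" by (auto simp: inj_on_def)
  have "eqv B (\<beta> j) (\<beta> l)" using real_tpm[OF B(2) \<beta>W, of j] real_tpm[OF B(2) \<beta>W, of l] jl(4) \<beta>W[of l] by auto
  then show ?thesis using jl eqv_sym by (metis linorder_neqE_nat)
qed

text \<open>The sequence becomes one formula with parameter tuples of length \<open>n\<close>, where
  \<open>n\<close> bounds its free variables; the pointwise conditions are then converted into the
  conditions on quotients.\<close>

lemma no_descent:
  assumes B: "finite B" "B \<subseteq> W" and q: "q \<in> W" and D: "Dm B (\<lambda>e. \<epsilon> (e 0) (e 1) (\<lambda>i. e (Suc (Suc i))))"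
    and b: "\<And>i. b i \<in> asg W"
    and rf: "\<And>i x. eqv B q x \<Longrightarrow> \<epsilon> x x (b i)"
    and sy: "\<And>i x y. eqv B q x \<Longrightarrow> eqv B q y \<Longrightarrow> \<epsilon> x y (b i) \<Longrightarrow> \<epsilon> y x (b i)"
    and tr: "\<And>i x y z. eqv B q x \<Longrightarrow> eqv B q y \<Longrightarrow> eqv B q z \<Longrightarrow> \<epsilon> x y (b i) \<Longrightarrow> \<epsilon> y z (b i) \<Longrightarrow> \<epsilon> x z (b i)"
    and cv: "\<And>i x y z. eqv B q x \<Longrightarrow> eqv B q y \<Longrightarrow> eqv B q z \<Longrightarrow> rk x < rk y \<Longrightarrow> rk y < rk z \<Longrightarrow> \<epsilon> x z (b i) \<Longrightarrow> \<epsilon> x y (b i)"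
    and dn: "\<And>i x y. eqv B q x \<Longrightarrow> eqv B q y \<Longrightarrow> rk x < rk y \<Longrightarrow> \<not> \<epsilon> x y (b i) \<Longrightarrow>
         \<exists>z. eqv B q z \<and> rk x < rk z \<and> rk z < rk y \<and> \<not> \<epsilon> x z (b i) \<and> \<not> \<epsilon> z y (b i)"
    and fi: "\<And>i x y. eqv B q x \<Longrightarrow> eqv B q y \<Longrightarrow> \<epsilon> x y (b (Suc i)) \<Longrightarrow> \<epsilon> x y (b i)"
    and im: "\<And>i x. eqv B q x \<Longrightarrow> infinite ((\<lambda>y. {z. eqv B q z \<and> \<epsilon> y z (b (Suc i))}) ` {y. eqv B q y \<and> \<epsilon> x y (b i)})"
    and ic: "\<And>i x. eqv B q x \<Longrightarrow> infinite {y. eqv B q y \<and> \<epsilon> x y (b (Suc i))}"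
  shows False
proof -
  define K where "K = {x. eqv B q x}"
  have KW: "K \<subseteq> W" using eqv_U by (auto simp: K_def)
  have P: "realizations M (tpm B q) = K" unfolding K_def by (rule real_tpm[OF B(2) q])
  obtain \<phi> where \<phi>: "wf_fm (lang_with L B) \<phi>" "\<And>e. e \<in> asg W \<Longrightarrow> \<epsilon> (e 0) (e 1) (\<lambda>i. e (Suc (Suc i))) = sat S e \<phi>"
    using D by (rule DmE) blast
  have "\<exists>n. \<forall>i\<in>free_vars \<phi>. i < n" using finite_free_vars[of \<phi>] by (simp add: finite_nat_set_iff_bounded)
  then obtain n where n: "\<forall>i\<in>free_vars \<phi>. i < n" by (rule exE)
  have \<phi>n: "\<phi> \<in> pformulas L B (n + 2)" using \<phi>(1) n by (force simp: formulas_def)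
  define c where "c = (\<lambda>i. map (b i) [0..<n])"
  have c: "c i \<in> tuples W n" for i using b asgD by (auto simp: c_def tuples_def)
  have ph: "pholds M \<phi> (x # y # c i) \<longleftrightarrow> \<epsilon> x y (b i)" if xy: "x \<in> W" "y \<in> W" for x y i
  proof -
    have "sat S (\<lambda>k. (x # y # c i) ! k) \<phi> = sat S (case_nat x (case_nat y (b i))) \<phi>"
    proof (rule sat_cong)
      fix k assume "k \<in> free_vars \<phi>"
      then have "k < n" using n by blast
      then show "(x # y # c i) ! k = case_nat x (case_nat y (b i)) k" by (auto simp: c_def nth_Cons split: nat.split)
    qed
    also have "\<dots> = \<epsilon> x y (b i)" using \<phi>(2)[of "case_nat x (case_nat y (b i))"] xy b by simp
    finally show ?thesis by (simp add: holds_def)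
  qed
  define \<rho> where "\<rho> = (\<lambda>i. {(x, y). x \<in> K \<and> y \<in> K \<and> \<epsilon> x y (b i)})"
  have rel: "rel_on M (tpm B q) \<phi> (c i) = \<rho> i" for i
    unfolding rel_on_def P \<rho>_def using ph KW by blast
  have eq: "equiv K (\<rho> i)" for i
  proof (rule equivI)
    show "\<rho> i \<subseteq> K \<times> K" by (auto simp: \<rho>_def)
    show "refl_on K (\<rho> i)" by (rule refl_onI) (use rf in \<open>auto simp: \<rho>_def K_def\<close>)
    show "sym (\<rho> i)"
    proof (rule symI)
      fix x y assume "(x, y) \<in> \<rho> i"
      then show "(y, x) \<in> \<rho> i" using sy[of x y i] by (simp add: \<rho>_def K_def)
    qed
    show "trans (\<rho> i)"
    proof (rule transI)
      fix x y z assume "(x, y) \<in> \<rho> i" "(y, z) \<in> \<rho> i"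
      then show "(x, z) \<in> \<rho> i" using tr[of x y z i] by (simp add: \<rho>_def K_def)
    qed
  qed
  have cls: "\<exists>x\<in>K. C = \<rho> i `` {x}" if "C \<in> K // \<rho> i" for C i using that by (rule quotientE) blast
  \<comment> \<open>Density is demanded of whole classes, so the order of two inequivalent
    representatives must be passed on to all members; this is convexity.\<close>
  have apart: "rk x' < rk y'" if h: "x \<in> K" "y \<in> K" "rk x < rk y" "\<not> \<epsilon> x y (b i)" "x' \<in> K" "y' \<in> K" "\<epsilon> x x' (b i)" "\<epsilon> y y' (b i)"
    for x y x' y' i
  proof (rule ccontr)
    assume n: "\<not> rk x' < rk y'"
    have E: "eqv B q x" "eqv B q y" "eqv B q x'" "eqv B q y'" using h by (auto simp: K_def)
    have xy': "\<not> \<epsilon> x' y' (b i)" "\<not> \<epsilon> x y' (b i)" "\<not> \<epsilon> x' y (b i)"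
      using h(4,7,8) sy tr E by meson+
    have ne: "rk u \<noteq> rk v" if "u \<in> K" "v \<in> K" "\<not> \<epsilon> u v (b i)" for u v
      using r_eq[of u v] that KW rf[of u i] by (auto simp: K_def)
    have lt: "rk y' < rk x'" using n ne[OF h(5,6) xy'(1)] by simp
    consider "rk y < rk x'" | "rk x' < rk y" using ne[OF h(5,2) xy'(3)] by linarith
    then show False
    proof cases
      case 1 then show False using cv[OF E(1,2,3) h(3) 1 h(7)] h(4) by blast
    next
      case 2
      then have "\<epsilon> y' x' (b i)" using cv[OF E(4,3,2) lt 2] sy[OF E(2,4) h(8)] by blast
      then show False using sy[OF E(4,3)] xy'(1) by blast
    qed
  qed
  have cd: "convex_dense_equiv L M K (\<rho> i)" for i
    unfolding convex_dense_equiv_def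
  proof (intro conjI eq ballI impI)
    fix C assume "C \<in> K // \<rho> i"
    then obtain x where x: "x \<in> K" "C = \<rho> i `` {x}" using cls by blast
    have C: "y \<in> C \<longleftrightarrow> y \<in> K \<and> \<epsilon> x y (b i)" for y using x by (auto simp: \<rho>_def)
    show "convex_in L M C K" unfolding convex_in_def
    proof (intro conjI ballI impI)
      show "C \<subseteq> K" using C by blast
      fix u v w assume h: "u \<in> C" "v \<in> C" "w \<in> K" "less_in L M u w \<and> less_in L M w v"
      have E: "eqv B q x" "eqv B q u" "eqv B q v" "eqv B q w" using h x C by (auto simp: K_def)
      have "rk u < rk w" "rk w < rk v" using h rk_less KW C by blast+
      moreover have "\<epsilon> u v (b i)" using tr[OF E(2,1,3)] sy[OF E(1,2)] h C by blast
      ultimately have "\<epsilon> u w (b i)" using cv[OF E(2,4,3)] by blast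
      then show "w \<in> C" using tr[OF E(1,2,4)] h C by blast
    qed
  next
    fix C C' assume CC: "C \<in> K // \<rho> i" "C' \<in> K // \<rho> i" "set_less L M C C'"
    obtain x where x: "x \<in> K" "C = \<rho> i `` {x}" using cls CC by blast
    obtain y where y: "y \<in> K" "C' = \<rho> i `` {y}" using cls CC by blast
    have C: "z \<in> C \<longleftrightarrow> z \<in> K \<and> \<epsilon> x z (b i)" "z \<in> C' \<longleftrightarrow> z \<in> K \<and> \<epsilon> y z (b i)" for z using x y by (auto simp: \<rho>_def)
    have E: "eqv B q x" "eqv B q y" using x y by (auto simp: K_def)
    have W: "x \<in> W" "y \<in> W" using x y KW by auto
    have "x \<in> C" "y \<in> C'" using C x y rf E by auto
    then have xy: "rk x < rk y" using CC(3) rk_less W by (auto simp: set_less_def)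
    have "\<not> \<epsilon> x y (b i)"
    proof
      assume "\<epsilon> x y (b i)"
      then have "y \<in> C" using C y by blast
      then have "less_in L M y y" using CC(3) \<open>y \<in> C'\<close> by (auto simp: set_less_def)
      then show False using less_irrefl W by blast
    qed
    then obtain z where z: "eqv B q z" "rk x < rk z" "rk z < rk y" "\<not> \<epsilon> x z (b i)" "\<not> \<epsilon> z y (b i)"
      using dn[OF E xy] by blast
    have zK: "z \<in> K" using z by (simp add: K_def)
    have "\<rho> i `` {z} \<in> K // \<rho> i" using zK by (rule quotientI)
    moreover have Z: "w \<in> \<rho> i `` {z} \<longleftrightarrow> w \<in> K \<and> \<epsilon> z w (b i)" for w using zK by (auto simp: \<rho>_def)
    moreover have "set_less L M C (\<rho> i `` {z})" unfolding set_less_def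
      using apart[OF x(1) zK z(2,4)] C Z rk_less KW by (meson subsetD)
    moreover have "set_less L M (\<rho> i `` {z}) C'" unfolding set_less_def
      using apart[OF zK y(1) z(3,5)] C Z rk_less KW by (meson subsetD)
    ultimately show "\<exists>D\<in>K // \<rho> i. set_less L M C D \<and> set_less L M D C'" by blast
  qed
  have sp: "splits_infinitely K (\<rho> i) (\<rho> (Suc i))" for i
    unfolding splits_infinitely_def
  proof (intro ballI conjI impI)
    fix C assume "C \<in> K // \<rho> i"
    then obtain x where x: "x \<in> K" "C = \<rho> i `` {x}" using cls by blast
    have C: "y \<in> C \<longleftrightarrow> y \<in> K \<and> \<epsilon> x y (b i)" for y using x by (auto simp: \<rho>_def)
    have Ex: "eqv B q x" using x by (simp add: K_def)
    have sub: "\<rho> (Suc i) `` {y} \<subseteq> C" if "y \<in> C" for y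
    proof
      fix z assume "z \<in> \<rho> (Suc i) `` {y}"
      then have z: "z \<in> K" "\<epsilon> y z (b (Suc i))" by (auto simp: \<rho>_def)
      have E: "eqv B q y" "eqv B q z" using that C z by (auto simp: K_def)
      show "z \<in> C" using tr[OF Ex E] fi[OF E z(2)] that C z(1) by blast
    qed
    have cl: "\<rho> (Suc i) `` {y} \<in> {D \<in> K // \<rho> (Suc i). D \<subseteq> C}" if "y \<in> C" for y
      using sub[OF that] that C quotientI[of y K "\<rho> (Suc i)"] by simp
    have ref: "y \<in> \<rho> (Suc i) `` {y}" if "y \<in> C" for y using that C rf by (auto simp: \<rho>_def K_def)
    show "partition_on C {D \<in> K // \<rho> (Suc i). D \<subseteq> C}"
    proof (rule partition_onI)
      show "\<Union>{D \<in> K // \<rho> (Suc i). D \<subseteq> C} = C" using cl ref by blast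
      show "disjnt p p'" if "p \<in> {D \<in> K // \<rho> (Suc i). D \<subseteq> C}" "p' \<in> {D \<in> K // \<rho> (Suc i). D \<subseteq> C}" "p \<noteq> p'" for p p'
        using quotient_disj[OF eq[of "Suc i"], of p p'] that by (auto simp: disjnt_def)
      show "{} \<notin> {D \<in> K // \<rho> (Suc i). D \<subseteq> C}"
        using in_quotient_imp_non_empty[OF eq[of "Suc i"]] by blast
    qed
    have "(\<lambda>y. {z. eqv B q z \<and> \<epsilon> y z (b (Suc i))}) ` {y. eqv B q y \<and> \<epsilon> x y (b i)} \<subseteq> {D \<in> K // \<rho> (Suc i). D \<subseteq> C}"
    proof (rule image_subsetI)
      fix y assume "y \<in> {y. eqv B q y \<and> \<epsilon> x y (b i)}"
      then have y: "y \<in> C" using C by (simp add: K_def)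
      have "{z. eqv B q z \<and> \<epsilon> y z (b (Suc i))} = \<rho> (Suc i) `` {y}" using y C by (auto simp: \<rho>_def K_def)
      then show "{z. eqv B q z \<and> \<epsilon> y z (b (Suc i))} \<in> {D \<in> K // \<rho> (Suc i). D \<subseteq> C}" using cl[OF y] by simp
    qed
    then show "infinite {D \<in> K // \<rho> (Suc i). D \<subseteq> C}" using im[OF Ex, of i] finite_subset by blast
    fix D assume "D \<in> K // \<rho> (Suc i)"
    then obtain y where y: "y \<in> K" "D = \<rho> (Suc i) `` {y}" using cls by blast
    then have "D = {z. eqv B q z \<and> \<epsilon> y z (b (Suc i))}" by (auto simp: \<rho>_def K_def)
    then show "infinite D" using ic[of y i] y by (simp add: K_def)
  qed
  have "no_descending_equivs L M B W" using RR[OF B(2,1)] by blast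
  then have "\<not> (\<exists>b. \<forall>i. b i \<in> tuples W n \<and>
             convex_dense_equiv L M K (rel_on M (tpm B q) \<phi> (b i)) \<and>
             splits_infinitely K (rel_on M (tpm B q) \<phi> (b i)) (rel_on M (tpm B q) \<phi> (b (Suc i))))"
    using tpm_S1[OF B(2) q] \<phi>n unfolding no_descending_equivs_def P[symmetric] by blast
  moreover have "\<forall>i. c i \<in> tuples W n \<and> convex_dense_equiv L M K (rel_on M (tpm B q) \<phi> (c i)) \<and>
             splits_infinitely K (rel_on M (tpm B q) \<phi> (c i)) (rel_on M (tpm B q) \<phi> (c (Suc i)))"
    unfolding rel using c cd sp by blast
  ultimately show False by blast
qed

end

sublocale lo_restricted \<subseteq> restricted "univ M" rk Dm
proof (unfold_locales, goal_cases)
  case 1 show ?case by (rule gen_right)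
next
  case 2 show ?case by (rule gen_left)
next
  case (3 B z \<beta> J) show ?case by (rule same_closure_eqv[OF 3])
next
  case (4 B q \<epsilon> b) show ?case by (rule no_descent[where B = B and q = q and \<epsilon> = \<epsilon> and b = b, OF 4])
qed

section \<open>Isomorphisms and elementary submodels\<close>

lemma eval_Inl: "eval_tm (struct_with M) e (map_tm Inl t) = eval_tm M e t"
proof (induction t)
  case (Fn f ts)
  then have "map (eval_tm (struct_with M) e \<circ> map_tm Inl) ts = map (eval_tm M e) ts" by auto
  then show ?case by (simp del: comp_apply map_eq_conv)
qed simp

lemma sat_Inl: "sat (struct_with M) e (map_fm Inl id \<phi>) = sat M e \<phi>"
proof (induction \<phi> arbitrary: e)
  case (Rel r ts)
  have "map (eval_tm (struct_with M) e \<circ> map_tm Inl) ts = map (eval_tm M e) ts" by (simp add: eval_Inl)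
  then show ?case by (simp del: comp_apply map_eq_conv)
qed (simp_all add: eval_Inl)

lemma wf_tm_Inl: "wf_tm L t \<Longrightarrow> wf_tm (lang_with L B) (map_tm Inl t)"
  by (induction t) auto

lemma wf_fm_Inl: "wf_fm L \<phi> \<Longrightarrow> wf_fm (lang_with L B) (map_fm Inl id \<phi>)"
  by (induction \<phi>) (auto simp: wf_tm_Inl)

lemma tm_projl:
  "wf_tm (lang_with L {}) t \<Longrightarrow> map_tm Inl (map_tm projl t) = t \<and> wf_tm L (map_tm projl t)"
proof (induction t)
  case (Fn f ts)
  obtain g where g: "f = Inl g" "g \<in> funs L" using Fn.prems by auto
  have "map (map_tm Inl \<circ> map_tm projl) ts = ts" by (rule map_idI) (use Fn in auto)
  then show ?case using Fn g by (auto simp del: comp_apply)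
qed simp

lemma fm_projl:
  "wf_fm (lang_with L {}) \<phi> \<Longrightarrow> map_fm Inl id (map_fm projl id \<phi>) = \<phi> \<and> wf_fm L (map_fm projl id \<phi>)"
proof (induction \<phi>)
  case (Rel r ts)
  have "map (map_tm Inl \<circ> map_tm projl) ts = ts" by (rule map_idI) (use Rel tm_projl in auto)
  then show ?case using Rel tm_projl by (auto simp del: comp_apply)
qed (auto simp: tm_projl)

lemma iso_eval:
  assumes N: "is_struct L N" "\<forall>f\<in>funs L. \<forall>xs\<in>tuples (univ N) (far L f). h (fint N f xs) = fint N' f (map h xs)"
    and e: "e \<in> asg (univ N)"
  shows "wf_tm L t \<Longrightarrow> eval_tm N e t \<in> univ N \<and> h (eval_tm N e t) = eval_tm N' (\<lambda>i. h (e i)) t"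
proof (induction t)
  case (Var i) then show ?case using e by (simp add: asg_def)
next
  case (Fn f ts)
  define xs where "xs = map (eval_tm N e) ts"
  have xs: "f \<in> funs L" "xs \<in> tuples (univ N) (far L f)" using Fn by (auto simp: xs_def tuples_def)
  have m: "map h xs = map (eval_tm N' (\<lambda>i. h (e i))) ts" using Fn by (auto simp: xs_def)
  have 1: "eval_tm N e (Fn f ts) = fint N f xs" by (simp add: xs_def)
  have 2: "eval_tm N' (\<lambda>i. h (e i)) (Fn f ts) = fint N' f (map h xs)" by (simp add: m)
  have "fint N f xs \<in> univ N" using N(1) xs by (simp add: is_struct_def)
  then show ?case unfolding 1 2 using N(2) xs by blast
qed

lemma iso_sat:
  assumes N: "is_struct L N" "\<forall>f\<in>funs L. \<forall>xs\<in>tuples (univ N) (far L f). h (fint N f xs) = fint N' f (map h xs)"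
    "\<forall>r\<in>rels L. \<forall>xs\<in>tuples (univ N) (rar L r). rint N r xs \<longleftrightarrow> rint N' r (map h xs)"
    and h: "bij_betw h (univ N) (univ N')"
  shows "wf_fm L \<phi> \<Longrightarrow> e \<in> asg (univ N) \<Longrightarrow> sat N e \<phi> = sat N' (\<lambda>i. h (e i)) \<phi>"
proof (induction \<phi> arbitrary: e)
  case (Eq s t)
  note s = iso_eval[OF N(1,2) Eq.prems(2), of s] and t = iso_eval[OF N(1,2) Eq.prems(2), of t]
  have "wf_tm L s" "wf_tm L t" using Eq.prems by auto
  then show ?case using s t inj_on_eq_iff[OF bij_betw_imp_inj_on[OF h], of "eval_tm N e s" "eval_tm N e t"] by simp
next
  case (Rel r ts)
  define xs where "xs = map (eval_tm N e) ts"
  have ev: "eval_tm N e t \<in> univ N \<and> h (eval_tm N e t) = eval_tm N' (\<lambda>i. h (e i)) t" if t: "t \<in> set ts" for t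
    using iso_eval[OF N(1,2) Rel.prems(2), of t] Rel.prems(1) t by simp
  have "r \<in> rels L" "xs \<in> tuples (univ N) (rar L r)" using Rel.prems(1) ev by (auto simp: xs_def tuples_def)
  moreover have "map h xs = map (eval_tm N' (\<lambda>i. h (e i))) ts" using ev by (simp add: xs_def)
  ultimately have "rint N r xs = rint N' r (map (eval_tm N' (\<lambda>i. h (e i))) ts)" using N(3) by simp
  then show ?case by (simp add: xs_def)
next
  case (Ex i \<phi>)
  have im: "univ N' = h ` univ N" using bij_betw_imp_surj_on[OF h] by simp
  have "sat N (e(i := a)) \<phi> = sat N' ((\<lambda>j. h (e j))(i := h a)) \<phi>" if a: "a \<in> univ N" for a
  proof -
    have "sat N (e(i := a)) \<phi> = sat N' (\<lambda>j. h ((e(i := a)) j)) \<phi>"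
      by (rule Ex.IH[OF _ asg_upd[OF Ex.prems(2) a]]) (use Ex.prems(1) in simp)
    also have "(\<lambda>j. h ((e(i := a)) j)) = (\<lambda>j. h (e j))(i := h a)" by auto
    finally show ?thesis .
  qed
  then show ?case by (simp add: im)
qed auto

lemma eval_univ: "eval_tm (M\<lparr>univ := N\<rparr>) e t = eval_tm M e t"
proof (induction t)
  case (Fn f ts)
  then have "map (eval_tm (M\<lparr>univ := N\<rparr>) e) ts = map (eval_tm M e) ts" by auto
  then show ?case by (simp del: map_eq_conv)
qed simp

context lo_model
begin

lemma Dm_fm:
  assumes "wf_fm L \<phi>" shows "Dm {} (\<lambda>e. sat M e \<phi>)"
  by (rule DmI[OF empty_subsetI wf_fm_Inl[OF assms]]) (simp add: sat_Inl)

lemma fm_Dm: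
  assumes "Dm {} Q" shows "\<exists>\<phi>. wf_fm L \<phi> \<and> (\<forall>e\<in>asg W. Q e = sat M e \<phi>)"
proof -
  obtain \<phi> where \<phi>: "wf_fm (lang_with L {}) \<phi>" "\<And>e. e \<in> asg W \<Longrightarrow> Q e = sat S e \<phi>"
    using assms by (rule DmE) blast
  note p = fm_projl[OF \<phi>(1)]
  have "sat S e \<phi> = sat M e (map_fm projl id \<phi>)" for e
    using sat_Inl[of M e "map_fm projl id \<phi>"] p by simp
  then show ?thesis using \<phi>(2) p by blast
qed

context
  fixes N :: "'m set"
  assumes ne: "N \<noteq> {}" and NW: "N \<subseteq> W"
    and tv: "\<And>Q e c. Dm {} Q \<Longrightarrow> e \<in> asg N \<Longrightarrow> c \<in> W \<Longrightarrow> Q (case_nat c e) \<Longrightarrow> \<exists>c\<in>N. Q (case_nat c e)"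
begin

lemma asg_N: "e \<in> asg N \<Longrightarrow> e \<in> asg W"
  using NW by (auto simp: asg_def)

lemma sat_univ: "wf_fm L \<phi> \<Longrightarrow> e \<in> asg N \<Longrightarrow> sat (M\<lparr>univ := N\<rparr>) e \<phi> = sat M e \<phi>"
proof (induction \<phi> arbitrary: e)
  case (Rel r ts)
  have "map (eval_tm (M\<lparr>univ := N\<rparr>) e) ts = map (eval_tm M e) ts" by (simp add: eval_univ)
  then show ?case by (simp del: map_eq_conv)
next
  case (Ex k \<phi>)
  have wf: "wf_fm L \<phi>" using Ex.prems(1) by simp
  have IH: "sat (M\<lparr>univ := N\<rparr>) (e(k := a)) \<phi> = sat M (e(k := a)) \<phi>" if a: "a \<in> N" for a
    by (rule Ex.IH[OF wf asg_upd[OF Ex.prems(2) a]])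
  have "\<exists>a\<in>N. sat M (e(k := a)) \<phi>" if c: "c \<in> W" "sat M (e(k := c)) \<phi>" for c
  proof -
    define g where "g = (\<lambda>i. if i = k then 0 else Suc i)"
    have g: "(\<lambda>i. case_nat d e (g i)) = e(k := d)" for d by (auto simp: fun_eq_iff g_def)
    from tv[OF D_ren[OF Dm_fm[OF wf], of g] Ex.prems(2) c(1)] c(2) show ?thesis unfolding g by blast
  qed
  then show ?case using IH NW by auto
qed (auto simp: eval_univ)

text \<open>The Tarski-Vaught property for the formula stating that variable 0 is the value of
  \<open>f\<close> closes \<open>N\<close> under the functions.\<close>

lemma fint_N:
  assumes f: "f \<in> funs L" and xs: "xs \<in> tuples N (far L f)" shows "fint M f xs \<in> N"
proof -
  obtain a where a: "a \<in> N" using ne by blast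
  define ts where "ts = map (\<lambda>k. Var (Suc k) :: 'f tm) [0..<far L f]"
  define e where "e = (\<lambda>k. if k < far L f then xs ! k else a)"
  have l: "length xs = far L f" "set xs \<subseteq> N" using xs by (auto simp: tuples_def)
  have e: "e \<in> asg N" using l a by (auto simp: asg_def e_def subset_iff)
  have m: "map (eval_tm M (case_nat d e)) ts = xs" for d
    by (rule nth_equalityI) (auto simp: ts_def e_def l)
  have wf: "wf_fm L (Eq (Var 0) (Fn f ts) :: ('f, 'r) fm)" using f by (auto simp: ts_def)
  have c: "fint M f xs \<in> W" using str f l NW by (auto simp: is_struct_def tuples_def)
  have sc: "sat M (case_nat d e) (Eq (Var 0) (Fn f ts)) \<longleftrightarrow> d = fint M f xs" for d using m[of d] by simp
  obtain d where "d \<in> N" "sat M (case_nat d e) (Eq (Var 0) (Fn f ts))"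
    using tv[OF Dm_fm[OF wf] e c] sc by blast
  then show ?thesis using sc by simp
qed

lemma model_univ:
  assumes "T \<subseteq> formulas L 0" "model L T M" shows "model L T (M\<lparr>univ := N\<rparr>)"
  unfolding model_def
proof (intro conjI ballI)
  show "is_struct L (M\<lparr>univ := N\<rparr>)" using ne fint_N by (simp add: is_struct_def)
  obtain a where a: "a \<in> N" using ne by blast
  fix \<phi> assume \<phi>: "\<phi> \<in> T"
  then have f: "wf_fm L \<phi>" "free_vars \<phi> = {}" using assms(1) by (auto simp: formulas_def)
  have "holds (M\<lparr>univ := N\<rparr>) \<phi> [] = sat (M\<lparr>univ := N\<rparr>) (\<lambda>_. a) \<phi>"
    unfolding holds_def by (rule sat_cong) (simp add: f)
  also have "\<dots> = sat M (\<lambda>_. a) \<phi>" by (rule sat_univ[OF f(1)]) (simp add: a)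
  also have "\<dots> = holds M \<phi> []" unfolding holds_def by (rule sat_cong) (simp add: f)
  also have "\<dots>" using assms(2) \<phi> by (simp add: model_def)
  finally show "holds (M\<lparr>univ := N\<rparr>) \<phi> []" .
qed

end

end

section \<open>Many pairwise non-isomorphic models\<close>

context lo_restricted
begin

text \<open>Preservation and convexity may be witnessed at two different realizations; \<upsilon>
  and \<tau> carry \<open>q\<close> to them, and all conditions are pulled back to
  \<open>q\<close>.\<close>

lemma CRF_CR:
  assumes A: "finite A" "A \<subseteq> W" and q: "q \<in> W" and \<phi>: "\<phi> \<in> CRF L M A (tpm A q)"
  shows "CR A q (\<lambda>y x. pholds M \<phi> [y, x])"
proof -
  define R where "R = (\<lambda>y x. pholds M \<phi> [y, x])"
  have P: "realizations M (tpm A q) = {b. eqv A q b}" by (rule real_tpm[OF A(2) q])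
  have s: "sol M \<phi> [a] = {x \<in> W. R x a}" for a by (simp add: sol_def R_def)
  have \<phi>2: "\<phi> \<in> pformulas L A 2" "preserving L M (tpm A q) \<phi>" "convex_right L M (tpm A q) \<phi>"
    using \<phi> by (auto simp: CRF_def convex_right_def)
  have D: "Dm A (\<lambda>e. R (e 0) (e 1))" unfolding R_def by (rule Dm_binary[OF A(2) \<phi>2(1)])
  obtain \<alpha> \<gamma>1 \<gamma>2 where \<alpha>: "eqv A q \<alpha>" "eqv A q \<gamma>1" "eqv A q \<gamma>2"
    and y0: "{b. eqv A q b} \<inter> ({x \<in> W. R x \<alpha>} - {\<alpha>}) \<noteq> {}"
    and g: "set_less L M {\<gamma>1} {x \<in> W. R x \<alpha>}" "set_less L M {x \<in> W. R x \<alpha>} {\<gamma>2}"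
    using \<phi>2(2) unfolding preserving_def P s by blast
  obtain \<beta> where \<beta>: "eqv A q \<beta>" "convex_in L M ({x \<in> W. R x \<beta>} \<inter> {b. eqv A q b}) {b. eqv A q b}"
    "R \<beta> \<beta>" "\<forall>b\<in>{x \<in> W. R x \<beta>}. le_in L M \<beta> b"
    using \<phi>2(3) unfolding convex_right_def trace_def P s by blast
  have PW: "b \<in> W" if h: "eqv A q b" for b using eqv_U[OF h] by blast
  obtain \<tau> where \<tau>: "\<tau> \<in> Au A" "\<tau> q = \<beta>" using \<beta>(1) eqv_iff[OF A] by blast
  obtain \<upsilon> where \<upsilon>: "\<upsilon> \<in> Au A" "\<upsilon> q = \<alpha>" using \<alpha>(1) eqv_iff[OF A] by blast
  obtain \<sigma> where \<sigma>: "\<sigma> \<in> Au A" "\<And>u. u \<in> W \<Longrightarrow> \<upsilon> (\<sigma> u) = u" using Au_inv[OF \<upsilon>(1) A(2)] by blast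
  have RU: "R (\<upsilon> x) \<alpha> = R x q" if h: "x \<in> W" for x using Au_2[OF A(1) \<upsilon>(1) D h q] \<upsilon>(2) by simp
  have RT: "R (\<tau> x) \<beta> = R x q" if h: "x \<in> W" for x using Au_2[OF A(1) \<tau>(1) D h q] \<tau>(2) by simp
  have PA: "eqv A q (\<rho> x)" if h: "\<rho> \<in> Au A" "eqv A q x" for \<rho> x
    by (rule eqv_trans[OF h(2) eqv_Au[OF A h(1) PW[OF h(2)]]])
  have Rq: "R q q" using RT[OF q] \<tau>(2) \<beta>(3) by simp
  note AW = Au_U[OF \<tau>(1)] Au_U[OF \<upsilon>(1)] Au_U[OF \<sigma>(1)]
  show ?thesis unfolding R_def[symmetric] CR_def
  proof (intro conjI)
    show "Dm A (\<lambda>e. R (e 0) (e 1))" by (rule D)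
    show "R q q" by (rule Rq)
    show "\<forall>x\<in>W. R x q \<longrightarrow> rk q \<le> rk x"
    proof (intro ballI impI)
      fix x assume x: "x \<in> W" "R x q"
      have "le_in L M \<beta> (\<tau> x)" using \<beta>(4) RT[OF x(1)] x AW(1) by simp
      then have "rk (\<tau> q) \<le> rk (\<tau> x)" using rk_le[OF PW[OF \<beta>(1)] AW(1)[OF x(1)]] \<tau>(2) by simp
      then show "rk q \<le> rk x" using Au_le[OF \<tau>(1) q x(1)] by simp
    qed
    obtain y where y: "eqv A q y" "R y \<alpha>" "y \<noteq> \<alpha>" using y0 by blast
    note yW = PW[OF y(1)]
    have "R (\<sigma> y) q" using RU[OF AW(3)[OF yW]] \<sigma>(2)[OF yW] y(2) by simp
    moreover have "\<sigma> y \<noteq> q" using \<sigma>(2)[OF yW] \<upsilon>(2) y(3) by auto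
    ultimately show "\<exists>y. eqv A q y \<and> y \<noteq> q \<and> R y q" using PA[OF \<sigma>(1) y(1)] by blast
    note W1 = PW[OF \<alpha>(1)] and W2 = PW[OF \<alpha>(2)] and W3 = PW[OF \<alpha>(3)]
    have "R \<alpha> \<alpha>" using RU[OF q] Rq \<upsilon>(2) by simp
    then have "less_in L M \<gamma>1 \<alpha>" using g(1) W1 by (simp add: set_less_def)
    then have "rk (\<upsilon> (\<sigma> \<gamma>1)) < rk (\<upsilon> q)" using rk_less[OF W2 W1] \<sigma>(2)[OF W2] \<upsilon>(2) by simp
    then have "rk (\<sigma> \<gamma>1) < rk q" using Au_lt[OF \<upsilon>(1) AW(3)[OF W2] q] by simp
    then show "\<exists>g. eqv A q g \<and> rk g < rk q" using PA[OF \<sigma>(1) \<alpha>(2)] by blast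
    have "rk x < rk (\<sigma> \<gamma>2)" if x: "x \<in> W" "R x q" for x
    proof -
      have "less_in L M (\<upsilon> x) \<gamma>2" using g(2) RU[OF x(1)] x AW(2) by (simp add: set_less_def)
      then have "rk (\<upsilon> x) < rk (\<upsilon> (\<sigma> \<gamma>2))" using rk_less[OF AW(2)[OF x(1)] W3] \<sigma>(2)[OF W3] by simp
      then show ?thesis using Au_lt[OF \<upsilon>(1) x(1) AW(3)[OF W3]] by simp
    qed
    then show "\<exists>g. eqv A q g \<and> (\<forall>x\<in>W. R x q \<longrightarrow> rk x < rk g)" using PA[OF \<sigma>(1) \<alpha>(3)] by blast
    show "\<forall>a b c. eqv A q a \<and> eqv A q b \<and> eqv A q c \<and> R a q \<and> R b q \<and> rk a < rk c \<and> rk c < rk b \<longrightarrow> R c q"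
    proof (intro allI impI, elim conjE)
      fix a b c assume h: "eqv A q a" "eqv A q b" "eqv A q c" "R a q" "R b q" "rk a < rk c" "rk c < rk b"
      note aW = PW[OF h(1)] and bW = PW[OF h(2)] and cW = PW[OF h(3)]
      have "less_in L M (\<tau> a) (\<tau> c)" using rk_less[OF AW(1)[OF aW] AW(1)[OF cW]] Au_lt[OF \<tau>(1) aW cW] h(6) by simp
      moreover have "less_in L M (\<tau> c) (\<tau> b)" using rk_less[OF AW(1)[OF cW] AW(1)[OF bW]] Au_lt[OF \<tau>(1) cW bW] h(7) by simp
      moreover have "\<tau> a \<in> {x \<in> W. R x \<beta>} \<inter> {b. eqv A q b}"
        using RT[OF aW] h(4) AW(1)[OF aW] PA[OF \<tau>(1) h(1)] by simp
      moreover have "\<tau> b \<in> {x \<in> W. R x \<beta>} \<inter> {b. eqv A q b}"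
        using RT[OF bW] h(5) AW(1)[OF bW] PA[OF \<tau>(1) h(2)] by simp
      moreover have "\<tau> c \<in> {b. eqv A q b}" using PA[OF \<tau>(1) h(3)] by simp
      ultimately have "\<tau> c \<in> {x \<in> W. R x \<beta>} \<inter> {b. eqv A q b}"
        using \<beta>(2) unfolding convex_in_def by blast
      then show "R c q" using RT[OF cW] by simp
    qed
  qed
qed

lemma CR_CRF:
  assumes A: "finite A" "A \<subseteq> W" and q: "q \<in> W" and R: "CR A q R"
  shows "\<exists>\<phi>\<in>CRF L M A (tpm A q). \<forall>a\<in>W. \<forall>b\<in>W. pholds M \<phi> [a, b] \<longleftrightarrow> R a b"
proof -
  obtain \<psi> where \<psi>: "\<psi> \<in> pformulas L A 2" "\<forall>a\<in>W. \<forall>b\<in>W. pholds M \<psi> [a, b] \<longleftrightarrow> R a b"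
    using binary_fm[OF CR_D[OF R]] by blast
  have "convex_right L M (tpm A q) \<psi>"
    by (rule convex_right_of[OF A(2) q \<psi>(2)]; (insert R[unfolded CR_def], elim conjE, assumption))
  then show ?thesis using \<psi> unfolding CRF_def by blast
qed

text \<open>Failure to be least occurs at some realization and is moved to \<open>q\<close>, where
  \<open>chain_exists\<close> asks for it.\<close>

lemma chain_of_CRF:
  assumes A: "finite A" "A \<subseteq> W" and q: "q \<in> W" and inf: "CRF_infinite L M A (tpm A q)"
    and nl: "\<not> (\<exists>\<phi>. least_CRF L M A (tpm A q) \<phi>)"
  shows "\<exists>E. chain W rk Dm A q E"
proof -
  obtain F where F: "F \<subseteq> CRF L M A (tpm A q)" "infinite F" using inf unfolding CRF_infinite_def by blast
  obtain \<phi>0 where "\<phi>0 \<in> F" using infinite_imp_nonempty[OF F(2)] by blast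
  then have \<phi>0: "\<phi>0 \<in> CRF L M A (tpm A q)" using F(1) by blast
  show ?thesis
  proof (rule chain_exists[OF A q CRF_CR[OF A q \<phi>0]])
    fix R assume R: "CR A q R"
    obtain \<phi> where \<phi>: "\<phi> \<in> CRF L M A (tpm A q)" "\<And>a b. a \<in> W \<Longrightarrow> b \<in> W \<Longrightarrow> pholds M \<phi> [a, b] \<longleftrightarrow> R a b"
      using CR_CRF[OF A q R] by blast
    have "\<not> least_CRF L M A (tpm A q) \<phi>" using nl by blast
    then obtain \<psi> \<alpha> where \<psi>: "\<psi> \<in> CRF L M A (tpm A q)" "\<alpha> \<in> realizations M (tpm A q)"
      "\<not> trace M (tpm A q) \<phi> \<alpha> \<subseteq> trace M (tpm A q) \<psi> \<alpha>" using \<phi>(1) unfolding least_CRF_def by blast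
    then obtain y where y: "y \<in> trace M (tpm A q) \<phi> \<alpha>" "y \<notin> trace M (tpm A q) \<psi> \<alpha>" by blast
    have \<alpha>: "eqv A q \<alpha>" using \<psi>(2) by (simp add: real_tpm[OF A(2) q])
    have yq: "eqv A q y" using y(1) by (simp add: trace_def real_tpm[OF A(2) q])
    have W: "\<alpha> \<in> W" "y \<in> W" using eqv_U[OF \<alpha>] eqv_U[OF yq] by blast+
    have y1: "R y \<alpha>" using y(1) \<phi>(2)[OF W(2,1)] by (simp add: trace_def sol_def)
    have y2: "\<not> pholds M \<psi> [y, \<alpha>]" using y W yq by (simp add: trace_def sol_def real_tpm[OF A(2) q])
    note C = CRF_CR[OF A q \<psi>(1)]
    obtain \<sigma> where \<sigma>: "\<sigma> \<in> Au A" "\<sigma> \<alpha> = q" using eqv_sym[OF \<alpha>] eqv_iff[OF A] by blast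
    have "R (\<sigma> y) q" using Au_2[OF A(1) \<sigma>(1) CR_D[OF R] W(2,1)] y1 \<sigma>(2) by simp
    moreover have "\<not> pholds M \<psi> [\<sigma> y, q]" using Au_2[OF A(1) \<sigma>(1) CR_D[OF C] W(2,1)] y2 \<sigma>(2) by simp
    moreover have "eqv A q (\<sigma> y)" by (rule eqv_trans[OF yq eqv_Au[OF A \<sigma>(1) W(2)]])
    ultimately show "\<exists>R'. CR A q R' \<and> (\<exists>y. eqv A q y \<and> R y q \<and> \<not> R' y q)" using C by blast
  qed
qed

text \<open>An isomorphism of two of the elementary submodels preserves truth and is thus an
  embedding in the sense of \<open>emb\<close>. So isomorphism is contained in an equivalence
  relation with countable classes, to which \<open>many_classes\<close> applies.\<close>

lemma many_models:
  assumes A: "finite A" "A \<subseteq> W" and q: "q \<in> W" and inf: "CRF_infinite L M A (tpm A q)"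
    and nl: "\<not> (\<exists>\<phi>. least_CRF L M A (tpm A q) \<phi>)" and T: "T \<subseteq> formulas L 0" "model L T M"
  shows "\<exists>K :: ('f, 'r, 'm) struct set. K \<approx> (UNIV :: nat set set) \<and>
    (\<forall>N\<in>K. model L T N \<and> countable (univ N)) \<and> pairwise (\<lambda>N N'. \<not> isomorphic L N N') K"
proof -
  obtain E where E: "chain W rk Dm A q E" using chain_of_CRF[OF A q inf nl] by blast
  interpret ch: chain "univ M" rk Dm A q E by (rule E)
  obtain N where N: "\<And>S::nat set. ch.elem (N S)" and cnt: "\<And>S. countable {S'. \<exists>h. ch.emb (N S') (N S) h}"
    using ch.main by blast
  have ne: "N S \<noteq> {}" and NW: "N S \<subseteq> W" for S using N[of S] by (auto simp: ch.elem_def)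
  have tv: "\<exists>c\<in>N S. Q (case_nat c e)" if h: "Dm {} Q" "e \<in> asg (N S)" "c \<in> W" "Q (case_nat c e)" for S Q e c
    using N[of S] h unfolding ch.elem_def by blast
  note el = ne NW tv
  define st where "st = (\<lambda>S. M\<lparr>univ := N S\<rparr>)"
  have mst: "model L T (st S)" for S unfolding st_def by (rule model_univ[OF el T])
  define R where "R = (\<lambda>S S'. \<exists>h. ch.emb (N S') (N S) h)"
  have emb_sym: "\<exists>g. ch.emb X' X g" if h: "ch.emb X X' h" for X X' h
  proof -
    have b: "bij_betw h X X'" using h by (simp add: ch.emb_def)
    define g where "g = the_inv_into X h"
    have g: "bij_betw g X' X" unfolding g_def by (rule bij_betw_the_inv_into[OF b])
    have hg: "h (g x) = x" if x: "x \<in> X'" for x unfolding g_def by (rule f_the_inv_into_f_bij_betw[OF b x])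
    have "Q (\<lambda>i. g (e i)) = Q e" if Q: "Dm {} Q" "e \<in> asg X'" for Q e
    proof -
      have "(\<lambda>i. g (e i)) \<in> asg X" using Q(2) bij_betw_apply[OF g] by (simp add: asg_def)
      then have "Q (\<lambda>i. h (g (e i))) = Q (\<lambda>i. g (e i))" using h Q(1) unfolding ch.emb_def by blast
      moreover have "(\<lambda>i. h (g (e i))) = e" using hg Q(2) by (simp add: asg_def fun_eq_iff)
      ultimately show ?thesis by simp
    qed
    then show ?thesis using g unfolding ch.emb_def by blast
  qed
  have emb_trans: "ch.emb X Z (k \<circ> h)" if h: "ch.emb X Y h" "ch.emb Y Z k" for X Y Z h k
  proof -
    have b: "bij_betw h X Y" "bij_betw k Y Z" using h by (simp_all add: ch.emb_def)
    have "Q (\<lambda>i. (k \<circ> h) (e i)) = Q e" if Q: "Dm {} Q" "e \<in> asg X" for Q e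
    proof -
      have "(\<lambda>i. h (e i)) \<in> asg Y" using Q(2) bij_betw_apply[OF b(1)] by (simp add: asg_def)
      then have "Q (\<lambda>i. k (h (e i))) = Q (\<lambda>i. h (e i))" using h(2) Q(1) unfolding ch.emb_def by blast
      moreover have "Q (\<lambda>i. h (e i)) = Q e" using h(1) Q unfolding ch.emb_def by blast
      ultimately show ?thesis by simp
    qed
    then show ?thesis using bij_betw_trans[OF b] unfolding ch.emb_def by blast
  qed
  have emb_id: "ch.emb X X id" for X by (simp add: ch.emb_def)
  have "equivp R"
  proof (intro equivpI reflpI sympI transpI)
    show "R S S" for S using emb_id unfolding R_def by blast
    show "R S' S" if "R S S'" for S S' using emb_sym that unfolding R_def by blast
    show "R S1 S3" if "R S1 S2" "R S2 S3" for S1 S2 S3 using emb_trans that unfolding R_def by blast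
  qed
  then obtain K where K: "K \<approx> (UNIV :: nat set set)" "pairwise (\<lambda>S S'. \<not> R S S') K"
    using many_classes[of R] cnt unfolding R_def by blast
  have iso: "R S S'" if h: "isomorphic L (st S') (st S)" for S S'
  proof -
    obtain h where h: "bij_betw h (univ (st S')) (univ (st S))"
      "\<forall>f\<in>funs L. \<forall>xs\<in>tuples (univ (st S')) (far L f). h (fint (st S') f xs) = fint (st S) f (map h xs)"
      "\<forall>r\<in>rels L. \<forall>xs\<in>tuples (univ (st S')) (rar L r). rint (st S') r xs \<longleftrightarrow> rint (st S) r (map h xs)"
      using h unfolding isomorphic_def by blast
    have u: "univ (st X) = N X" for X by (simp add: st_def)
    have "Q (\<lambda>i. h (e i)) = Q e" if Q: "Dm {} Q" "e \<in> asg (N S')" for Q e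
    proof -
      obtain \<phi> where \<phi>: "wf_fm L \<phi>" "\<And>e. e \<in> asg W \<Longrightarrow> Q e = sat M e \<phi>" using fm_Dm[OF Q(1)] by blast
      have he: "(\<lambda>i. h (e i)) \<in> asg (N S)" using Q(2) bij_betw_apply[OF h(1)[unfolded u]] by (simp add: asg_def)
      have "Q (\<lambda>i. h (e i)) = sat M (\<lambda>i. h (e i)) \<phi>" by (rule \<phi>(2)[OF asg_N[OF el he]])
      also have "\<dots> = sat (st S) (\<lambda>i. h (e i)) \<phi>" unfolding st_def by (rule sat_univ[OF el \<phi>(1) he, symmetric])
      also have "\<dots> = sat (st S') e \<phi>"
        by (rule iso_sat[OF _ h(2,3,1) \<phi>(1), symmetric]) (use mst[of S'] Q(2) in \<open>simp_all add: model_def u\<close>)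
      also have "\<dots> = sat M e \<phi>" unfolding st_def by (rule sat_univ[OF el \<phi>(1) Q(2)])
      also have "\<dots> = Q e" by (rule \<phi>(2)[OF asg_N[OF el Q(2)], symmetric])
      finally show ?thesis .
    qed
    then show ?thesis using h(1) unfolding R_def ch.emb_def u by blast
  qed
  have inj: "inj_on st K"
  proof (rule inj_onI)
    fix S S' assume h: "S \<in> K" "S' \<in> K" "st S = st S'"
    have "N S = N S'" using arg_cong[OF h(3), of univ] by (simp add: st_def)
    then have "R S S'" using emb_id unfolding R_def by metis
    then show "S = S'" using K(2) h(1,2) unfolding pairwise_def by blast
  qed
  show ?thesis
  proof (intro exI[of _ "st ` K"] conjI ballI)
    show "st ` K \<approx> (UNIV :: nat set set)" using inj_on_image_eqpoll_self[OF inj] K(1) eqpoll_trans by blast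
    show "pairwise (\<lambda>N N'. \<not> isomorphic L N N') (st ` K)"
      unfolding pairwise_def
    proof (intro ballI impI notI)
      fix X X' assume X: "X \<in> st ` K" "X' \<in> st ` K" "X \<noteq> X'" "isomorphic L X X'"
      obtain S S' where S: "S \<in> K" "S' \<in> K" "X = st S" "X' = st S'" using X(1,2) by blast
      have "R S' S" using iso X(4) S(3,4) by blast
      have "S' \<noteq> S" using S(3,4) X(3) by auto
      from K(2)[unfolded pairwise_def, THEN bspec, OF S(2), THEN bspec, OF S(1), THEN mp, OF this]
      show False using \<open>R S' S\<close> by (rule notE)
    qed
    fix X assume "X \<in> st ` K"
    then obtain S where S: "X = st S" by blast
    show "model L T X" unfolding S by (rule mst)
    show "countable (univ X)" unfolding S st_def using countable_subset[OF NW cu] by simp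
  qed
qed

end

theorem theorem5p5:
  fixes L :: "('f, 'r) lang"
    and T :: "('f, 'r) fm set"
    and M :: "('f, 'r, 'm) struct"
    and A :: "'m set"
    and p :: "('f + 'm, 'r) fm set"
  assumes "countable_lang L"
    and "complete_theory TYPE('m) L T"
    and "linearly_ordered_theory TYPE('m) L T"
    and "restriction TYPE('m) L T"
    and "model L T M" and "countable (univ M)" and "saturated L M"
    and "A \<subseteq> univ M" and "finite A"
    and "p \<in> S1 L M A" and "nonalgebraic M p"
    and "CRF_infinite L M A p"
    and "\<not> (\<exists>\<phi>. least_CRF L M A p \<phi>)"
  shows "\<exists>K :: ('f, 'r, 'm) struct set.
           K \<approx> (UNIV :: nat set set) \<and>
           (\<forall>N\<in>K. model L T N \<and> countable (univ N)) \<and>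
           pairwise (\<lambda>N N'. \<not> isomorphic L N N') K"
proof -
  \<comment> \<open>A tautology: it or its negation belongs to \<open>p\<close>, so nonalgebraicity
    makes the universe infinite. It also defines the whole universe over any parameter set.\<close>
  define tt where "tt = (Eq (Var 0) (Var 0) :: ('f + 'm, 'r) fm)"
  have tt: "tt \<in> pformulas L B 1" for B by (simp add: tt_def formulas_def)
  have "tt \<in> p \<or> Neg tt \<in> p" using assms(10) tt unfolding S1_def by blast
  then obtain \<phi> where "\<phi> \<in> p" by blast
  then have "infinite (sol M \<phi> [])" using assms(11) by (simp add: nonalgebraic_def)
  then have iu: "infinite (univ M)" by (rule contrapos_nn) (rule finite_subset[rotated], auto simp: sol_def)
  \<comment> \<open>A set smaller than the naturals is finite, hence smaller than the infinite
    universe, so saturation covers it.\<close>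
  have sat0: "aleph0_saturated L M"
    unfolding aleph0_saturated_def saturated_at_def
  proof (intro allI impI, elim conjE)
    fix B assume B: "B \<subseteq> univ M" "B \<prec> (UNIV :: nat set)"
    have "finite B" using B(2) by (meson infinite_le_lepoll lepoll_antisym lesspoll_def)
    then have "B \<prec> univ M" by (rule finite_lesspoll_infinite[OF iu])
    then show "\<forall>p\<in>S1 L M B. realizations M p \<noteq> {}"
      using assms(7) B(1) unfolding saturated_def saturated_at_def by blast
  qed
  have "univ M = sol M tt []" by (simp add: sol_def holds_def tt_def)
  then have dfn: "definable L M B (univ M)" for B unfolding definable_def using tt by blast
  interpret lo_restricted L M
  proof unfold_locales
    show "countable_lang L" "countable (univ M)" "infinite (univ M)" "saturated L M" by fact+
    show "is_struct L M" using assms(5) by (simp add: model_def)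
    show "lt L \<in> rels L" "rar L (lt L) = 2" using assms(3) by (simp_all add: linearly_ordered_theory_def)
    show "strict_linear_order_on (univ M) {(a, b) \<in> univ M \<times> univ M. less_in L M a b}"
      using assms(3,5) by (simp add: linearly_ordered_theory_def)
    fix B assume B: "B \<subseteq> univ M" "finite B"
    show "no_descending_equivs L M B (univ M) \<and>
      (\<forall>p\<in>S1 L M B. finite {q \<in> S1 L M B. type_closure L M q = type_closure L M p}) \<and>
      (\<forall>p\<in>S1 L M B. \<forall>\<phi>\<in>pformulas L B 2.
        (convex_right L M p \<phi> \<longrightarrow> eq_generating_right L M p \<phi>) \<and>
        (convex_left L M p \<phi> \<longrightarrow> eq_generating_left L M p \<phi>))"
      using assms(4)[unfolded restriction_def, THEN spec[of _ M], THEN spec[of _ B], THEN spec[of _ "univ M"]]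
        assms(5) sat0 B dfn by blast
  qed
  obtain q where q: "q \<in> realizations M p" using realized[OF assms(9,8,10)] by blast
  have qW: "q \<in> univ M" using q by (simp add: realizations_def)
  have pt: "p = tpm A q" by (rule S1_tpm[OF assms(10) q])
  have "T \<subseteq> formulas L 0" using assms(2) by (simp add: complete_theory_def)
  then show ?thesis
    using many_models[OF assms(9,8) qW assms(12)[unfolded pt] assms(13)[unfolded pt] _ assms(5)] by blast
qed

end
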